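(* Let $C>0$ and $s>\frac12$. There exists $\varepsilon_0>0$ such that the following holds for every $\varepsilon\in(0,\varepsilon_0)$. Let $(u,\partial_t u)(t)$, $t\in\mathbb{R}$, be a global real-valued solution of the one-dimensional Born-Infeld equation $$(1- (\partial_t u)^2)\, \partial_x^2 u + 2\,\partial_x u\, \partial_t u \, \partial_{t}\partial_x u - (1+(\partial_x u)^2)\, \partial_t^2 u = 0,\qquad (t,x)\in\mathbb{R}\times\mathbb{R},$$ such that $$\sup_{t\in\mathbb{R}}\|(u,\partial_t u)(t)\|_{(H^{s+1}\times H^s)(\mathbb{R})} <\varepsilon .$$ For $|t|\ge 2$ let $I(t):= \Big( -\frac{C |t|}{\log^2 |t|} ,\frac{C |t|}{\log^2 |t|} \Big)$. Then $$\lim_{t\to +\infty}\|(u,\partial_t u )(t) \|_{(\dot H^1\times L^2)(I(t))} =0\quad\text{and}\quad \lim_{t\to -\infty}\|(u,\partial_t u )(t) \|_{(\dot H^1\times L^2)(I(t))} =0.$$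
   Context: For an interval $I\subset\mathbb{R}$, $\|(f,g)\|_{(\dot H^1\times L^2)(I)}^2 := \int_I \big((\partial_x f)^2+g^2\big)\,dx$. $\log^2|t|$ means $(\log|t|)^2$. A global solution at regularity $H^{s+1}\times H^s$ ($s>\frac12$) is a function $u=u(t,x)\in\mathbb{R}$ with $(u,\partial_t u)\in C(\mathbb{R};H^{s+1}(\mathbb{R})\times H^s(\mathbb{R}))$ satisfying the equation in the sense of distributions (the products being well defined since multiplication $H^s\times H^{s-1}\to H^{s-1}$ is bounded for $s>\frac12$). *)

theory Defs
  imports "HOL-Analysis.Analysis"
begin

section \<open>Tempered distributions on the line\<close>

definition schwartz :: "(real \<Rightarrow> complex) set" where
  "schwartz = {\<phi>. \<exists>D :: nat \<Rightarrow> real \<Rightarrow> complex. D 0 = \<phi> \<and>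
     (\<forall>k x. (D k has_vector_derivative D (Suc k) x) (at x)) \<and>
     (\<forall>k m. bounded (range (\<lambda>x. complex_of_real (x ^ m) * D k x)))}"

text \<open>A distribution is a functional on complex-valued functions of which only the values on
  \<open>schwartz\<close> matter. Linearity and continuity are not imposed separately: they follow
  from membership in a Sobolev space, as defined below.\<close>

type_synonym distr = "(real \<Rightarrow> complex) \<Rightarrow> complex"

definition distr_of :: "(real \<Rightarrow> real) \<Rightarrow> distr" where
  "distr_of f \<phi> = (LINT x|lborel. complex_of_real (f x) * \<phi> x)"

definition distr_deriv :: "distr \<Rightarrow> distr" where
  "distr_deriv T \<phi> = - T (\<lambda>x. vector_derivative \<phi> (at x))"

definition fourier :: "(real \<Rightarrow> complex) \<Rightarrow> real \<Rightarrow> complex" where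
  "fourier \<phi> \<xi> = (LINT x|lborel. cis (- (x * \<xi>)) * \<phi> x)"

text \<open>\<open>F\<close> is a function representing the Fourier transform of \<open>T\<close>. Such an \<open>F\<close> is unique up to
  null sets.\<close>

definition is_fourier_of :: "(real \<Rightarrow> complex) \<Rightarrow> distr \<Rightarrow> bool" where
  "is_fourier_of F T \<longleftrightarrow> F \<in> borel_measurable borel \<and>
     (\<forall>\<phi>\<in>schwartz. integrable lborel (\<lambda>\<xi>. F \<xi> * \<phi> \<xi>) \<and>
        T (fourier \<phi>) = (LINT \<xi>|lborel. F \<xi> * \<phi> \<xi>))"

definition fourier_distr :: "distr \<Rightarrow> real \<Rightarrow> complex" where
  "fourier_distr T = (SOME F. is_fourier_of F T)"


section \<open>Sobolev spaces of real order\<close>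

definition sobolev :: "real \<Rightarrow> distr set" where
  "sobolev \<sigma> = {T. \<exists>F. is_fourier_of F T \<and>
     integrable lborel (\<lambda>\<xi>. (1 + \<xi>\<^sup>2) powr \<sigma> * (cmod (F \<xi>))\<^sup>2)}"

definition sobolev_norm :: "real \<Rightarrow> distr \<Rightarrow> real" where
  "sobolev_norm \<sigma> T =
     sqrt ((LINT \<xi>|lborel. (1 + \<xi>\<^sup>2) powr \<sigma> * (cmod (fourier_distr T \<xi>))\<^sup>2) / (2 * pi))"

definition L2_fun :: "(real \<Rightarrow> real) set" where
  "L2_fun = {f. f \<in> borel_measurable borel \<and> integrable lborel (\<lambda>x. (f x)\<^sup>2)}"

text \<open>For nonnegative order, elements are represented by (Borel representatives of)
  square-integrable functions. The \<open>L2\<close> requirement makes all integrals in \<open>distr_of f\<close>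
  absolutely convergent.\<close>

definition sobolev_fun :: "real \<Rightarrow> (real \<Rightarrow> real) set" where
  "sobolev_fun \<sigma> = {f \<in> L2_fun. distr_of f \<in> sobolev \<sigma>}"

definition pair_norm :: "real \<Rightarrow> (real \<Rightarrow> real) \<Rightarrow> (real \<Rightarrow> real) \<Rightarrow> real" where
  "pair_norm s f g =
     sqrt ((sobolev_norm (s + 1) (distr_of f))\<^sup>2 + (sobolev_norm s (distr_of g))\<^sup>2)"

definition weak_deriv :: "(real \<Rightarrow> real) \<Rightarrow> real \<Rightarrow> real" where
  "weak_deriv f = (SOME g. g \<in> L2_fun \<and>
     (\<forall>\<phi>\<in>schwartz. distr_of g \<phi> = distr_deriv (distr_of f) \<phi>))"

text \<open>The norm of \<open>(f, g)\<close> in \<open>\<dot>H\<^sup>1 \<times> L\<^sup>2\<close> restricted to \<open>I\<close>.\<close>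

definition energy_norm :: "real set \<Rightarrow> (real \<Rightarrow> real) \<Rightarrow> (real \<Rightarrow> real) \<Rightarrow> real" where
  "energy_norm I f g = sqrt (LINT x:I|lborel. (weak_deriv f x)\<^sup>2 + (g x)\<^sup>2)"

text \<open>The product of a function \<open>a\<close> and a distribution \<open>T\<close>, that is \<open>\<phi> \<mapsto> \<langle>T, a \<phi>\<rangle>\<close>. As \<open>a \<phi>\<close> need not
  be smooth, the bracket is the \<open>H\<^bsup>s-1\<^esup>\<close>-\<open>H\<^bsup>1-s\<^esup>\<close> duality, written through Parseval's formula
  \<open>\<langle>T, \<psi>\<rangle> = 1/(2\<pi>) \<integral> T^(\<xi>) \<psi>^(-\<xi>) d\<xi>\<close>. If \<open>s > 1/2\<close>, \<open>T \<in> H\<^bsup>s-1\<^esup>\<close>, \<open>a \<in> \<real> + H\<^sup>s\<close>, and \<open>\<phi>\<close> is a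
  Schwartz function, then \<open>a \<phi> \<in> H\<^sup>s \<subseteq> H\<^bsup>1-s\<^esup>\<close> and the integral converges absolutely; it is the
  continuous extension of the pointwise product to \<open>H\<^sup>s \<times> H\<^bsup>s-1\<^esup> \<rightarrow> H\<^bsup>s-1\<^esup>\<close>.\<close>

definition distr_mult :: "(real \<Rightarrow> real) \<Rightarrow> distr \<Rightarrow> distr" where
  "distr_mult a T \<phi> =
     (LINT \<xi>|lborel. fourier_distr T \<xi> * fourier (\<lambda>x. complex_of_real (a x) * \<phi> x) (- \<xi>))
       / complex_of_real (2 * pi)"


section \<open>Distributions on space-time\<close>

text \<open>Smooth compactly supported functions of \<open>(t, x)\<close>; \<open>D j k\<close> is the mixed partial derivative of
  order \<open>j\<close> in \<open>t\<close> and \<open>k\<close> in \<open>x\<close>.\<close>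

definition test_fun :: "(real \<Rightarrow> real \<Rightarrow> complex) set" where
  "test_fun = {\<phi>.
     (\<exists>D :: nat \<Rightarrow> nat \<Rightarrow> real \<Rightarrow> real \<Rightarrow> complex. D 0 0 = \<phi> \<and>
        (\<forall>j k. continuous_on UNIV (\<lambda>(t, x). D j k t x) \<and>
           (\<forall>t x. ((\<lambda>\<tau>. D j k \<tau> x) has_vector_derivative D (Suc j) k t x) (at t) \<and>
                  ((\<lambda>y. D j k t y) has_vector_derivative D j (Suc k) t x) (at x)))) \<and>
     (\<exists>R. \<forall>t x. \<phi> t x \<noteq> 0 \<longrightarrow> \<bar>t\<bar> \<le> R \<and> \<bar>x\<bar> \<le> R)}"

text \<open>A family \<open>U :: real \<Rightarrow> distr\<close> is read as the space-time distribution
  \<open>\<phi> \<mapsto> \<integral> \<langle>U t, \<phi> t\<rangle> dt\<close>. \<open>W\<close> is its distributional derivative in time.\<close>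

definition is_time_deriv :: "(real \<Rightarrow> distr) \<Rightarrow> (real \<Rightarrow> distr) \<Rightarrow> bool" where
  "is_time_deriv U W \<longleftrightarrow> (\<forall>\<phi>\<in>test_fun.
     (LINT t|lborel. W t (\<phi> t)) =
       - (LINT t|lborel. U t (\<lambda>x. vector_derivative (\<lambda>\<tau>. \<phi> \<tau> x) (at t))))"

text \<open>\<open>L\<^sup>1\<^sub>l\<^sub>o\<^sub>c\<close> in time with values in \<open>H\<^sup>\<sigma>\<close>; weak measurability suffices as \<open>H\<^sup>\<sigma>\<close> is separable.\<close>

definition loc_integrable_sobolev :: "real \<Rightarrow> (real \<Rightarrow> distr) \<Rightarrow> bool" where
  "loc_integrable_sobolev \<sigma> w \<longleftrightarrow>
     (\<forall>t. w t \<in> sobolev \<sigma>) \<and>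
     (\<forall>\<phi>\<in>schwartz. (\<lambda>t. w t \<phi>) \<in> borel_measurable borel) \<and>
     (\<forall>R. (\<integral>\<^sup>+t\<in>{-R..R}. ennreal (sobolev_norm \<sigma> (w t)) \<partial>lborel) < \<infinity>)"


section \<open>The Born-Infeld equation\<close>

text \<open>The left-hand side at time \<open>t\<close>, where \<open>u\<close>, \<open>ut\<close>, \<open>utt\<close> stand for \<open>u(t)\<close>, \<open>\<partial>\<^sub>t u(t)\<close>, \<open>\<partial>\<^sub>t\<^sup>2 u(t)\<close>.\<close>

definition born_infeld :: "(real \<Rightarrow> real) \<Rightarrow> (real \<Rightarrow> real) \<Rightarrow> distr \<Rightarrow> distr" where
  "born_infeld u ut utt \<phi> =
     distr_mult (\<lambda>x. 1 - (ut x)\<^sup>2) (distr_deriv (distr_deriv (distr_of u))) \<phi>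
     + 2 * distr_mult (\<lambda>x. weak_deriv u x * ut x) (distr_deriv (distr_of ut)) \<phi>
     - distr_mult (\<lambda>x. 1 + (weak_deriv u x)\<^sup>2) utt \<phi>"

text \<open>The product of \<open>1 + (\<partial>\<^sub>x u)\<^sup>2\<close> with \<open>\<partial>\<^sub>t\<^sup>2 u\<close> is given by the multiplication
  \<open>H\<^sup>s \<times> H\<^bsup>s-1\<^esup> \<rightarrow> H\<^bsup>s-1\<^esup>\<close>, which presupposes that \<open>\<partial>\<^sub>t\<^sup>2 u\<close> takes values in \<open>H\<^bsup>s-1\<^esup>\<close>. Only local
  integrability in time is required; the equation itself then gives continuity.\<close>

definition born_infeld_global_solution ::
  "real \<Rightarrow> (real \<Rightarrow> real \<Rightarrow> real) \<Rightarrow> (real \<Rightarrow> real \<Rightarrow> real) \<Rightarrow> bool" where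
  "born_infeld_global_solution s u ut \<longleftrightarrow>
     (\<forall>t. u t \<in> sobolev_fun (s + 1) \<and> ut t \<in> sobolev_fun s) \<and>
     (\<forall>t\<^sub>0. ((\<lambda>t. pair_norm s (\<lambda>x. u t x - u t\<^sub>0 x) (\<lambda>x. ut t x - ut t\<^sub>0 x)) \<longlongrightarrow> 0) (at t\<^sub>0)) \<and>
     is_time_deriv (\<lambda>t. distr_of (u t)) (\<lambda>t. distr_of (ut t)) \<and>
     (\<exists>utt. loc_integrable_sobolev (s - 1) utt \<and>
        is_time_deriv (\<lambda>t. distr_of (ut t)) utt \<and>
        (\<forall>\<phi>\<in>test_fun. (LINT t|lborel. born_infeld (u t) (ut t) (utt t) (\<phi> t)) = 0))"

definition inner_interval :: "real \<Rightarrow> real \<Rightarrow> real set" where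
  "inner_interval C t = {- (C * \<bar>t\<bar> / (ln \<bar>t\<bar>)\<^sup>2) <..< C * \<bar>t\<bar> / (ln \<bar>t\<bar>)\<^sup>2}"

end

theory Submission
  imports Defs "HOL-Probability.Probability" "HOL-Real_Asymp.Real_Asymp"
begin

text \<open>
  Write \<open>p = u\<^sub>x\<close>, \<open>q = u\<^sub>t\<close>, \<open>r = 1 / (1 + p\<^sup>2)\<close>, \<open>M = 2 p q r\<close> and \<open>e = (p\<^sup>2 + q\<^sup>2) r\<close>. The equation
  implies the two conservation laws \<open>M\<^sub>t = e\<^sub>x\<close> and \<open>(e - M\<^sup>2)\<^sub>t = (M (1 - e))\<^sub>x\<close>, which have no
  derivatives on the right-hand side. With \<open>\<lambda>(t) = C t / log\<^sup>2 t\<close> and a bump \<open>b\<close> with primitive \<open>\<phi>\<close>, the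
  functional \<open>V = \<integral> \<phi>(x / \<lambda>) M\<close> is bounded and satisfies \<open>V' \<le> - 1 / (2 \<lambda>) \<integral> b(x / \<lambda>) e\<close>, while
  the time derivative of \<open>W = \<integral> \<psi>(x / \<lambda>) (e - M\<^sup>2)\<close>, for a narrower bump \<open>\<psi>\<close>, is at most a constant times
  \<open>- V'\<close>. Hence \<open>W\<close> converges; as \<open>1 / \<lambda>\<close> is not integrable, its limit is zero.

  The solution has less than one classical derivative, so the conservation laws are derived by difference quotients:
  \<open>p\<close> and \<open>q\<close> have \<open>L\<^sup>2\<close> modulus of continuity \<open>h\<^bsup>\<sigma>\<^esup>\<close> in space with \<open>\<sigma> > 1/2\<close>, and on a short time interval
  the coefficients are frozen; the quadratic errors are controlled by the \<open>H\<^bsup>s-1\<^esup>\<close>-\<open>H\<^bsup>1-s\<^esup>\<close> duality.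
\<close>

text \<open>Both laws come from one mechanism: multiplied by \<open>k(p, q)\<close>, the equation
  yields \<open>G(p, q)_t = F(p, q)_x\<close> as soon as \<open>G_q = (1 + p^2) k\<close>,
  \<open>F_p = (1 - q^2) k\<close> and \<open>F_q = G_p + 2 p q k\<close>. The obstacle is the chain
  rule: \<open>u_tt\<close> is only locally integrable in time with values in
  \<open>H^(s-1)\<close>, and no rate of continuity in time is available. The threshold 1/2 enters
  twice. An L2 modulus \<open>h^\<sigma>\<close> with \<sigma> > 1/2 survives products and Lipschitz
  maps and puts a compactly supported function in \<open>H^(1/2)\<close>, which pairs with
  \<open>H^(s-1)\<close>; and quadratic Taylor errors of size \<open>h^(2 \<sigma>)\<close> are
  o(h). In time, a squared increment is itself the pairing of the increment with a test function
  containing the increment as a factor, so it is small relative to the time integral of the norm.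
  Smallness of the solution serves to give |p|, |q| <= 1/2; then
  \<open>|M| <= e <= 2 (e - M^2)\<close> and \<open>|M (1 - e)| <= e\<close>, so every term of the
  virial argument is measured by \<open>e\<close>, and the threshold for \<epsilon> does not depend
  on \<open>C\<close>.\<close>

text \<open>Without the prefix, these names refer to facts about the Henstock-Kurzweil integral.\<close>

lemmas integrable_bound = Bochner_Integration.integrable_bound
lemmas integrable_add = Bochner_Integration.integrable_add
lemmas integral_cong = Bochner_Integration.integral_cong
lemmas integral_diff = Bochner_Integration.integral_diff
lemmas integral_cnj = Bochner_Integration.integral_cnj
lemmas integral_add = Bochner_Integration.integral_add
lemmas integral_nonneg = Bochner_Integration.integral_nonneg
lemmas integrable_diff = Bochner_Integration.integrable_diff

section \<open>Smooth functions and mollifiers\<close>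

definition smooth :: "(real \<Rightarrow> 'a::real_normed_vector) \<Rightarrow> bool" where
  "smooth f \<longleftrightarrow> (\<exists>D :: nat \<Rightarrow> real \<Rightarrow> 'a. D 0 = f \<and>
     (\<forall>k x. (D k has_vector_derivative D (Suc k) x) (at x)))"

lemma derivative_family:
  assumes "f \<in> S"
    and "\<And>g. g \<in> S \<Longrightarrow> \<exists>g'\<in>S. \<forall>x. (g has_vector_derivative g' x) (at x)"
  obtains D where "D 0 = f" "\<And>k. D k \<in> S"
    "\<And>k x. (D k has_vector_derivative D (Suc k) x) (at x)"
proof -
  obtain d where d: "\<And>g. g \<in> S \<Longrightarrow> d g \<in> S \<and> (\<forall>x. (g has_vector_derivative d g x) (at x))"
    using assms(2) by metis
  define D where "D k = (d ^^ k) f" for k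
  have "D k \<in> S" for k
    by (induction k) (auto simp: D_def assms(1) d)
  with d have "D 0 = f" "\<And>k. D k \<in> S" "\<And>k x. (D k has_vector_derivative D (Suc k) x) (at x)"
    by (auto simp: D_def)
  then show thesis
    using that by blast
qed

text \<open>Choosing derivatives inside \<open>S\<close> again and again produces all orders at
  once. Smoothness proofs below therefore only exhibit a set closed under one differentiation; no
  formula for a higher derivative is ever written down.\<close>

lemma smooth_coinduct:
  assumes "f \<in> S"
    and "\<And>g. g \<in> S \<Longrightarrow> \<exists>g'\<in>S. \<forall>x. (g has_vector_derivative g' x) (at x)"
  shows "smooth f"
proof -
  obtain D where "D 0 = f" "\<And>k x. (D k has_vector_derivative D (Suc k) x) (at x)"
    by (rule derivative_family[OF assms]) auto
  then show ?thesis unfolding smooth_def by blast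
qed

lemma smooth_derivative:
  assumes "smooth f"
  obtains f' where "smooth f'" "\<And>x. (f has_vector_derivative f' x) (at x)"
proof -
  obtain D where D: "D 0 = f" "\<And>k x. (D k has_vector_derivative D (Suc k) x) (at x)"
    using assms unfolding smooth_def by blast
  have "smooth (D (Suc 0))"
    unfolding smooth_def by (rule exI[of _ "\<lambda>k. D (Suc k)"]) (simp add: D(2))
  with D that show thesis by metis
qed

lemma smooth_from_derivative:
  assumes "\<And>x. (f has_vector_derivative f' x) (at x)" "smooth f'"
  shows "smooth f"
proof (rule smooth_coinduct[of f "insert f (Collect smooth)"])
  show "\<exists>g'\<in>insert f (Collect smooth). \<forall>x. (g has_vector_derivative g' x) (at x)"
    if "g \<in> insert f (Collect smooth)" for g
  proof (cases "g = f")
    case True then show ?thesis using assms by blast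
  next
    case False
    with that have "smooth g" by simp
    then obtain g' where "smooth g'" "\<And>x. (g has_vector_derivative g' x) (at x)"
      by (rule smooth_derivative) auto
    then show ?thesis by blast
  qed
qed simp

lemma smooth_continuous: "smooth f \<Longrightarrow> continuous_on A f"
  by (erule smooth_derivative)
    (blast intro: has_vector_derivative_continuous continuous_at_imp_continuous_on)

text \<open>The product rule leaves the set of products of two smooth functions, so coinduction
  needs a set that is closed under sums and products at the same time.\<close>

inductive_set smooth_alg :: "(real \<Rightarrow> 'a::real_normed_algebra) set" where
  base: "smooth f \<Longrightarrow> f \<in> smooth_alg"
| add: "f \<in> smooth_alg \<Longrightarrow> g \<in> smooth_alg \<Longrightarrow> (\<lambda>x. f x + g x) \<in> smooth_alg"
| mult: "f \<in> smooth_alg \<Longrightarrow> g \<in> smooth_alg \<Longrightarrow> (\<lambda>x. f x * g x) \<in> smooth_alg"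

lemma smooth_alg_smooth:
  assumes "f \<in> smooth_alg" shows "smooth f"
proof (rule smooth_coinduct[OF assms])
  show "\<exists>g'\<in>smooth_alg. \<forall>x. (g has_vector_derivative g' x) (at x)" if "g \<in> smooth_alg" for g :: "real \<Rightarrow> 'a"
    using that
  proof induction
    case (base f)
    then obtain f' where "smooth f'" "\<And>x. (f has_vector_derivative f' x) (at x)"
      by (rule smooth_derivative) auto
    then show ?case by (blast intro: smooth_alg.base)
  next
    case (add f g)
    then obtain f' g' where "f' \<in> smooth_alg" "g' \<in> smooth_alg"
      "\<forall>x. (f has_vector_derivative f' x) (at x)" "\<forall>x. (g has_vector_derivative g' x) (at x)" by blast
    then show ?case
      by (intro bexI[of _ "\<lambda>x. f' x + g' x"]) (auto intro: has_vector_derivative_add smooth_alg.add)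
  next
    case (mult f g)
    then obtain f' g' where "f' \<in> smooth_alg" "g' \<in> smooth_alg"
      "\<forall>x. (f has_vector_derivative f' x) (at x)" "\<forall>x. (g has_vector_derivative g' x) (at x)" by blast
    with mult show ?case
      by (intro bexI[of _ "\<lambda>x. f x * g' x + f' x * g x"])
        (auto intro: has_vector_derivative_mult smooth_alg.intros)
  qed
qed

lemma smooth_add: "smooth f \<Longrightarrow> smooth g \<Longrightarrow> smooth (\<lambda>x. f x + g x :: 'a::real_normed_algebra)"
  and smooth_mult: "smooth f \<Longrightarrow> smooth g \<Longrightarrow> smooth (\<lambda>x. f x * g x :: 'a)"
  by (auto intro: smooth_alg_smooth smooth_alg.intros)

lemma smooth_const: "smooth (\<lambda>x. c)"
  unfolding smooth_def
  by (rule exI[of _ "\<lambda>k x. if k = 0 then c else 0"]) auto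

lemma smooth_ident: "smooth (\<lambda>x::real. x)"
  by (rule smooth_from_derivative[of _ "\<lambda>x. 1"]) (auto intro: smooth_const)

lemma smooth_affine:
  assumes "smooth f" shows "smooth (\<lambda>x. f (a * x + b))"
proof (rule smooth_coinduct[of _ "{\<lambda>x. c *\<^sub>R g (a * x + b) | c g. smooth g}"])
  show "(\<lambda>x. f (a * x + b)) \<in> {\<lambda>x. c *\<^sub>R g (a * x + b) | c g. smooth g}"
    using assms by (auto intro!: exI[of _ "1::real"] exI[of _ f])
next
  fix h assume "h \<in> {\<lambda>x. c *\<^sub>R g (a * x + b) | c g. smooth g}"
  then obtain c g where h: "h = (\<lambda>x. c *\<^sub>R g (a * x + b))" "smooth g" by blast
  obtain g' where g': "smooth g'" "\<And>x. (g has_vector_derivative g' x) (at x)"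
    using h(2) smooth_derivative by blast
  have "(h has_vector_derivative (c * a) *\<^sub>R g' (a * x + b)) (at x)" for x
  proof -
    have "((\<lambda>x. g (a * x + b)) has_vector_derivative a *\<^sub>R g' (a * x + b)) (at x)"
      using vector_diff_chain_at[of "\<lambda>x. a * x + b" a x g "g' (a * x + b)"] g'(2)
      by (auto intro!: has_vector_derivative_add_const[THEN iffD2] has_vector_derivative_mult_right[of "\<lambda>x. x" 1, simplified] simp: o_def)
    from has_vector_derivative_scaleR[OF DERIV_const this, of c] show ?thesis
      by (simp add: h(1))
  qed
  with g'(1) show "\<exists>g'\<in>{\<lambda>x. c *\<^sub>R g (a * x + b) | c g. smooth g}. \<forall>x. (h has_vector_derivative g' x) (at x)"
    by (intro bexI[of _ "\<lambda>x. (c * a) *\<^sub>R g' (a * x + b)"]) auto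
qed

definition test1 :: "(real \<Rightarrow> real) \<Rightarrow> bool" where
  "test1 f \<longleftrightarrow> smooth f \<and> (\<exists>R. \<forall>x. \<bar>x\<bar> > R \<longrightarrow> f x = 0)"

lemma vanishing_derivative:
  assumes f: "\<And>x. \<bar>x\<bar> > R \<Longrightarrow> f x = 0"
    and d: "\<And>x. (f has_vector_derivative f' x) (at x)" and x: "\<bar>x\<bar> > R"
  shows "f' x = 0"
proof -
  have "open {x. \<bar>x\<bar> > R}"
    by (intro open_Collect_less continuous_intros)
  then have "(f has_vector_derivative 0) (at x)"
    by (rule has_vector_derivative_transform_within_open[where f="\<lambda>x. 0" and x=x, rotated])
      (use f x in \<open>auto intro: has_vector_derivative_const\<close>)
  from vector_derivative_unique_at[OF d this] show ?thesis .
qed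

lemma test1_derivative:
  assumes "test1 f"
  obtains f' where "test1 f'" "\<And>x. (f has_real_derivative f' x) (at x)"
proof -
  obtain R where R: "\<And>x. \<bar>x\<bar> > R \<Longrightarrow> f x = 0" and f: "smooth f"
    using assms unfolding test1_def by blast
  obtain f' where f': "smooth f'" "\<And>x. (f has_vector_derivative f' x) (at x)"
    using f smooth_derivative by blast
  have "f' x = 0" if "\<bar>x\<bar> > R" for x
    using vanishing_derivative[OF R f'(2) that] by simp
  with f' that show thesis
    unfolding test1_def has_real_derivative_iff_has_vector_derivative by blast
qed

lemma bounded_compact_support:
  fixes f :: "real \<Rightarrow> 'a::real_normed_vector"
  assumes "continuous_on UNIV f" "\<And>x. \<bar>x\<bar> > R \<Longrightarrow> f x = 0"
  obtains B where "B > 0" "\<And>x. norm (f x) \<le> B"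
proof -
  have "compact (f ` {-R..R})"
    using assms(1) by (intro compact_continuous_image) (auto intro: continuous_on_subset)
  then obtain B where B: "B > 0" "\<And>y. y \<in> f ` {-R..R} \<Longrightarrow> norm y \<le> B"
    using compact_imp_bounded bounded_pos by metis
  have "norm (f x) \<le> B" for x
    using B assms(2)[of x] by (cases "\<bar>x\<bar> > R") (auto simp: not_less abs_le_iff)
  with B that show thesis by blast
qed

lemma test1_bounded:
  assumes "test1 f" obtains B where "B > 0" "\<And>x. \<bar>f x\<bar> \<le> B"
proof -
  obtain R where "smooth f" "\<And>x. \<bar>x\<bar> > R \<Longrightarrow> f x = 0"
    using assms unfolding test1_def by blast
  then show thesis
    using that by (elim bounded_compact_support[of f R, OF smooth_continuous]) auto
qed

lemma test1_continuous: "test1 f \<Longrightarrow> continuous_on A f"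
  unfolding test1_def by (blast intro: smooth_continuous)

lemma test1_measurable[measurable_dest]: "test1 f \<Longrightarrow> f \<in> borel_measurable borel"
  by (intro borel_measurable_continuous_onI test1_continuous)

lemma integrable_compact_support:
  fixes f :: "real \<Rightarrow> 'a::{banach, second_countable_topology}"
  assumes "f \<in> borel_measurable borel" "\<And>x. norm (f x) \<le> B" "\<And>x. \<bar>x\<bar> > R \<Longrightarrow> f x = 0"
  shows "integrable lborel f"
proof (rule integrable_bound)
  show "integrable lborel (\<lambda>x. B * indicator {-R..R} x :: real)"
    by (intro integrable_mult_right) (simp add: integrable_indicator_iff emeasure_lborel_Icc_eq)
  show "AE x in lborel. norm (f x) \<le> norm (B * indicator {-R..R} x :: real)"
  proof (rule AE_I2)
    fix x show "norm (f x) \<le> norm (B * indicator {-R..R} x :: real)"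
      using assms(2)[of x] assms(3)[of x] by (cases "\<bar>x\<bar> > R") (auto simp: not_less abs_le_iff indicator_def)
  qed
qed (use assms in simp)

lemma test1_integrable: "test1 f \<Longrightarrow> integrable lborel f"
proof -
  assume f: "test1 f"
  obtain R where "\<And>x. \<bar>x\<bar> > R \<Longrightarrow> f x = 0" using f unfolding test1_def by blast
  moreover obtain B where "\<And>x. \<bar>f x\<bar> \<le> B" using f using test1_bounded[OF f] by metis
  ultimately show ?thesis
    by (intro integrable_compact_support[of f B R] test1_measurable f) auto
qed

lemma test1_mult: "test1 f \<Longrightarrow> smooth g \<Longrightarrow> test1 (\<lambda>x. f x * g x)"
  unfolding test1_def by (fastforce intro: smooth_mult)

lemma test1_mult': "test1 g \<Longrightarrow> smooth f \<Longrightarrow> test1 (\<lambda>x. f x * g x)"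
  unfolding test1_def by (fastforce intro: smooth_mult)

lemma test1_add: "test1 f \<Longrightarrow> test1 g \<Longrightarrow> test1 (\<lambda>x. f x + g x)"
  unfolding test1_def
proof (intro conjI smooth_add; elim conjE exE)
  fix R R' assume "\<forall>x. \<bar>x\<bar> > R \<longrightarrow> f x = 0" "\<forall>x. \<bar>x\<bar> > R' \<longrightarrow> g x = 0"
  then show "\<exists>R. \<forall>x. \<bar>x\<bar> > R \<longrightarrow> f x + g x = 0"
    by (intro exI[of _ "max R R'"]) auto
qed auto

lemma test1_affine:
  assumes "test1 f" "a \<noteq> 0" shows "test1 (\<lambda>x. f (a * x + b))"
proof -
  obtain R where R: "\<And>x. \<bar>x\<bar> > R \<Longrightarrow> f x = 0" and f: "smooth f"
    using assms unfolding test1_def by blast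
  have "f (a * x + b) = 0" if "\<bar>x\<bar> > (\<bar>R\<bar> + \<bar>b\<bar>) / \<bar>a\<bar>" for x
  proof (rule R)
    from that assms have "\<bar>R\<bar> + \<bar>b\<bar> < \<bar>a * x\<bar>"
      by (simp add: field_simps abs_mult)
    then show "R < \<bar>a * x + b\<bar>" by linarith
  qed
  with smooth_affine[OF f] show ?thesis unfolding test1_def by blast
qed

section \<open>A compactly supported bump and the mollifiers built from it\<close>

definition flat :: "real poly \<Rightarrow> real \<Rightarrow> real" where
  "flat P x = (if x > 0 then poly P (1 / x) * exp (- (1 / x)) else 0)"

lemma poly_exp_limit: "((\<lambda>y. poly P y * exp (- y)) \<longlongrightarrow> 0) at_top" for P :: "real poly"
proof (induction P)
  case 0 then show ?case by simp
next
  case (pCons a P)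
  have "((\<lambda>y. poly Q y * exp (- (y/2))) \<longlongrightarrow> 0) at_top" for Q :: "real poly"
  proof -
    have "((\<lambda>y. \<Sum>i\<le>degree Q. coeff Q i * y ^ i * exp (- (y/2))) \<longlongrightarrow> (\<Sum>i\<le>degree Q. 0)) at_top"
      by (intro tendsto_sum) real_asymp
    then show ?thesis by (simp add: poly_altdef sum_distrib_right)
  qed
  from this[of "pCons a P"] have "((\<lambda>y. (poly (pCons a P) y * exp (- (y/2))) * exp (-(y/2))) \<longlongrightarrow> 0 * 0) at_top"
    by (intro tendsto_mult) (assumption, real_asymp)
  then show ?case by (simp add: mult.assoc flip: exp_add)
qed

text \<open>With y = 1/x, the derivative of P(y) exp(-y) is y^2 (P - P')(y) exp(-y), and
  \<open>[:0,0,1:]\<close> is the polynomial y^2. So the range of \<open>flat\<close> is closed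
  under differentiation, which is all that \<open>smooth_coinduct\<close> asks for.\<close>

lemma flat_derivative:
  "(flat P has_vector_derivative flat ([:0,0,1:] * (P - pderiv P)) x) (at x)"
proof -
  consider "x > 0" | "x < 0" | "x = 0" by linarith
  then have "(flat P has_real_derivative flat ([:0,0,1:] * (P - pderiv P)) x) (at x)"
  proof cases
    case 1
    have "((\<lambda>x. poly P (1 / x) * exp (- (1 / x))) has_real_derivative flat ([:0,0,1:] * (P - pderiv P)) x) (at x)"
      using 1 unfolding flat_def
      by (auto intro!: derivative_eq_intros poly_DERIV[THEN DERIV_chain2] simp: field_simps power2_eq_square)
    then show ?thesis
      by (rule DERIV_cong_ev[THEN iffD1, rotated -1])
        (use 1 eventually_nhds_in_open[of "{0<..}" x] in \<open>auto simp: flat_def elim: eventually_mono\<close>)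
  next
    case 2
    have "((\<lambda>x. 0::real) has_real_derivative flat ([:0,0,1:] * (P - pderiv P)) x) (at x)"
      using 2 by (simp add: flat_def)
    then show ?thesis
      by (rule DERIV_cong_ev[THEN iffD1, rotated -1])
        (use 2 eventually_nhds_in_open[of "{..<0}" x] in \<open>auto simp: flat_def elim!: eventually_mono\<close>)
  next
    case 3
    have "((\<lambda>h. flat P h / h) \<longlongrightarrow> 0) (at 0)"
    proof (rule filterlim_split_at)
      show "((\<lambda>h. flat P h / h) \<longlongrightarrow> 0) (at_left 0)"
        by (rule tendsto_eventually) (auto simp: flat_def eventually_at_left[of "-1"] intro!: exI[of _ "-1"])
      \<comment> \<open>Dividing by \<open>h\<close> multiplies by y = 1/h, which turns
        \<open>P\<close> into \<open>pCons 0 P\<close>; the quotient at 0 is thus again a polynomial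
        times an exponential.\<close>
      have "((\<lambda>y. poly (pCons 0 P) y * exp (- y)) \<longlongrightarrow> 0) at_top"
        by (rule poly_exp_limit)
      then have "((\<lambda>h. poly (pCons 0 P) (inverse h) * exp (- inverse h)) \<longlongrightarrow> 0) (at_right 0)"
        by (rule filterlim_compose[OF _ filterlim_inverse_at_top_right])
      then show "((\<lambda>h. flat P h / h) \<longlongrightarrow> 0) (at_right 0)"
        by (rule Lim_transform_eventually)
          (auto simp: flat_def field_simps eventually_at_right[of 0 1] intro!: exI[of _ 1])
    qed
    with 3 show ?thesis
      by (simp add: DERIV_def flat_def)
  qed
  then show ?thesis by (simp add: has_real_derivative_iff_has_vector_derivative)
qed

lemma flat_smooth: "smooth (flat P)"
  by (rule smooth_coinduct[of _ "range flat"]) (auto intro: flat_derivative)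

text \<open>On (-1, 1) this is exp(-2 / (1 - x^2)).\<close>

definition bump :: "real \<Rightarrow> real" where
  "bump x = flat 1 (1 + x) * flat 1 (1 - x)"

lemma bump_pos: "\<bar>x\<bar> < 1 \<Longrightarrow> 0 < bump x"
  and bump_zero: "\<bar>x\<bar> \<ge> 1 \<Longrightarrow> bump x = 0"
  and bump_nonneg: "0 \<le> bump x"
  by (auto simp: bump_def flat_def abs_less_iff abs_le_iff not_less abs_if split: if_splits)

lemma bump_test1: "test1 bump"
proof -
  have "smooth (\<lambda>x. flat 1 (1 * x + 1) * flat 1 ((-1) * x + 1))"
    by (intro smooth_mult smooth_affine flat_smooth)
  then have "smooth bump"
    by (simp add: bump_def[abs_def] add.commute)
  then show ?thesis
    unfolding test1_def using bump_zero by (intro conjI exI[of _ 1]) auto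
qed

lemma bump_continuous: "continuous_on A bump"
  by (rule test1_continuous[OF bump_test1])

lemma bump_lower_bound:
  assumes "0 \<le> r" "r < 1" obtains c where "c > 0" "\<And>x. \<bar>x\<bar> \<le> r \<Longrightarrow> c \<le> bump x"
proof -
  obtain y where y: "y \<in> {-r..r}" "\<forall>x\<in>{-r..r}. bump y \<le> bump x"
    using continuous_attains_inf[of "{-r..r}" bump] bump_continuous assms(1) by auto
  with assms bump_pos[of y] that[of "bump y"] show thesis by (auto simp: abs_le_iff)
qed

lemma integral_bump_pos: "0 < (LBINT x. bump x)"
proof -
  obtain c where c: "c > 0" "\<And>x. \<bar>x\<bar> \<le> 1/2 \<Longrightarrow> c \<le> bump x"
    using bump_lower_bound[of "1/2"] by auto
  have "(LBINT x. c * indicator {-1/2..1/2::real} x) \<le> (LBINT x. bump x)"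
  proof (rule integral_mono)
    show "integrable lborel (\<lambda>x. c * indicator {-1/2..1/2::real} x)"
      by (intro integrable_mult_right) (simp add: integrable_indicator_iff emeasure_lborel_Icc_eq)
  qed (use c bump_nonneg in \<open>auto split: split_indicator intro: test1_integrable bump_test1\<close>)
  with c show ?thesis by simp
qed

text \<open>Unit mass, support in \<open>[-1/n, 1/n]\<close>.\<close>

definition moll :: "real \<Rightarrow> real \<Rightarrow> real" where
  "moll n x = n * bump (n * x) / (LBINT y. bump y)"

lemma moll_test1: "n > 0 \<Longrightarrow> test1 (moll n)"
  using test1_mult'[OF test1_affine[OF bump_test1, of n 0] smooth_const[of "n / (LBINT y. bump y)"]]
  by (simp add: moll_def[abs_def] field_simps)

lemma moll_nonneg: "n > 0 \<Longrightarrow> 0 \<le> moll n x"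
  using bump_nonneg integral_bump_pos by (simp add: moll_def less_imp_le)

lemma moll_zero: "n > 0 \<Longrightarrow> \<bar>x\<bar> \<ge> 1 / n \<Longrightarrow> moll n x = 0"
  by (simp add: moll_def bump_zero field_simps abs_mult)

lemma integral_moll: "n > 0 \<Longrightarrow> (LBINT x. moll n x) = 1"
  using lborel_integral_real_affine[of n bump 0] integral_bump_pos
  by (simp add: moll_def) (metis less_irrefl mult_zero_right)

section \<open>Differentiation under the integral, Fubini bounds and the Cauchy-Schwarz
  inequality\<close>

lemma has_vector_derivative_iff_limit:
  "(f has_vector_derivative D) (at x) \<longleftrightarrow> ((\<lambda>h. (f (x + h) - f x) /\<^sub>R h) \<longlongrightarrow> D) (at 0)"
proof -
  have "((\<lambda>h. norm (f (x + h) - f x - h *\<^sub>R D) / norm h) \<longlongrightarrow> 0) (at 0)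
    \<longleftrightarrow> ((\<lambda>h. norm ((f (x + h) - f x) /\<^sub>R h - D)) \<longlongrightarrow> 0) (at 0)"
  proof (rule filterlim_cong[OF refl refl], unfold eventually_at_filter, rule always_eventually, intro allI impI)
    fix h :: real assume h: "h \<noteq> 0"
    then have "f (x + h) - f x - h *\<^sub>R D = h *\<^sub>R ((f (x + h) - f x) /\<^sub>R h - D)"
      by (simp add: algebra_simps)
    with h show "norm (f (x + h) - f x - h *\<^sub>R D) / norm h = norm ((f (x + h) - f x) /\<^sub>R h - D)"
      by simp
  qed
  then show ?thesis
    unfolding has_vector_derivative_def has_derivative_at
    by (simp add: bounded_linear_scaleR_left tendsto_norm_zero_iff LIM_zero_iff)
qed

lemma vector_derivative_sequence:
  assumes "(f has_vector_derivative D) (at x)" "\<And>n. X n \<noteq> 0" "X \<longlonglongrightarrow> 0"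
  shows "(\<lambda>n. (f (x + X n) - f x) /\<^sub>R X n) \<longlonglongrightarrow> D"
  using assms unfolding has_vector_derivative_iff_limit tendsto_at_iff_sequentially by (simp add: o_def)

lemma norm_vector_derivative_bound:
  fixes f :: "real \<Rightarrow> 'a::real_normed_vector"
  assumes "\<And>x. (f has_vector_derivative f' x) (at x)" "\<And>x. norm (f' x) \<le> B"
  shows "norm (f y - f x) \<le> B * \<bar>y - x\<bar>"
proof -
  have "norm (f y - f x) \<le> B * norm (y - x)"
    by (rule differentiable_bound[of UNIV f "\<lambda>x h. h *\<^sub>R f' x"])
      (use assms in \<open>auto simp: has_vector_derivative_def intro!: onorm_le simp: mult.commute[of B] mult_left_mono\<close>)
  then show ?thesis by simp
qed

text \<open>The mean value inequality transfers the bound \<open>g\<close> from the derivative to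
  all difference quotients, so dominated convergence applies along every null sequence.
  Measurability of \<open>f' x\<close> is not assumed; it is inherited from the quotients.\<close>

lemma integral_has_vector_derivative:
  fixes f :: "real \<Rightarrow> 'b \<Rightarrow> 'a::{banach, second_countable_topology}"
  assumes d: "\<And>x y. ((\<lambda>x. f x y) has_vector_derivative f' x y) (at x)"
    and f: "\<And>x. integrable M (f x)" and g: "integrable M g"
    and bd: "\<And>x y. norm (f' x y) \<le> g y"
  shows "((\<lambda>x. LINT y|M. f x y) has_vector_derivative (LINT y|M. f' x y)) (at x)"
    and "integrable M (f' x)"
proof -
  let ?q = "\<lambda>h y. (f (x + h) y - f x y) /\<^sub>R h"
  have lim: "(\<lambda>n. ?q (X n) y) \<longlonglongrightarrow> f' x y" if "\<And>n. X n \<noteq> 0" "X \<longlonglongrightarrow> 0" for X y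
    using vector_derivative_sequence[OF d that] .
  have meas: "?q h \<in> borel_measurable M" for h
    using f by measurable
  let ?X = "\<lambda>n. 1 / real (Suc n)"
  have X: "?X \<longlonglongrightarrow> 0"
    by (rule LIMSEQ_Suc[OF lim_1_over_n])
  have meas': "f' x \<in> borel_measurable M"
    by (rule borel_measurable_LIMSEQ_metric[where f="\<lambda>i. ?q (?X i)", OF meas]) (intro lim X, simp)
  then show "integrable M (f' x)"
    by (rule_tac integrable_bound[OF g]) (auto intro!: AE_I2 order_trans[OF bd abs_ge_self])
  have bound: "norm (?q h y) \<le> g y" if "h \<noteq> 0" for h y
    using norm_vector_derivative_bound[of "\<lambda>x. f x y" "\<lambda>x. f' x y" "g y" "x + h" x, OF d bd] that
    by (simp add: pos_divide_le_eq divide_inverse_commute[symmetric] flip: abs_inverse)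
      (simp add: abs_inverse pos_divide_le_eq flip: divide_inverse_commute)
  have *: "(LINT y|M. ?q h y) = ((LINT y|M. f (x + h) y) - (LINT y|M. f x y)) /\<^sub>R h" for h
    using f by simp
  have "(\<lambda>n. LINT y|M. ?q (X n) y) \<longlonglongrightarrow> (LINT y|M. f' x y)" if "\<And>n. X n \<noteq> 0" "X \<longlonglongrightarrow> 0" for X
    by (rule integral_dominated_convergence[OF meas' meas g]) (intro AE_I2 lim bound that; simp)+
  then show "((\<lambda>x. LINT y|M. f x y) has_vector_derivative (LINT y|M. f' x y)) (at x)"
    unfolding has_vector_derivative_iff_limit tendsto_at_iff_sequentially o_def * by auto
qed

lemma integrable_pair_bound:
  fixes F :: "real \<Rightarrow> real \<Rightarrow> 'a::{banach, second_countable_topology}"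
  assumes F: "case_prod F \<in> borel_measurable (lborel \<Otimes>\<^sub>M lborel)"
    and a: "integrable lborel a" and b: "integrable lborel b"
    and le: "\<And>x y. norm (F x y) \<le> a x * (b y :: real)"
  shows "integrable (lborel \<Otimes>\<^sub>M lborel) (case_prod F)"
proof (rule integrable_bound[OF _ F])
  show "integrable (lborel \<Otimes>\<^sub>M lborel) (\<lambda>(x, y). a x * b y)"
  proof (rule lborel_pair.Fubini_integrable)
    show "(\<lambda>(x, y). a x * b y) \<in> borel_measurable (lborel \<Otimes>\<^sub>M lborel)"
      using a b by measurable
    show "integrable lborel (\<lambda>x. LBINT y. norm (case (x, y) of (x, y) \<Rightarrow> a x * b y))"
      using a by (simp add: abs_mult)
    show "AE x in lborel. integrable lborel (\<lambda>y. case (x, y) of (x, y) \<Rightarrow> a x * b y)"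
      using b by simp
  qed
  show "AE xy in lborel \<Otimes>\<^sub>M lborel. norm (case_prod F xy) \<le> norm (case xy of (x, y) \<Rightarrow> a x * b y)"
    using order_trans[OF le abs_ge_self] by (auto intro!: AE_I2)
qed

lemma integral_translate:
  fixes f :: "real \<Rightarrow> 'a::{banach, second_countable_topology}"
  shows "(LBINT x. f (x + h)) = (LBINT x. f x)"
  using lborel_integral_real_affine[of 1 f h] by (simp add: add.commute)

lemma integral_reflect:
  fixes f :: "real \<Rightarrow> 'a::{banach, second_countable_topology}"
  shows "(LBINT x. f (a - x)) = (LBINT x. f x)"
  using lborel_integral_real_affine[of "-1" f a] by simp

lemma integrable_translate:
  fixes f :: "real \<Rightarrow> 'a::{banach, second_countable_topology}"
  shows "integrable lborel (\<lambda>x. f (x + h)) \<longleftrightarrow> integrable lborel f"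
  using lborel_integrable_real_affine_iff[of 1 f h] by (simp add: add.commute)

lemma integrable_reflect:
  fixes f :: "real \<Rightarrow> 'a::{banach, second_countable_topology}"
  shows "integrable lborel (\<lambda>x. f (a - x)) \<longleftrightarrow> integrable lborel f"
  using lborel_integrable_real_affine_iff[of "-1" f a] by simp

lemma integrable_square_product:
  fixes f g :: "'a \<Rightarrow> real"
  assumes [measurable]: "f \<in> borel_measurable M" "g \<in> borel_measurable M"
    and f: "integrable M (\<lambda>x. (f x)\<^sup>2)" and g: "integrable M (\<lambda>x. (g x)\<^sup>2)"
  shows "integrable M (\<lambda>x. f x * g x)"
    and "integrable M (\<lambda>x. (f x + g x)\<^sup>2)"
    and "integrable M (\<lambda>x. (f x - g x)\<^sup>2)"
proof -
  show *: "integrable M (\<lambda>x. f x * g x)"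
  proof (rule integrable_bound[OF integrable_add[OF f g]])
    show "AE x in M. norm (f x * g x) \<le> norm ((f x)\<^sup>2 + (g x)\<^sup>2)"
    proof (rule AE_I2)
      fix x
      have "2 * (\<bar>f x\<bar> * \<bar>g x\<bar>) \<le> (f x)\<^sup>2 + (g x)\<^sup>2"
        using sum_squares_bound[of "\<bar>f x\<bar>" "\<bar>g x\<bar>"] by (simp add: mult.assoc)
      moreover have "0 \<le> \<bar>f x\<bar> * \<bar>g x\<bar>" by simp
      ultimately show "norm (f x * g x) \<le> norm ((f x)\<^sup>2 + (g x)\<^sup>2)"
        unfolding real_norm_def abs_mult by linarith
    qed
  qed measurable
  show "integrable M (\<lambda>x. (f x + g x)\<^sup>2)" "integrable M (\<lambda>x. (f x - g x)\<^sup>2)"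
    using f g * by (simp_all add: power2_sum power2_diff mult.assoc)
qed

lemma Cauchy_Schwarz_integral:
  fixes f g :: "'a \<Rightarrow> real"
  assumes [measurable]: "f \<in> borel_measurable M" "g \<in> borel_measurable M"
    and f: "integrable M (\<lambda>x. (f x)\<^sup>2)" and g: "integrable M (\<lambda>x. (g x)\<^sup>2)"
  shows "(LINT x|M. \<bar>f x * g x\<bar>) \<le> sqrt (LINT x|M. (f x)\<^sup>2) * sqrt (LINT x|M. (g x)\<^sup>2)"
proof -
  let ?A = "LINT x|M. (f x)\<^sup>2" and ?B = "LINT x|M. \<bar>f x * g x\<bar>" and ?C = "LINT x|M. (g x)\<^sup>2"
  have i: "integrable M (\<lambda>x. \<bar>f x * g x\<bar>)"
    using integrable_square_product(1)[OF assms] by simp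
  have nn: "0 \<le> ?A" "0 \<le> ?B" "0 \<le> ?C" by simp_all
  have "0 \<le> t\<^sup>2 * ?A - 2 * t * ?B + ?C" for t
  proof -
    have "0 \<le> (LINT x|M. (t * \<bar>f x\<bar> - \<bar>g x\<bar>)\<^sup>2)" by simp
    also have "\<dots> = (LINT x|M. t\<^sup>2 * (f x)\<^sup>2 - 2 * t * \<bar>f x * g x\<bar> + (g x)\<^sup>2)"
      by (intro integral_cong) (auto simp: power2_diff power_mult_distrib abs_mult)
    also have "\<dots> = t\<^sup>2 * ?A - 2 * t * ?B + ?C"
      using f g i by simp
    finally show ?thesis .
  qed
  note q = this
  have "?B\<^sup>2 \<le> ?A * ?C"
  proof (cases "?A = 0")
    case True
    have "?B = 0"
    proof (rule ccontr)
      assume "?B \<noteq> 0"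
      with nn have "?B > 0" by linarith
      \<comment> \<open>If \<open>?A = 0\<close>, the quadratic is affine in \<open>t\<close>, and
        at this value it equals -1.\<close>
      with q[of "(?C + 1) / (2 * ?B)"] True show False by simp
    qed
    with True show ?thesis by simp
  next
    case False
    with nn have "?A > 0" by linarith
    with q[of "?B / ?A"] show ?thesis
      by (simp add: field_simps power2_eq_square)
  qed
  then have "sqrt (?B\<^sup>2) \<le> sqrt (?A * ?C)" by (rule real_sqrt_le_mono)
  with nn show ?thesis by (simp add: real_sqrt_mult)
qed

section \<open>Convolution with mollifiers and the du Bois-Reymond lemma\<close>

lemma convolution_derivative:
  fixes f :: "real \<Rightarrow> real"
  assumes f: "integrable lborel f" and \<rho>: "test1 \<rho>"
    and \<rho>': "test1 \<rho>'" "\<And>x. (\<rho> has_real_derivative \<rho>' x) (at x)"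
  shows "((\<lambda>x. LBINT y. \<rho> (x - y) * f y) has_vector_derivative (LBINT y. \<rho>' (x - y) * f y)) (at x)"
proof -
  obtain B where B: "B > 0" "\<And>x. \<bar>\<rho> x\<bar> \<le> B" using \<rho> test1_bounded by blast
  obtain B' where B': "B' > 0" "\<And>x. \<bar>\<rho>' x\<bar> \<le> B'" using \<rho>'(1) test1_bounded by blast
  have [measurable]: "\<rho> \<in> borel_measurable borel" using \<rho> by measurable
  have [measurable]: "f \<in> borel_measurable borel" using f by auto
  show ?thesis
  proof (rule integral_has_vector_derivative)
    show "((\<lambda>x. \<rho> (x - y) * f y) has_vector_derivative \<rho>' (x - y) * f y) (at x)" for x y
    proof -
      have "((\<lambda>x. \<rho> (x - y)) has_real_derivative \<rho>' (x - y)) (at x)"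
        using DERIV_chain2[OF \<rho>'(2), of "\<lambda>x. x - y" 1 x UNIV] by (simp add: DERIV_diff[OF DERIV_ident DERIV_const, simplified])
      from DERIV_cmult_right[OF this, of "f y"] show ?thesis
        by (simp add: has_real_derivative_iff_has_vector_derivative mult.commute)
    qed
    show "integrable lborel (\<lambda>y. \<rho> (x - y) * f y)" for x
      by (rule integrable_bound[of lborel "\<lambda>y. B * f y"])
        (use B f in \<open>auto simp: abs_mult intro!: mult_right_mono AE_I2\<close>)
    show "integrable lborel (\<lambda>y. B' * \<bar>f y\<bar>)" using f by simp
    show "norm (\<rho>' (x - y) * f y) \<le> B' * \<bar>f y\<bar>" for x y
      using B' by (auto simp: abs_mult intro!: mult_right_mono)
  qed
qed

lemma convolution_test1:
  fixes f :: "real \<Rightarrow> real"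
  assumes f: "integrable lborel f" and R: "\<And>x. \<bar>x\<bar> > R \<Longrightarrow> f x = 0" and \<rho>: "test1 \<rho>"
  shows "test1 (\<lambda>x. LBINT y. \<rho> (x - y) * f y)"
proof -
  have "smooth (\<lambda>x. LBINT y. \<rho> (x - y) * f y)"
  proof (rule smooth_coinduct[of _ "{\<lambda>x. LBINT y. \<rho> (x - y) * f y | \<rho>. test1 \<rho>}"])
    show "\<exists>g'\<in>{\<lambda>x. LBINT y. \<rho> (x - y) * f y | \<rho>. test1 \<rho>}. \<forall>x. (g has_vector_derivative g' x) (at x)"
      if "g \<in> {\<lambda>x. LBINT y. \<rho> (x - y) * f y | \<rho>. test1 \<rho>}" for g
    proof -
      obtain \<rho> where g: "g = (\<lambda>x. LBINT y. \<rho> (x - y) * f y)" and \<rho>: "test1 \<rho>"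
        using \<open>g \<in> _\<close> by blast
      obtain \<rho>' where \<rho>': "test1 \<rho>'" "\<And>x. (\<rho> has_real_derivative \<rho>' x) (at x)"
        using \<rho> test1_derivative by blast
      show ?thesis
        by (rule bexI[of _ "\<lambda>x. LBINT y. \<rho>' (x - y) * f y"])
          (use convolution_derivative[OF f \<rho> \<rho>'] \<rho>' g in auto)
    qed
  qed (use \<rho> in blast)
  moreover obtain R' where R': "\<And>x. \<bar>x\<bar> > R' \<Longrightarrow> \<rho> x = 0" using \<rho> unfolding test1_def by blast
  have "(LBINT y. \<rho> (x - y) * f y) = 0" if "\<bar>x\<bar> > \<bar>R\<bar> + \<bar>R'\<bar>" for x
  proof -
    have "\<rho> (x - y) * f y = 0" for y
      using R[of y] R'[of "x - y"] that by (cases "\<bar>y\<bar> > R") auto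
    then show ?thesis by (simp only: Bochner_Integration.integral_zero)
  qed
  ultimately show ?thesis unfolding test1_def by blast
qed

lemma moll_integrable: "n > 0 \<Longrightarrow> integrable lborel (moll n)"
  by (intro test1_integrable moll_test1)

lemma integral_moll_shift: "n > 0 \<Longrightarrow> (LBINT y. moll n (x - y)) = 1"
  using integral_reflect[of "moll n" x] integral_moll by simp

lemma moll_constant:
  fixes f :: "real \<Rightarrow> real"
  assumes "n > 0" "\<And>y. \<bar>x - y\<bar> < 1 / n \<Longrightarrow> f y = c"
  shows "(LBINT y. moll n (x - y) * f y) = c"
proof -
  have "(LBINT y. moll n (x - y) * f y) = (LBINT y. moll n (x - y) * c)"
    using assms moll_zero[OF assms(1)]
    by (intro integral_cong) (auto simp: not_less, metis linorder_not_less)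
  then show ?thesis using integral_moll_shift[OF assms(1)] by simp
qed

lemma moll_le:
  fixes f :: "real \<Rightarrow> real"
  assumes n: "n > 0" and f: "f \<in> borel_measurable borel" "\<And>y. \<bar>f y\<bar> \<le> B"
  shows "\<bar>LBINT y. moll n (x - y) * f y\<bar> \<le> B"
    and "integrable lborel (\<lambda>y. moll n (x - y) * f y)"
proof -
  have [measurable]: "moll n \<in> borel_measurable borel" "f \<in> borel_measurable borel"
    using moll_test1[OF n] f by auto
  have m: "integrable lborel (\<lambda>y. moll n (x - y))"
    using moll_integrable[OF n] by (simp add: integrable_reflect)
  have le: "\<bar>moll n (x - y) * f y\<bar> \<le> moll n (x - y) * B" for y
    using f(2)[of y] moll_nonneg[OF n] by (simp add: abs_mult mult_left_mono)
  show i: "integrable lborel (\<lambda>y. moll n (x - y) * f y)"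
    by (rule integrable_bound[OF integrable_mult_left[OF m, of B]])
      (use le in \<open>auto intro!: AE_I2 order_trans[OF _ abs_ge_self]\<close>)
  have "\<bar>LBINT y. moll n (x - y) * f y\<bar> \<le> (LBINT y. moll n (x - y) * B)"
    using m le i by (intro order_trans[OF integral_abs_bound] integral_mono) auto
  then show "\<bar>LBINT y. moll n (x - y) * f y\<bar> \<le> B"
    using integral_moll_shift[OF n] by simp
qed

text \<open>The functions are mollified indicators. Their derivative, given in closed form, is the
  difference of two approximate point masses at \<open>a\<close> and \<open>b\<close>; testing with
  it recovers the values of a continuous function at the two endpoints in
  \<open>time_du_Bois_Reymond\<close>.\<close>

lemma indicator_by_test1:
  fixes a b :: real assumes "a < b"
  obtains \<theta> :: "nat \<Rightarrow> real \<Rightarrow> real"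
  where "\<And>n. test1 (\<theta> n)" "\<And>n x. \<bar>\<theta> n x\<bar> \<le> 1" "\<And>n x. x \<notin> {a-1..b+1} \<Longrightarrow> \<theta> n x = 0"
    "\<And>x. x \<noteq> a \<Longrightarrow> x \<noteq> b \<Longrightarrow> (\<lambda>n. \<theta> n x) \<longlonglongrightarrow> indicator {a..b} x"
    "\<And>n x. (\<theta> n has_real_derivative (moll (Suc n) (x - a) - moll (Suc n) (x - b))) (at x)"
proof -
  define I where "I = (indicator {a..b} :: real \<Rightarrow> real)"
  define \<theta> where "\<theta> n x = (LBINT y. moll (Suc n) (x - y) * I y)" for n :: nat and x
  have I: "integrable lborel I" "\<And>x. \<bar>x\<bar> > max \<bar>a\<bar> \<bar>b\<bar> \<Longrightarrow> I x = 0" "\<And>y. \<bar>I y\<bar> \<le> 1" "I \<in> borel_measurable borel"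
    unfolding I_def using assms
    by (auto simp: indicator_def integrable_indicator_iff emeasure_lborel_Icc_eq)
  have 1: "test1 (\<theta> n)" for n
    unfolding \<theta>_def by (rule convolution_test1[where R="max \<bar>a\<bar> \<bar>b\<bar>", OF I(1) _ moll_test1]) (rule I(2), simp_all)
  have 2: "\<bar>\<theta> n x\<bar> \<le> 1" for n x
    unfolding \<theta>_def by (rule moll_le) (use I in auto)
  have 3: "\<theta> n x = 0" if "x \<notin> {a-1..b+1}" for n x
    unfolding \<theta>_def
  proof (rule moll_constant)
    fix y assume "\<bar>x - y\<bar> < 1 / real (Suc n)"
    moreover have "1 / real (Suc n) \<le> 1" by simp
    ultimately have "\<bar>x - y\<bar> < 1" by linarith
    then show "I y = 0" using that unfolding I_def by (auto simp: indicator_def)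
  qed simp
  have 4: "(\<lambda>n. \<theta> n x) \<longlonglongrightarrow> indicator {a..b} x" if x: "x \<noteq> a" "x \<noteq> b" for x
  proof -
    define d where "d = min \<bar>x - a\<bar> \<bar>x - b\<bar>"
    have "d > 0" using x by (simp add: d_def)
    then obtain N where N: "1 / real (Suc N) < d" using nat_approx_posE by blast
    have "\<theta> n x = indicator {a..b} x" if n: "n \<ge> N" for n
      unfolding \<theta>_def
    proof (rule moll_constant)
      fix y assume "\<bar>x - y\<bar> < 1 / real (Suc n)"
      moreover have "1 / real (Suc n) \<le> 1 / real (Suc N)" using n by (simp add: field_simps)
      ultimately have "\<bar>x - y\<bar> < d" using N by linarith
      then show "I y = indicator {a..b} x" unfolding I_def d_def by (auto simp: indicator_def)
    qed simp
    then show ?thesis by (intro tendsto_eventually) (auto simp: eventually_sequentially)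
  qed
  have 5: "(\<theta> n has_real_derivative (moll (Suc n) (x - a) - moll (Suc n) (x - b))) (at x)" for n x
  proof -
    let ?m = "moll (Suc n)"
    obtain m' where m': "test1 m'" "\<And>x. (?m has_real_derivative m' x) (at x)"
      using test1_derivative[OF moll_test1[of "Suc n"]] by auto
    have "(\<theta> n has_vector_derivative (LBINT y. m' (x - y) * I y)) (at x)"
      unfolding \<theta>_def by (rule convolution_derivative[OF I(1) _ m']) (simp add: moll_test1)
    moreover have "(LBINT y. m' (x - y) * I y) = ?m (x - a) - ?m (x - b)"
    proof -
      have "(LBINT y. indicator {a..b} y *\<^sub>R m' (x - y)) = (- ?m (x - b)) - (- ?m (x - a))"
      proof (rule integral_FTC_Icc)
        show "((\<lambda>y. - ?m (x - y)) has_vector_derivative m' (x - y)) (at y within {a..b})" for y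
        proof -
          have "((\<lambda>y. - ?m (x - y)) has_real_derivative - (m' (x - y) * (- 1))) (at y)"
            by (intro DERIV_minus DERIV_chain2[OF m'(2)]) (auto intro!: derivative_eq_intros)
          then show ?thesis
            by (simp add: has_real_derivative_iff_has_vector_derivative has_vector_derivative_at_within)
        qed
        show "continuous_on {a..b} (\<lambda>y. m' (x - y))"
          by (intro continuous_on_compose2[OF test1_continuous[OF m'(1), of UNIV]] continuous_intros) auto
      qed (use assms in simp)
      then show ?thesis by (simp add: I_def mult.commute)
    qed
    ultimately show ?thesis by (simp add: has_real_derivative_iff_has_vector_derivative)
  qed
  show thesis by (rule that[of \<theta>]) (use 1 2 3 4 5 in auto)
qed

text \<open>Smooth approximations of indicators show that the integral of \<open>f\<close> over
  every bounded interval vanishes. A finite measure on the line is determined by its values on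
  half-lines, so the positive and negative parts of a truncation of \<open>f\<close> are densities
  of the same measure.\<close>

lemma du_Bois_Reymond:
  fixes f :: "real \<Rightarrow> real"
  assumes [measurable]: "f \<in> borel_measurable borel"
    and int: "\<And>\<psi>. test1 \<psi> \<Longrightarrow> integrable lborel (\<lambda>x. f x * \<psi> x)"
    and zero: "\<And>\<psi>. test1 \<psi> \<Longrightarrow> (LBINT x. f x * \<psi> x) = 0"
  shows "AE x in lborel. f x = 0"
proof -
  \<comment> \<open>Local integrability is extracted from \<open>int\<close> by testing with a
    dilated bump that is bounded below by \<open>c\<close> on the interval.\<close>
  have loc: "set_integrable lborel {a..b} f" for a b
  proof -
    define r where "r = \<bar>a\<bar> + \<bar>b\<bar> + 1"
    define \<psi> where "\<psi> x = bump ((1 / (2 * r)) * x + 0)" for x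
    have r: "r > 0" by (simp add: r_def)
    obtain c where c: "c > 0" "\<And>x. \<bar>x\<bar> \<le> 1/2 \<Longrightarrow> c \<le> bump x"
      using bump_lower_bound[of "1/2"] by auto
    have \<psi>: "test1 \<psi>" unfolding \<psi>_def by (rule test1_affine[OF bump_test1]) (use r in simp)
    have ge: "c \<le> \<psi> x" if "x \<in> {a..b}" for x
      unfolding \<psi>_def using that r by (intro c(2)) (auto simp: r_def field_simps abs_le_iff)
    show ?thesis unfolding set_integrable_def
    proof (rule integrable_bound[OF integrable_mult_right[OF int[OF \<psi>], of "1 / c"]])
      show "AE x in lborel. norm (indicator {a..b} x *\<^sub>R f x) \<le> norm (1 / c * (f x * \<psi> x))"
      proof (rule AE_I2)
        fix x
        have "\<bar>f x\<bar> * c \<le> \<bar>f x\<bar> * \<bar>\<psi> x\<bar>" if "x \<in> {a..b}"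
          using ge[OF that] c(1) by (intro mult_left_mono) auto
        then show "norm (indicator {a..b} x *\<^sub>R f x) \<le> norm (1 / c * (f x * \<psi> x))"
          using c(1) by (auto simp: indicator_def abs_mult field_simps)
      qed
    qed measurable
  qed
  have z: "(LBINT x:{a..b}. f x) = 0" if ab: "a < b" for a b
  proof -
    obtain \<theta> :: "nat \<Rightarrow> real \<Rightarrow> real" where \<theta>: "\<And>n. test1 (\<theta> n)" "\<And>n x. \<bar>\<theta> n x\<bar> \<le> 1"
      "\<And>n x. x \<notin> {a-1..b+1} \<Longrightarrow> \<theta> n x = 0"
      "\<And>x. x \<noteq> a \<Longrightarrow> x \<noteq> b \<Longrightarrow> (\<lambda>n. \<theta> n x) \<longlonglongrightarrow> indicator {a..b} x"
      by (rule indicator_by_test1[OF ab]) blast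
    have [measurable]: "\<theta> n \<in> borel_measurable borel" for n using \<theta>(1) by auto
    have "(\<lambda>n. LBINT x. f x * \<theta> n x) \<longlonglongrightarrow> (LBINT x. f x * indicator {a..b} x)"
    proof (rule integral_dominated_convergence)
      show "integrable lborel (\<lambda>x. \<bar>indicator {a-1..b+1} x *\<^sub>R f x\<bar>)"
        using loc unfolding set_integrable_def by (rule integrable_abs)
      have "AE x in lborel. x \<noteq> a" "AE x in lborel. x \<noteq> b" by (rule AE_lborel_singleton)+
      then show "AE x in lborel. (\<lambda>n. f x * \<theta> n x) \<longlonglongrightarrow> f x * indicator {a..b} x"
        by eventually_elim (intro tendsto_mult tendsto_const \<theta>(4))
      show "AE x in lborel. norm (f x * \<theta> n x) \<le> \<bar>indicator {a-1..b+1} x *\<^sub>R f x\<bar>" for n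
      proof (rule AE_I2)
        fix x
        have "\<bar>f x\<bar> * \<bar>\<theta> n x\<bar> \<le> \<bar>f x\<bar> * 1" using \<theta>(2) by (intro mult_left_mono) auto
        then show "norm (f x * \<theta> n x) \<le> \<bar>indicator {a-1..b+1} x *\<^sub>R f x\<bar>"
          using \<theta>(3)[of x n] by (cases "x \<in> {a-1..b+1}") (auto simp: abs_mult)
      qed
    qed measurable
    then have "(LBINT x. f x * indicator {a..b} x) = 0"
      using zero[OF \<theta>(1)] by (simp add: LIMSEQ_const_iff)
    then show ?thesis by (simp add: set_lebesgue_integral_def mult.commute)
  qed
  \<comment> \<open>The truncation \<open>g\<close> is integrable, so \<open>?p\<close> and
    \<open>?m\<close> define finite measures. On a half-line starting at \<open>x\<close> their
    difference is the integral of \<open>f\<close> over an interval, already known to be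
    zero.\<close>
  have "AE x in lborel. indicator {-R..R} x * f x = 0" for R :: real
  proof -
    define g where "g x = indicator {-R..R} x * f x" for x
    have [measurable]: "g \<in> borel_measurable borel" unfolding g_def by measurable
    have g: "integrable lborel g" using loc[of "-R" R] by (simp add: g_def[abs_def] set_integrable_def)
    let ?p = "\<lambda>x. max (g x) 0" and ?m = "\<lambda>x. max (- g x) 0"
    have i: "integrable lborel ?p" "integrable lborel ?m" using g by auto
    have fin: "emeasure (density lborel (\<lambda>x. ennreal (h x))) {x<..} = ennreal (LBINT y. h y * indicator {x<..} y)"
      if "integrable lborel h" "\<And>x. 0 \<le> h x" for x and h :: "real \<Rightarrow> real"
    proof -
      have [measurable]: "h \<in> borel_measurable borel" using that by auto
      have "emeasure (density lborel (\<lambda>x. ennreal (h x))) {x<..} = (\<integral>\<^sup>+y. ennreal (h y * indicator {x<..} y) \<partial>lborel)"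
        by (subst emeasure_density) (auto intro!: nn_integral_cong split: split_indicator)
      also have "\<dots> = ennreal (LBINT y. h y * indicator {x<..} y)"
        using that by (intro nn_integral_eq_integral integrable_real_mult_indicator) auto
      finally show ?thesis .
    qed
    have "(LBINT y. ?p y * indicator {x<..} y) = (LBINT y. ?m y * indicator {x<..} y)" for x
    proof -
      have "(LBINT y. ?p y * indicator {x<..} y) - (LBINT y. ?m y * indicator {x<..} y)
        = (LBINT y. ?p y * indicator {x<..} y - ?m y * indicator {x<..} y)"
        using i by (intro integral_diff[symmetric] integrable_real_mult_indicator) auto
      also have "\<dots> = (LBINT y. f y * indicator {max x (-R)..R} y)"
      proof (rule integral_cong_AE)
        have "AE y in lborel. y \<noteq> x" by (rule AE_lborel_singleton)
        then show "AE y in lborel. ?p y * indicator {x<..} y - ?m y * indicator {x<..} y = f y * indicator {max x (-R)..R} y"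
          by eventually_elim (auto simp: g_def split: split_indicator)
      qed measurable
      also have "\<dots> = 0"
      proof (cases "max x (-R) < R")
        case True
        from z[OF this] show ?thesis by (simp add: set_lebesgue_integral_def mult.commute)
      next
        case False
        have "AE y in lborel. f y * indicator {max x (-R)..R} y = 0"
          by (rule AE_mp[OF AE_lborel_singleton[of R]]) (use False in \<open>auto simp: indicator_def intro!: AE_I2\<close>)
        then show ?thesis by (rule integral_eq_zero_AE)
      qed
      finally show ?thesis by simp
    qed
    then have "density lborel (\<lambda>x. ennreal (?p x)) = density lborel (\<lambda>x. ennreal (?m x))"
    proof (intro measure_eqI_lessThan)
      fix x
      have p: "emeasure (density lborel (\<lambda>x. ennreal (?p x))) {x<..} = ennreal (LBINT y. ?p y * indicator {x<..} y)"
        by (rule fin[OF i(1)]) simp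
      have m: "emeasure (density lborel (\<lambda>x. ennreal (?m x))) {x<..} = ennreal (LBINT y. ?m y * indicator {x<..} y)"
        by (rule fin[OF i(2)]) simp
      show "emeasure (density lborel (\<lambda>x. ennreal (?p x))) {x<..} < \<infinity>"
        unfolding p by simp
      show "emeasure (density lborel (\<lambda>x. ennreal (?p x))) {x<..} = emeasure (density lborel (\<lambda>x. ennreal (?m x))) {x<..}"
        unfolding p m by (rule arg_cong[OF \<open>\<And>x. (LBINT y. ?p y * indicator {x<..} y) = (LBINT y. ?m y * indicator {x<..} y)\<close>])
    qed simp_all
    then have "AE x in lborel. ennreal (?p x) = ennreal (?m x)"
      by (intro sigma_finite_measure.density_unique[OF lborel.sigma_finite_measure_axioms]) auto
    then have "AE x in lborel. g x = 0"
      by eventually_elim (auto simp: max_def split: if_splits)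
    then show ?thesis by (simp add: g_def)
  qed
  then have "AE x in lborel. \<forall>n::nat. indicator {-real n..real n} x * f x = 0"
    by (subst AE_all_countable) auto
  then show ?thesis
  proof eventually_elim
    case (elim x)
    obtain n :: nat where "\<bar>x\<bar> \<le> real n" using real_arch_simple by blast
    with elim[rule_format, of n] show ?case by (auto simp: indicator_def abs_le_iff split: if_splits)
  qed
qed

lemma du_Bois_Reymond_complex:
  fixes f :: "real \<Rightarrow> complex"
  assumes [measurable]: "f \<in> borel_measurable borel"
    and int: "\<And>\<psi>. test1 \<psi> \<Longrightarrow> integrable lborel (\<lambda>x. f x * complex_of_real (\<psi> x))"
    and zero: "\<And>\<psi>. test1 \<psi> \<Longrightarrow> (LBINT x. f x * complex_of_real (\<psi> x)) = 0"
  shows "AE x in lborel. f x = 0"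
proof -
  have "AE x in lborel. Re (f x) = 0"
  proof (rule du_Bois_Reymond)
    fix \<psi> assume \<psi>: "test1 \<psi>"
    show "integrable lborel (\<lambda>x. Re (f x) * \<psi> x)"
      using integrable_Re[OF int[OF \<psi>]] by simp
    show "(LBINT x. Re (f x) * \<psi> x) = 0"
      using integral_Re[OF int[OF \<psi>]] zero[OF \<psi>] by simp
  qed measurable
  moreover have "AE x in lborel. Im (f x) = 0"
  proof (rule du_Bois_Reymond)
    fix \<psi> assume \<psi>: "test1 \<psi>"
    show "integrable lborel (\<lambda>x. Im (f x) * \<psi> x)"
      using integrable_Im[OF int[OF \<psi>]] by simp
    show "(LBINT x. Im (f x) * \<psi> x) = 0"
      using integral_Im[OF int[OF \<psi>]] zero[OF \<psi>] by simp
  qed measurable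
  ultimately show ?thesis
    by eventually_elim (simp add: complex_eq_iff)
qed

section \<open>The Fourier transform\<close>

lemma fourier_integrand:
  fixes f :: "real \<Rightarrow> complex" and a :: "real \<Rightarrow> real"
  assumes f: "integrable lborel f" and a: "a \<in> borel_measurable borel"
  shows "integrable lborel (\<lambda>x. cis (a x) * f x)"
proof (rule integrable_bound[OF f])
  have [measurable]: "(\<lambda>x. cis (a x)) \<in> borel_measurable borel"
    unfolding cis_conv_exp using a by measurable
  show "(\<lambda>x. cis (a x) * f x) \<in> borel_measurable lborel" using assms by measurable
qed (auto simp: norm_mult)

lemma cis_measurable[measurable (raw)]:
  "a \<in> borel_measurable M \<Longrightarrow> (\<lambda>x. cis (a x)) \<in> borel_measurable M"
  unfolding cis_conv_exp by measurable

lemma cnj_measurable[measurable (raw)]: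
  "f \<in> borel_measurable M \<Longrightarrow> (\<lambda>x. cnj (f x)) \<in> borel_measurable M"
  by (erule measurable_compose) (intro borel_measurable_continuous_onI continuous_intros)

lemma fourier_measurable[measurable]:
  assumes [measurable]: "f \<in> borel_measurable borel"
  shows "fourier f \<in> borel_measurable borel"
  unfolding fourier_def by measurable

lemma norm_fourier_le:
  assumes "integrable lborel f"
  shows "cmod (fourier f w) \<le> (LBINT x. cmod (f x))"
  unfolding fourier_def using integral_norm_bound[of lborel "\<lambda>x. cis (- (x * w)) * f x"]
  by (simp add: norm_mult)

lemma fourier_diff:
  assumes "integrable lborel f" "integrable lborel g"
  shows "fourier (\<lambda>x. f x - g x) w = fourier f w - fourier g w"
  unfolding fourier_def using fourier_integrand[OF assms(1), of "\<lambda>x. - (x * w)"] fourier_integrand[OF assms(2), of "\<lambda>x. - (x * w)"]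
  by (simp add: right_diff_distrib)

lemma fourier_cmult: "fourier (\<lambda>x. c * f x) w = c * fourier f w"
  unfolding fourier_def by (simp add: mult.left_commute)

lemma fourier_translate: "fourier (\<lambda>x. f (x + h)) w = cis (h * w) * fourier f w"
proof -
  have "fourier (\<lambda>x. f (x + h)) w = (LBINT x. cis (h * w) * (cis (- ((x + h) * w)) * f (x + h)))"
    unfolding fourier_def mult.assoc[symmetric] cis_mult
    by (intro integral_cong) (simp_all add: algebra_simps)
  also have "\<dots> = cis (h * w) * fourier f w"
    unfolding fourier_def using integral_translate[of "\<lambda>x. cis (- (x * w)) * f x" h] by simp
  finally show ?thesis .
qed

section \<open>Gaussian regularization and the Plancherel inequality\<close>

definition gk :: "nat \<Rightarrow> real \<Rightarrow> real" where
  "gk n w = exp (- (w / real (Suc n))\<^sup>2 / 2)"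

text \<open>The Fourier transform of the frequency cutoff \<open>gk n\<close>. It is an approximate
  identity of total mass 2 pi instead of 1, because \<open>fourier\<close> carries no normalizing
  factor.\<close>

definition gh :: "nat \<Rightarrow> real \<Rightarrow> real" where
  "gh n y = real (Suc n) * sqrt (2 * pi) * exp (- (real (Suc n) * y)\<^sup>2 / 2)"

lemma gk_measurable[measurable]: "gk n \<in> borel_measurable borel"
  and gh_measurable[measurable]: "gh n \<in> borel_measurable borel"
  unfolding gk_def[abs_def] gh_def[abs_def] by measurable

lemma gk_nonneg: "0 \<le> gk n x" and gk_le_1: "gk n x \<le> 1" and gh_nonneg: "0 \<le> gh n x"
  by (simp_all add: gk_def gh_def)

lemma gk_limit: "(\<lambda>n. gk n x) \<longlonglongrightarrow> 1"
proof -
  have "(\<lambda>n. exp (- (x / real (Suc n))\<^sup>2 / 2)) \<longlonglongrightarrow> exp (- 0\<^sup>2 / 2)"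
    by (intro tendsto_intros LIMSEQ_Suc[OF lim_const_over_n]) simp
  then show ?thesis by (simp add: gk_def)
qed

lemma integrable_gauss: "integrable lborel (\<lambda>x::real. exp (- x\<^sup>2 / 2))"
  and integral_gauss: "(LBINT x. exp (- x\<^sup>2 / 2)) = sqrt (2 * pi)"
proof -
  have "has_bochner_integral lborel (\<lambda>x. std_normal_density x * x ^ (2 * 0)) (fact (2 * 0) / (2^0 * fact 0))"
    by (rule std_normal_moment_even)
  then have h: "has_bochner_integral lborel (\<lambda>x. 1 / sqrt (2 * pi) * exp (- x\<^sup>2 / 2)) 1"
    by (simp add: std_normal_density_def)
  from has_bochner_integral_mult_right[OF this, of "sqrt (2 * pi)"]
  have "has_bochner_integral lborel (\<lambda>x::real. exp (- x\<^sup>2 / 2)) (sqrt (2 * pi))" by simp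
  then show "integrable lborel (\<lambda>x::real. exp (- x\<^sup>2 / 2))" "(LBINT x. exp (- x\<^sup>2 / 2)) = sqrt (2 * pi)"
    by (simp_all add: has_bochner_integral_iff)
qed

lemma integrable_gk: "integrable lborel (gk n)"
  using lborel_integrable_real_affine[OF integrable_gauss, of "1 / real (Suc n)" 0]
  by (simp add: gk_def[abs_def])

lemma integrable_gh: "integrable lborel (gh n)"
  using lborel_integrable_real_affine[OF integrable_gauss, of "real (Suc n)" 0]
  by (simp add: gh_def[abs_def])

lemma integral_gh: "(LBINT x. gh n x) = 2 * pi"
proof -
  have "(LBINT x. gh n x) = real (Suc n) * sqrt (2 * pi) * (LBINT x. exp (- (real (Suc n) * x)\<^sup>2 / 2))"
    unfolding gh_def by (rule integral_mult_right_zero)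
  also have "real (Suc n) * (LBINT x. exp (- (real (Suc n) * x)\<^sup>2 / 2)) = (LBINT x. exp (- x\<^sup>2 / 2))"
    using lborel_integral_real_affine[of "real (Suc n)" "\<lambda>x. exp (- x\<^sup>2 / 2)" 0] by simp
  then have "real (Suc n) * sqrt (2 * pi) * (LBINT x. exp (- (real (Suc n) * x)\<^sup>2 / 2)) = sqrt (2 * pi) * sqrt (2 * pi)"
    unfolding integral_gauss by (metis mult.assoc mult.commute)
  finally show ?thesis by simp
qed

text \<open>A rescaling of the characteristic function of the standard normal distribution.\<close>

lemma gauss_transform: "(LBINT w. complex_of_real (gk n w) * cis (y * w)) = complex_of_real (gh n y)"
proof -
  let ?n = "real (Suc n)"
  have "char std_normal_distribution t = (LBINT x. complex_of_real (1 / sqrt (2 * pi) * exp (- x\<^sup>2 / 2)) * cis (t * x))" for t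
  proof -
    have "char std_normal_distribution t = (LBINT x. std_normal_density x *\<^sub>R iexp (t * x))"
      unfolding char_def by (rule integral_density) (simp_all add: normal_density_nonneg)
    also have "\<dots> = (LBINT x. complex_of_real (1 / sqrt (2 * pi) * exp (- x\<^sup>2 / 2)) * cis (t * x))"
      by (intro integral_cong refl)
        (simp only: std_normal_density_def scaleR_conv_of_real cis_conv_exp)
    finally show ?thesis .
  qed
  note char_eq = this
  have 1: "(LBINT x. complex_of_real (1 / sqrt (2 * pi) * exp (- x\<^sup>2 / 2)) * cis (t * x)) = complex_of_real (exp (- t\<^sup>2 / 2))" for t
    using char_eq[of t] unfolding char_std_normal_distribution by (rule sym)
  have 2: "(LBINT x. complex_of_real (exp (- x\<^sup>2 / 2)) * cis (t * x)) = complex_of_real (sqrt (2 * pi) * exp (- t\<^sup>2 / 2))" for t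
  proof -
    have "(LBINT x. complex_of_real (exp (- x\<^sup>2 / 2)) * cis (t * x))
      = (LBINT x. complex_of_real (sqrt (2 * pi)) * (complex_of_real (1 / sqrt (2 * pi) * exp (- x\<^sup>2 / 2)) * cis (t * x)))"
      by (intro integral_cong) auto
    also have "\<dots> = complex_of_real (sqrt (2 * pi)) * complex_of_real (exp (- t\<^sup>2 / 2))"
      by (subst integral_mult_right_zero) (simp only: 1)
    finally show ?thesis by simp
  qed
  have "(LBINT w. complex_of_real (gk n w) * cis (y * w))
    = ?n *\<^sub>R (LBINT x. complex_of_real (gk n (?n * x)) * cis (y * (?n * x)))"
    using lborel_integral_real_affine[of ?n "\<lambda>w. complex_of_real (gk n w) * cis (y * w)" 0] by simp
  also have "(LBINT x. complex_of_real (gk n (?n * x)) * cis (y * (?n * x)))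
    = (LBINT x. complex_of_real (exp (- x\<^sup>2 / 2)) * cis ((?n * y) * x))"
    by (intro integral_cong) (auto simp: gk_def mult_ac)
  also have "?n *\<^sub>R \<dots> = complex_of_real (gh n y)"
    unfolding 2 by (simp add: gh_def scaleR_conv_of_real)
  finally show ?thesis .
qed

lemma gauss_regularization:
  assumes f: "integrable lborel (f :: real \<Rightarrow> complex)"
  shows "(LBINT w. complex_of_real (gk n w) * (cis (x * w) * fourier f w))
    = (LBINT y. complex_of_real (gh n (x - y)) * f y)"
proof -
  have [measurable]: "f \<in> borel_measurable borel" using f by auto
  let ?F = "\<lambda>y w. complex_of_real (gk n w) * cis ((x - y) * w) * f y"
  have "(LBINT w. complex_of_real (gk n w) * (cis (x * w) * fourier f w)) = (LBINT w. LBINT y. ?F y w)"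
  proof (rule integral_cong[OF refl])
    fix w
    have "(LBINT y. ?F y w) = (LBINT y. complex_of_real (gk n w) * cis (x * w) * (cis (- (y * w)) * f y))"
    proof (intro integral_cong refl)
      fix y
      have "cis ((x - y) * w) = cis (x * w) * cis (- (y * w))"
        by (simp add: cis_mult left_diff_distrib)
      then show "?F y w = complex_of_real (gk n w) * cis (x * w) * (cis (- (y * w)) * f y)"
        by (simp only: mult.assoc)
    qed
    also have "\<dots> = complex_of_real (gk n w) * cis (x * w) * fourier f w"
      unfolding fourier_def by (rule integral_mult_right_zero)
    finally show "complex_of_real (gk n w) * (cis (x * w) * fourier f w) = (LBINT y. ?F y w)"
      by (simp only: mult.assoc)
  qed
  also have "\<dots> = (LBINT y. LBINT w. ?F y w)"
  proof (rule lborel_pair.Fubini_integral[OF integrable_pair_bound])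
    show "integrable lborel (\<lambda>y. cmod (f y))" using f by simp
    show "integrable lborel (gk n)" by (rule integrable_gk)
  qed (auto simp: norm_mult gk_nonneg)
  also have "\<dots> = (LBINT y. complex_of_real (gh n (x - y)) * f y)"
    by (simp add: gauss_transform)
  finally show ?thesis .
qed

text \<open>With the cutoff \<open>gk n\<close> the left side becomes the quadratic form of the
  kernel \<open>gh n (x - y)\<close> on \<open>f\<close>, which is at most its mass 2 pi times the
  squared L2 norm. Fatou's lemma removes the cutoff. Every later estimate is an upper bound, so this
  inequality is the form of Plancherel's theorem that is needed.\<close>

lemma plancherel_le:
  assumes f: "integrable lborel (f :: real \<Rightarrow> complex)" and f2: "integrable lborel (\<lambda>x. (cmod (f x))\<^sup>2)"
  shows "integrable lborel (\<lambda>w. (cmod (fourier f w))\<^sup>2)"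
    and "(LBINT w. (cmod (fourier f w))\<^sup>2) \<le> 2 * pi * (LBINT x. (cmod (f x))\<^sup>2)"
proof -
  have [measurable]: "f \<in> borel_measurable borel" using f by auto
  let ?S = "LBINT x. (cmod (f x))\<^sup>2"
  define G where "G = fourier f"
  have [measurable]: "G \<in> borel_measurable borel" unfolding G_def by measurable
  define B where "B = (LBINT x. cmod (f x))"
  have GB: "cmod (G w) \<le> B" for w unfolding G_def B_def by (rule norm_fourier_le[OF f])
  have step: "(LBINT w. gk n w * (cmod (G w))\<^sup>2) \<le> 2 * pi * ?S" for n
  proof -
    let ?H = "\<lambda>x w. complex_of_real (gk n w) * cis (- (x * w)) * f x * cnj (G w)"
    define J where "J x = (LBINT w. complex_of_real (gk n w) * (cis (x * w) * G w))" for x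
    have [measurable]: "J \<in> borel_measurable borel" unfolding J_def by measurable
    have J: "J x = (LBINT y. complex_of_real (gh n (x - y)) * f y)" for x
      unfolding J_def G_def by (rule gauss_regularization[OF f])
    have e1: "(\<integral>\<^sup>+x. ennreal (gh n (x - y) * ((cmod (f y))\<^sup>2 / 2)) \<partial>lborel) = ennreal (pi * (cmod (f y))\<^sup>2)" for y
    proof -
      have "integrable lborel (\<lambda>x. gh n (x - y))" using integrable_translate[of "gh n" "- y"] integrable_gh by simp
      then have "(\<integral>\<^sup>+x. ennreal (gh n (x - y) * ((cmod (f y))\<^sup>2 / 2)) \<partial>lborel) = ennreal (LBINT x. gh n (x - y) * ((cmod (f y))\<^sup>2 / 2))"
        by (intro nn_integral_eq_integral) (auto simp: gh_nonneg)
      then show ?thesis using integral_translate[of "gh n" "- y"] integral_gh by simp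
    qed
    have e2: "(\<integral>\<^sup>+y. ennreal (gh n (x - y) * ((cmod (f x))\<^sup>2 / 2)) \<partial>lborel) = ennreal (pi * (cmod (f x))\<^sup>2)" for x
    proof -
      have "integrable lborel (\<lambda>y. gh n (x - y))" using integrable_reflect[of "gh n" x] integrable_gh by simp
      then have "(\<integral>\<^sup>+y. ennreal (gh n (x - y) * ((cmod (f x))\<^sup>2 / 2)) \<partial>lborel) = ennreal (LBINT y. gh n (x - y) * ((cmod (f x))\<^sup>2 / 2))"
        by (intro nn_integral_eq_integral) (auto simp: gh_nonneg)
      then show ?thesis using integral_reflect[of "gh n" x] integral_gh by simp
    qed
    have "complex_of_real (LBINT w. gk n w * (cmod (G w))\<^sup>2) = (LBINT w. complex_of_real (gk n w * (cmod (G w))\<^sup>2))"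
      by (rule integral_complex_of_real[symmetric])
    also have "\<dots> = (LBINT w. LBINT x. ?H x w)"
    proof (rule integral_cong[OF refl])
      fix w
      have "(LBINT x. ?H x w) = (LBINT x. (complex_of_real (gk n w) * cnj (G w)) * (cis (- (x * w)) * f x))"
        by (intro integral_cong) auto
      also have "\<dots> = complex_of_real (gk n w) * (cnj (G w) * G w)"
        by (simp add: G_def fourier_def)
      also have "cnj (G w) * G w = complex_of_real ((cmod (G w))\<^sup>2)"
        by (subst mult.commute) (simp add: complex_norm_square[symmetric])
      finally show "complex_of_real (gk n w * (cmod (G w))\<^sup>2) = (LBINT x. ?H x w)" by simp
    qed
    also have "\<dots> = (LBINT x. LBINT w. ?H x w)"
    proof (rule lborel_pair.Fubini_integral[OF integrable_pair_bound])
      show "integrable lborel (\<lambda>y. cmod (f y))" using f by simp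
      show "integrable lborel (\<lambda>w. gk n w * B)" using integrable_gk by simp
      show "cmod (?H x w) \<le> cmod (f x) * (gk n w * B)" for x w
      proof -
        have "cmod (?H x w) = cmod (f x) * (gk n w * cmod (G w))"
          by (simp add: norm_mult gk_nonneg)
        then show ?thesis using GB[of w] gk_nonneg[of n w] by (simp add: mult_left_mono)
      qed
    qed measurable
    also have "\<dots> = (LBINT x. f x * cnj (J x))"
    proof (rule integral_cong[OF refl])
      fix x
      have "(LBINT w. ?H x w) = f x * (LBINT w. cnj (complex_of_real (gk n w) * (cis (x * w) * G w)))"
        by (subst integral_mult_right_zero[symmetric]) (intro integral_cong, auto simp: cis_cnj)
      then show "(LBINT w. ?H x w) = f x * cnj (J x)"
        unfolding J_def integral_cnj .
    qed
    finally have eq: "complex_of_real (LBINT w. gk n w * (cmod (G w))\<^sup>2) = (LBINT x. f x * cnj (J x))" .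
    have "ennreal (LBINT w. gk n w * (cmod (G w))\<^sup>2) = ennreal (cmod (LBINT x. f x * cnj (J x)))"
      unfolding eq[symmetric] by (simp add: gk_nonneg)
    also have "\<dots> \<le> (\<integral>\<^sup>+x. ennreal (cmod (f x * cnj (J x))) \<partial>lborel)"
    proof (cases "integrable lborel (\<lambda>x. f x * cnj (J x))")
      case True then show ?thesis by (rule integral_norm_bound_ennreal)
    qed (simp add: not_integrable_integral_eq)
    also have "\<dots> \<le> (\<integral>\<^sup>+x. \<integral>\<^sup>+y. ennreal (gh n (x - y) * (cmod (f x) * cmod (f y))) \<partial>lborel \<partial>lborel)"
    proof (rule nn_integral_mono)
      fix x
      have i: "integrable lborel (\<lambda>y. complex_of_real (gh n (x - y)) * f y)"
      proof (rule integrable_bound[OF integrable_mult_right[OF f, of "complex_of_real (gh n 0)"]])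
        have "gh n z \<le> gh n 0" for z by (simp add: gh_def)
        then show "AE y in lborel. norm (complex_of_real (gh n (x - y)) * f y) \<le> norm (complex_of_real (gh n 0) * f y)"
          by (auto simp: norm_mult gh_nonneg intro!: AE_I2 mult_right_mono)
      qed measurable
      have "ennreal (cmod (f x * cnj (J x))) = ennreal (cmod (f x)) * ennreal (cmod (J x))"
        by (simp add: norm_mult ennreal_mult)
      also have "\<dots> \<le> ennreal (cmod (f x)) * (\<integral>\<^sup>+y. ennreal (cmod (complex_of_real (gh n (x - y)) * f y)) \<partial>lborel)"
        unfolding J by (intro mult_left_mono integral_norm_bound_ennreal i) simp
      also have "\<dots> = (\<integral>\<^sup>+y. ennreal (gh n (x - y) * (cmod (f x) * cmod (f y))) \<partial>lborel)"
        by (subst nn_integral_cmult[symmetric])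
          (auto intro!: nn_integral_cong simp: norm_mult gh_nonneg mult_ac simp flip: ennreal_mult)
      finally show "ennreal (cmod (f x * cnj (J x))) \<le> (\<integral>\<^sup>+y. ennreal (gh n (x - y) * (cmod (f x) * cmod (f y))) \<partial>lborel)" .
    qed
    \<comment> \<open>Schur's test: after |f(x) f(y)| <= |f(x)|^2 / 2 + |f(y)|^2 / 2 the kernel can
      be integrated in the other variable, and each half contributes pi times the squared
      norm.\<close>
    also have "\<dots> \<le> (\<integral>\<^sup>+x. \<integral>\<^sup>+y. (ennreal (gh n (x - y) * ((cmod (f x))\<^sup>2 / 2)) + ennreal (gh n (x - y) * ((cmod (f y))\<^sup>2 / 2))) \<partial>lborel \<partial>lborel)"
    proof (intro nn_integral_mono)
      fix x y
      have "cmod (f x) * cmod (f y) \<le> (cmod (f x))\<^sup>2 / 2 + (cmod (f y))\<^sup>2 / 2"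
        using sum_squares_bound[of "cmod (f x)" "cmod (f y)"] by simp
      then have "gh n (x - y) * (cmod (f x) * cmod (f y)) \<le> gh n (x - y) * ((cmod (f x))\<^sup>2 / 2 + (cmod (f y))\<^sup>2 / 2)"
        by (rule mult_left_mono) (rule gh_nonneg)
      then show "ennreal (gh n (x - y) * (cmod (f x) * cmod (f y)))
        \<le> ennreal (gh n (x - y) * ((cmod (f x))\<^sup>2 / 2)) + ennreal (gh n (x - y) * ((cmod (f y))\<^sup>2 / 2))"
        unfolding distrib_left
        by (rule order_trans[OF ennreal_leI eq_refl[OF ennreal_plus]]) (simp_all add: gh_nonneg)
    qed
    also have "\<dots> = (\<integral>\<^sup>+x. \<integral>\<^sup>+y. ennreal (gh n (x - y) * ((cmod (f x))\<^sup>2 / 2)) \<partial>lborel \<partial>lborel)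
       + (\<integral>\<^sup>+x. \<integral>\<^sup>+y. ennreal (gh n (x - y) * ((cmod (f y))\<^sup>2 / 2)) \<partial>lborel \<partial>lborel)"
      by (simp add: nn_integral_add)
    also have "(\<integral>\<^sup>+x. \<integral>\<^sup>+y. ennreal (gh n (x - y) * ((cmod (f y))\<^sup>2 / 2)) \<partial>lborel \<partial>lborel)
       = (\<integral>\<^sup>+y. \<integral>\<^sup>+x. ennreal (gh n (x - y) * ((cmod (f y))\<^sup>2 / 2)) \<partial>lborel \<partial>lborel)"
      by (rule lborel_pair.Fubini'[symmetric]) measurable
    also have "\<dots> = (\<integral>\<^sup>+x. ennreal (pi * (cmod (f x))\<^sup>2) \<partial>lborel)" (is "_ = ?T") unfolding e1 ..
    also have "(\<integral>\<^sup>+x. \<integral>\<^sup>+y. ennreal (gh n (x - y) * ((cmod (f x))\<^sup>2 / 2)) \<partial>lborel \<partial>lborel) = ?T"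
      unfolding e2 ..
    also have "?T = ennreal (LBINT x. pi * (cmod (f x))\<^sup>2)"
      using f2 by (intro nn_integral_eq_integral) auto
    also have "\<dots> + \<dots> = ennreal (2 * pi * ?S)"
      by (subst ennreal_plus[symmetric]) auto
    finally have "ennreal (LBINT w. gk n w * (cmod (G w))\<^sup>2) \<le> ennreal (2 * pi * ?S)" .
    moreover have "0 \<le> 2 * pi * ?S" by simp
    ultimately show ?thesis using ennreal_le_iff by blast
  qed
  have "(\<integral>\<^sup>+w. ennreal ((cmod (G w))\<^sup>2) \<partial>lborel) = (\<integral>\<^sup>+w. liminf (\<lambda>n. ennreal (gk n w * (cmod (G w))\<^sup>2)) \<partial>lborel)"
  proof (rule nn_integral_cong)
    fix w
    have "(\<lambda>n. ennreal (gk n w * (cmod (G w))\<^sup>2)) \<longlonglongrightarrow> ennreal (1 * (cmod (G w))\<^sup>2)"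
      by (intro tendsto_ennrealI tendsto_mult gk_limit tendsto_const)
    from lim_imp_Liminf[OF _ this] show "ennreal ((cmod (G w))\<^sup>2) = liminf (\<lambda>n. ennreal (gk n w * (cmod (G w))\<^sup>2))" by simp
  qed
  also have "\<dots> \<le> liminf (\<lambda>n. \<integral>\<^sup>+w. ennreal (gk n w * (cmod (G w))\<^sup>2) \<partial>lborel)"
    by (rule nn_integral_liminf) measurable
  also have "\<dots> \<le> ennreal (2 * pi * ?S)"
  proof (rule Liminf_le)
    show "\<forall>\<^sub>F n in sequentially. (\<integral>\<^sup>+w. ennreal (gk n w * (cmod (G w))\<^sup>2) \<partial>lborel) \<le> ennreal (2 * pi * ?S)"
    proof (intro always_eventually allI)
      fix n
      have "integrable lborel (\<lambda>w. gk n w * (cmod (G w))\<^sup>2)"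
      proof (rule integrable_bound[OF integrable_mult_left[OF integrable_gk[of n], of "B\<^sup>2"]])
        show "AE w in lborel. norm (gk n w * (cmod (G w))\<^sup>2) \<le> norm (gk n w * B\<^sup>2)"
          by (auto simp: abs_mult gk_nonneg intro!: AE_I2 mult_left_mono power_mono GB)
      qed measurable
      then have "(\<integral>\<^sup>+w. ennreal (gk n w * (cmod (G w))\<^sup>2) \<partial>lborel) = ennreal (LBINT w. gk n w * (cmod (G w))\<^sup>2)"
        by (intro nn_integral_eq_integral) (auto simp: gk_nonneg)
      then show "(\<integral>\<^sup>+w. ennreal (gk n w * (cmod (G w))\<^sup>2) \<partial>lborel) \<le> ennreal (2 * pi * ?S)"
        using step[of n] by (simp add: ennreal_leI)
    qed
  qed simp
  finally have le: "(\<integral>\<^sup>+w. ennreal ((cmod (G w))\<^sup>2) \<partial>lborel) \<le> ennreal (2 * pi * ?S)" .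
  then show i: "integrable lborel (\<lambda>w. (cmod (fourier f w))\<^sup>2)"
    unfolding G_def[symmetric] by (intro integrableI_bounded) (auto intro: le_less_trans)
  have "ennreal (LBINT w. (cmod (G w))\<^sup>2) \<le> ennreal (2 * pi * ?S)"
    using le i unfolding G_def[symmetric] by (subst nn_integral_eq_integral[symmetric]) auto
  then show "(LBINT w. (cmod (fourier f w))\<^sup>2) \<le> 2 * pi * ?S"
    unfolding G_def by (subst (asm) ennreal_le_iff) auto
qed

section \<open>Schwartz functions and Fourier inversion\<close>

lemma schwartz_coinduct:
  assumes "f \<in> S"
    and "\<And>g. g \<in> S \<Longrightarrow> \<exists>g'\<in>S. \<forall>x. (g has_vector_derivative g' x) (at x)"
    and bd: "\<And>g m. g \<in> S \<Longrightarrow> bounded (range (\<lambda>x. complex_of_real (x ^ m) * g x))"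
  shows "f \<in> schwartz"
proof -
  obtain D where D: "D 0 = f" "\<And>k. D k \<in> S" "\<And>k x. (D k has_vector_derivative D (Suc k) x) (at x)"
    by (rule derivative_family[OF assms(1,2)]) auto
  show ?thesis
    unfolding schwartz_def mem_Collect_eq
    by (rule exI[of _ D]) (use D bd in blast)
qed

lemma schwartz_bounded:
  assumes "f \<in> schwartz" shows "bounded (range (\<lambda>x. complex_of_real (x ^ m) * f x))"
  using assms unfolding schwartz_def by blast

lemma schwartz_derivative:
  assumes "f \<in> schwartz"
  obtains f' where "f' \<in> schwartz" "\<And>x. (f has_vector_derivative f' x) (at x)"
proof -
  obtain D where D: "D 0 = f" "\<forall>k x. (D k has_vector_derivative D (Suc k) x) (at x)"
    "\<forall>k m. bounded (range (\<lambda>x. complex_of_real (x ^ m) * D k x))"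
    using assms unfolding schwartz_def by blast
  have "D (Suc 0) \<in> schwartz"
    unfolding schwartz_def mem_Collect_eq by (rule exI[of _ "\<lambda>k. D (Suc k)"]) (use D in blast)
  then show thesis using that[of "D (Suc 0)"] D(1,2) by blast
qed

lemma schwartz_vector_derivative: "f \<in> schwartz \<Longrightarrow> (\<lambda>x. vector_derivative f (at x)) \<in> schwartz"
  and schwartz_has_vector_derivative: "f \<in> schwartz \<Longrightarrow> (f has_vector_derivative vector_derivative f (at x)) (at x)"
proof -
  assume f: "f \<in> schwartz"
  obtain f' where f': "f' \<in> schwartz" "\<And>x. (f has_vector_derivative f' x) (at x)"
    using schwartz_derivative[OF f] by blast
  have "vector_derivative f (at x) = f' x" for x
    using f'(2) by (rule vector_derivative_at)
  with f' show "(\<lambda>x. vector_derivative f (at x)) \<in> schwartz" "(f has_vector_derivative vector_derivative f (at x)) (at x)"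
    by simp_all
qed

lemma cis_has_vector_derivative:
  "((\<lambda>x. cis (a * x)) has_vector_derivative \<i> * complex_of_real a * cis (a * x)) (at x)"
proof -
  have "((\<lambda>z. exp (\<i> * complex_of_real a * z)) has_field_derivative \<i> * complex_of_real a * exp (\<i> * complex_of_real a * complex_of_real x)) (at (complex_of_real x))"
    by (auto intro!: derivative_eq_intros)
  from has_vector_derivative_real_field[OF this, of UNIV] show ?thesis
    by (simp add: cis_conv_exp mult.assoc)
qed

text \<open>All operations used on Schwartz functions are closed up together, since differentiating
  one brings in others: the derivative of \<open>cis (a * x) * f x\<close> is a sum involving a
  scalar multiple. The decay bounds must be proved for all powers of \<open>x\<close> simultaneously
  because \<open>xmult\<close> raises the power.\<close>

inductive_set schwartz_alg :: "(real \<Rightarrow> complex) set" where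
  base: "f \<in> schwartz \<Longrightarrow> f \<in> schwartz_alg"
| add: "f \<in> schwartz_alg \<Longrightarrow> g \<in> schwartz_alg \<Longrightarrow> (\<lambda>x. f x + g x) \<in> schwartz_alg"
| cmult: "f \<in> schwartz_alg \<Longrightarrow> (\<lambda>x. c * f x) \<in> schwartz_alg"
| xmult: "f \<in> schwartz_alg \<Longrightarrow> (\<lambda>x. complex_of_real x * f x) \<in> schwartz_alg"
| cis: "f \<in> schwartz_alg \<Longrightarrow> (\<lambda>x. cis (a * x) * f x) \<in> schwartz_alg"
| cnj: "f \<in> schwartz_alg \<Longrightarrow> (\<lambda>x. cnj (f x)) \<in> schwartz_alg"
| reflect: "f \<in> schwartz_alg \<Longrightarrow> (\<lambda>x. f (- x)) \<in> schwartz_alg"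

lemma schwartz_alg_schwartz:
  assumes "f \<in> schwartz_alg" shows "f \<in> schwartz"
proof (rule schwartz_coinduct[OF assms])
  show "\<exists>g'\<in>schwartz_alg. \<forall>x. (g has_vector_derivative g' x) (at x)" if "g \<in> schwartz_alg" for g
    using that
  proof induction
    case (base f)
    then obtain f' where "f' \<in> schwartz" "\<And>x. (f has_vector_derivative f' x) (at x)"
      using schwartz_derivative by blast
    then show ?case by (blast intro: schwartz_alg.base)
  next
    case (add f g)
    then obtain f' g' where "f' \<in> schwartz_alg" "g' \<in> schwartz_alg"
      "\<forall>x. (f has_vector_derivative f' x) (at x)" "\<forall>x. (g has_vector_derivative g' x) (at x)" by blast
    then show ?case
      by (intro bexI[of _ "\<lambda>x. f' x + g' x"]) (auto intro: has_vector_derivative_add schwartz_alg.add)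
  next
    case (cmult f c)
    then obtain f' where "f' \<in> schwartz_alg" "\<forall>x. (f has_vector_derivative f' x) (at x)" by blast
    then show ?case
      by (intro bexI[of _ "\<lambda>x. c * f' x"]) (auto intro: has_vector_derivative_mult_right schwartz_alg.cmult)
  next
    case (xmult f)
    then obtain f' where f': "f' \<in> schwartz_alg" "\<forall>x. (f has_vector_derivative f' x) (at x)" by blast
    have "((\<lambda>x. complex_of_real x * f x) has_vector_derivative complex_of_real x * f' x + 1 * f x) (at x)" for x
      by (rule has_vector_derivative_mult[OF has_vector_derivative_of_real[of "\<lambda>x. x" 1, simplified]]) (use f' in auto)
    then show ?case
      using f' xmult by (intro bexI[of _ "\<lambda>x. complex_of_real x * f' x + f x"]) (auto intro: schwartz_alg.intros)
  next
    case (cis f a)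
    then obtain f' where f': "f' \<in> schwartz_alg" "\<forall>x. (f has_vector_derivative f' x) (at x)" by blast
    have "((\<lambda>x. cis (a * x) * f x) has_vector_derivative cis (a * x) * f' x + \<i> * complex_of_real a * cis (a * x) * f x) (at x)" for x
      by (rule has_vector_derivative_mult[OF cis_has_vector_derivative]) (use f' in auto)
    then have "((\<lambda>x. cis (a * x) * f x) has_vector_derivative cis (a * x) * f' x + (\<i> * complex_of_real a) * (cis (a * x) * f x)) (at x)" for x
      by (simp add: mult.assoc)
    then show ?case
      using f' cis by (intro bexI[of _ "\<lambda>x. cis (a * x) * f' x + (\<i> * complex_of_real a) * (cis (a * x) * f x)"] allI
        schwartz_alg.add schwartz_alg.cmult schwartz_alg.cis)
  next
    case (cnj f)
    then obtain f' where "f' \<in> schwartz_alg" "\<forall>x. (f has_vector_derivative f' x) (at x)" by blast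
    then show ?case
      by (intro bexI[of _ "\<lambda>x. cnj (f' x)"]) (auto intro: has_vector_derivative_cnj schwartz_alg.cnj)
  next
    case (reflect f)
    then obtain f' where f': "f' \<in> schwartz_alg" "\<forall>x. (f has_vector_derivative f' x) (at x)" by blast
    have "((\<lambda>x. f (- x)) has_vector_derivative (-1) * f' (- x)) (at x)" for x
    proof -
      have "(uminus has_vector_derivative - 1) (at x)"
        unfolding has_real_derivative_iff_has_vector_derivative[symmetric] by (auto intro!: derivative_eq_intros)
      from vector_diff_chain_at[OF this, of f "f' (- x)"] f'(2) show ?thesis by (simp add: o_def)
    qed
    then show ?case
      using f'(1) by (intro bexI[of _ "\<lambda>x. (-1) * f' (- x)"] allI schwartz_alg.cmult schwartz_alg.reflect)
  qed
  show "bounded (range (\<lambda>x. complex_of_real (x ^ m) * g x))" if "g \<in> schwartz_alg" for g m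
  proof -
    have "\<exists>B. \<forall>x. \<bar>x\<bar> ^ m * cmod (g x) \<le> B" for m
      using that
    proof (induction arbitrary: m)
      case (base f)
      then show ?case
        using schwartz_bounded[OF base, of m] by (auto simp: bounded_iff norm_mult norm_power power_abs)
    next
      case (add f g)
      obtain B B' where "\<forall>x. \<bar>x\<bar> ^ m * cmod (f x) \<le> B" "\<forall>x. \<bar>x\<bar> ^ m * cmod (g x) \<le> B'"
        using add.IH by blast
      then have "\<bar>x\<bar> ^ m * cmod (f x + g x) \<le> B + B'" for x
        using mult_left_mono[OF norm_triangle_ineq[of "f x" "g x"], of "\<bar>x\<bar> ^ m"]
        by (smt (verit) distrib_left zero_le_power abs_ge_zero)
      then show ?case by blast
    next
      case (cmult f c)
      obtain B where B: "\<forall>x. \<bar>x\<bar> ^ m * cmod (f x) \<le> B" using cmult.IH by blast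
      have "\<bar>x\<bar> ^ m * cmod (c * f x) \<le> cmod c * B" for x
        using mult_left_mono[OF B[rule_format, of x], of "cmod c"] by (simp add: norm_mult mult_ac)
      then show ?case by blast
    next
      case (xmult f)
      obtain B where B: "\<forall>x. \<bar>x\<bar> ^ Suc m * cmod (f x) \<le> B" using xmult.IH by blast
      then show ?case by (intro exI[of _ B]) (auto simp: norm_mult mult_ac)
    next
      case (reflect f)
      obtain B where B: "\<forall>x. \<bar>x\<bar> ^ m * cmod (f x) \<le> B" using reflect.IH by blast
      then show ?case by (metis abs_minus_cancel)
    qed (auto simp: norm_mult)
    then show ?thesis by (fastforce simp: bounded_iff norm_mult norm_power power_abs)
  qed
qed

lemma schwartz_add: "f \<in> schwartz \<Longrightarrow> g \<in> schwartz \<Longrightarrow> (\<lambda>x. f x + g x) \<in> schwartz"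
  and schwartz_cmult: "f \<in> schwartz \<Longrightarrow> (\<lambda>x. c * f x) \<in> schwartz"
  and schwartz_xmult: "f \<in> schwartz \<Longrightarrow> (\<lambda>x. complex_of_real x * f x) \<in> schwartz"
  and schwartz_cis: "f \<in> schwartz \<Longrightarrow> (\<lambda>x. cis (a * x) * f x) \<in> schwartz"
  and schwartz_cnj: "f \<in> schwartz \<Longrightarrow> (\<lambda>x. cnj (f x)) \<in> schwartz"
  and schwartz_reflect: "f \<in> schwartz \<Longrightarrow> (\<lambda>x. f (- x)) \<in> schwartz"
proof -
  note I = schwartz_alg.intros schwartz_alg_schwartz
  show "f \<in> schwartz \<Longrightarrow> g \<in> schwartz \<Longrightarrow> (\<lambda>x. f x + g x) \<in> schwartz"
    by (rule I(8)[OF I(2)[OF I(1) I(1)]])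
  show "f \<in> schwartz \<Longrightarrow> (\<lambda>x. c * f x) \<in> schwartz"
    by (rule I(8)[OF I(3)[OF I(1)]])
  show "f \<in> schwartz \<Longrightarrow> (\<lambda>x. complex_of_real x * f x) \<in> schwartz"
    by (rule I(8)[OF I(4)[OF I(1)]])
  show "f \<in> schwartz \<Longrightarrow> (\<lambda>x. cis (a * x) * f x) \<in> schwartz"
    by (rule I(8)[OF I(5)[OF I(1)]])
  show "f \<in> schwartz \<Longrightarrow> (\<lambda>x. cnj (f x)) \<in> schwartz"
    by (rule I(8)[OF I(6)[OF I(1)]])
  show "f \<in> schwartz \<Longrightarrow> (\<lambda>x. f (- x)) \<in> schwartz"
    by (rule I(8)[OF I(7)[OF I(1)]])
qed

lemma schwartz_continuous: "f \<in> schwartz \<Longrightarrow> continuous_on A f"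
  by (meson schwartz_has_vector_derivative has_vector_derivative_continuous continuous_at_imp_continuous_on)

lemma schwartz_measurable[measurable_dest]: "f \<in> schwartz \<Longrightarrow> f \<in> borel_measurable borel"
  by (intro borel_measurable_continuous_onI schwartz_continuous)

lemma integrable_inverse_square: "integrable lborel (\<lambda>x::real. inverse (1 + x\<^sup>2))"
  using integrable_inverse_1_plus_square by (simp add: set_integrable_def einterval_def)

lemma schwartz_decay:
  assumes "f \<in> schwartz"
  obtains B where "B \<ge> 0" "\<And>x. cmod (f x) \<le> B * inverse (1 + x\<^sup>2)"
proof -
  obtain B0 where B0: "\<And>x. cmod (f x) \<le> B0"
    using schwartz_bounded[OF assms, of 0] by (auto simp: bounded_iff)
  obtain B2 where B2: "\<And>x. x\<^sup>2 * cmod (f x) \<le> B2"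
    using schwartz_bounded[OF assms, of 2] by (auto simp: bounded_iff norm_mult norm_power)
  have le: "cmod (f x) \<le> (B0 + B2) * inverse (1 + x\<^sup>2)" for x
  proof -
    have "cmod (f x) * (1 + x\<^sup>2) \<le> B0 + B2"
      using B0[of x] B2[of x] by (simp add: algebra_simps)
    moreover have "0 < 1 + x\<^sup>2" by (smt (verit) zero_le_power2)
    ultimately show ?thesis by (simp add: field_simps)
  qed
  moreover have "0 \<le> B0 + B2"
    using order_trans[OF norm_ge_zero le[of 0]] by simp
  ultimately show thesis using that by blast
qed

lemma schwartz_integrable:
  assumes "f \<in> schwartz" shows "integrable lborel f"
proof -
  obtain B where B: "B \<ge> 0" "\<And>x. cmod (f x) \<le> B * inverse (1 + x\<^sup>2)"
    using schwartz_decay[OF assms] by blast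
  show ?thesis
    by (rule integrable_bound[OF integrable_mult_right[OF integrable_inverse_square, of B]])
      (use assms B in \<open>auto intro!: AE_I2 order_trans[OF _ abs_ge_self]\<close>)
qed

lemma schwartz_integral_derivative:
  assumes f: "f \<in> schwartz" and f': "f' \<in> schwartz" "\<And>x. (f has_vector_derivative f' x) (at x)"
  shows "(LBINT x. f' x) = 0"
proof -
  obtain B where B: "\<And>x. cmod (f x) \<le> B * inverse (1 + x\<^sup>2)"
    using schwartz_decay[OF f] by blast
  have lim: "(f \<longlongrightarrow> 0) at_top" "(f \<longlongrightarrow> 0) at_bot"
  proof -
    have "((\<lambda>x::real. B * inverse (1 + x\<^sup>2)) \<longlongrightarrow> 0) at_top" by real_asymp
    then show "(f \<longlongrightarrow> 0) at_top"
      by (rule Lim_null_comparison[rotated]) (use B in auto)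
    have "((\<lambda>x::real. B * inverse (1 + x\<^sup>2)) \<longlongrightarrow> 0) at_bot" by real_asymp
    then show "(f \<longlongrightarrow> 0) at_bot"
      by (rule Lim_null_comparison[rotated]) (use B in auto)
  qed
  have "(LBINT x=-\<infinity>..\<infinity>. f' x) = 0 - 0"
  proof (rule interval_integral_FTC_integrable)
    show "set_integrable lborel (einterval (-\<infinity>) \<infinity>) f'"
      using schwartz_integrable[OF f'(1)] by (simp add: set_integrable_def einterval_def)
    show "isCont f' x" for x
      using schwartz_continuous[OF f'(1), of UNIV] continuous_on_eq_continuous_at by blast
  qed (use f'(2) lim in \<open>auto simp: ereal_tendsto_simps\<close>)
  then show ?thesis
    by (simp add: interval_lebesgue_integral_def einterval_def set_lebesgue_integral_def)
qed

lemma fourier_derivative: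
  assumes f: "f \<in> schwartz" and f': "f' \<in> schwartz" "\<And>x. (f has_vector_derivative f' x) (at x)"
  shows "fourier f' w = \<i> * complex_of_real w * fourier f w"
proof -
  let ?c = "\<lambda>x. cis ((- w) * x)"
  have "(LBINT x. ?c x * f' x + (\<i> * complex_of_real (- w)) * (?c x * f x)) = 0"
  proof (rule schwartz_integral_derivative[of "\<lambda>x. ?c x * f x"])
    show "((\<lambda>x. ?c x * f x) has_vector_derivative ?c x * f' x + (\<i> * complex_of_real (- w)) * (?c x * f x)) (at x)" for x
      using has_vector_derivative_mult[OF cis_has_vector_derivative f'(2), of "-w" x] by (simp add: mult.assoc)
  qed (intro schwartz_cis schwartz_add schwartz_cmult f f')+
  moreover have "(LBINT x. ?c x * f' x + (\<i> * complex_of_real (- w)) * (?c x * f x))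
    = (LBINT x. ?c x * f' x) + (\<i> * complex_of_real (- w)) * (LBINT x. ?c x * f x)"
    unfolding integral_add[OF schwartz_integrable[OF schwartz_cis[OF f'(1)]]
        schwartz_integrable[OF schwartz_cmult[OF schwartz_cis[OF f]]]]
    by (simp only: integral_mult_right_zero)
  ultimately show ?thesis
    by (simp add: fourier_def mult.commute[of w])
qed

lemma fourier_has_vector_derivative:
  assumes f: "f \<in> schwartz"
  shows "(fourier f has_vector_derivative fourier (\<lambda>x. (- \<i>) * (complex_of_real x * f x)) w) (at w)"
proof -
  have "((\<lambda>w. LBINT x. cis (- (x * w)) * f x) has_vector_derivative
    (LBINT x. cis (- (x * w)) * ((- \<i>) * (complex_of_real x * f x)))) (at w)"
  proof (rule integral_has_vector_derivative)
    show "((\<lambda>w. cis (- (x * w)) * f x) has_vector_derivative cis (- (x * w)) * ((- \<i>) * (complex_of_real x * f x))) (at w)" for x w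
      using has_vector_derivative_mult_left[OF cis_has_vector_derivative[of "-x" w], of "f x"] by (simp add: mult_ac)
    show "integrable lborel (\<lambda>x. cis (- (x * w)) * f x)" for w
      by (intro fourier_integrand schwartz_integrable f) measurable
    show "integrable lborel (\<lambda>x. cmod (complex_of_real x * f x))"
      by (intro integrable_norm schwartz_integrable schwartz_xmult f)
  qed (simp add: norm_mult)
  then show ?thesis by (simp add: fourier_def[abs_def])
qed

text \<open>Multiplication by \<open>w\<close> on the frequency side is differentiation in space, so
  \<open>w ^ m * fourier f w\<close> is the transform of another Schwartz function and hence
  bounded.\<close>

lemma fourier_schwartz:
  assumes "f \<in> schwartz" shows "fourier f \<in> schwartz"
proof (rule schwartz_coinduct[of _ "fourier ` schwartz"])
  show "\<exists>g'\<in>fourier ` schwartz. \<forall>x. (g has_vector_derivative g' x) (at x)" if "g \<in> fourier ` schwartz" for g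
    using that fourier_has_vector_derivative schwartz_cmult[OF schwartz_xmult] by blast
  have *: "\<exists>h\<in>schwartz. \<forall>w. complex_of_real (w ^ m) * fourier f w = fourier h w" if "f \<in> schwartz" for f m
    using that
  proof (induction m arbitrary: f)
    case 0 then show ?case by (intro bexI[of _ f]) auto
  next
    case (Suc m)
    obtain f' where f': "f' \<in> schwartz" "\<And>x. (f has_vector_derivative f' x) (at x)"
      using schwartz_derivative[OF Suc.prems] by blast
    have "complex_of_real w * fourier f w = fourier (\<lambda>x. (- \<i>) * f' x) w" for w
      unfolding fourier_cmult fourier_derivative[OF Suc.prems f'] by (simp add: mult.assoc[symmetric])
    moreover obtain h where "h \<in> schwartz" "\<forall>w. complex_of_real (w ^ m) * fourier (\<lambda>x. (- \<i>) * f' x) w = fourier h w"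
      using Suc.IH[OF schwartz_cmult[OF f'(1)]] by blast
    moreover have "complex_of_real (w ^ Suc m) * fourier f w = complex_of_real (w ^ m) * (complex_of_real w * fourier f w)" for w
      by simp
    ultimately show ?case by metis
  qed
  show "bounded (range (\<lambda>x. complex_of_real (x ^ m) * g x))" if "g \<in> fourier ` schwartz" for g m
  proof -
    obtain f where f: "f \<in> schwartz" "g = fourier f" using \<open>g \<in> _\<close> by blast
    obtain h where h: "h \<in> schwartz" "\<forall>w. complex_of_real (w ^ m) * fourier f w = fourier h w"
      using *[OF f(1)] by blast
    then show ?thesis
      using norm_fourier_le[OF schwartz_integrable[OF h(1)]] f(2) by (auto simp: bounded_iff)
  qed
qed (use assms in blast)

text \<open>Both sides of \<open>gauss_regularization\<close> converge: the cutoff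
  \<open>gk n\<close> tends to 1 on the left, and on the right the kernel concentrates at
  \<open>x\<close> while keeping mass 2 pi.\<close>

lemma fourier_inversion:
  assumes f: "f \<in> schwartz"
  shows "(LBINT w. cis (x * w) * fourier f w) = complex_of_real (2 * pi) * f x"
proof -
  have [measurable]: "f \<in> borel_measurable borel" by (rule schwartz_measurable[OF f])
  have ff: "integrable lborel (fourier f)" by (intro schwartz_integrable fourier_schwartz f)
  have i: "integrable lborel (\<lambda>w. cis (x * w) * fourier f w)"
    by (intro fourier_integrand ff) measurable
  have 1: "(\<lambda>n. LBINT w. complex_of_real (gk n w) * (cis (x * w) * fourier f w)) \<longlonglongrightarrow> (LBINT w. cis (x * w) * fourier f w)"
  proof (rule integral_dominated_convergence[OF _ _ integrable_norm[OF ff]])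
    show "AE w in lborel. (\<lambda>n. complex_of_real (gk n w) * (cis (x * w) * fourier f w)) \<longlonglongrightarrow> cis (x * w) * fourier f w"
    proof (rule AE_I2)
      fix w
      have "(\<lambda>n. complex_of_real (gk n w) * (cis (x * w) * fourier f w)) \<longlonglongrightarrow> complex_of_real 1 * (cis (x * w) * fourier f w)"
        by (intro tendsto_mult tendsto_of_real gk_limit tendsto_const)
      then show "(\<lambda>n. complex_of_real (gk n w) * (cis (x * w) * fourier f w)) \<longlonglongrightarrow> cis (x * w) * fourier f w" by simp
    qed
    show "AE w in lborel. norm (complex_of_real (gk n w) * (cis (x * w) * fourier f w)) \<le> norm (fourier f w)" for n
      by (rule AE_I2) (simp add: norm_mult gk_nonneg gk_le_1 mult_left_le_one_le)
  qed measurable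
  obtain B where B: "\<And>x. cmod (f x) \<le> B"
    using schwartz_bounded[OF f, of 0] by (auto simp: bounded_iff)
  let ?g = "\<lambda>z::real. exp (- z\<^sup>2 / 2)"
  have 2: "(LBINT y. complex_of_real (gh n (x - y)) * f y)
      = complex_of_real (sqrt (2 * pi)) * (LBINT z. complex_of_real (?g z) * f (x + (1 / real (Suc n)) * z))" for n
  proof -
    let ?n = "real (Suc n)"
    have "(LBINT y. complex_of_real (gh n (x - y)) * f y)
      = \<bar>1 / ?n\<bar> *\<^sub>R (LBINT z. complex_of_real (gh n (x - (x + (1 / ?n) * z))) * f (x + (1 / ?n) * z))"
      by (rule lborel_integral_real_affine) simp
    also have "(LBINT z. complex_of_real (gh n (x - (x + (1 / ?n) * z))) * f (x + (1 / ?n) * z))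
      = (LBINT z. complex_of_real (?n * sqrt (2 * pi)) * (complex_of_real (?g z) * f (x + (1 / ?n) * z)))"
      by (intro integral_cong) (auto simp: gh_def)
    finally show ?thesis by (simp add: scaleR_conv_of_real del: of_nat_Suc)
  qed
  have "(\<lambda>n. LBINT z. complex_of_real (?g z) * f (x + (1 / real (Suc n)) * z)) \<longlonglongrightarrow> (LBINT z. complex_of_real (?g z) * f x)"
  proof (rule integral_dominated_convergence[OF _ _ integrable_mult_left[OF integrable_gauss, of B]])
    show "AE z in lborel. (\<lambda>n. complex_of_real (?g z) * f (x + (1 / real (Suc n)) * z)) \<longlonglongrightarrow> complex_of_real (?g z) * f x"
    proof (rule AE_I2)
      fix z
      have "(\<lambda>n. x + (1 / real (Suc n)) * z) \<longlonglongrightarrow> x + 0 * z"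
        by (intro tendsto_intros LIMSEQ_Suc[OF lim_1_over_n])
      then have "(\<lambda>n. f (x + (1 / real (Suc n)) * z)) \<longlonglongrightarrow> f x"
        using schwartz_continuous[OF f, of UNIV] by (intro isCont_tendsto_compose[of x f]) (auto simp: continuous_on_eq_continuous_at)
      then show "(\<lambda>n. complex_of_real (?g z) * f (x + (1 / real (Suc n)) * z)) \<longlonglongrightarrow> complex_of_real (?g z) * f x"
        by (intro tendsto_mult tendsto_const)
    qed
    show "AE z in lborel. norm (complex_of_real (?g z) * f (x + (1 / real (Suc n)) * z)) \<le> ?g z * B" for n
      by (rule AE_I2) (simp only: norm_mult norm_of_real abs_exp_cancel, intro mult_left_mono B, simp)
  qed measurable
  also have "(LBINT z. complex_of_real (?g z) * f x) = complex_of_real (sqrt (2 * pi)) * f x"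
    by (simp only: integral_mult_left_zero integral_complex_of_real integral_gauss)
  finally have "(\<lambda>n. LBINT y. complex_of_real (gh n (x - y)) * f y) \<longlonglongrightarrow> complex_of_real (sqrt (2 * pi)) * (complex_of_real (sqrt (2 * pi)) * f x)"
    unfolding 2 by (intro tendsto_mult tendsto_const)
  moreover have "complex_of_real (sqrt (2 * pi)) * (complex_of_real (sqrt (2 * pi)) * f x) = complex_of_real (2 * pi) * f x"
    unfolding mult.assoc[symmetric] of_real_mult[symmetric] by simp
  ultimately have "(\<lambda>n. LBINT w. complex_of_real (gk n w) * (cis (x * w) * fourier f w)) \<longlonglongrightarrow> complex_of_real (2 * pi) * f x"
    unfolding gauss_regularization[OF schwartz_integrable[OF f]] by simp
  then show ?thesis using 1 LIMSEQ_unique by blast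
qed

text \<open>\<open>is_fourier_of\<close> prescribes \<open>T\<close> only on functions of the form
  \<open>fourier \<phi>\<close>. Writing a given Schwartz function in this form is what allows
  \<open>T\<close> to be evaluated at it.\<close>

lemma fourier_surj:
  assumes f: "f \<in> schwartz"
  shows "(\<lambda>w. fourier f (- w) / (2 * pi)) \<in> schwartz"
    and "fourier (\<lambda>w. fourier f (- w) / (2 * pi)) = f"
proof -
  have "(\<lambda>w. (1 / (2 * pi)) * fourier f (- w)) \<in> schwartz"
    by (intro schwartz_cmult schwartz_reflect fourier_schwartz f)
  then show "(\<lambda>w. fourier f (- w) / (2 * pi)) \<in> schwartz" by simp
  have "fourier (\<lambda>w. fourier f (- w) / (2 * pi)) x = f x" for x
  proof -
    have "fourier (\<lambda>w. fourier f (- w) / (2 * pi)) x = (LBINT w. (cis (x * (- w)) * fourier f (- w)) / (2 * pi))"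
      unfolding fourier_def by (simp add: mult.commute)
    also have "\<dots> = (LBINT w. cis (x * (0 - w)) * fourier f (0 - w)) / (2 * pi)"
      by (simp only: integral_divide_zero diff_0)
    also have "\<dots> = f x"
      unfolding integral_reflect[of "\<lambda>w. cis (x * w) * fourier f w" 0] fourier_inversion[OF f] by simp
    finally show ?thesis .
  qed
  then show "fourier (\<lambda>w. fourier f (- w) / (2 * pi)) = f" by blast
qed

lemma test1_schwartz:
  assumes "test1 f" shows "(\<lambda>x. complex_of_real (f x)) \<in> schwartz"
proof (rule schwartz_coinduct[of _ "{\<lambda>x. complex_of_real (f x) | f. test1 f}"])
  show "\<exists>g'\<in>{\<lambda>x. complex_of_real (f x) | f. test1 f}. \<forall>x. (g has_vector_derivative g' x) (at x)"
    if "g \<in> {\<lambda>x. complex_of_real (f x) | f. test1 f}" for g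
  proof -
    obtain f where f: "test1 f" "g = (\<lambda>x. complex_of_real (f x))" using \<open>g \<in> _\<close> by blast
    obtain f' where f': "test1 f'" "\<And>x. (f has_real_derivative f' x) (at x)"
      using test1_derivative[OF f(1)] by blast
    show ?thesis
      by (rule bexI[of _ "\<lambda>x. complex_of_real (f' x)"]) (use f f' in \<open>auto intro: has_vector_derivative_of_real\<close>)
  qed
  show "bounded (range (\<lambda>x. complex_of_real (x ^ m) * g x))"
    if "g \<in> {\<lambda>x. complex_of_real (f x) | f. test1 f}" for g m
  proof -
    obtain f where f: "test1 f" "g = (\<lambda>x. complex_of_real (f x))" using \<open>g \<in> _\<close> by blast
    have "smooth (\<lambda>x::real. x ^ m)"
      by (induction m) (auto intro: smooth_const smooth_mult smooth_ident)
    then obtain B where "\<And>x. \<bar>f x * x ^ m\<bar> \<le> B"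
      using test1_bounded[OF test1_mult[OF f(1)]] by blast
    then show ?thesis
      using f(2) by (auto simp: bounded_iff norm_mult norm_power power_abs abs_mult mult.commute intro!: exI[of _ B])
  qed
qed (use assms in blast)

section \<open>Sobolev functions\<close>

text \<open>Makes the choice operator in \<open>fourier_distr\<close> harmless: norms and pairings
  depend only on the class of the transform modulo null sets.\<close>

lemma is_fourier_unique:
  assumes F: "is_fourier_of F T" and G: "is_fourier_of G T"
  shows "AE w in lborel. F w = G w"
proof -
  have [measurable]: "F \<in> borel_measurable borel" "G \<in> borel_measurable borel"
    using F G unfolding is_fourier_of_def by auto
  have "AE w in lborel. F w - G w = 0"
  proof (rule du_Bois_Reymond_complex)
    fix \<psi> assume "test1 \<psi>"
    then have s: "(\<lambda>x. complex_of_real (\<psi> x)) \<in> schwartz" by (rule test1_schwartz)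
    have i: "integrable lborel (\<lambda>w. F w * complex_of_real (\<psi> w))" "integrable lborel (\<lambda>w. G w * complex_of_real (\<psi> w))"
      and e: "(LBINT w. F w * complex_of_real (\<psi> w)) = (LBINT w. G w * complex_of_real (\<psi> w))"
      using F G s unfolding is_fourier_of_def by auto
    show "integrable lborel (\<lambda>w. (F w - G w) * complex_of_real (\<psi> w))"
      "(LBINT w. (F w - G w) * complex_of_real (\<psi> w)) = 0"
      using i e by (simp_all add: left_diff_distrib)
  qed measurable
  then show ?thesis by simp
qed

lemma is_fourier_of_fourier_distr: "is_fourier_of F T \<Longrightarrow> is_fourier_of (fourier_distr T) T"
  unfolding fourier_distr_def by (rule someI[of "\<lambda>F. is_fourier_of F T"])

lemma fourier_distr_AE: "is_fourier_of F T \<Longrightarrow> AE w in lborel. fourier_distr T w = F w"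
  by (blast intro: is_fourier_unique is_fourier_of_fourier_distr)

lemma is_fourier_measurable: "is_fourier_of F T \<Longrightarrow> F \<in> borel_measurable borel"
  by (simp add: is_fourier_of_def)

lemma sobolevD:
  assumes "T \<in> sobolev \<sigma>"
  shows "is_fourier_of (fourier_distr T) T"
    and "integrable lborel (\<lambda>w. (1 + w\<^sup>2) powr \<sigma> * (cmod (fourier_distr T w))\<^sup>2)"
proof -
  obtain F where F: "is_fourier_of F T" "integrable lborel (\<lambda>w. (1 + w\<^sup>2) powr \<sigma> * (cmod (F w))\<^sup>2)"
    using assms unfolding sobolev_def by blast
  show T: "is_fourier_of (fourier_distr T) T" using F(1) by (rule is_fourier_of_fourier_distr)
  note [measurable] = is_fourier_measurable[OF T] is_fourier_measurable[OF F(1)]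
  have "AE w in lborel. (1 + w\<^sup>2) powr \<sigma> * (cmod (F w))\<^sup>2 = (1 + w\<^sup>2) powr \<sigma> * (cmod (fourier_distr T w))\<^sup>2"
    using fourier_distr_AE[OF F(1)] by eventually_elim simp
  then show "integrable lborel (\<lambda>w. (1 + w\<^sup>2) powr \<sigma> * (cmod (fourier_distr T w))\<^sup>2)"
    by (rule integrable_cong_AE_imp[OF F(2), rotated]) measurable
qed

lemma sobolev_norm_square:
  "(sobolev_norm \<sigma> T)\<^sup>2 = (LBINT w. (1 + w\<^sup>2) powr \<sigma> * (cmod (fourier_distr T w))\<^sup>2) / (2 * pi)"
  unfolding sobolev_norm_def by (subst real_sqrt_pow2) auto

lemma sobolev_norm_nonneg: "0 \<le> sobolev_norm \<sigma> T"
  unfolding sobolev_norm_def by simp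

lemma sobolevI:
  assumes F: "is_fourier_of F T" and i: "integrable lborel (\<lambda>w. (1 + w\<^sup>2) powr \<sigma> * (cmod (F w))\<^sup>2)"
  shows "T \<in> sobolev \<sigma>"
    and "(sobolev_norm \<sigma> T)\<^sup>2 = (LBINT w. (1 + w\<^sup>2) powr \<sigma> * (cmod (F w))\<^sup>2) / (2 * pi)"
proof -
  show "T \<in> sobolev \<sigma>" using assms unfolding sobolev_def by blast
  note [measurable] = is_fourier_measurable[OF F] is_fourier_measurable[OF is_fourier_of_fourier_distr[OF F]]
  have "AE w in lborel. (1 + w\<^sup>2) powr \<sigma> * (cmod (fourier_distr T w))\<^sup>2 = (1 + w\<^sup>2) powr \<sigma> * (cmod (F w))\<^sup>2"
    using fourier_distr_AE[OF F] by eventually_elim simp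
  then have "(LBINT w. (1 + w\<^sup>2) powr \<sigma> * (cmod (fourier_distr T w))\<^sup>2) = (LBINT w. (1 + w\<^sup>2) powr \<sigma> * (cmod (F w))\<^sup>2)"
    by (intro integral_cong_AE) measurable
  then show "(sobolev_norm \<sigma> T)\<^sup>2 = (LBINT w. (1 + w\<^sup>2) powr \<sigma> * (cmod (F w))\<^sup>2) / (2 * pi)"
    by (simp add: sobolev_norm_square)
qed

lemma is_fourier_cong:
  assumes "\<And>\<phi>. \<phi> \<in> schwartz \<Longrightarrow> T \<phi> = T' \<phi>"
  shows "is_fourier_of F T \<longleftrightarrow> is_fourier_of F T'"
  unfolding is_fourier_of_def using assms[OF fourier_schwartz] by auto

text \<open>A true equality, not one modulo null sets: the transform of a Schwartz function is
  Schwartz, so the two predicates under the choice operator coincide and the same function is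
  chosen.\<close>

lemma fourier_distr_cong:
  assumes "\<And>\<phi>. \<phi> \<in> schwartz \<Longrightarrow> T \<phi> = T' \<phi>"
  shows "fourier_distr T = fourier_distr T'"
  unfolding fourier_distr_def using is_fourier_cong[OF assms] by presburger

lemma is_fourier_apply:
  assumes F: "is_fourier_of F T" and \<psi>: "\<psi> \<in> schwartz"
  shows "T \<psi> = (LBINT w. F w * fourier \<psi> (- w)) / complex_of_real (2 * pi)"
    and "integrable lborel (\<lambda>w. F w * fourier \<psi> (- w))"
proof -
  let ?\<phi> = "\<lambda>w. fourier \<psi> (- w) / (2 * pi)"
  have "T (fourier ?\<phi>) = (LBINT w. F w * ?\<phi> w)"
    using F fourier_surj(1)[OF \<psi>] unfolding is_fourier_of_def by blast
  then show "T \<psi> = (LBINT w. F w * fourier \<psi> (- w)) / complex_of_real (2 * pi)"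
    unfolding fourier_surj(2)[OF \<psi>] times_divide_eq_right by (simp only: integral_divide_zero)
  show "integrable lborel (\<lambda>w. F w * fourier \<psi> (- w))"
    using bspec[OF conjunct2[OF F[unfolded is_fourier_of_def]] schwartz_reflect[OF fourier_schwartz[OF \<psi>]]] by simp
qed

lemma is_fourier_deriv:
  assumes F: "is_fourier_of F T"
  shows "is_fourier_of (\<lambda>w. \<i> * complex_of_real w * F w) (distr_deriv T)"
  unfolding is_fourier_of_def
proof (intro conjI ballI)
  note [measurable] = is_fourier_measurable[OF F]
  show "(\<lambda>w. \<i> * complex_of_real w * F w) \<in> borel_measurable borel" by measurable
  fix \<phi> assume \<phi>: "\<phi> \<in> schwartz"
  let ?\<psi> = "\<lambda>x. (- \<i>) * (complex_of_real x * \<phi> x)"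
  have \<psi>: "?\<psi> \<in> schwartz" by (intro schwartz_cmult schwartz_xmult \<phi>)
  have i: "integrable lborel (\<lambda>w. F w * ?\<psi> w)" and e: "T (fourier ?\<psi>) = (LBINT w. F w * ?\<psi> w)"
    using F \<psi> unfolding is_fourier_of_def by auto
  have eq: "\<i> * complex_of_real w * F w * \<phi> w = - (F w * ?\<psi> w)" for w by simp
  show "integrable lborel (\<lambda>w. \<i> * complex_of_real w * F w * \<phi> w)"
    unfolding eq using i by (rule Bochner_Integration.integrable_minus)
  have "(\<lambda>x. vector_derivative (fourier \<phi>) (at x)) = fourier ?\<psi>"
    using vector_derivative_at[OF fourier_has_vector_derivative[OF \<phi>]] by blast
  then show "distr_deriv T (fourier \<phi>) = (LBINT w. \<i> * complex_of_real w * F w * \<phi> w)"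
    unfolding distr_deriv_def eq by (simp only: e integral_minus)
qed

section \<open>Weighted square-integrable functions on the frequency side\<close>

lemma weight_pos: "0 < 1 + (w::real)\<^sup>2"
  by (smt (verit) zero_le_power2)

lemma integrable_weight:
  assumes s: "s > 1/2" shows "integrable lborel (\<lambda>w::real. (1 + w\<^sup>2) powr (- s))"
proof -
  have "((\<lambda>x. x powr (- 2 * s)) has_integral - (1 powr (- 2 * s + 1)) / (- 2 * s + 1)) {1..}"
    by (rule has_integral_powr_to_inf) (use s in auto)
  then have "(\<lambda>x. x powr (- 2 * s)) absolutely_integrable_on {1..}"
    by (intro nonnegative_absolutely_integrable_1) (auto simp: integrable_on_def)
  then have t: "integrable lborel (\<lambda>x. indicator {1..} x * x powr (- 2 * s))"
    unfolding set_integrable_def by (subst (asm) integrable_completion) auto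
  have t': "integrable lborel (\<lambda>x. indicator {1..} (0 - x) * (0 - x) powr (- 2 * s))"
    using integrable_reflect[of "\<lambda>x. indicator {1..} x * x powr (- 2 * s)" 0] t by simp
  have b: "integrable lborel (\<lambda>x::real. indicator {-1..1} x :: real)"
    by (simp add: integrable_indicator_iff emeasure_lborel_Icc_eq)
  let ?B = "\<lambda>x. indicator {-1..1} x + (indicator {1..} x * x powr (- 2 * s) + indicator {1..} (0 - x) * (0 - x) powr (- 2 * s)) :: real"
  show ?thesis
  proof (rule integrable_bound[of lborel ?B])
    show "integrable lborel ?B" using t t' b by (intro integrable_add)
    show "AE x in lborel. norm ((1 + x\<^sup>2) powr (- s)) \<le> norm (?B x)"
    proof (rule AE_I2)
      fix x :: real
      have nn: "0 \<le> ?B x" by simp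
      have "(1 + x\<^sup>2) powr (- s) \<le> ?B x"
      proof (cases "\<bar>x\<bar> \<le> 1")
        case True
        have "(1 + x\<^sup>2) powr (- s) \<le> 1 powr (- s)"
          using s by (intro powr_mono2') auto
        also have "1 powr (- s) \<le> ?B x" using True by (simp add: abs_le_iff)
        finally show ?thesis .
      next
        case False
        have "(1 + x\<^sup>2) powr (- s) \<le> (\<bar>x\<bar> powr 2) powr (- s)"
          using s False by (intro powr_mono2') auto
        also have "\<dots> = \<bar>x\<bar> powr (- 2 * s)" unfolding powr_powr by simp
        also have "\<dots> \<le> ?B x"
          using False by (cases "x > 0") (auto simp: indicator_def)
        finally show ?thesis .
      qed
      with nn show "norm ((1 + x\<^sup>2) powr (- s)) \<le> norm (?B x)" by simp
    qed
  qed measurable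
qed

lemma weight_split:
  "((1 + (w::real)\<^sup>2) powr (a / 2))\<^sup>2 = (1 + w\<^sup>2) powr a"
  by (simp add: power2_eq_square flip: powr_add)

text \<open>Cauchy-Schwarz after splitting 1 into opposite powers of the weight. With
  \<open>f = 1\<close> it is the embedding of the weighted space into L1; with
  \<open>a = 1/2\<close> it is the duality that underlies \<open>pairing\<close>.\<close>

lemma weighted_product:
  fixes f g :: "real \<Rightarrow> complex"
  assumes [measurable]: "f \<in> borel_measurable borel" "g \<in> borel_measurable borel"
    and f: "integrable lborel (\<lambda>w. (1 + w\<^sup>2) powr (- a) * (cmod (f w))\<^sup>2)"
    and g: "integrable lborel (\<lambda>w. (1 + w\<^sup>2) powr a * (cmod (g w))\<^sup>2)"
  shows "integrable lborel (\<lambda>w. f w * g w)"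
    and "(LBINT w. cmod (f w * g w)) \<le>
      sqrt (LBINT w. (1 + w\<^sup>2) powr (- a) * (cmod (f w))\<^sup>2) * sqrt (LBINT w. (1 + w\<^sup>2) powr a * (cmod (g w))\<^sup>2)"
proof -
  let ?f = "\<lambda>w. (1 + w\<^sup>2) powr (- a / 2) * cmod (f w)" and ?g = "\<lambda>w. (1 + w\<^sup>2) powr (a / 2) * cmod (g w)"
  have f2: "(?f w)\<^sup>2 = (1 + w\<^sup>2) powr (- a) * (cmod (f w))\<^sup>2" for w
    unfolding power_mult_distrib weight_split ..
  have g2: "(?g w)\<^sup>2 = (1 + w\<^sup>2) powr a * (cmod (g w))\<^sup>2" for w
    unfolding power_mult_distrib weight_split ..
  have eq: "?f w * ?g w = cmod (f w * g w)" for w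
  proof -
    have "(1 + w\<^sup>2) powr (- a / 2) * (1 + w\<^sup>2) powr (a / 2) = 1"
      using weight_pos[of w] by (simp flip: powr_add)
    moreover have "?f w * ?g w = ((1 + w\<^sup>2) powr (- a / 2) * (1 + w\<^sup>2) powr (a / 2)) * (cmod (f w) * cmod (g w))"
      by (simp only: ac_simps)
    ultimately show ?thesis by (simp only: norm_mult mult_1_left)
  qed
  have [measurable]: "?f \<in> borel_measurable lborel" "?g \<in> borel_measurable lborel" by measurable
  have i: "integrable lborel (\<lambda>w. (?f w)\<^sup>2)" "integrable lborel (\<lambda>w. (?g w)\<^sup>2)"
    unfolding f2 g2 using f g by auto
  have "integrable lborel (\<lambda>w. ?f w * ?g w)"
    by (rule integrable_square_product(1)) (use i in measurable)
  then show "integrable lborel (\<lambda>w. f w * g w)"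
    unfolding eq by (subst (asm) integrable_norm_iff) measurable
  have "(LBINT w. \<bar>?f w * ?g w\<bar>) \<le> sqrt (LBINT w. (?f w)\<^sup>2) * sqrt (LBINT w. (?g w)\<^sup>2)"
    by (rule Cauchy_Schwarz_integral) (use i in measurable)
  then show "(LBINT w. cmod (f w * g w)) \<le>
      sqrt (LBINT w. (1 + w\<^sup>2) powr (- a) * (cmod (f w))\<^sup>2) * sqrt (LBINT w. (1 + w\<^sup>2) powr a * (cmod (g w))\<^sup>2)"
    unfolding f2 g2 eq by simp
qed

text \<open>The constant of the embedding of \<open>H^s\<close> into the bounded functions, that is
  the L2 norm of the weight (1 + w^2)^(-s/2). It comes from \<open>weighted_L1\<close> and is
  meaningful for s > 1/2 by \<open>integrable_weight\<close>.\<close>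

definition sob_const :: "real \<Rightarrow> real" where
  "sob_const s = sqrt (LBINT w. (1 + w\<^sup>2) powr (- s))"

lemma weighted_L1:
  fixes F :: "real \<Rightarrow> complex"
  assumes s: "s > 1/2" and [measurable]: "F \<in> borel_measurable borel"
    and F: "integrable lborel (\<lambda>w. (1 + w\<^sup>2) powr s * (cmod (F w))\<^sup>2)"
  shows "integrable lborel F"
    and "(LBINT w. cmod (F w)) \<le> sob_const s * sqrt (LBINT w. (1 + w\<^sup>2) powr s * (cmod (F w))\<^sup>2)"
  using weighted_product[of "\<lambda>_. 1" F s] integrable_weight[OF s] F
  by (simp_all add: sob_const_def)

lemma weighted_L2:
  fixes F :: "real \<Rightarrow> complex"
  assumes s: "s \<ge> 0" and [measurable]: "F \<in> borel_measurable borel"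
    and F: "integrable lborel (\<lambda>w. (1 + w\<^sup>2) powr s * (cmod (F w))\<^sup>2)"
  shows "integrable lborel (\<lambda>w. (cmod (F w))\<^sup>2)"
    and "(LBINT w. (cmod (F w))\<^sup>2) \<le> (LBINT w. (1 + w\<^sup>2) powr s * (cmod (F w))\<^sup>2)"
proof -
  have le: "(cmod (F w))\<^sup>2 \<le> (1 + w\<^sup>2) powr s * (cmod (F w))\<^sup>2" for w
    using mult_right_mono[OF ge_one_powr_ge_zero[of "1 + w\<^sup>2" s], of "(cmod (F w))\<^sup>2"] s by simp
  show i: "integrable lborel (\<lambda>w. (cmod (F w))\<^sup>2)"
    by (rule integrable_bound[OF F]) (use le in \<open>auto intro!: AE_I2 order_trans[OF _ abs_ge_self]\<close>)
  show "(LBINT w. (cmod (F w))\<^sup>2) \<le> (LBINT w. (1 + w\<^sup>2) powr s * (cmod (F w))\<^sup>2)"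
    by (rule integral_mono[OF i F le])
qed

section \<open>Inverse transforms of weighted functions and their L2 modulus\<close>

definition ift :: "(real \<Rightarrow> complex) \<Rightarrow> real \<Rightarrow> complex" where
  "ift F x = fourier F (- x) / complex_of_real (2 * pi)"

lemma ift_measurable[measurable]:
  assumes [measurable]: "F \<in> borel_measurable borel"
  shows "ift F \<in> borel_measurable borel"
  unfolding ift_def[abs_def] by measurable

lemma ift_pairing:
  assumes F: "integrable lborel F" and \<phi>: "integrable lborel \<phi>"
  shows "(LBINT x. ift F x * \<phi> x) = (LBINT w. F w * fourier \<phi> (- w)) / complex_of_real (2 * pi)"
    and "integrable lborel (\<lambda>x. ift F x * \<phi> x)"
proof -
  have [measurable]: "F \<in> borel_measurable borel" "\<phi> \<in> borel_measurable borel" using F \<phi> by auto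
  let ?H = "\<lambda>x w. cis (x * w) * F w * \<phi> x"
  have e1: "fourier F (- x) * \<phi> x = (LBINT w. ?H x w)" for x
    unfolding fourier_def by (subst integral_mult_left_zero) (simp add: mult.commute)
  have e2: "F w * fourier \<phi> (- w) = (LBINT x. ?H x w)" for w
  proof -
    have "(LBINT x. ?H x w) = (LBINT x. F w * (cis (- (x * (- w))) * \<phi> x))"
      by (intro integral_cong) auto
    then show ?thesis unfolding fourier_def by (simp only: integral_mult_right_zero)
  qed
  have "(LBINT x. ift F x * \<phi> x) = (LBINT x. fourier F (- x) * \<phi> x) / complex_of_real (2 * pi)"
    unfolding ift_def times_divide_eq_left by (simp only: integral_divide_zero)
  also have "(LBINT x. fourier F (- x) * \<phi> x) = (LBINT w. F w * fourier \<phi> (- w))"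
    unfolding e1 e2
  proof (rule lborel_pair.Fubini_integral[symmetric, OF integrable_pair_bound])
    show "integrable lborel (\<lambda>x. cmod (\<phi> x))" "integrable lborel (\<lambda>x. cmod (F x))" using F \<phi> by auto
  qed (measurable, simp add: norm_mult)
  finally show "(LBINT x. ift F x * \<phi> x) = (LBINT w. F w * fourier \<phi> (- w)) / complex_of_real (2 * pi)" .
  show "integrable lborel (\<lambda>x. ift F x * \<phi> x)"
  proof (rule integrable_bound[OF integrable_mult_right[OF \<phi>, of "complex_of_real ((LBINT x. cmod (F x)) / (2 * pi))"]])
    have "cmod (ift F x) \<le> (LBINT x. cmod (F x)) / (2 * pi)" for x
      unfolding ift_def norm_divide using norm_fourier_le[OF F] by (simp add: divide_right_mono)
    then show "AE x in lborel. norm (ift F x * \<phi> x) \<le> norm (complex_of_real ((LBINT x. cmod (F x)) / (2 * pi)) * \<phi> x)"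
      unfolding norm_mult norm_of_real by (intro AE_I2 mult_right_mono order_trans[OF _ abs_ge_self]) auto
  qed measurable
qed

lemma ift_L2:
  assumes F: "integrable lborel F" "integrable lborel (\<lambda>x. (cmod (F x))\<^sup>2)"
  shows "integrable lborel (\<lambda>x. (cmod (ift F x))\<^sup>2)"
    and "(LBINT x. (cmod (ift F x))\<^sup>2) \<le> (LBINT w. (cmod (F w))\<^sup>2) / (2 * pi)"
proof -
  have eq: "(cmod (ift F x))\<^sup>2 = (cmod (fourier F (0 - x)))\<^sup>2 / (2 * pi)\<^sup>2" for x
    by (simp add: ift_def norm_divide power_divide)
  have i: "integrable lborel (\<lambda>x. (cmod (fourier F (0 - x)))\<^sup>2)"
    using plancherel_le(1)[OF F] integrable_reflect[of "\<lambda>x. (cmod (fourier F x))\<^sup>2" 0] by simp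
  then show "integrable lborel (\<lambda>x. (cmod (ift F x))\<^sup>2)" unfolding eq by simp
  have "(LBINT x. (cmod (ift F x))\<^sup>2) = (LBINT x. (cmod (fourier F x))\<^sup>2) / (2 * pi)\<^sup>2"
    unfolding eq integral_divide_zero integral_reflect[of "\<lambda>x. (cmod (fourier F x))\<^sup>2" 0] ..
  also have "\<dots> \<le> (2 * pi * (LBINT w. (cmod (F w))\<^sup>2)) / (2 * pi)\<^sup>2"
    by (intro divide_right_mono plancherel_le F) simp
  also have "\<dots> = (LBINT w. (cmod (F w))\<^sup>2) / (2 * pi)"
    by (simp add: power2_eq_square)
  finally show "(LBINT x. (cmod (ift F x))\<^sup>2) \<le> (LBINT w. (cmod (F w))\<^sup>2) / (2 * pi)" .
qed

lemma ift_increment: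
  assumes F: "integrable lborel F"
  shows "ift F (x + h) - ift F x = ift (\<lambda>w. (cis (h * w) - 1) * F w) x"
proof -
  have i: "integrable lborel (\<lambda>w. cis (- (w * (- (x + h)))) * F w)" "integrable lborel (\<lambda>w. cis (- (w * (- x))) * F w)"
    by (intro fourier_integrand F, measurable)+
  have "fourier (\<lambda>w. (cis (h * w) - 1) * F w) (- x) = (LBINT w. cis (- (w * (- (x + h)))) * F w - cis (- (w * (- x))) * F w)"
    unfolding fourier_def
  proof (intro integral_cong refl)
    fix w
    have "cis (- (w * (- (x + h)))) = cis (- (w * (- x))) * cis (h * w)"
      unfolding cis_mult by (simp add: algebra_simps)
    then show "cis (- (w * - x)) * ((cis (h * w) - 1) * F w) = cis (- (w * - (x + h))) * F w - cis (- (w * - x)) * F w"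
      by (simp add: algebra_simps)
  qed
  also have "\<dots> = fourier F (- (x + h)) - fourier F (- x)"
    unfolding fourier_def by (rule integral_diff[OF i])
  finally show ?thesis by (simp add: ift_def diff_divide_distrib)
qed

lemma cis_increment_integrable:
  fixes F :: "real \<Rightarrow> complex"
  assumes F: "integrable lborel F"
  shows "integrable lborel (\<lambda>w. (cis (h * w) - 1) * F w)"
  using fourier_integrand[OF F, of "\<lambda>w. h * w"] F by (simp add: left_diff_distrib)

lemma norm_cis_minus_1_le: "cmod (cis \<theta> - 1) \<le> \<bar>\<theta>\<bar>"
  using iexp_approx1[of \<theta> 0] by (simp add: cis_conv_exp)

lemma norm_cis_minus_1_ge: "\<bar>\<theta>\<bar> - \<theta>\<^sup>2 / 2 \<le> cmod (cis \<theta> - 1)"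
proof -
  have "cmod (cis \<theta> - 1 - \<i> * complex_of_real \<theta>) \<le> \<bar>\<theta>\<bar>\<^sup>2 / 2"
    using iexp_approx1[of \<theta> 1] by (simp add: cis_conv_exp diff_diff_eq power2_eq_square)
  moreover have "cmod (\<i> * complex_of_real \<theta>) \<le> cmod (cis \<theta> - 1) + cmod (cis \<theta> - 1 - \<i> * complex_of_real \<theta>)"
    by (metis norm_triangle_sub norm_minus_commute)
  ultimately show ?thesis by (simp add: norm_mult)
qed

lemma norm_cis_minus_1_powr:
  assumes "0 \<le> \<sigma>" "\<sigma> \<le> 1" "\<theta> \<noteq> 0"
  shows "cmod (cis \<theta> - 1) \<le> 2 * \<bar>\<theta>\<bar> powr \<sigma>"
proof (cases "\<bar>\<theta>\<bar> \<le> 1")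
  case True
  have "\<bar>\<theta>\<bar> powr 1 \<le> \<bar>\<theta>\<bar> powr \<sigma>"
    using assms True by (intro powr_mono') auto
  with norm_cis_minus_1_le[of \<theta>] assms show ?thesis by simp
next
  case False
  have "cmod (cis \<theta> - 1) \<le> cmod (cis \<theta>) + cmod 1" by (rule norm_triangle_ineq4)
  also have "\<dots> = 2" by simp
  also have "\<dots> \<le> 2 * \<bar>\<theta>\<bar> powr \<sigma>" using ge_one_powr_ge_zero[of "\<bar>\<theta>\<bar>" \<sigma>] False assms by simp
  finally show ?thesis .
qed

text \<open>A translation by \<open>h\<close> multiplies the transform by
  \<open>cis (h * w)\<close>, and |cis \<theta> - 1| <= 2 |\<theta>|^\<sigma> for 0 <= \<sigma> <=
  1. First differences do not see smoothness beyond order one, hence the exponent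
  \<open>min s 1\<close>.\<close>

lemma ift_modulus:
  assumes s: "s > 1/2" and [measurable]: "F \<in> borel_measurable borel"
    and F: "integrable lborel (\<lambda>w. (1 + w\<^sup>2) powr s * (cmod (F w))\<^sup>2)" and h: "h > 0"
  shows "integrable lborel (\<lambda>x. (cmod (ift F (x + h) - ift F x))\<^sup>2)"
    and "(LBINT x. (cmod (ift F (x + h) - ift F x))\<^sup>2)
      \<le> (2 * h powr (min s 1))\<^sup>2 * ((LBINT w. (1 + w\<^sup>2) powr s * (cmod (F w))\<^sup>2) / (2 * pi))"
proof -
  define \<sigma> where "\<sigma> = min s 1"
  have \<sigma>: "0 \<le> \<sigma>" "\<sigma> \<le> 1" "\<sigma> \<le> s" using s by (auto simp: \<sigma>_def)
  note F1 = weighted_L1(1)[OF s _ F]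
  let ?H = "\<lambda>w. (cis (h * w) - 1) * F w"
  have le: "(cmod (?H w))\<^sup>2 \<le> (2 * h powr \<sigma>)\<^sup>2 * ((1 + w\<^sup>2) powr s * (cmod (F w))\<^sup>2)" for w
  proof (cases "w = 0")
    case False
    have "(cmod (cis (h * w) - 1))\<^sup>2 \<le> (2 * \<bar>h * w\<bar> powr \<sigma>)\<^sup>2"
      using False h \<sigma> by (intro power_mono norm_cis_minus_1_powr) auto
    also have "\<dots> = (2 * h powr \<sigma>)\<^sup>2 * (\<bar>w\<bar> powr \<sigma>)\<^sup>2"
      using h by (simp add: abs_mult powr_mult power_mult_distrib)
    also have "(\<bar>w\<bar> powr \<sigma>)\<^sup>2 = (w\<^sup>2) powr \<sigma>"
      by (simp add: power2_eq_square powr_mult[symmetric] abs_mult[symmetric])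
    also have "(w\<^sup>2) powr \<sigma> \<le> (1 + w\<^sup>2) powr \<sigma>"
      using \<sigma> by (intro powr_mono2) auto
    also have "\<dots> \<le> (1 + w\<^sup>2) powr s"
      using \<sigma> by (intro powr_mono) auto
    finally have "(cmod (cis (h * w) - 1))\<^sup>2 \<le> (2 * h powr \<sigma>)\<^sup>2 * (1 + w\<^sup>2) powr s"
      by (simp add: mult_left_mono)
    from mult_right_mono[OF this, of "(cmod (F w))\<^sup>2"] show ?thesis
      by (simp add: norm_mult power_mult_distrib mult.assoc)
  qed simp
  have i: "integrable lborel (\<lambda>w. (2 * h powr \<sigma>)\<^sup>2 * ((1 + w\<^sup>2) powr s * (cmod (F w))\<^sup>2))"
    using F by simp
  have H: "integrable lborel ?H" by (rule cis_increment_integrable[OF F1]) measurable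
  have H2: "integrable lborel (\<lambda>w. (cmod (?H w))\<^sup>2)"
    by (rule integrable_bound[OF i]) (measurable, use le in \<open>auto intro!: AE_I2 order_trans[OF _ abs_ge_self]\<close>)
  have F1': "integrable lborel F" by (rule F1) measurable
  show "integrable lborel (\<lambda>x. (cmod (ift F (x + h) - ift F x))\<^sup>2)"
    unfolding ift_increment[OF F1'] by (rule ift_L2[OF H H2])
  have "(LBINT x. (cmod (ift ?H x))\<^sup>2) \<le> (LBINT w. (cmod (?H w))\<^sup>2) / (2 * pi)"
    by (rule ift_L2[OF H H2])
  also have "\<dots> \<le> (LBINT w. (2 * h powr \<sigma>)\<^sup>2 * ((1 + w\<^sup>2) powr s * (cmod (F w))\<^sup>2)) / (2 * pi)"
    by (intro divide_right_mono integral_mono H2 i le) simp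
  finally show "(LBINT x. (cmod (ift F (x + h) - ift F x))\<^sup>2)
      \<le> (2 * h powr (min s 1))\<^sup>2 * ((LBINT w. (1 + w\<^sup>2) powr s * (cmod (F w))\<^sup>2) / (2 * pi))"
    unfolding ift_increment[OF F1'] \<sigma>_def by simp
qed

lemma AE_translate:
  fixes f g :: "real \<Rightarrow> 'a::{second_countable_topology, t2_space}"
  assumes [measurable]: "f \<in> borel_measurable borel" "g \<in> borel_measurable borel"
    and eq: "AE x in lborel. f x = g x"
  shows "AE x in lborel. f (x + h) = g (x + h)"
proof -
  have [measurable]: "{x. f x = g x} \<in> sets borel"
    using measurable_equality_set[of f borel g] by simp
  have "AE x in distr lborel borel (\<lambda>x. h + x). f x = g x"
    by (subst lborel_distr_plus) (rule eq)
  then show ?thesis by (subst (asm) AE_distr_iff) (auto simp: add.commute)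
qed

lemma schwartz_square_integrable:
  assumes "\<phi> \<in> schwartz" shows "integrable lborel (\<lambda>x. (cmod (\<phi> x))\<^sup>2)"
proof -
  obtain B where B: "\<And>x. cmod (\<phi> x) \<le> B"
    using schwartz_bounded[OF assms, of 0] by (auto simp: bounded_iff)
  have [measurable]: "\<phi> \<in> borel_measurable borel" by (rule schwartz_measurable[OF assms])
  show ?thesis
  proof (rule integrable_bound[OF integrable_mult_right[OF integrable_norm[OF schwartz_integrable[OF assms]], of B]])
    show "AE x in lborel. norm ((cmod (\<phi> x))\<^sup>2) \<le> norm (B * norm (\<phi> x))"
      using B by (auto simp: power2_eq_square abs_mult intro!: AE_I2 mult_right_mono order_trans[OF _ abs_ge_self])
  qed measurable
qed

section \<open>Sobolev functions and their bounded representatives\<close>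

lemma L2_fun_schwartz_integrable:
  assumes f: "f \<in> L2_fun" and \<phi>: "\<phi> \<in> schwartz"
  shows "integrable lborel (\<lambda>x. complex_of_real (f x) * \<phi> x)"
proof -
  have [measurable]: "f \<in> borel_measurable borel" "\<phi> \<in> borel_measurable borel"
    using f schwartz_measurable[OF \<phi>] by (auto simp: L2_fun_def)
  have "integrable lborel (\<lambda>x. f x * cmod (\<phi> x))"
    by (rule integrable_square_product(1)) (use f schwartz_square_integrable[OF \<phi>] in \<open>auto simp: L2_fun_def\<close>)
  then show ?thesis
    by (rule integrable_bound) (auto simp: norm_mult abs_mult)
qed

lemma L2_fun_diff: "f \<in> L2_fun \<Longrightarrow> g \<in> L2_fun \<Longrightarrow> (\<lambda>x. f x - g x) \<in> L2_fun"
  using integrable_square_product(3)[of f lborel g] by (simp add: L2_fun_def borel_measurable_diff)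

lemma distr_of_diff:
  assumes "f \<in> L2_fun" "g \<in> L2_fun" "\<phi> \<in> schwartz"
  shows "distr_of (\<lambda>x. f x - g x) \<phi> = distr_of f \<phi> - distr_of g \<phi>"
  unfolding distr_of_def
  using L2_fun_schwartz_integrable[OF assms(1,3)] L2_fun_schwartz_integrable[OF assms(2,3)]
  by (simp add: left_diff_distrib)

lemma sobolev_funD:
  assumes "f \<in> sobolev_fun s"
  shows "f \<in> L2_fun" "is_fourier_of (fourier_distr (distr_of f)) (distr_of f)"
    "integrable lborel (\<lambda>w. (1 + w\<^sup>2) powr s * (cmod (fourier_distr (distr_of f) w))\<^sup>2)"
    "fourier_distr (distr_of f) \<in> borel_measurable borel"
  using assms sobolevD[of "distr_of f" s] is_fourier_measurable by (auto simp: sobolev_fun_def)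

lemma sobolev_fun_diff:
  assumes f: "f \<in> sobolev_fun s" and g: "g \<in> sobolev_fun s"
  shows "(\<lambda>x. f x - g x) \<in> sobolev_fun s"
proof -
  let ?F = "fourier_distr (distr_of f)" and ?G = "fourier_distr (distr_of g)"
  note F = sobolev_funD[OF f] and G = sobolev_funD[OF g]
  note [measurable] = F(4) G(4)
  have "is_fourier_of (\<lambda>w. ?F w - ?G w) (distr_of (\<lambda>x. f x - g x))"
    unfolding is_fourier_of_def
  proof (intro conjI ballI)
    fix \<phi> assume \<phi>: "\<phi> \<in> schwartz"
    have i: "integrable lborel (\<lambda>w. ?F w * \<phi> w)" "integrable lborel (\<lambda>w. ?G w * \<phi> w)"
      and e: "distr_of f (fourier \<phi>) = (LBINT w. ?F w * \<phi> w)" "distr_of g (fourier \<phi>) = (LBINT w. ?G w * \<phi> w)"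
      using F(2) G(2) \<phi> unfolding is_fourier_of_def by auto
    show "integrable lborel (\<lambda>w. (?F w - ?G w) * \<phi> w)"
      using i by (simp add: left_diff_distrib)
    show "distr_of (\<lambda>x. f x - g x) (fourier \<phi>) = (LBINT w. (?F w - ?G w) * \<phi> w)"
      using i by (simp add: distr_of_diff[OF F(1) G(1) fourier_schwartz[OF \<phi>]] e left_diff_distrib)
  qed measurable
  moreover have "integrable lborel (\<lambda>w. (1 + w\<^sup>2) powr s * (cmod (?F w - ?G w))\<^sup>2)"
  proof (rule integrable_bound[OF integrable_mult_right[OF integrable_add[OF F(3) G(3)], of 2]])
    show "AE w in lborel. norm ((1 + w\<^sup>2) powr s * (cmod (?F w - ?G w))\<^sup>2) \<le>
      norm (2 * ((1 + w\<^sup>2) powr s * (cmod (?F w))\<^sup>2 + (1 + w\<^sup>2) powr s * (cmod (?G w))\<^sup>2))"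
    proof (rule AE_I2)
      fix w
      have "(cmod (?F w - ?G w))\<^sup>2 \<le> (cmod (?F w) + cmod (?G w))\<^sup>2"
        by (intro power_mono norm_triangle_ineq4) simp
      also have "\<dots> \<le> 2 * ((cmod (?F w))\<^sup>2 + (cmod (?G w))\<^sup>2)"
        using sum_squares_bound[of "cmod (?F w)" "cmod (?G w)"] by (simp add: power2_sum)
      finally have "(1 + w\<^sup>2) powr s * (cmod (?F w - ?G w))\<^sup>2 \<le> (1 + w\<^sup>2) powr s * (2 * ((cmod (?F w))\<^sup>2 + (cmod (?G w))\<^sup>2))"
        by (rule mult_left_mono) simp
      then show "norm ((1 + w\<^sup>2) powr s * (cmod (?F w - ?G w))\<^sup>2) \<le>
        norm (2 * ((1 + w\<^sup>2) powr s * (cmod (?F w))\<^sup>2 + (1 + w\<^sup>2) powr s * (cmod (?G w))\<^sup>2))"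
        by (simp add: algebra_simps)
    qed
  qed measurable
  ultimately show ?thesis
    using L2_fun_diff[OF F(1) G(1)] sobolevI(1) by (auto simp: sobolev_fun_def)
qed

text \<open>A canonical representative, defined at every point. With it the bounds |p|, |q| <= 1/2
  hold everywhere instead of almost everywhere, so that nonlinear functions of \<open>p\<close> and
  \<open>q\<close> can be treated pointwise. The real part is taken because \<open>ift\<close> is
  complex-valued; it changes nothing almost everywhere.\<close>

definition rep :: "(real \<Rightarrow> real) \<Rightarrow> real \<Rightarrow> real" where
  "rep f x = Re (ift (fourier_distr (distr_of f)) x)"

context
  fixes f :: "real \<Rightarrow> real" and s :: real
  assumes f: "f \<in> sobolev_fun s" and s: "s > 1/2"
begin

private abbreviation (input) "F \<equiv> fourier_distr (distr_of f)"
private abbreviation (input) "N \<equiv> sobolev_norm s (distr_of f)"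

lemma sobolev_fourier_integrable: "integrable lborel (fourier_distr (distr_of f))"
  by (rule weighted_L1(1)[OF s sobolev_funD(4,3)[OF f]])

lemma sobolev_ift_AE: "AE x in lborel. complex_of_real (f x) = ift (fourier_distr (distr_of f)) x"
proof -
  have [measurable]: "f \<in> borel_measurable borel" "F \<in> borel_measurable borel"
    using sobolev_funD[OF f] by (auto simp: L2_fun_def)
  have "AE x in lborel. complex_of_real (f x) - ift F x = 0"
  proof (rule du_Bois_Reymond_complex)
    fix \<psi> assume \<psi>: "test1 \<psi>"
    note \<psi>s = test1_schwartz[OF \<psi>]
    note i1 = L2_fun_schwartz_integrable[OF sobolev_funD(1)[OF f] \<psi>s]
    note p = ift_pairing[OF sobolev_fourier_integrable schwartz_integrable[OF \<psi>s]]
    show "integrable lborel (\<lambda>x. (complex_of_real (f x) - ift F x) * complex_of_real (\<psi> x))"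
      using i1 p(2) by (simp add: left_diff_distrib)
    have "(LBINT x. complex_of_real (f x) * complex_of_real (\<psi> x)) = (LBINT x. ift F x * complex_of_real (\<psi> x))"
      using is_fourier_apply(1)[OF sobolev_funD(2)[OF f] \<psi>s] p(1) by (simp add: distr_of_def)
    then show "(LBINT x. (complex_of_real (f x) - ift F x) * complex_of_real (\<psi> x)) = 0"
      using i1 p(2) by (simp add: left_diff_distrib)
  qed measurable
  then show ?thesis by simp
qed

lemma rep_measurable: "rep f \<in> borel_measurable borel"
  unfolding rep_def[abs_def] using sobolev_funD(4)[OF f] by measurable

lemma rep_AE: "AE x in lborel. f x = rep f x"
  using sobolev_ift_AE by eventually_elim (metis rep_def Re_complex_of_real)

lemma ift_rep_AE: "AE x in lborel. ift (fourier_distr (distr_of f)) x = complex_of_real (rep f x)"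
  using sobolev_ift_AE by eventually_elim (metis rep_def Re_complex_of_real)

lemma ift_rep_AE_translate:
  "AE x in lborel. ift (fourier_distr (distr_of f)) (x + h) = complex_of_real (rep f (x + h))"
  by (rule AE_translate[OF _ _ ift_rep_AE]) (use sobolev_funD(4)[OF f] rep_measurable in measurable)

lemma sobolev_weight_integral:
  "(LBINT w. (1 + w\<^sup>2) powr s * (cmod (fourier_distr (distr_of f) w))\<^sup>2) = 2 * pi * (sobolev_norm s (distr_of f))\<^sup>2"
  by (simp add: sobolev_norm_square)

lemma rep_bounded: "\<bar>rep f x\<bar> \<le> sob_const s * sobolev_norm s (distr_of f)"
proof -
  have c: "0 \<le> sob_const s" by (simp add: sob_const_def)
  have "\<bar>rep f x\<bar> \<le> cmod (ift F x)" unfolding rep_def by (rule abs_Re_le_cmod)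
  also have "\<dots> \<le> (LBINT w. cmod (F w)) / (2 * pi)"
    unfolding ift_def norm_divide using norm_fourier_le[OF sobolev_fourier_integrable] by (simp add: divide_right_mono)
  also have "\<dots> \<le> (sob_const s * sqrt (2 * pi * N\<^sup>2)) / (2 * pi)"
    using weighted_L1(2)[OF s sobolev_funD(4,3)[OF f]] unfolding sobolev_weight_integral by (intro divide_right_mono) auto
  also have "\<dots> = (sob_const s * N) * (sqrt (2 * pi) / (2 * pi))"
    by (simp add: real_sqrt_mult sobolev_norm_nonneg)
  also have "\<dots> \<le> (sob_const s * N) * 1"
  proof (intro mult_left_mono)
    have "sqrt (2 * pi) \<le> 2 * pi"
      using pi_gt3 by (intro real_le_lsqrt) (auto simp: power2_eq_square)
    then show "sqrt (2 * pi) / (2 * pi) \<le> 1" by simp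
  qed (use c sobolev_norm_nonneg in auto)
  finally show ?thesis by simp
qed

lemma rep_L2:
  "integrable lborel (\<lambda>x. (rep f x)\<^sup>2)" "(LBINT x. (rep f x)\<^sup>2) \<le> (sobolev_norm s (distr_of f))\<^sup>2"
proof -
  note [measurable] = sobolev_funD(4)[OF f] rep_measurable
  note L2 = weighted_L2[OF _ sobolev_funD(4,3)[OF f]]
  have s0: "0 \<le> s" using s by simp
  note i = ift_L2[OF sobolev_fourier_integrable L2(1)[OF s0]]
  have eq: "AE x in lborel. (cmod (ift F x))\<^sup>2 = (rep f x)\<^sup>2"
    using ift_rep_AE by eventually_elim simp
  show "integrable lborel (\<lambda>x. (rep f x)\<^sup>2)"
    by (rule integrable_cong_AE_imp[OF i(1) _ eq]) measurable
  have "(LBINT x. (rep f x)\<^sup>2) = (LBINT x. (cmod (ift F x))\<^sup>2)"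
    by (rule integral_cong_AE) (use eq in \<open>auto elim: eventually_mono\<close>)
  also have "\<dots> \<le> (2 * pi * N\<^sup>2) / (2 * pi)"
    using L2(2)[OF s0] unfolding sobolev_weight_integral by (intro order_trans[OF i(2)] divide_right_mono) auto
  finally show "(LBINT x. (rep f x)\<^sup>2) \<le> N\<^sup>2" by simp
qed

lemma rep_modulus:
  assumes h: "h > 0"
  shows "integrable lborel (\<lambda>x. (rep f (x + h) - rep f x)\<^sup>2)"
    and "(LBINT x. (rep f (x + h) - rep f x)\<^sup>2) \<le> (2 * h powr (min s 1) * sobolev_norm s (distr_of f))\<^sup>2"
proof -
  note [measurable] = sobolev_funD(4)[OF f] rep_measurable
  note i = ift_modulus[OF s sobolev_funD(4,3)[OF f] h]
  have eq: "AE x in lborel. (cmod (ift F (x + h) - ift F x))\<^sup>2 = (rep f (x + h) - rep f x)\<^sup>2"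
    using ift_rep_AE ift_rep_AE_translate[of h]
    by eventually_elim (simp flip: of_real_diff)
  show "integrable lborel (\<lambda>x. (rep f (x + h) - rep f x)\<^sup>2)"
    by (rule integrable_cong_AE_imp[OF i(1) _ eq]) measurable
  have "(LBINT x. (rep f (x + h) - rep f x)\<^sup>2) = (LBINT x. (cmod (ift F (x + h) - ift F x))\<^sup>2)"
    by (rule integral_cong_AE) (use eq in \<open>auto elim: eventually_mono\<close>)
  also have "\<dots> \<le> (2 * h powr (min s 1))\<^sup>2 * ((2 * pi * N\<^sup>2) / (2 * pi))"
    using i(2) unfolding sobolev_weight_integral .
  finally show "(LBINT x. (rep f (x + h) - rep f x)\<^sup>2) \<le> (2 * h powr (min s 1) * N)\<^sup>2"
    by (simp add: power_mult_distrib)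
qed

text \<open>Rewrites a tested difference as a frequency integral with multiplier
  \<open>cis (h * w) - 1\<close>. After division by \<open>h\<close> this multiplier tends to that
  of the derivative, which is how \<open>derivative_pairing\<close> passes from difference quotients
  to distributions.\<close>

lemma rep_increment_pairing:
  fixes k :: "real \<Rightarrow> real"
  assumes k: "integrable lborel k"
  shows "complex_of_real (LBINT x. (rep f (x + h) - rep f x) * k x)
    = (LBINT w. (cis (h * w) - 1) * fourier_distr (distr_of f) w * fourier (\<lambda>x. complex_of_real (k x)) (- w)) / complex_of_real (2 * pi)"
proof -
  note [measurable] = sobolev_funD(4)[OF f] rep_measurable
  have [measurable]: "k \<in> borel_measurable borel" using k by auto
  let ?H = "\<lambda>w. (cis (h * w) - 1) * F w"
  have kc: "integrable lborel (\<lambda>x. complex_of_real (k x))" using k by simp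
  have "complex_of_real (LBINT x. (rep f (x + h) - rep f x) * k x) = (LBINT x. complex_of_real ((rep f (x + h) - rep f x) * k x))"
    by (rule integral_complex_of_real[symmetric])
  also have "\<dots> = (LBINT x. ift ?H x * complex_of_real (k x))"
  proof (rule integral_cong_AE)
    show "AE x in lborel. complex_of_real ((rep f (x + h) - rep f x) * k x) = ift ?H x * complex_of_real (k x)"
      unfolding ift_increment[OF sobolev_fourier_integrable, symmetric]
      using ift_rep_AE ift_rep_AE_translate[of h] by eventually_elim simp
  qed measurable
  also have "\<dots> = (LBINT w. ?H w * fourier (\<lambda>x. complex_of_real (k x)) (- w)) / complex_of_real (2 * pi)"
    by (rule ift_pairing(1)[OF cis_increment_integrable[OF sobolev_fourier_integrable] kc])
  finally show ?thesis .
qed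

end

section \<open>Weak derivatives\<close>

lemma weak_derivative_sobolev:
  assumes v: "v \<in> sobolev_fun (s + 1)" and g: "g \<in> L2_fun"
    and wd: "\<And>\<phi>. \<phi> \<in> schwartz \<Longrightarrow> distr_of g \<phi> = distr_deriv (distr_of v) \<phi>"
  shows "g \<in> sobolev_fun s" and "sobolev_norm s (distr_of g) \<le> sobolev_norm (s + 1) (distr_of v)"
proof -
  let ?F = "fourier_distr (distr_of v)"
  let ?H = "\<lambda>w. \<i> * complex_of_real w * ?F w"
  note V = sobolev_funD[OF v]
  note [measurable] = V(4)
  have H: "is_fourier_of ?H (distr_of g)"
    using is_fourier_deriv[OF V(2)] is_fourier_cong[of "distr_of g" "distr_deriv (distr_of v)", OF wd] by blast
  have le: "(1 + w\<^sup>2) powr s * (cmod (?H w))\<^sup>2 \<le> (1 + w\<^sup>2) powr (s + 1) * (cmod (?F w))\<^sup>2" for w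
  proof -
    have "(1 + w\<^sup>2) powr s * w\<^sup>2 \<le> (1 + w\<^sup>2) powr s * (1 + w\<^sup>2)"
      by (intro mult_left_mono) auto
    also have "\<dots> = (1 + w\<^sup>2) powr (s + 1)"
      using weight_pos[of w] by (simp add: powr_add)
    finally have "(1 + w\<^sup>2) powr s * w\<^sup>2 * (cmod (?F w))\<^sup>2 \<le> (1 + w\<^sup>2) powr (s + 1) * (cmod (?F w))\<^sup>2"
      by (intro mult_right_mono) auto
    then show ?thesis by (simp add: norm_mult power_mult_distrib mult.assoc)
  qed
  have i: "integrable lborel (\<lambda>w. (1 + w\<^sup>2) powr s * (cmod (?H w))\<^sup>2)"
    by (rule integrable_bound[OF V(3)]) (measurable, use le in \<open>auto intro!: AE_I2\<close>)
  show "g \<in> sobolev_fun s" using sobolevI(1)[OF H i] g by (simp add: sobolev_fun_def)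
  have "(sobolev_norm s (distr_of g))\<^sup>2 \<le> (sobolev_norm (s + 1) (distr_of v))\<^sup>2"
    unfolding sobolevI(2)[OF H i] sobolev_norm_square[of "s + 1"]
    by (intro divide_right_mono integral_mono i V(3) le) simp
  then show "sobolev_norm s (distr_of g) \<le> sobolev_norm (s + 1) (distr_of v)"
    using sobolev_norm_nonneg power2_le_imp_le by blast
qed

text \<open>Gives content to the choice operator in \<open>weak_deriv\<close>. The candidate is the
  inverse transform of \<open>\<i> * w * ?F w\<close>, which is integrable because it lies in the
  weighted space of order s > 1/2.\<close>

lemma weak_deriv_exists:
  assumes v: "v \<in> sobolev_fun (s + 1)" and s: "s > 1/2"
  shows "weak_deriv v \<in> L2_fun" and "\<phi> \<in> schwartz \<Longrightarrow> distr_of (weak_deriv v) \<phi> = distr_deriv (distr_of v) \<phi>"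
proof -
  let ?F = "fourier_distr (distr_of v)"
  let ?H = "\<lambda>w. \<i> * complex_of_real w * ?F w"
  note V = sobolev_funD[OF v]
  note [measurable] = V(4)
  have le: "(1 + w\<^sup>2) powr s * (cmod (?H w))\<^sup>2 \<le> (1 + w\<^sup>2) powr (s + 1) * (cmod (?F w))\<^sup>2" for w
  proof -
    have "(1 + w\<^sup>2) powr s * w\<^sup>2 \<le> (1 + w\<^sup>2) powr s * (1 + w\<^sup>2)"
      by (intro mult_left_mono) auto
    also have "\<dots> = (1 + w\<^sup>2) powr (s + 1)"
      using weight_pos[of w] by (simp add: powr_add)
    finally have "(1 + w\<^sup>2) powr s * w\<^sup>2 * (cmod (?F w))\<^sup>2 \<le> (1 + w\<^sup>2) powr (s + 1) * (cmod (?F w))\<^sup>2"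
      by (intro mult_right_mono) auto
    then show ?thesis by (simp add: norm_mult power_mult_distrib mult.assoc)
  qed
  have Hm: "?H \<in> borel_measurable borel" by measurable
  have i: "integrable lborel (\<lambda>w. (1 + w\<^sup>2) powr s * (cmod (?H w))\<^sup>2)"
    by (rule integrable_bound[OF V(3)]) (measurable, use le in \<open>auto intro!: AE_I2\<close>)
  have H1: "integrable lborel ?H" by (rule weighted_L1(1)[OF s Hm i])
  have H2: "integrable lborel (\<lambda>w. (cmod (?H w))\<^sup>2)" by (rule weighted_L2(1)[OF _ Hm i]) (use s in simp)
  have T: "(LBINT x. ift ?H x * \<phi> x) = distr_deriv (distr_of v) \<phi>" if \<phi>: "\<phi> \<in> schwartz" for \<phi>
  proof -
    obtain \<phi>' where \<phi>': "\<phi>' \<in> schwartz" "\<And>x. (\<phi> has_vector_derivative \<phi>' x) (at x)"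
      using schwartz_derivative[OF \<phi>] by blast
    have "(\<lambda>x. vector_derivative \<phi> (at x)) = \<phi>'" using vector_derivative_at[OF \<phi>'(2)] by blast
    then have "distr_deriv (distr_of v) \<phi> = - ((LBINT w. ?F w * fourier \<phi>' (- w)) / complex_of_real (2 * pi))"
      unfolding distr_deriv_def by (simp only: is_fourier_apply(1)[OF V(2) \<phi>'(1)])
    also have "(LBINT w. ?F w * fourier \<phi>' (- w)) = - (LBINT w. ?H w * fourier \<phi> (- w))"
      unfolding fourier_derivative[OF \<phi> \<phi>'] Bochner_Integration.integral_minus[symmetric]
      by (intro integral_cong) auto
    finally show ?thesis
      unfolding ift_pairing(1)[OF H1 schwartz_integrable[OF \<phi>]] by simp
  qed
  define g where "g x = Re (ift ?H x)" for x
  have [measurable]: "g \<in> borel_measurable borel" unfolding g_def by measurable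
  have g: "g \<in> L2_fun"
    unfolding L2_fun_def
  proof (intro CollectI conjI)
    show "integrable lborel (\<lambda>x. (g x)\<^sup>2)"
    proof (rule integrable_bound[OF ift_L2(1)[OF H1 H2]])
      show "AE x in lborel. norm ((g x)\<^sup>2) \<le> norm ((cmod (ift ?H x))\<^sup>2)"
        unfolding g_def using power_mono[OF abs_Re_le_cmod abs_ge_zero, of _ 2] by (auto intro!: AE_I2)
    qed measurable
  qed measurable
  have gT: "distr_of g \<phi> = distr_deriv (distr_of v) \<phi>" if \<phi>: "\<phi> \<in> schwartz" for \<phi>
  proof -
    note \<phi>c = schwartz_cnj[OF \<phi>]
    \<comment> \<open>As \<open>v\<close> is real, its distributional derivative commutes with
      conjugation. Averaging the pairing with its conjugate then shows that the real part
      \<open>g\<close> alone represents the derivative.\<close>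
    have cnj: "distr_deriv (distr_of v) (\<lambda>x. cnj (\<phi> x)) = cnj (distr_deriv (distr_of v) \<phi>)"
    proof -
      have "vector_derivative (\<lambda>x. cnj (\<phi> x)) (at x) = cnj (vector_derivative \<phi> (at x))" for x
        by (intro vector_derivative_at has_vector_derivative_cnj schwartz_has_vector_derivative \<phi>)
      then have "distr_deriv (distr_of v) (\<lambda>x. cnj (\<phi> x)) = - (LBINT x. cnj (complex_of_real (v x) * vector_derivative \<phi> (at x)))"
        unfolding distr_deriv_def distr_of_def by simp
      then show ?thesis
        unfolding integral_cnj distr_deriv_def distr_of_def by simp
    qed
    note i1 = ift_pairing(2)[OF H1 schwartz_integrable[OF \<phi>]] and i2 = ift_pairing(2)[OF H1 schwartz_integrable[OF \<phi>c]]
    have eq: "complex_of_real (g x) * \<phi> x = (ift ?H x * \<phi> x + cnj (ift ?H x * cnj (\<phi> x))) / 2" for x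
    proof -
      have "complex_of_real (g x) = (ift ?H x + cnj (ift ?H x)) / 2"
        unfolding g_def by (simp add: complex_add_cnj)
      then show ?thesis by (simp add: algebra_simps)
    qed
    have "distr_of g \<phi> = (LBINT x. (ift ?H x * \<phi> x + cnj (ift ?H x * cnj (\<phi> x))) / 2)"
      unfolding distr_of_def[of g \<phi>] eq ..
    also have "\<dots> = ((LBINT x. ift ?H x * \<phi> x) + (LBINT x. cnj (ift ?H x * cnj (\<phi> x)))) / 2"
      unfolding integral_divide_zero
      by (subst integral_add[OF i1 integrable_cnj[OF i2]]) simp
    also have "\<dots> = distr_deriv (distr_of v) \<phi>"
      unfolding integral_cnj T[OF \<phi>] T[OF \<phi>c] cnj by simp
    finally show ?thesis .
  qed
  have ex: "\<exists>g. g \<in> L2_fun \<and> (\<forall>\<phi>\<in>schwartz. distr_of g \<phi> = distr_deriv (distr_of v) \<phi>)"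
    using g gT by blast
  have r: "weak_deriv v \<in> L2_fun \<and> (\<forall>\<phi>\<in>schwartz. distr_of (weak_deriv v) \<phi> = distr_deriv (distr_of v) \<phi>)"
    unfolding weak_deriv_def by (rule someI_ex[OF ex])
  then show "weak_deriv v \<in> L2_fun" by blast
  show "distr_of (weak_deriv v) \<phi> = distr_deriv (distr_of v) \<phi>" if "\<phi> \<in> schwartz"
    using r that by blast
qed

lemma weak_deriv_sobolev:
  assumes v: "v \<in> sobolev_fun (s + 1)" and s: "s > 1/2"
  shows "weak_deriv v \<in> sobolev_fun s"
    and "sobolev_norm s (distr_of (weak_deriv v)) \<le> sobolev_norm (s + 1) (distr_of v)"
  using weak_derivative_sobolev[OF v weak_deriv_exists[OF v s]] by auto

lemma weak_deriv_diff_norm: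
  assumes v: "v \<in> sobolev_fun (s + 1)" and w: "w \<in> sobolev_fun (s + 1)" and s: "s > 1/2"
  shows "sobolev_norm s (distr_of (\<lambda>x. weak_deriv v x - weak_deriv w x)) \<le> sobolev_norm (s + 1) (distr_of (\<lambda>x. v x - w x))"
proof (rule weak_derivative_sobolev(2)[OF sobolev_fun_diff[OF v w]])
  note V = weak_deriv_exists[OF v s] and W = weak_deriv_exists[OF w s]
  show "(\<lambda>x. weak_deriv v x - weak_deriv w x) \<in> L2_fun" by (rule L2_fun_diff[OF V(1) W(1)])
  fix \<phi> assume \<phi>: "\<phi> \<in> schwartz"
  show "distr_of (\<lambda>x. weak_deriv v x - weak_deriv w x) \<phi> = distr_deriv (distr_of (\<lambda>x. v x - w x)) \<phi>"
    using distr_of_diff[OF V(1) W(1) \<phi>] V(2)[OF \<phi>] W(2)[OF \<phi>]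
      distr_of_diff[OF sobolev_funD(1)[OF v] sobolev_funD(1)[OF w] schwartz_vector_derivative[OF \<phi>]]
    unfolding distr_deriv_def by simp
qed

section \<open>The duality pairing\<close>

text \<open>The class of functions against which elements of \<open>H^(s-1)\<close> are tested:
  compactly supported, bounded, with L2 modulus of continuity \<open>h^\<sigma>\<close>, i.e. a ball
  of the Besov space with exponents 2 and infinity. One constant \<open>M\<close> serves both
  bounds. Unlike a Sobolev norm of order s, this modulus passes directly through products and
  Lipschitz compositions.\<close>

definition adm :: "real \<Rightarrow> real \<Rightarrow> real \<Rightarrow> (real \<Rightarrow> real) \<Rightarrow> bool" where
  "adm \<sigma> R M f \<longleftrightarrow> f \<in> borel_measurable borel \<and> (\<forall>x. \<bar>f x\<bar> \<le> M) \<and> (\<forall>x. \<bar>x\<bar> > R \<longrightarrow> f x = 0) \<and>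
     (\<forall>h. 0 < h \<and> h \<le> 1 \<longrightarrow> (LBINT x. (f (x + h) - f x)\<^sup>2) \<le> (M * h powr \<sigma>)\<^sup>2)"

lemma admD:
  assumes "adm \<sigma> R M f"
  shows "f \<in> borel_measurable borel" "\<bar>f x\<bar> \<le> M" "\<bar>x\<bar> > R \<Longrightarrow> f x = 0"
    "0 < h \<Longrightarrow> h \<le> 1 \<Longrightarrow> (LBINT x. (f (x + h) - f x)\<^sup>2) \<le> (M * h powr \<sigma>)\<^sup>2" "0 \<le> M"
  using assms unfolding adm_def by (auto intro: order_trans[OF abs_ge_zero])

lemma adm_integrable:
  assumes "adm \<sigma> R M f" shows "integrable lborel f" "integrable lborel (\<lambda>x. (f x)\<^sup>2)"
    "integrable lborel (\<lambda>x. (f (x + h) - f x)\<^sup>2)"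
proof -
  note a = admD[OF assms]
  note [measurable] = a(1)
  show "integrable lborel f"
    by (rule integrable_compact_support[where B=M and R=R]) (use a in auto)
  show f2: "integrable lborel (\<lambda>x. (f x)\<^sup>2)"
    by (rule integrable_compact_support[where B="M\<^sup>2" and R=R]) (use a in \<open>auto simp: abs_le_square_iff[symmetric]\<close>)
  have "integrable lborel (\<lambda>x. (f (x + h))\<^sup>2)"
    using f2 integrable_translate[of "\<lambda>x. (f x)\<^sup>2" h] by simp
  then show "integrable lborel (\<lambda>x. (f (x + h) - f x)\<^sup>2)"
    using f2 by (intro integrable_square_product(3)) measurable
qed

lemma adm_mono:
  assumes "adm \<sigma> R M f" "R \<le> R'" "M \<le> M'" shows "adm \<sigma> R' M' f"
proof -
  note a = admD[OF assms(1)]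
  have "(M * h powr \<sigma>)\<^sup>2 \<le> (M' * h powr \<sigma>)\<^sup>2" for h
    using assms(3) a(5) by (intro power_mono mult_right_mono) auto
  with a assms show ?thesis unfolding adm_def by (meson order_trans le_less_trans)
qed

lemma adm_cmult:
  assumes "adm \<sigma> R M f" shows "adm \<sigma> R (\<bar>c\<bar> * M) (\<lambda>x. c * f x)"
proof -
  note a = admD[OF assms]
  have "(LBINT x. (c * f (x + h) - c * f x)\<^sup>2) \<le> (\<bar>c\<bar> * M * h powr \<sigma>)\<^sup>2" if "0 < h" "h \<le> 1" for h
  proof -
    have "(LBINT x. (c * f (x + h) - c * f x)\<^sup>2) = c\<^sup>2 * (LBINT x. (f (x + h) - f x)\<^sup>2)"
      by (simp only: right_diff_distrib[symmetric] power_mult_distrib integral_mult_right_zero)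
    also have "\<dots> \<le> c\<^sup>2 * (M * h powr \<sigma>)\<^sup>2" by (intro mult_left_mono a that) simp
    finally show ?thesis by (simp add: power_mult_distrib mult.assoc)
  qed
  with a(1,2,3) show ?thesis unfolding adm_def by (auto simp: abs_mult mult_left_mono)
qed

lemma square_diff_le: "(a - b)\<^sup>2 \<le> 2 * a\<^sup>2 + 2 * (b::real)\<^sup>2"
  using zero_le_power2[of "a + b"] by (simp add: power2_sum power2_diff)

lemma square_sum_le: "(a + b)\<^sup>2 \<le> 2 * a\<^sup>2 + 2 * (b::real)\<^sup>2"
  using zero_le_power2[of "a - b"] by (simp add: power2_sum power2_diff)

lemma adm_diff:
  assumes f: "adm \<sigma> R M f" and g: "adm \<sigma> R M' g"
  shows "adm \<sigma> R (2 * (M + M')) (\<lambda>x. f x - g x)"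
proof -
  note F = admD[OF f] and G = admD[OF g]
  note [measurable] = F(1) G(1)
  have "(LBINT x. ((f (x + h) - g (x + h)) - (f x - g x))\<^sup>2) \<le> (2 * (M + M') * h powr \<sigma>)\<^sup>2" if h: "0 < h" "h \<le> 1" for h
  proof -
    note i = adm_integrable(3)[OF f, of h] adm_integrable(3)[OF g, of h]
    have "(LBINT x. ((f (x + h) - g (x + h)) - (f x - g x))\<^sup>2)
      \<le> (LBINT x. 2 * (f (x + h) - f x)\<^sup>2 + 2 * (g (x + h) - g x)\<^sup>2)"
    proof (rule integral_mono')
      fix x
      have "((f (x + h) - g (x + h)) - (f x - g x))\<^sup>2 = ((f (x + h) - f x) - (g (x + h) - g x))\<^sup>2"
        by (simp add: algebra_simps)
      then show "((f (x + h) - g (x + h)) - (f x - g x))\<^sup>2 \<le> 2 * (f (x + h) - f x)\<^sup>2 + 2 * (g (x + h) - g x)\<^sup>2"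
        using square_diff_le[of "f (x + h) - f x" "g (x + h) - g x"] by simp
    qed (use i in auto)
    also have "\<dots> \<le> 2 * (M * h powr \<sigma>)\<^sup>2 + 2 * (M' * h powr \<sigma>)\<^sup>2"
      using i F(4)[OF h] G(4)[OF h] by simp
    also have "\<dots> \<le> (2 * (M + M') * h powr \<sigma>)\<^sup>2"
    proof -
      have "2 * M\<^sup>2 + 2 * M'\<^sup>2 \<le> (2 * (M + M'))\<^sup>2"
        using F(5) G(5) by (simp add: power2_eq_square algebra_simps)
      from mult_right_mono[OF this, of "(h powr \<sigma>)\<^sup>2"]
      have "(2 * M\<^sup>2 + 2 * M'\<^sup>2) * (h powr \<sigma>)\<^sup>2 \<le> (2 * (M + M') * h powr \<sigma>)\<^sup>2"
        unfolding power_mult_distrib[of "2 * (M + M')"] by simp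
      then show ?thesis by (simp only: power_mult_distrib distrib_right mult.assoc)
    qed
    finally show ?thesis .
  qed
  moreover have "\<bar>f x - g x\<bar> \<le> 2 * (M + M')" for x
  proof -
    have "\<bar>f x\<bar> + \<bar>g x\<bar> \<le> M + M'" by (intro add_mono F(2) G(2))
    moreover have "M + M' \<le> 2 * (M + M')" using F(5) G(5) by simp
    ultimately show ?thesis by (rule order_trans[OF abs_triangle_ineq4 order_trans])
  qed
  ultimately show ?thesis unfolding adm_def using F(3) G(3) by auto
qed

section \<open>The \<open>H^(1/2)\<close> bound for admissible functions\<close>

lemma interpolate:
  fixes w a b :: real
  assumes "0 \<le> w" "w \<le> a" "w \<le> b" "0 \<le> \<theta>" "\<theta> \<le> 1"
  shows "w \<le> a powr (1 - \<theta>) * b powr \<theta>"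
proof (cases "w = 0")
  case False
  then have "w = w powr (1 - \<theta>) * w powr \<theta>" using assms by (simp flip: powr_add)
  also have "\<dots> \<le> a powr (1 - \<theta>) * b powr \<theta>"
    using assms by (intro mult_mono powr_mono2) auto
  finally show ?thesis .
qed simp

text \<open>The squared L2 increment is at most \<open>(M h^\<sigma>)^2\<close> and at most
  \<open>4 \<eta>^2\<close>. Interpolating with weight 1/2 - 1/(4 \<sigma>) on the second bound
  leaves the power \<sigma> + 1/2 of \<open>h\<close>, halfway between 1 and 2 \<sigma>: large
  enough for integrability against \<open>h^(-2)\<close> at 0, while a positive power of \<eta> is
  retained.\<close>

definition Aint :: "real \<Rightarrow> real \<Rightarrow> real \<Rightarrow> real" where
  "Aint \<sigma> M \<eta> = (M\<^sup>2) powr (1/2 + 1 / (4 * \<sigma>)) * (4 * \<eta>\<^sup>2) powr (1/2 - 1 / (4 * \<sigma>))"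

text \<open>A bound for the \<open>H^(1/2)\<close> norm on the frequency side. The term 4 pi is
  twice the Plancherel factor 2 pi; 64 pi is that factor times the 32 of
  \<open>kernel_lower_bound\<close>; 1 / (\<sigma> - 1/2) is the integral of
  \<open>h^(\<sigma> - 3/2)\<close> over [0, 1]. The point is that it tends to 0 with the L2 norm
  \<eta> while \<open>M\<close> stays fixed.\<close>

definition Qb :: "real \<Rightarrow> real \<Rightarrow> real \<Rightarrow> real" where
  "Qb \<sigma> M \<eta> = sqrt (4 * pi * \<eta>\<^sup>2 + 64 * pi * (Aint \<sigma> M \<eta> / (\<sigma> - 1/2)))"

lemma Qb_nonneg: "\<sigma> > 1/2 \<Longrightarrow> 0 \<le> Qb \<sigma> M \<eta>"
  unfolding Qb_def Aint_def by simp

lemma Qb_tendsto_0: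
  assumes "\<sigma> > 1/2" "(\<eta> \<longlongrightarrow> 0) F" shows "((\<lambda>t. Qb \<sigma> M (\<eta> t)) \<longlongrightarrow> 0) F"
proof -
  have p: "0 < 1/2 - 1 / (4 * \<sigma>)" using assms(1) by (simp add: field_simps)
  have "((\<lambda>t. 4 * (\<eta> t)\<^sup>2) \<longlongrightarrow> 4 * 0\<^sup>2) F"
    by (intro tendsto_intros assms)
  then have "((\<lambda>t. (4 * (\<eta> t)\<^sup>2) powr (1/2 - 1 / (4 * \<sigma>))) \<longlongrightarrow> 0) F"
    by (intro tendsto_zero_powrI[where b="1/2 - 1 / (4 * \<sigma>)"]) (use p in auto)
  then have "((\<lambda>t. Qb \<sigma> M (\<eta> t)) \<longlongrightarrow> sqrt (4 * pi * 0\<^sup>2 + 64 * pi * (((M\<^sup>2) powr (1/2 + 1 / (4 * \<sigma>)) * 0) / (\<sigma> - 1/2)))) F"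
    unfolding Qb_def Aint_def using assms by (intro tendsto_intros) auto
  then show ?thesis by simp
qed

lemma adm_modulus_interpolated:
  assumes f: "adm \<sigma> R M f" and \<sigma>: "1/2 < \<sigma>" "\<sigma> \<le> 1" and \<eta>: "(LBINT x. (f x)\<^sup>2) \<le> \<eta>\<^sup>2" and h: "0 < h" "h \<le> 1"
  shows "(LBINT x. (f (x + h) - f x)\<^sup>2) \<le> Aint \<sigma> M \<eta> * h powr (\<sigma> + 1/2)"
proof -
  let ?w = "LBINT x. (f (x + h) - f x)\<^sup>2" and ?\<theta> = "1/2 - 1 / (4 * \<sigma>)"
  note i = adm_integrable[OF f]
  have i2: "integrable lborel (\<lambda>x. (f (x + h))\<^sup>2)"
    using i(2) integrable_translate[of "\<lambda>x. (f x)\<^sup>2" h] by simp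
  have "?w \<le> (LBINT x. 2 * (f (x + h))\<^sup>2 + 2 * (f x)\<^sup>2)"
    by (rule integral_mono') (use i i2 square_diff_le in auto)
  also have "\<dots> = 4 * (LBINT x. (f x)\<^sup>2)"
    using i(2) i2 integral_translate[of "\<lambda>x. (f x)\<^sup>2" h] by simp
  finally have w2: "?w \<le> 4 * \<eta>\<^sup>2" using \<eta> by simp
  have \<theta>: "0 \<le> ?\<theta>" "?\<theta> \<le> 1" using \<sigma> by (auto simp: field_simps)
  have "?w \<le> ((M * h powr \<sigma>)\<^sup>2) powr (1 - ?\<theta>) * (4 * \<eta>\<^sup>2) powr ?\<theta>"
    by (rule interpolate[OF _ admD(4)[OF f h] w2 \<theta>]) simp
  also have "((M * h powr \<sigma>)\<^sup>2) powr (1 - ?\<theta>) = (M\<^sup>2) powr (1/2 + 1 / (4 * \<sigma>)) * h powr (\<sigma> + 1/2)"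
  proof -
    have "((M * h powr \<sigma>)\<^sup>2) powr (1 - ?\<theta>) = (M\<^sup>2) powr (1 - ?\<theta>) * (h powr (2 * \<sigma>)) powr (1 - ?\<theta>)"
      using h by (simp add: power_mult_distrib powr_mult powr_power)
    also have "(h powr (2 * \<sigma>)) powr (1 - ?\<theta>) = h powr (\<sigma> + 1/2)"
    proof -
      have "\<sigma> * (1 / (4 * \<sigma>)) = 1/4" using \<sigma> by simp
      moreover have "2 * \<sigma> * (1 - (1/2 - y)) = \<sigma> + 2 * (\<sigma> * y)" for y by (simp add: algebra_simps)
      ultimately have "2 * \<sigma> * (1 - ?\<theta>) = \<sigma> + 1/2" by (simp only:)
      then show ?thesis unfolding powr_powr by (simp only:)
    qed
    finally show ?thesis by simp
  qed
  finally show ?thesis unfolding Aint_def by (simp add: mult_ac)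
qed

text \<open>Compares |w| with the symbol of the difference-quotient seminorm of
  \<open>H^(1/2)\<close>. For |w| > 1 the window 1/(2|w|) <= h <= 1/|w| suffices: there |cis (h w) -
  1| >= |h w| / 2, so the integrand is at least w^2 / 16, and the window has length 1/(2|w|). Hence
  the factor 32.\<close>

lemma kernel_lower_bound:
  "ennreal \<bar>w\<bar> \<le> 1 + 32 * (\<integral>\<^sup>+h. ennreal (indicator {0<..1} h * ((cmod (cis (h * w) - 1))\<^sup>2 / h\<^sup>2)) \<partial>lborel)"
proof (cases "\<bar>w\<bar> \<le> 1")
  case True
  then have "ennreal \<bar>w\<bar> \<le> 1" by simp
  then show ?thesis by (rule order_trans) simp
next
  case False
  then have w: "\<bar>w\<bar> > 1" by simp
  let ?a = "1 / (2 * \<bar>w\<bar>)" and ?b = "1 / \<bar>w\<bar>"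
  have ab: "?a \<le> ?b" "0 < ?a" "?b \<le> 1" using w by (auto simp: field_simps)
  have "ennreal (\<bar>w\<bar> / 32) = (\<integral>\<^sup>+h. ennreal (w\<^sup>2 / 16) * indicator {?a..?b} h \<partial>lborel)"
  proof -
    have *: "z\<^sup>2 / 16 * (1 / z - 1 / (2 * z)) = z / 32" if "z > 0" for z :: real
      using that by (simp add: power2_eq_square field_simps)
    have "w\<^sup>2 / 16 * (?b - ?a) = \<bar>w\<bar> / 32" using *[of "\<bar>w\<bar>"] w by simp
    moreover have "(\<integral>\<^sup>+h. ennreal (w\<^sup>2 / 16) * indicator {?a..?b} h \<partial>lborel) = ennreal (w\<^sup>2 / 16) * ennreal (?b - ?a)"
      by (subst nn_integral_cmult_indicator, simp, subst emeasure_lborel_Icc[OF ab(1)], rule refl)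
    ultimately show ?thesis
      using ab(1) by (metis ennreal_mult diff_ge_0_iff_ge zero_le_power2 divide_nonneg_nonneg zero_le_numeral)
  qed
  also have "\<dots> \<le> (\<integral>\<^sup>+h. ennreal (indicator {0<..1} h * ((cmod (cis (h * w) - 1))\<^sup>2 / h\<^sup>2)) \<partial>lborel)"
  proof (rule nn_integral_mono)
    fix h
    show "ennreal (w\<^sup>2 / 16) * indicator {?a..?b} h \<le> ennreal (indicator {0<..1} h * ((cmod (cis (h * w) - 1))\<^sup>2 / h\<^sup>2))"
    proof (cases "h \<in> {?a..?b}")
      case True
      then have "?a \<le> h" "h \<le> ?b" by simp_all
      with ab have h: "0 < h" "h \<le> 1" by linarith+
      define \<theta> where "\<theta> = h * \<bar>w\<bar>"
      have \<theta>: "1/2 \<le> \<theta>" "\<theta> \<le> 1" using True w by (auto simp: \<theta>_def field_simps)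
      have "\<theta> / 2 \<le> cmod (cis (h * w) - 1)"
      proof -
        have "\<theta>\<^sup>2 \<le> \<theta>" using \<theta> by (simp add: power2_eq_square mult_left_le)
        then have "\<theta> / 2 \<le> \<bar>h * w\<bar> - (h * w)\<^sup>2 / 2"
          using h by (simp add: \<theta>_def abs_mult power_mult_distrib)
        with norm_cis_minus_1_ge[of "h * w"] show ?thesis by linarith
      qed
      then have "(\<theta> / 2)\<^sup>2 \<le> (cmod (cis (h * w) - 1))\<^sup>2"
        using \<theta> by (intro power_mono) auto
      moreover have "w\<^sup>2 / 16 * h\<^sup>2 \<le> (\<theta> / 2)\<^sup>2"
        unfolding \<theta>_def by (simp add: power_divide power_mult_distrib)
      ultimately have "w\<^sup>2 / 16 \<le> (cmod (cis (h * w) - 1))\<^sup>2 / h\<^sup>2"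
        using h by (simp add: pos_le_divide_eq)
      with True h show ?thesis by (simp add: ennreal_leI)
    qed simp
  qed
  finally have le: "ennreal (\<bar>w\<bar> / 32) \<le> (\<integral>\<^sup>+h. ennreal (indicator {0<..1} h * ((cmod (cis (h * w) - 1))\<^sup>2 / h\<^sup>2)) \<partial>lborel)" .
  have "ennreal \<bar>w\<bar> = 32 * ennreal (\<bar>w\<bar> / 32)"
    by (simp flip: ennreal_numeral ennreal_mult)
  also have "\<dots> \<le> 1 + 32 * (\<integral>\<^sup>+h. ennreal (indicator {0<..1} h * ((cmod (cis (h * w) - 1))\<^sup>2 / h\<^sup>2)) \<partial>lborel)"
    by (rule order_trans[OF mult_left_mono[OF le]]) simp_all
  finally show ?thesis .
qed

text \<open>The weight (1 + u^2)^(1/2) is at most 1 + |u|, and |u| is replaced by the integral of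
  \<open>kernel_lower_bound\<close>. After exchanging the integrals, Plancherel turns the inner one
  into a squared L2 increment for each fixed \<open>h\<close>, to which the interpolated modulus
  applies.\<close>

lemma adm_fourier:
  assumes f: "adm \<sigma> R M f" and \<sigma>: "1/2 < \<sigma>" "\<sigma> \<le> 1" and \<eta>: "(LBINT x. (f x)\<^sup>2) \<le> \<eta>\<^sup>2"
  defines "G \<equiv> fourier (\<lambda>x. complex_of_real (f x))"
  shows "integrable lborel (\<lambda>u. (1 + u\<^sup>2) powr (1/2) * (cmod (G u))\<^sup>2)"
    and "(LBINT u. (1 + u\<^sup>2) powr (1/2) * (cmod (G u))\<^sup>2) \<le> (Qb \<sigma> M \<eta>)\<^sup>2"
proof -
  note a = admD[OF f] and i = adm_integrable[OF f]
  note [measurable] = a(1)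
  have [measurable]: "G \<in> borel_measurable borel" unfolding G_def by measurable
  have fc: "integrable lborel (\<lambda>x. complex_of_real (f x))" using i(1) by simp
  have fc2: "integrable lborel (\<lambda>x. (cmod (complex_of_real (f x)))\<^sup>2)" using i(2) by simp
  have P: "(\<integral>\<^sup>+u. ennreal ((cmod (fourier g u))\<^sup>2) \<partial>lborel) \<le> ennreal (2 * pi * (LBINT x. (cmod (g x))\<^sup>2))"
    if "integrable lborel g" "integrable lborel (\<lambda>x. (cmod (g x))\<^sup>2)" for g
    using plancherel_le[OF that] by (subst nn_integral_eq_integral) (auto simp: ennreal_leI)
  have 0: "(\<integral>\<^sup>+u. ennreal ((cmod (G u))\<^sup>2) \<partial>lborel) \<le> ennreal (2 * pi * \<eta>\<^sup>2)"
    using \<eta> unfolding G_def by (intro order_trans[OF P[OF fc fc2]] ennreal_leI) auto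
  have w: "(\<integral>\<^sup>+u. ennreal ((cmod (cis (h * u) - 1))\<^sup>2 * (cmod (G u))\<^sup>2) \<partial>lborel) \<le> ennreal (2 * pi * (Aint \<sigma> M \<eta> * h powr (\<sigma> + 1/2)))"
    if h: "0 < h" "h \<le> 1" for h
  proof -
    let ?d = "\<lambda>x. complex_of_real (f (x + h)) - complex_of_real (f x)"
    have fh: "integrable lborel (\<lambda>x. complex_of_real (f (x + h)))"
      using fc integrable_translate[of "\<lambda>x. complex_of_real (f x)" h] by simp
    have d: "integrable lborel ?d" using fc fh by simp
    have nd: "(cmod (?d x))\<^sup>2 = (f (x + h) - f x)\<^sup>2" for x
      by (simp flip: of_real_diff)
    have "fourier ?d u = (cis (h * u) - 1) * G u" for u
      unfolding fourier_diff[OF fh fc] fourier_translate[of "\<lambda>x. complex_of_real (f x)"] G_def by (simp add: left_diff_distrib)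
    then have "(\<integral>\<^sup>+u. ennreal ((cmod (cis (h * u) - 1))\<^sup>2 * (cmod (G u))\<^sup>2) \<partial>lborel) = (\<integral>\<^sup>+u. ennreal ((cmod (fourier ?d u))\<^sup>2) \<partial>lborel)"
      by (simp add: norm_mult power_mult_distrib)
    also have "\<dots> \<le> ennreal (2 * pi * (LBINT x. (cmod (?d x))\<^sup>2))"
      by (rule P[OF d]) (unfold nd, rule i)
    also have "\<dots> \<le> ennreal (2 * pi * (Aint \<sigma> M \<eta> * h powr (\<sigma> + 1/2)))"
      unfolding nd using adm_modulus_interpolated[OF f \<sigma> \<eta> h] by (intro ennreal_leI mult_left_mono) auto
    finally show ?thesis .
  qed
  have A: "0 \<le> Aint \<sigma> M \<eta>" by (simp add: Aint_def)
  let ?k = "\<lambda>h u. indicator {0<..1} h * ((cmod (cis (h * u) - 1))\<^sup>2 / h\<^sup>2)"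
  have "(\<integral>\<^sup>+u. ennreal ((cmod (G u))\<^sup>2) * (\<integral>\<^sup>+h. ennreal (?k h u) \<partial>lborel) \<partial>lborel)
      = (\<integral>\<^sup>+u. \<integral>\<^sup>+h. ennreal ((cmod (G u))\<^sup>2) * ennreal (?k h u) \<partial>lborel \<partial>lborel)"
    by (intro nn_integral_cong nn_integral_cmult[symmetric]) measurable
  also have "\<dots> = (\<integral>\<^sup>+h. \<integral>\<^sup>+u. ennreal ((cmod (G u))\<^sup>2) * ennreal (?k h u) \<partial>lborel \<partial>lborel)"
    by (rule lborel_pair.Fubini') measurable
  also have "\<dots> \<le> (\<integral>\<^sup>+h. ennreal (2 * pi * Aint \<sigma> M \<eta>) * (ennreal (h powr (\<sigma> - 3/2)) * indicator {0..1} h) \<partial>lborel)"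
  proof (rule nn_integral_mono)
    fix h :: real
    show "(\<integral>\<^sup>+u. ennreal ((cmod (G u))\<^sup>2) * ennreal (?k h u) \<partial>lborel)
      \<le> ennreal (2 * pi * Aint \<sigma> M \<eta>) * (ennreal (h powr (\<sigma> - 3/2)) * indicator {0..1} h)"
    proof (cases "h \<in> {0<..1}")
      case True
      then have h: "0 < h" "h \<le> 1" by auto
      have "(\<integral>\<^sup>+u. ennreal ((cmod (G u))\<^sup>2) * ennreal (?k h u) \<partial>lborel)
        = (\<integral>\<^sup>+u. ennreal (1 / h\<^sup>2) * ennreal ((cmod (cis (h * u) - 1))\<^sup>2 * (cmod (G u))\<^sup>2) \<partial>lborel)"
        using h by (intro nn_integral_cong) (simp add: mult_ac flip: ennreal_mult)
      also have "\<dots> = ennreal (1 / h\<^sup>2) * (\<integral>\<^sup>+u. ennreal ((cmod (cis (h * u) - 1))\<^sup>2 * (cmod (G u))\<^sup>2) \<partial>lborel)"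
        by (rule nn_integral_cmult) measurable
      also have "\<dots> \<le> ennreal (1 / h\<^sup>2) * ennreal (2 * pi * (Aint \<sigma> M \<eta> * h powr (\<sigma> + 1/2)))"
        by (intro mult_left_mono w h) simp
      also have "\<dots> = ennreal (2 * pi * Aint \<sigma> M \<eta> * h powr (\<sigma> - 3/2))"
      proof -
        have "h powr (\<sigma> - 3/2) = h powr (\<sigma> + 1/2) / h powr 2"
          by (simp flip: powr_diff)
        also have "h powr 2 = h\<^sup>2" using h by simp
        finally have "h powr (\<sigma> - 3/2) = h powr (\<sigma> + 1/2) / h\<^sup>2" .
        then show ?thesis using A by (simp flip: ennreal_mult)
      qed
      finally show ?thesis using h A by (simp add: ennreal_mult)
    qed (auto simp: indicator_def)
  qed
  also have "\<dots> = ennreal (2 * pi * Aint \<sigma> M \<eta>) * (\<integral>\<^sup>+h. ennreal (h powr (\<sigma> - 3/2)) * indicator {0..1} h \<partial>lborel)"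
    by (rule nn_integral_cmult) measurable
  also have "(\<integral>\<^sup>+h. ennreal (h powr (\<sigma> - 3/2)) * indicator {0..1} h \<partial>lborel) = ennreal (1 / (\<sigma> - 1/2))"
  proof -
    have "((\<lambda>h. h powr (\<sigma> - 3/2)) has_integral (1 powr (\<sigma> - 3/2 + 1) / (\<sigma> - 3/2 + 1))) {0..1}"
      by (rule has_integral_powr_from_0) (use \<sigma> in auto)
    then have "((\<lambda>h. h powr (\<sigma> - 3/2)) has_integral (1 / (\<sigma> - 1/2))) {0..1}" by simp
    from nn_integral_has_integral_lebesgue[OF _ this] show ?thesis
      by (simp add: nn_integral_completion mult.commute ennreal_indicator[symmetric] ennreal_mult[symmetric] indicator_times_eq_if)
  qed
  finally have K: "(\<integral>\<^sup>+u. ennreal ((cmod (G u))\<^sup>2) * (\<integral>\<^sup>+h. ennreal (?k h u) \<partial>lborel) \<partial>lborel)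
    \<le> ennreal (2 * pi * (Aint \<sigma> M \<eta> / (\<sigma> - 1/2)))"
    using A \<sigma> by (simp flip: ennreal_mult)
  have "(\<integral>\<^sup>+u. ennreal ((1 + u\<^sup>2) powr (1/2) * (cmod (G u))\<^sup>2) \<partial>lborel)
    \<le> (\<integral>\<^sup>+u. 2 * ennreal ((cmod (G u))\<^sup>2) + 32 * (ennreal ((cmod (G u))\<^sup>2) * (\<integral>\<^sup>+h. ennreal (?k h u) \<partial>lborel)) \<partial>lborel)"
  proof (rule nn_integral_mono)
    fix u :: real
    have "(1 + u\<^sup>2) powr (1/2) \<le> 1 + \<bar>u\<bar>"
      unfolding powr_half_sqrt[OF less_imp_le[OF weight_pos]] by (rule real_le_lsqrt) (auto simp: power2_sum)
    then have "ennreal ((1 + u\<^sup>2) powr (1/2)) \<le> ennreal (1 + \<bar>u\<bar>)" by (rule ennreal_leI)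
    also have "\<dots> = 1 + ennreal \<bar>u\<bar>" by (subst ennreal_plus) auto
    also have "\<dots> \<le> 1 + (1 + 32 * (\<integral>\<^sup>+h. ennreal (?k h u) \<partial>lborel))"
      by (intro add_left_mono kernel_lower_bound)
    also have "1 + (1 + y) = 2 + y" for y :: ennreal by (simp add: add.assoc[symmetric])
    finally have "ennreal ((1 + u\<^sup>2) powr (1/2)) \<le> 2 + 32 * (\<integral>\<^sup>+h. ennreal (?k h u) \<partial>lborel)" .
    then have "ennreal ((1 + u\<^sup>2) powr (1/2)) * ennreal ((cmod (G u))\<^sup>2) \<le> (2 + 32 * (\<integral>\<^sup>+h. ennreal (?k h u) \<partial>lborel)) * ennreal ((cmod (G u))\<^sup>2)"
      by (rule mult_right_mono) simp
    moreover have "(2 + 32 * K) * g = 2 * g + 32 * (g * K)" for K g :: ennreal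
      by (simp only: distrib_right mult.assoc mult.commute[of K g])
    ultimately show "ennreal ((1 + u\<^sup>2) powr (1/2) * (cmod (G u))\<^sup>2) \<le> 2 * ennreal ((cmod (G u))\<^sup>2) + 32 * (ennreal ((cmod (G u))\<^sup>2) * (\<integral>\<^sup>+h. ennreal (?k h u) \<partial>lborel))"
      by (simp only: ennreal_mult powr_ge_zero zero_le_power2)
  qed
  also have "\<dots> = 2 * (\<integral>\<^sup>+u. ennreal ((cmod (G u))\<^sup>2) \<partial>lborel) + 32 * (\<integral>\<^sup>+u. ennreal ((cmod (G u))\<^sup>2) * (\<integral>\<^sup>+h. ennreal (?k h u) \<partial>lborel) \<partial>lborel)"
    by (subst nn_integral_add) (auto simp: nn_integral_cmult)
  also have "\<dots> \<le> 2 * ennreal (2 * pi * \<eta>\<^sup>2) + 32 * ennreal (2 * pi * (Aint \<sigma> M \<eta> / (\<sigma> - 1/2)))"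
    by (intro add_mono mult_left_mono 0 K) simp_all
  also have "\<dots> = ennreal (4 * pi * \<eta>\<^sup>2 + 64 * pi * (Aint \<sigma> M \<eta> / (\<sigma> - 1/2)))"
    using A \<sigma> by (simp flip: ennreal_numeral ennreal_mult ennreal_plus)
  also have "\<dots> = ennreal ((Qb \<sigma> M \<eta>)\<^sup>2)"
    unfolding Qb_def using A \<sigma> by (subst real_sqrt_pow2) auto
  finally have Q: "(\<integral>\<^sup>+u. ennreal ((1 + u\<^sup>2) powr (1/2) * (cmod (G u))\<^sup>2) \<partial>lborel) \<le> ennreal ((Qb \<sigma> M \<eta>)\<^sup>2)" .
  then show int: "integrable lborel (\<lambda>u. (1 + u\<^sup>2) powr (1/2) * (cmod (G u))\<^sup>2)"
    by (intro integrableI_bounded) (auto intro: le_less_trans)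
  have "ennreal (LBINT u. (1 + u\<^sup>2) powr (1/2) * (cmod (G u))\<^sup>2) \<le> ennreal ((Qb \<sigma> M \<eta>)\<^sup>2)"
    using Q int by (subst nn_integral_eq_integral[symmetric]) auto
  then show "(LBINT u. (1 + u\<^sup>2) powr (1/2) * (cmod (G u))\<^sup>2) \<le> (Qb \<sigma> M \<eta>)\<^sup>2"
    by (subst (asm) ennreal_le_iff) auto
qed

section \<open>Distributions of order s - 1 as functionals on admissible functions\<close>

definition pairing :: "distr \<Rightarrow> (real \<Rightarrow> real) \<Rightarrow> complex" where
  "pairing T f = (LBINT w. fourier_distr T w * fourier (\<lambda>x. complex_of_real (f x)) (- w)) / complex_of_real (2 * pi)"

lemma distr_mult_pairing: "distr_mult a T (\<lambda>x. complex_of_real (\<psi> x)) = pairing T (\<lambda>x. a x * \<psi> x)"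
  unfolding distr_mult_def pairing_def by simp

lemma pairing_cong_AE:
  assumes "AE x in lborel. f x = g x" "f \<in> borel_measurable borel" "g \<in> borel_measurable borel"
  shows "pairing T f = pairing T g"
proof -
  have "fourier (\<lambda>x. complex_of_real (f x)) = fourier (\<lambda>x. complex_of_real (g x))"
    unfolding fourier_def using assms by (intro ext integral_cong_AE) (auto elim: eventually_mono)
  then show ?thesis unfolding pairing_def by simp
qed

lemma pairing_schwartz:
  assumes "T \<in> sobolev \<sigma>" "test1 \<psi>"
  shows "pairing T \<psi> = T (\<lambda>x. complex_of_real (\<psi> x))"
  unfolding pairing_def using is_fourier_apply(1)[OF sobolevD(1)[OF assms(1)] test1_schwartz[OF assms(2)]] by simp

text \<open>Abstracts from \<open>pairing T\<close> what the time integration uses. The last clause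
  is a continuity property: on admissible functions with a common \<open>M\<close>, L2 convergence
  forces convergence of the values. The bound does not involve the support radius.\<close>

definition dual_fun :: "real \<Rightarrow> real \<Rightarrow> ((real \<Rightarrow> real) \<Rightarrow> complex) \<Rightarrow> bool" where
  "dual_fun \<sigma> c L \<longleftrightarrow>
    (\<forall>R M f g. adm \<sigma> R M f \<longrightarrow> adm \<sigma> R M g \<longrightarrow> L (\<lambda>x. f x - g x) = L f - L g) \<and>
    (\<forall>a f. L (\<lambda>x. a * f x) = complex_of_real a * L f) \<and>
    (\<forall>R M \<eta> f. adm \<sigma> R M f \<longrightarrow> (LBINT x. (f x)\<^sup>2) \<le> \<eta>\<^sup>2 \<longrightarrow> cmod (L f) \<le> c * Qb \<sigma> M \<eta>)"

text \<open>Since s - 1 >= -1/2, the transform of \<open>T\<close> is square integrable with weight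
  (1 + w^2)^(-1/2), which is dual to the weight in \<open>adm_fourier\<close>. The remaining factor
  sqrt (2 pi) / (2 pi) is at most 1 and is dropped.\<close>

lemma pairing_integrable:
  assumes T: "T \<in> sobolev (s - 1)" and s: "s > 1/2" and f: "adm \<sigma> R M f" and \<sigma>: "1/2 < \<sigma>" "\<sigma> \<le> 1"
  shows "integrable lborel (\<lambda>w. fourier_distr T w * fourier (\<lambda>x. complex_of_real (f x)) (- w))"
    and "(LBINT x. (f x)\<^sup>2) \<le> \<eta>\<^sup>2 \<Longrightarrow> cmod (pairing T f) \<le> sobolev_norm (s - 1) T * Qb \<sigma> M \<eta>"
proof -
  note [measurable] = admD(1)[OF f] is_fourier_measurable[OF sobolevD(1)[OF T]]
  let ?F = "fourier_distr T" and ?G = "fourier (\<lambda>x. complex_of_real (f x))"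
  have G: "integrable lborel (\<lambda>w. (1 + w\<^sup>2) powr (1/2) * (cmod (?G (- w)))\<^sup>2)"
    "(LBINT w. (1 + w\<^sup>2) powr (1/2) * (cmod (?G (- w)))\<^sup>2) \<le> (Qb \<sigma> M \<eta>)\<^sup>2"
    if "(LBINT x. (f x)\<^sup>2) \<le> \<eta>\<^sup>2" for \<eta>
    using adm_fourier[OF f \<sigma> that]
      integrable_reflect[of "\<lambda>w. (1 + w\<^sup>2) powr (1/2) * (cmod (?G w))\<^sup>2" 0]
      integral_reflect[of "\<lambda>w. (1 + w\<^sup>2) powr (1/2) * (cmod (?G w))\<^sup>2" 0] by simp_all
  have le: "(1 + w\<^sup>2) powr (- (1/2)) * (cmod (?F w))\<^sup>2 \<le> (1 + w\<^sup>2) powr (s - 1) * (cmod (?F w))\<^sup>2" for w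
    using s by (intro mult_right_mono powr_mono) auto
  have F: "integrable lborel (\<lambda>w. (1 + w\<^sup>2) powr (- (1/2)) * (cmod (?F w))\<^sup>2)"
    by (rule integrable_bound[OF sobolevD(2)[OF T]]) (measurable, use le in \<open>auto intro!: AE_I2\<close>)
  have Fle: "(LBINT w. (1 + w\<^sup>2) powr (- (1/2)) * (cmod (?F w))\<^sup>2) \<le> 2 * pi * (sobolev_norm (s - 1) T)\<^sup>2"
    unfolding sobolev_norm_square using integral_mono[OF F sobolevD(2)[OF T] le] by simp
  have L2: "(LBINT x. (f x)\<^sup>2) \<le> (sqrt (LBINT x. (f x)\<^sup>2))\<^sup>2" by simp
  have m: "?F \<in> borel_measurable borel" "(\<lambda>w. ?G (- w)) \<in> borel_measurable borel" by measurable
  show i: "integrable lborel (\<lambda>w. ?F w * ?G (- w))"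
    by (rule weighted_product(1)[OF m F G(1)[OF L2]])
  assume \<eta>: "(LBINT x. (f x)\<^sup>2) \<le> \<eta>\<^sup>2"
  have "cmod (pairing T f) \<le> (LBINT w. cmod (?F w * ?G (- w))) / (2 * pi)"
    unfolding pairing_def norm_divide using integral_norm_bound[of lborel "\<lambda>w. ?F w * ?G (- w)"] by (simp add: divide_right_mono)
  also have "\<dots> \<le> (sqrt (2 * pi * (sobolev_norm (s - 1) T)\<^sup>2) * sqrt ((Qb \<sigma> M \<eta>)\<^sup>2)) / (2 * pi)"
    using Fle G(2)[OF \<eta>] by (intro divide_right_mono order_trans[OF weighted_product(2)[OF m F G(1)[OF L2]]] mult_mono real_sqrt_le_mono) auto
  also have "\<dots> = sobolev_norm (s - 1) T * Qb \<sigma> M \<eta> * (sqrt (2 * pi) / (2 * pi))"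
    using Qb_nonneg[OF \<sigma>(1)] sobolev_norm_nonneg by (simp add: real_sqrt_mult)
  also have "\<dots> \<le> sobolev_norm (s - 1) T * Qb \<sigma> M \<eta> * 1"
  proof (intro mult_left_mono mult_nonneg_nonneg Qb_nonneg \<sigma> sobolev_norm_nonneg)
    have "sqrt (2 * pi) \<le> 2 * pi"
      using pi_gt3 by (intro real_le_lsqrt) (auto simp: power2_eq_square)
    then show "sqrt (2 * pi) / (2 * pi) \<le> 1" by simp
  qed
  finally show "cmod (pairing T f) \<le> sobolev_norm (s - 1) T * Qb \<sigma> M \<eta>" by simp
qed

lemma pairing_dual_fun:
  assumes T: "T \<in> sobolev (s - 1)" and s: "s > 1/2" and \<sigma>: "1/2 < \<sigma>" "\<sigma> \<le> 1"
  shows "dual_fun \<sigma> (sobolev_norm (s - 1) T) (pairing T)"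
  unfolding dual_fun_def
proof (intro conjI allI impI)
  fix R M f g assume f: "adm \<sigma> R M f" and g: "adm \<sigma> R M g"
  note fi = adm_integrable(1)[OF f] and gi = adm_integrable(1)[OF g]
  have e: "fourier (\<lambda>x. complex_of_real (f x - g x)) w = fourier (\<lambda>x. complex_of_real (f x)) w - fourier (\<lambda>x. complex_of_real (g x)) w" for w
    unfolding of_real_diff by (rule fourier_diff) (use fi gi in auto)
  show "pairing T (\<lambda>x. f x - g x) = pairing T f - pairing T g"
    unfolding pairing_def e right_diff_distrib
      integral_diff[OF pairing_integrable(1)[OF T s f \<sigma>] pairing_integrable(1)[OF T s g \<sigma>]]
    by (rule diff_divide_distrib)
next
  fix a f
  have "fourier (\<lambda>x. complex_of_real (a * f x)) w = complex_of_real a * fourier (\<lambda>x. complex_of_real (f x)) w" for w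
    unfolding of_real_mult by (rule fourier_cmult)
  then show "pairing T (\<lambda>x. a * f x) = complex_of_real a * pairing T f"
    unfolding pairing_def by (simp add: mult.left_commute[of _ "complex_of_real a"])
next
  fix R M \<eta> f assume f: "adm \<sigma> R M f" and "(LBINT x. (f x)\<^sup>2) \<le> \<eta>\<^sup>2"
  then show "cmod (pairing T f) \<le> sobolev_norm (s - 1) T * Qb \<sigma> M \<eta>"
    using pairing_integrable(2)[OF T s f \<sigma>] by blast
qed

text \<open>The limit statement ties the distributional derivative to pointwise values of
  \<open>rep g\<close>. On the frequency side the quotients are dominated by
  \<open>|w F(w) G(-w)|\<close>, because |cis (h w) - 1| <= |h w|, and this majorant is integrable
  by the duality itself.\<close>

lemma derivative_pairing:
  assumes g: "g \<in> sobolev_fun s" and s: "s > 1/2"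
  shows "distr_deriv (distr_of g) \<in> sobolev (s - 1)"
    and "sobolev_norm (s - 1) (distr_deriv (distr_of g)) \<le> sobolev_norm s (distr_of g)"
    and "\<lbrakk>adm \<sigma> R M f; 1/2 < \<sigma>; \<sigma> \<le> 1; \<And>n. X n \<noteq> 0; X \<longlonglongrightarrow> 0\<rbrakk> \<Longrightarrow>
      (\<lambda>n. complex_of_real ((LBINT x. (rep g (x + X n) - rep g x) * f x) / X n)) \<longlonglongrightarrow> pairing (distr_deriv (distr_of g)) f"
proof -
  let ?F = "fourier_distr (distr_of g)" and ?T = "distr_deriv (distr_of g)"
  let ?H = "\<lambda>w. \<i> * complex_of_real w * ?F w"
  note V = sobolev_funD[OF g]
  note [measurable] = V(4)
  have H: "is_fourier_of ?H ?T" by (rule is_fourier_deriv[OF V(2)])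
  have le: "(1 + w\<^sup>2) powr (s - 1) * (cmod (?H w))\<^sup>2 \<le> (1 + w\<^sup>2) powr s * (cmod (?F w))\<^sup>2" for w
  proof -
    have "(1 + w\<^sup>2) powr (s - 1) * w\<^sup>2 \<le> (1 + w\<^sup>2) powr (s - 1) * (1 + w\<^sup>2)"
      by (intro mult_left_mono) auto
    also have "\<dots> = (1 + w\<^sup>2) powr s"
      using weight_pos[of w] by (simp add: powr_diff)
    finally have "(1 + w\<^sup>2) powr (s - 1) * w\<^sup>2 * (cmod (?F w))\<^sup>2 \<le> (1 + w\<^sup>2) powr s * (cmod (?F w))\<^sup>2"
      by (intro mult_right_mono) auto
    then show ?thesis by (simp add: norm_mult power_mult_distrib mult.assoc)
  qed
  have i: "integrable lborel (\<lambda>w. (1 + w\<^sup>2) powr (s - 1) * (cmod (?H w))\<^sup>2)"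
    by (rule integrable_bound[OF V(3)]) (measurable, use le in \<open>auto intro!: AE_I2\<close>)
  show T: "?T \<in> sobolev (s - 1)" by (rule sobolevI(1)[OF H i])
  have "(sobolev_norm (s - 1) ?T)\<^sup>2 \<le> (sobolev_norm s (distr_of g))\<^sup>2"
    unfolding sobolevI(2)[OF H i] sobolev_norm_square[of s]
    by (intro divide_right_mono integral_mono i V(3) le) simp
  then show "sobolev_norm (s - 1) ?T \<le> sobolev_norm s (distr_of g)"
    using sobolev_norm_nonneg power2_le_imp_le by blast
  assume f: "adm \<sigma> R M f" and \<sigma>: "1/2 < \<sigma>" "\<sigma> \<le> 1" and X: "\<And>n. X n \<noteq> 0" "X \<longlonglongrightarrow> 0"
  note [measurable] = admD(1)[OF f]
  let ?G = "fourier (\<lambda>x. complex_of_real (f x))"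
  have [measurable]: "?G \<in> borel_measurable borel" by measurable
  have AE: "AE w in lborel. fourier_distr ?T w = ?H w" by (rule fourier_distr_AE[OF H])
  note [measurable] = is_fourier_measurable[OF sobolevD(1)[OF T]]
  have Hm: "(\<lambda>w. ?H w * ?G (- w)) \<in> borel_measurable borel" by measurable
  have HG: "integrable lborel (\<lambda>w. ?H w * ?G (- w))"
    by (rule integrable_cong_AE_imp[OF pairing_integrable(1)[OF T s f \<sigma>]]) (use Hm AE in \<open>auto elim: eventually_mono\<close>)
  have P: "pairing ?T f = (LBINT w. ?H w * ?G (- w)) / complex_of_real (2 * pi)"
  proof -
    have "(LBINT w. fourier_distr ?T w * ?G (- w)) = (LBINT w. ?H w * ?G (- w))"
    proof (rule integral_cong_AE)
      show "AE w in lborel. fourier_distr ?T w * ?G (- w) = ?H w * ?G (- w)"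
        using AE by eventually_elim simp
    qed measurable
    then show ?thesis unfolding pairing_def by simp
  qed
  have lim: "(\<lambda>n. LBINT w. ((cis (X n * w) - 1) / X n) * ?F w * ?G (- w)) \<longlonglongrightarrow> (LBINT w. ?H w * ?G (- w))"
  proof (rule integral_dominated_convergence[OF _ _ integrable_norm[OF HG]])
    show "AE w in lborel. (\<lambda>n. ((cis (X n * w) - 1) / X n) * ?F w * ?G (- w)) \<longlonglongrightarrow> ?H w * ?G (- w)"
    proof (rule AE_I2)
      fix w
      have "(\<lambda>n. (cis (w * (0 + X n)) - cis (w * 0)) /\<^sub>R X n) \<longlonglongrightarrow> \<i> * complex_of_real w * cis (w * 0)"
        by (rule vector_derivative_sequence[OF cis_has_vector_derivative X])
      then have "(\<lambda>n. (cis (X n * w) - 1) / X n) \<longlonglongrightarrow> \<i> * complex_of_real w"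
        by (simp add: scaleR_conv_of_real divide_inverse mult.commute)
      then show "(\<lambda>n. ((cis (X n * w) - 1) / X n) * ?F w * ?G (- w)) \<longlonglongrightarrow> ?H w * ?G (- w)"
        by (intro tendsto_mult tendsto_const)
    qed
    show "AE w in lborel. norm (((cis (X n * w) - 1) / X n) * ?F w * ?G (- w)) \<le> norm (?H w * ?G (- w))" for n
    proof (rule AE_I2)
      fix w
      have "cmod ((cis (X n * w) - 1) / X n) \<le> \<bar>w\<bar>"
        using norm_cis_minus_1_le[of "X n * w"] X(1)[of n] by (simp add: norm_divide abs_mult pos_divide_le_eq mult.commute)
      then show "norm (((cis (X n * w) - 1) / X n) * ?F w * ?G (- w)) \<le> norm (?H w * ?G (- w))"
        unfolding norm_mult by (intro mult_right_mono) auto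
    qed
  qed measurable
  have eq: "complex_of_real ((LBINT x. (rep g (x + X n) - rep g x) * f x) / X n)
      = (LBINT w. ((cis (X n * w) - 1) / X n) * ?F w * ?G (- w)) / complex_of_real (2 * pi)" for n
  proof -
    have "(LBINT w. ((cis (X n * w) - 1) / X n) * ?F w * ?G (- w)) = (LBINT w. (cis (X n * w) - 1) * ?F w * ?G (- w)) / X n"
      unfolding times_divide_eq_left by (simp only: integral_divide_zero)
    then show ?thesis
      unfolding of_real_divide rep_increment_pairing[OF g s adm_integrable(1)[OF f]] by simp
  qed
  show "(\<lambda>n. complex_of_real ((LBINT x. (rep g (x + X n) - rep g x) * f x) / X n)) \<longlonglongrightarrow> pairing ?T f"
    unfolding eq P by (intro tendsto_divide lim tendsto_const) simp
qed

text \<open>The analogue of \<open>adm\<close> for functions without compact support. Integrability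
  of the increment must be demanded here: the integral of a non-integrable function is 0 by
  convention, which would make the bound vacuous. In \<open>adm\<close> it follows from boundedness
  and support.\<close>

definition reg :: "real \<Rightarrow> real \<Rightarrow> (real \<Rightarrow> real) \<Rightarrow> bool" where
  "reg \<sigma> M g \<longleftrightarrow> g \<in> borel_measurable borel \<and> (\<forall>x. \<bar>g x\<bar> \<le> M) \<and>
     (\<forall>h. 0 < h \<and> h \<le> 1 \<longrightarrow> integrable lborel (\<lambda>x. (g (x + h) - g x)\<^sup>2) \<and>
       (LBINT x. (g (x + h) - g x)\<^sup>2) \<le> (M * h powr \<sigma>)\<^sup>2)"

lemma regD:
  assumes "reg \<sigma> M g"
  shows "g \<in> borel_measurable borel" "\<bar>g x\<bar> \<le> M" "0 \<le> M"
    "0 < h \<Longrightarrow> h \<le> 1 \<Longrightarrow> integrable lborel (\<lambda>x. (g (x + h) - g x)\<^sup>2)"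
    "0 < h \<Longrightarrow> h \<le> 1 \<Longrightarrow> (LBINT x. (g (x + h) - g x)\<^sup>2) \<le> (M * h powr \<sigma>)\<^sup>2"
  using assms unfolding reg_def by (auto intro: order_trans[OF abs_ge_zero])

lemma adm_mult:
  assumes f: "adm \<sigma> R M f" and g: "reg \<sigma> M' g"
  shows "adm \<sigma> R (2 * M * M') (\<lambda>x. f x * g x)"
proof -
  note F = admD[OF f] and G = regD[OF g]
  note [measurable] = F(1) G(1)
  have "(LBINT x. (f (x + h) * g (x + h) - f x * g x)\<^sup>2) \<le> (2 * M * M' * h powr \<sigma>)\<^sup>2" if h: "0 < h" "h \<le> 1" for h
  proof -
    note i = adm_integrable(3)[OF f, of h] G(4)[OF h]
    have "(LBINT x. (f (x + h) * g (x + h) - f x * g x)\<^sup>2)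
      \<le> (LBINT x. (2 * M'\<^sup>2) * (f (x + h) - f x)\<^sup>2 + (2 * M\<^sup>2) * (g (x + h) - g x)\<^sup>2)"
    proof (rule integral_mono')
      fix x
      have "(f (x + h) * g (x + h) - f x * g x)\<^sup>2 = ((f (x + h) - f x) * g (x + h) + f x * (g (x + h) - g x))\<^sup>2"
        by (simp add: algebra_simps)
      also have "\<dots> \<le> 2 * ((f (x + h) - f x) * g (x + h))\<^sup>2 + 2 * (f x * (g (x + h) - g x))\<^sup>2"
        by (rule square_sum_le)
      also have "\<dots> \<le> 2 * ((f (x + h) - f x)\<^sup>2 * M'\<^sup>2) + 2 * (M\<^sup>2 * (g (x + h) - g x)\<^sup>2)"
        using F(2,5) G(2,3) unfolding power_mult_distrib
        by (intro add_mono mult_left_mono mult_right_mono) (auto simp: abs_le_square_iff[symmetric])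
      finally show "(f (x + h) * g (x + h) - f x * g x)\<^sup>2 \<le> (2 * M'\<^sup>2) * (f (x + h) - f x)\<^sup>2 + (2 * M\<^sup>2) * (g (x + h) - g x)\<^sup>2"
        by (simp add: mult_ac)
    qed (use i in auto)
    also have "\<dots> \<le> (2 * M'\<^sup>2) * (M * h powr \<sigma>)\<^sup>2 + (2 * M\<^sup>2) * (M' * h powr \<sigma>)\<^sup>2"
      using i by (simp add: add_mono mult_left_mono F(4)[OF h] G(5)[OF h])
    also have "\<dots> = (2 * M * M' * h powr \<sigma>)\<^sup>2"
      by (simp add: power_mult_distrib)
    finally show ?thesis .
  qed
  moreover have "\<bar>f x * g x\<bar> \<le> 2 * M * M'" for x
  proof -
    have "\<bar>f x * g x\<bar> \<le> M * M'" unfolding abs_mult using F(2,5) G(2) by (intro mult_mono) auto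
    moreover have "0 \<le> M * M'" using F(5) G(3) by simp
    ultimately show ?thesis by linarith
  qed
  ultimately show ?thesis unfolding adm_def using F(3) by auto
qed

text \<open>Restricted to the unit square because \<open>p\<close> and \<open>q\<close> take their
  values there; polynomials and rational functions qualify only on a bounded set. The same
  \<open>L\<close> bounds the values and the Lipschitz constant.\<close>

definition lipb :: "real \<Rightarrow> (real \<Rightarrow> real \<Rightarrow> real) \<Rightarrow> bool" where
  "lipb L H \<longleftrightarrow> (\<forall>a b a' b'. \<bar>a\<bar> \<le> 1 \<longrightarrow> \<bar>b\<bar> \<le> 1 \<longrightarrow> \<bar>a'\<bar> \<le> 1 \<longrightarrow> \<bar>b'\<bar> \<le> 1 \<longrightarrow>
     \<bar>H a b\<bar> \<le> L \<and> \<bar>H a' b' - H a b\<bar> \<le> L * (\<bar>a' - a\<bar> + \<bar>b' - b\<bar>))"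

lemma abs_sum_square: "(\<bar>a\<bar> + \<bar>b\<bar>)\<^sup>2 \<le> 2 * a\<^sup>2 + 2 * (b::real)\<^sup>2"
  using square_sum_le[of "\<bar>a\<bar>" "\<bar>b\<bar>"] by simp

lemma reg_compose:
  assumes p: "reg \<sigma> M p" and q: "reg \<sigma> M q" and le: "\<And>x. \<bar>p x\<bar> \<le> 1" "\<And>x. \<bar>q x\<bar> \<le> 1"
    and H: "lipb L H" and m: "(\<lambda>x. H (p x) (q x)) \<in> borel_measurable borel"
  shows "reg \<sigma> (L * (1 + 2 * M)) (\<lambda>x. H (p x) (q x))"
proof -
  note P = regD[OF p] and Q = regD[OF q]
  have H': "\<bar>H a b\<bar> \<le> L" "\<bar>H a' b' - H a b\<bar> \<le> L * (\<bar>a' - a\<bar> + \<bar>b' - b\<bar>)"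
    if "\<bar>a\<bar> \<le> 1" "\<bar>b\<bar> \<le> 1" "\<bar>a'\<bar> \<le> 1" "\<bar>b'\<bar> \<le> 1" for a b a' b'
    using H that unfolding lipb_def by auto
  have L: "0 \<le> L" using H'(1)[of 0 0 0 0] by (simp add: order_trans[OF abs_ge_zero])
  have i: "integrable lborel (\<lambda>x. (H (p (x + h)) (q (x + h)) - H (p x) (q x))\<^sup>2) \<and>
    (LBINT x. (H (p (x + h)) (q (x + h)) - H (p x) (q x))\<^sup>2) \<le> (L * (1 + 2 * M) * h powr \<sigma>)\<^sup>2"
    if h: "0 < h" "h \<le> 1" for h
  proof -
    let ?B = "\<lambda>x. L\<^sup>2 * (2 * (p (x + h) - p x)\<^sup>2 + 2 * (q (x + h) - q x)\<^sup>2)"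
    have le2: "(H (p (x + h)) (q (x + h)) - H (p x) (q x))\<^sup>2 \<le> ?B x" for x
    proof -
      have "\<bar>H (p (x + h)) (q (x + h)) - H (p x) (q x)\<bar>\<^sup>2 \<le> (L * (\<bar>p (x + h) - p x\<bar> + \<bar>q (x + h) - q x\<bar>))\<^sup>2"
        by (intro power_mono H' le) simp
      also have "\<dots> \<le> ?B x"
        unfolding power_mult_distrib by (intro mult_left_mono abs_sum_square) simp
      finally show ?thesis by simp
    qed
    have iB: "integrable lborel ?B" using P(4)[OF h] Q(4)[OF h] by simp
    have "(\<lambda>x. H (p (x + h)) (q (x + h))) \<in> borel_measurable borel"
      using measurable_compose[OF _ m, of "\<lambda>x. x + h" borel] by simp
    then have i: "integrable lborel (\<lambda>x. (H (p (x + h)) (q (x + h)) - H (p x) (q x))\<^sup>2)"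
      by (intro integrable_bound[OF iB]) (use m le2 in \<open>auto intro!: AE_I2 order_trans[OF _ abs_ge_self]\<close>)
    have "(LBINT x. (H (p (x + h)) (q (x + h)) - H (p x) (q x))\<^sup>2) \<le> (LBINT x. ?B x)"
      by (rule integral_mono[OF i iB le2])
    also have "\<dots> \<le> L\<^sup>2 * (2 * (M * h powr \<sigma>)\<^sup>2 + 2 * (M * h powr \<sigma>)\<^sup>2)"
      using P(4,5)[OF h] Q(4,5)[OF h] by (simp add: mult_left_mono add_mono)
    also have "\<dots> = (L * (2 * M) * h powr \<sigma>)\<^sup>2" by (simp add: power_mult_distrib)
    also have "\<dots> \<le> (L * (1 + 2 * M) * h powr \<sigma>)\<^sup>2"
      using L P(3) by (intro power_mono mult_right_mono mult_left_mono) auto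
    finally show ?thesis using i by simp
  qed
  have "\<bar>H (p x) (q x)\<bar> \<le> L * (1 + 2 * M)" for x
  proof -
    have "\<bar>H (p x) (q x)\<bar> \<le> L" using H'(1) le by blast
    also have "L * 1 \<le> L * (1 + 2 * M)" using L P(3) by (intro mult_left_mono) auto
    finally show ?thesis by simp
  qed
  with m i show ?thesis unfolding reg_def by blast
qed

lemma adm_lipschitz:
  assumes f: "f \<in> borel_measurable borel" "\<And>x. \<bar>f x\<bar> \<le> B" "\<And>x. \<bar>x\<bar> > R \<Longrightarrow> f x = 0"
    and l: "\<And>x y. \<bar>f x - f y\<bar> \<le> L * \<bar>x - y\<bar>" and R: "R \<ge> 0" and \<sigma>: "\<sigma> \<le> 1"
  shows "adm \<sigma> R (B + L * sqrt (2 * R + 2)) f"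
proof -
  have B: "0 \<le> B" using f(2)[of 0] by simp
  have L: "0 \<le> L" using l[of 1 0] by simp
  have "(LBINT x. (f (x + h) - f x)\<^sup>2) \<le> ((B + L * sqrt (2 * R + 2)) * h powr \<sigma>)\<^sup>2" if h: "0 < h" "h \<le> 1" for h
  proof -
    \<comment> \<open>For h <= 1 the increment vanishes outside [-(R+1), R+1], an interval of length
      2 R + 2; this is the origin of \<open>sqrt (2 * R + 2)\<close>.\<close>
    let ?I = "\<lambda>x. (L * h)\<^sup>2 * indicator {-(R+1)..R+1} x :: real"
    have "(f (x + h) - f x)\<^sup>2 \<le> ?I x" for x
    proof (cases "x \<in> {-(R+1)..R+1}")
      case True
      have "\<bar>f (x + h) - f x\<bar>\<^sup>2 \<le> (L * h)\<^sup>2"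
        using l[of "x + h" x] h by (intro power_mono) auto
      with True show ?thesis by simp
    next
      case False
      then have "\<bar>x\<bar> > R" "\<bar>x + h\<bar> > R" using h by auto
      then show ?thesis using f(3) False by simp
    qed
    then have "(LBINT x. (f (x + h) - f x)\<^sup>2) \<le> (LBINT x. ?I x)"
      by (intro integral_mono') (auto intro!: integrable_mult_right simp: integrable_indicator_iff emeasure_lborel_Icc_eq)
    also have "\<dots> = (L * h)\<^sup>2 * (2 * R + 2)" using R by simp
    also have "\<dots> = (L * sqrt (2 * R + 2) * h)\<^sup>2" using R by (simp add: power_mult_distrib)
    also have "\<dots> \<le> ((B + L * sqrt (2 * R + 2)) * h powr \<sigma>)\<^sup>2"
    proof (intro power_mono mult_mono)
      show "h \<le> h powr \<sigma>" using powr_mono'[of \<sigma> 1 h] h \<sigma> by simp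
    qed (use B L R h in auto)
    finally show ?thesis .
  qed
  moreover have "\<bar>f x\<bar> \<le> B + L * sqrt (2 * R + 2)" for x
    using f(2)[of x] L R by (smt (verit) mult_nonneg_nonneg real_sqrt_ge_zero)
  ultimately show ?thesis unfolding adm_def using f by auto
qed

lemma test1_lipschitz:
  assumes "test1 \<phi>"
  obtains B L R where "B \<ge> 0" "L \<ge> 0" "R \<ge> 0" "\<And>x. \<bar>\<phi> x\<bar> \<le> B" "\<And>x. \<bar>x\<bar> > R \<Longrightarrow> \<phi> x = 0"
    "\<And>x y. \<bar>\<phi> x - \<phi> y\<bar> \<le> L * \<bar>x - y\<bar>"
proof -
  obtain \<phi>' where \<phi>': "test1 \<phi>'" "\<And>x. (\<phi> has_real_derivative \<phi>' x) (at x)" using test1_derivative[OF assms] by blast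
  obtain B where B: "B > 0" "\<And>x. \<bar>\<phi> x\<bar> \<le> B" using test1_bounded[OF assms] by blast
  obtain L where L: "L > 0" "\<And>x. \<bar>\<phi>' x\<bar> \<le> L" using test1_bounded[OF \<phi>'(1)] by blast
  obtain R where R: "\<And>x. \<bar>x\<bar> > R \<Longrightarrow> \<phi> x = 0" using assms unfolding test1_def by blast
  have "\<bar>\<phi> x - \<phi> y\<bar> \<le> L * \<bar>x - y\<bar>" for x y
    using norm_vector_derivative_bound[of \<phi> \<phi>' L x y] \<phi>'(2) L(2)
    by (simp add: has_real_derivative_iff_has_vector_derivative)
  then show thesis using that[of B L "max R 0"] B L R by auto
qed

text \<open>The absolute value is included because the quadratic Taylor errors are weighted by
  |\<phi>|, which is then used as the nonnegative admissible weight in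
  \<open>time_square_integral\<close>.\<close>

lemma test1_adm:
  assumes "test1 \<phi>" "\<sigma> \<le> 1"
  obtains R M where "adm \<sigma> R M \<phi>" "adm \<sigma> R M (\<lambda>x. \<bar>\<phi> x\<bar>)"
proof -
  obtain B L R where b: "B \<ge> 0" "L \<ge> 0" "R \<ge> 0" "\<And>x. \<bar>\<phi> x\<bar> \<le> B" "\<And>x. \<bar>x\<bar> > R \<Longrightarrow> \<phi> x = 0"
    "\<And>x y. \<bar>\<phi> x - \<phi> y\<bar> \<le> L * \<bar>x - y\<bar>" using test1_lipschitz[OF assms(1)] by metis
  have [measurable]: "\<phi> \<in> borel_measurable borel" using assms(1) by (rule test1_measurable)
  have "adm \<sigma> R (B + L * sqrt (2 * R + 2)) \<phi>"
    by (rule adm_lipschitz) (use b assms in auto)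
  moreover have "adm \<sigma> R (B + L * sqrt (2 * R + 2)) (\<lambda>x. \<bar>\<phi> x\<bar>)"
  proof (rule adm_lipschitz)
    show "\<bar>\<bar>\<phi> x\<bar> - \<bar>\<phi> y\<bar>\<bar> \<le> L * \<bar>x - y\<bar>" for x y
      using b(6)[of x y] abs_triangle_ineq3[of "\<phi> x" "\<phi> y"] by linarith
  qed (use b assms in auto)
  ultimately show thesis using that by blast
qed

section \<open>Mollification of admissible functions\<close>

lemma moll_jensen:
  fixes g :: "real \<Rightarrow> real \<Rightarrow> real"
  assumes n: "n > 0" and [measurable]: "case_prod g \<in> borel_measurable (borel \<Otimes>\<^sub>M borel)"
    and bd: "\<And>y x. \<bar>g y x\<bar> \<le> K"
    and B: "\<And>y. \<bar>y\<bar> < 1 / n \<Longrightarrow> (\<integral>\<^sup>+x. ennreal ((g y x)\<^sup>2) \<partial>lborel) \<le> B"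
  shows "(\<integral>\<^sup>+x. ennreal ((LBINT y. moll n y * g y x)\<^sup>2) \<partial>lborel) \<le> B"
proof -
  note [measurable] = test1_measurable[OF moll_test1[OF n]]
  have gm: "(\<lambda>y. g y x) \<in> borel_measurable borel" for x by measurable
  have g2: "\<bar>(g y x)\<^sup>2\<bar> \<le> K\<^sup>2" for y x
    using power_mono[OF bd[of y x], of 2] by simp
  have mr: "moll n y = moll n (0 - (- y))" for y by simp
  have int: "integrable lborel (\<lambda>y. moll n y * k y)" if "k \<in> borel_measurable borel" "\<And>y. \<bar>k y\<bar> \<le> C" for k C
  proof (rule integrable_bound[OF integrable_mult_left[OF moll_integrable[OF n], of C]])
    show "AE y in lborel. norm (moll n y * k y) \<le> norm (moll n y * C)"
      using that(2) by (auto simp: abs_mult moll_nonneg[OF n] intro!: AE_I2 mult_left_mono order_trans[OF _ abs_ge_self])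
  qed (use that(1) in measurable)
  have jensen: "(LBINT y. moll n y * g y x)\<^sup>2 \<le> (LBINT y. moll n y * (g y x)\<^sup>2)" for x
  proof -
    define c where "c = (LBINT y. moll n y * g y x)"
    note i1 = int[OF gm[of x] bd] and i2 = int[of "\<lambda>y. (g y x)\<^sup>2", OF _ g2]
    have i2': "integrable lborel (\<lambda>y. moll n y * (g y x)\<^sup>2)" by (rule i2) measurable
    have "0 \<le> (LBINT y. moll n y * (g y x - c)\<^sup>2)"
      by (intro integral_nonneg) (simp add: moll_nonneg[OF n])
    also have "\<dots> = (LBINT y. moll n y * (g y x)\<^sup>2 - 2 * c * (moll n y * g y x) + c\<^sup>2 * moll n y)"
      by (intro integral_cong) (auto simp: power2_diff algebra_simps)
    also have "\<dots> = (LBINT y. moll n y * (g y x)\<^sup>2) - 2 * c * c + c\<^sup>2 * 1"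
      using i1 i2' moll_integrable[OF n] integral_moll[OF n] by (simp add: c_def)
    finally show ?thesis by (simp add: c_def power2_eq_square)
  qed
  have "(\<integral>\<^sup>+x. ennreal ((LBINT y. moll n y * g y x)\<^sup>2) \<partial>lborel)
    \<le> (\<integral>\<^sup>+x. \<integral>\<^sup>+y. ennreal (moll n y) * ennreal ((g y x)\<^sup>2) \<partial>lborel \<partial>lborel)"
  proof (rule nn_integral_mono)
    fix x
    have i2: "integrable lborel (\<lambda>y. moll n y * (g y x)\<^sup>2)"
      by (rule int[OF _ g2]) measurable
    have "ennreal ((LBINT y. moll n y * g y x)\<^sup>2) \<le> ennreal (LBINT y. moll n y * (g y x)\<^sup>2)"
      by (rule ennreal_leI[OF jensen])
    also have "\<dots> = (\<integral>\<^sup>+y. ennreal (moll n y * (g y x)\<^sup>2) \<partial>lborel)"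
      by (rule nn_integral_eq_integral[symmetric, OF i2]) (simp add: moll_nonneg[OF n])
    also have "\<dots> = (\<integral>\<^sup>+y. ennreal (moll n y) * ennreal ((g y x)\<^sup>2) \<partial>lborel)"
      by (intro nn_integral_cong ennreal_mult moll_nonneg[OF n]) simp
    finally show "ennreal ((LBINT y. moll n y * g y x)\<^sup>2) \<le> (\<integral>\<^sup>+y. ennreal (moll n y) * ennreal ((g y x)\<^sup>2) \<partial>lborel)" .
  qed
  also have "\<dots> = (\<integral>\<^sup>+y. \<integral>\<^sup>+x. ennreal (moll n y) * ennreal ((g y x)\<^sup>2) \<partial>lborel \<partial>lborel)"
    by (rule lborel_pair.Fubini') measurable
  also have "\<dots> = (\<integral>\<^sup>+y. ennreal (moll n y) * (\<integral>\<^sup>+x. ennreal ((g y x)\<^sup>2) \<partial>lborel) \<partial>lborel)"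
    by (intro nn_integral_cong nn_integral_cmult) measurable
  also have "\<dots> \<le> (\<integral>\<^sup>+y. ennreal (moll n y) * B \<partial>lborel)"
  proof (rule nn_integral_mono)
    fix y
    show "ennreal (moll n y) * (\<integral>\<^sup>+x. ennreal ((g y x)\<^sup>2) \<partial>lborel) \<le> ennreal (moll n y) * B"
    proof (cases "\<bar>y\<bar> < 1 / n")
      case True then show ?thesis by (intro mult_left_mono B) auto
    next
      case False then show ?thesis using moll_zero[OF n, of y] by simp
    qed
  qed
  also have "\<dots> = (\<integral>\<^sup>+y. ennreal (moll n y) \<partial>lborel) * B"
    by (rule nn_integral_multc) measurable
  also have "(\<integral>\<^sup>+y. ennreal (moll n y) \<partial>lborel) = 1"
    using nn_integral_eq_integral[OF moll_integrable[OF n]] moll_nonneg[OF n] integral_moll[OF n] by simp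
  finally show ?thesis by simp
qed

lemma adm_increment_nn:
  assumes f: "adm \<sigma> R M f" and h: "0 < h" "h \<le> 1"
  shows "(\<integral>\<^sup>+x. ennreal ((f (x + h) - f x)\<^sup>2) \<partial>lborel) \<le> ennreal ((M * h powr \<sigma>)\<^sup>2)"
  using adm_integrable(3)[OF f] admD(4)[OF f h] by (subst nn_integral_eq_integral) (auto simp: ennreal_leI)

text \<open>An average of translates has no larger sup norm and, by Jensen's inequality, no larger
  L2 modulus. The constant \<open>M\<close> is thus kept, so \<open>dual_fun\<close> gives
  convergence along the approximating sequence.\<close>

lemma mollify:
  assumes f: "adm \<sigma> R M f" and \<sigma>: "0 < \<sigma>"
  obtains \<psi> where "\<And>n. test1 (\<psi> n)" "\<And>n. adm \<sigma> (R + 1) M (\<psi> n)" "(\<lambda>n::nat. LBINT x. (\<psi> n x - f x)\<^sup>2) \<longlonglongrightarrow> 0"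
proof -
  note F = admD[OF f]
  note [measurable] = F(1)
  define \<psi> where "\<psi> n x = (LBINT y. moll (Suc n) (x - y) * f y)" for n :: nat and x
  have t: "test1 (\<psi> n)" for n
    unfolding \<psi>_def by (rule convolution_test1[OF adm_integrable(1)[OF f]]) (use F moll_test1 in auto)
  have alt: "\<psi> n x = (LBINT y. moll (Suc n) y * f (x - y))" for n x
    unfolding \<psi>_def using integral_reflect[of "\<lambda>y. moll (Suc n) (x - y) * f y" x] by simp
  have bd: "\<bar>\<psi> n x\<bar> \<le> M" for n x
    unfolding \<psi>_def by (rule moll_le(1)) (use F in auto)
  have m: "integrable lborel (\<lambda>y. moll (Suc n) y * f (x - y))" for n x
  proof (rule integrable_bound[OF integrable_mult_left[OF moll_integrable[of "Suc n"], of M]])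
    note [measurable] = test1_measurable[OF moll_test1[of "Suc n"]]
    show "(\<lambda>y. moll (Suc n) y * f (x - y)) \<in> borel_measurable lborel" by measurable
    show "AE y in lborel. norm (moll (Suc n) y * f (x - y)) \<le> norm (moll (Suc n) y * M)"
      using F(2) by (auto simp: abs_mult moll_nonneg intro!: AE_I2 mult_left_mono order_trans[OF _ abs_ge_self])
  qed simp
  have supp: "\<psi> n x = 0" if "\<bar>x\<bar> > R + 1" for n x
    unfolding \<psi>_def
  proof (rule moll_constant)
    fix y assume "\<bar>x - y\<bar> < 1 / real (Suc n)"
    moreover have "1 / real (Suc n) \<le> 1" by simp
    ultimately have "\<bar>x - y\<bar> < 1" by linarith
    then show "f y = 0" using that by (intro F(3)) linarith
  qed simp
  have [measurable]: "\<psi> n \<in> borel_measurable borel" for n using t by (rule test1_measurable)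
  have [measurable]: "(\<lambda>(x, y). f (x - y)) \<in> borel_measurable (borel \<Otimes>\<^sub>M borel)" by measurable
  have a: "adm \<sigma> (R + 1) M (\<psi> n)" for n
  proof -
    have "(LBINT x. (\<psi> n (x + h) - \<psi> n x)\<^sup>2) \<le> (M * h powr \<sigma>)\<^sup>2" if h: "0 < h" "h \<le> 1" for h
    proof -
      have "(\<integral>\<^sup>+x. ennreal ((LBINT y. moll (Suc n) y * (f ((x - y) + h) - f (x - y)))\<^sup>2) \<partial>lborel) \<le> ennreal ((M * h powr \<sigma>)\<^sup>2)"
      proof (rule moll_jensen[where n="real (Suc n)" and K="2 * M" and g="\<lambda>y x. f ((x - y) + h) - f (x - y)" and B="ennreal ((M * h powr \<sigma>)\<^sup>2)"])
        show "\<bar>f ((x - y) + h) - f (x - y)\<bar> \<le> 2 * M" for x y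
          using F(2)[of "(x - y) + h"] F(2)[of "x - y"] by linarith
        show "(\<integral>\<^sup>+x. ennreal ((f ((x - y) + h) - f (x - y))\<^sup>2) \<partial>lborel) \<le> ennreal ((M * h powr \<sigma>)\<^sup>2)" for y
          using adm_increment_nn[OF f h] nn_integral_real_affine[of "\<lambda>x. ennreal ((f (x + h) - f x)\<^sup>2)" 1 "-y"]
          by (simp add: algebra_simps)
      qed (simp, measurable)
      moreover have "(LBINT y. moll (Suc n) y * (f ((x - y) + h) - f (x - y))) = \<psi> n (x + h) - \<psi> n x" for x
        unfolding alt using m[of n "x + h"] m[of n x] by (simp add: right_diff_distrib algebra_simps)
      ultimately have "(\<integral>\<^sup>+x. ennreal ((\<psi> n (x + h) - \<psi> n x)\<^sup>2) \<partial>lborel) \<le> ennreal ((M * h powr \<sigma>)\<^sup>2)" by simp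
      then have "enn2real (\<integral>\<^sup>+x. ennreal ((\<psi> n (x + h) - \<psi> n x)\<^sup>2) \<partial>lborel) \<le> (M * h powr \<sigma>)\<^sup>2"
        by (rule enn2real_leI[rotated]) simp
      then show ?thesis by (subst integral_eq_nn_integral) auto
    qed
    then show ?thesis unfolding adm_def using bd supp by auto
  qed
  have le: "(LBINT x. (\<psi> n x - f x)\<^sup>2) \<le> (M * (1 / real (Suc n)) powr \<sigma>)\<^sup>2" for n
  proof -
    have "(\<integral>\<^sup>+x. ennreal ((LBINT y. moll (Suc n) y * (f (x - y) - f x))\<^sup>2) \<partial>lborel) \<le> ennreal ((M * (1 / real (Suc n)) powr \<sigma>)\<^sup>2)"
    proof (rule moll_jensen[where n="real (Suc n)" and K="2 * M" and g="\<lambda>y x. f (x - y) - f x" and B="ennreal ((M * (1 / real (Suc n)) powr \<sigma>)\<^sup>2)"])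
      show "\<bar>f (x - y) - f x\<bar> \<le> 2 * M" for x y
        using F(2)[of "x - y"] F(2)[of "x"] by linarith
      fix y :: real assume y: "\<bar>y\<bar> < 1 / real (Suc n)"
      have mono: "ennreal ((M * \<bar>y\<bar> powr \<sigma>)\<^sup>2) \<le> ennreal ((M * (1 / real (Suc n)) powr \<sigma>)\<^sup>2)"
        using y \<sigma> F(5) by (intro ennreal_leI power_mono mult_left_mono powr_mono2) auto
      have y1: "\<bar>y\<bar> \<le> 1" using y by (rule order_trans[OF less_imp_le]) simp
      consider "y = 0" | "y > 0" | "y < 0" by linarith
      then show "(\<integral>\<^sup>+x. ennreal ((f (x - y) - f x)\<^sup>2) \<partial>lborel) \<le> ennreal ((M * (1 / real (Suc n)) powr \<sigma>)\<^sup>2)"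
      proof cases
        case 1 then show ?thesis by simp
      next
        case 2
        have "(\<integral>\<^sup>+x. ennreal ((f (x - y) - f x)\<^sup>2) \<partial>lborel) = (\<integral>\<^sup>+x. ennreal ((f x - f (y + x))\<^sup>2) \<partial>lborel)"
          using nn_integral_real_affine[of "\<lambda>x. ennreal ((f (x - y) - f x)\<^sup>2)" 1 y] by simp
        also have "\<dots> = (\<integral>\<^sup>+x. ennreal ((f (x + y) - f x)\<^sup>2) \<partial>lborel)"
          by (subst power2_commute) (simp only: add.commute)
        finally have "(\<integral>\<^sup>+x. ennreal ((f (x - y) - f x)\<^sup>2) \<partial>lborel) = (\<integral>\<^sup>+x. ennreal ((f (x + y) - f x)\<^sup>2) \<partial>lborel)" .
        then show ?thesis using adm_increment_nn[OF f, of y] 2 y1 mono by (auto intro: order_trans)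
      next
        case 3
        then show ?thesis using adm_increment_nn[OF f, of "-y"] y1 mono by (auto intro: order_trans)
      qed
    qed (simp, measurable)
    moreover have "(LBINT y. moll (Suc n) y * (f (x - y) - f x)) = \<psi> n x - f x" for x
    proof -
      have "(LBINT y. moll (Suc n) y * (f (x - y) - f x)) = (LBINT y. moll (Suc n) y * f (x - y)) - (LBINT y. moll (Suc n) y * f x)"
        unfolding right_diff_distrib
        by (rule integral_diff[OF m]) (simp add: moll_integrable)
      then show ?thesis using integral_moll[of "real (Suc n)"] by (simp add: alt)
    qed
    ultimately have "(\<integral>\<^sup>+x. ennreal ((\<psi> n x - f x)\<^sup>2) \<partial>lborel) \<le> ennreal ((M * (1 / real (Suc n)) powr \<sigma>)\<^sup>2)" by simp
    then have "enn2real (\<integral>\<^sup>+x. ennreal ((\<psi> n x - f x)\<^sup>2) \<partial>lborel) \<le> (M * (1 / real (Suc n)) powr \<sigma>)\<^sup>2"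
      by (rule enn2real_leI[rotated]) simp
    then show ?thesis by (subst integral_eq_nn_integral) auto
  qed
  have "(\<lambda>n. (M * (1 / real (Suc n)) powr \<sigma>)\<^sup>2) \<longlonglongrightarrow> (M * 0)\<^sup>2"
    by (intro tendsto_power tendsto_mult tendsto_const tendsto_zero_powrI[where b=\<sigma>] LIMSEQ_Suc[OF lim_1_over_n]) (use \<sigma> in auto)
  then have "(\<lambda>n. LBINT x. (\<psi> n x - f x)\<^sup>2) \<longlonglongrightarrow> 0"
    by (intro tendsto_sandwich[of "\<lambda>_. 0" "\<lambda>n. LBINT x. (\<psi> n x - f x)\<^sup>2" _ "\<lambda>n. (M * (1 / real (Suc n)) powr \<sigma>)\<^sup>2"])
      (use le in auto)
  then show thesis using that[of \<psi>] t a by blast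
qed

text \<open>The integral of a function that is not known to be measurable is a lower integral. It is attained.\<close>

lemma nn_integral_attained:
  fixes f :: "'a \<Rightarrow> ennreal"
  obtains g where "g \<in> borel_measurable M" "\<And>x. g x \<le> f x" "(\<integral>\<^sup>+x. g x \<partial>M) = (\<integral>\<^sup>+x. f x \<partial>M)"
proof -
  let ?S = "{g. simple_function M g \<and> g \<le> f}"
  have ne: "?S \<noteq> {}" by (auto intro!: exI[of _ "\<lambda>x. 0"] simp: le_fun_def)
  obtain s where s: "range s \<subseteq> (integral\<^sup>S M) ` ?S" "(SUP g\<in>?S. integral\<^sup>S M g) = (SUP i::nat. s i)"
    using ennreal_SUP_countable_SUP[OF ne, of "integral\<^sup>S M"] by metis
  then have "\<forall>i. \<exists>g. g \<in> ?S \<and> s i = integral\<^sup>S M g" by blast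
  then obtain G where G: "\<And>i. G i \<in> ?S" "\<And>i. s i = integral\<^sup>S M (G i)" by metis
  define g where "g x = (SUP i. G i x)" for x
  have [measurable]: "G i \<in> borel_measurable M" for i using G(1)[of i] by (auto intro: borel_measurable_simple_function)
  have m: "g \<in> borel_measurable M" unfolding g_def by measurable
  have le: "g x \<le> f x" for x unfolding g_def using G(1) by (auto intro!: SUP_least simp: le_fun_def)
  have "(\<integral>\<^sup>+x. f x \<partial>M) = (SUP i. integral\<^sup>S M (G i))"
    unfolding nn_integral_def s(2) by (simp add: G(2))
  also have "\<dots> \<le> (\<integral>\<^sup>+x. g x \<partial>M)"
  proof (rule SUP_least)
    fix i
    have "integral\<^sup>S M (G i) = (\<integral>\<^sup>+x. G i x \<partial>M)"
      using G(1)[of i] by (intro nn_integral_eq_simple_integral[symmetric]) auto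
    also have "\<dots> \<le> (\<integral>\<^sup>+x. g x \<partial>M)"
      unfolding g_def by (intro nn_integral_mono SUP_upper) simp
    finally show "integral\<^sup>S M (G i) \<le> (\<integral>\<^sup>+x. g x \<partial>M)" .
  qed
  finally have "(\<integral>\<^sup>+x. f x \<partial>M) \<le> (\<integral>\<^sup>+x. g x \<partial>M)" .
  with le have "(\<integral>\<^sup>+x. g x \<partial>M) = (\<integral>\<^sup>+x. f x \<partial>M)"
    by (rule_tac antisym[OF nn_integral_mono]) auto
  with m le that show thesis by blast
qed

text \<open>The norm \<open>N t\<close> of the second time derivative is not known to be measurable
  in \<open>t\<close>, so its integral is only a lower integral. The minorant \<open>g\<close>
  attaining it dominates every measurable \<open>h / e\<close> below \<open>N\<close> almost
  everywhere: otherwise the maximum of the two would be a measurable minorant with a larger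
  integral.\<close>

lemma measurable_majorant:
  fixes N :: "real \<Rightarrow> real"
  assumes fin: "(\<integral>\<^sup>+t\<in>{a..b}. ennreal (N t) \<partial>lborel) < \<infinity>" and nn: "\<And>t. 0 \<le> N t"
  obtains \<gamma> where "integrable lborel \<gamma>" "\<And>t. 0 \<le> \<gamma> t"
    "\<And>(h :: real \<Rightarrow> complex) e u v. \<lbrakk>h \<in> borel_measurable borel; 0 \<le> e; \<And>t. t \<in> {u..v} \<Longrightarrow> cmod (h t) \<le> N t * e;
       {u..v} \<subseteq> {a..b}\<rbrakk> \<Longrightarrow> AE t in lborel. t \<in> {u..v} \<longrightarrow> cmod (h t) \<le> \<gamma> t * e"
proof -
  define f where "f t = ennreal (N t) * indicator {a..b} t" for t
  obtain g where g: "g \<in> borel_measurable lborel" "\<And>t. g t \<le> f t" "(\<integral>\<^sup>+t. g t \<partial>lborel) = (\<integral>\<^sup>+t. f t \<partial>lborel)"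
    using nn_integral_attained[of lborel f] by blast
  have fin': "(\<integral>\<^sup>+t. f t \<partial>lborel) < \<infinity>" using fin by (simp add: f_def)
  note [measurable] = g(1)
  define \<gamma> where "\<gamma> t = enn2real (g t)" for t
  have g\<gamma>: "ennreal (\<gamma> t) = g t" for t
  proof -
    have "g t < top" using g(2)[of t] by (rule le_less_trans) (simp add: f_def indicator_def)
    then show ?thesis by (simp add: \<gamma>_def)
  qed
  have [measurable]: "\<gamma> \<in> borel_measurable borel" unfolding \<gamma>_def using g(1) by simp
  have i: "integrable lborel \<gamma>"
    by (rule integrableI_nonneg) (use fin' g(3) in \<open>auto simp: g\<gamma> \<gamma>_def[symmetric] intro: enn2real_nonneg\<close>, simp add: \<gamma>_def)
  have "AE t in lborel. t \<in> {u..v} \<longrightarrow> cmod (h t) \<le> \<gamma> t * e"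
    if [measurable]: "h \<in> borel_measurable borel" and e: "0 \<le> e" and le: "\<And>t. t \<in> {u..v} \<Longrightarrow> cmod (h t) \<le> N t * e"
      and sub: "{u..v} \<subseteq> {a..b}" for h :: "real \<Rightarrow> complex" and e u v
  proof (cases "e = 0")
    case True
    with le show ?thesis by (auto intro!: AE_I2)
  next
    case False
    with e have e: "e > 0" by simp
    define k where "k t = max (g t) (ennreal (cmod (h t) / e) * indicator {u..v} t)" for t
    have [measurable]: "k \<in> borel_measurable lborel" unfolding k_def by measurable
    have "k t \<le> f t" for t
    proof (cases "t \<in> {u..v}")
      case True
      then have "cmod (h t) / e \<le> N t" using le[OF True] e by (simp add: pos_divide_le_eq)
      moreover have "t \<in> {a..b}" using True sub by blast
      ultimately show ?thesis using g(2)[of t] True by (auto simp: k_def f_def ennreal_leI)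
    next
      case False then show ?thesis using g(2)[of t] by (simp add: k_def)
    qed
    then have "(\<integral>\<^sup>+t. k t \<partial>lborel) \<le> (\<integral>\<^sup>+t. g t \<partial>lborel)"
      unfolding g(3) by (intro nn_integral_mono) auto
    moreover have "(\<integral>\<^sup>+t. k t - g t \<partial>lborel) = (\<integral>\<^sup>+t. k t \<partial>lborel) - (\<integral>\<^sup>+t. g t \<partial>lborel)"
      by (rule nn_integral_diff) (use fin' g(3) in \<open>auto simp: k_def\<close>)
    moreover have "(\<integral>\<^sup>+t. g t \<partial>lborel) < top" using fin' g(3) by simp
    ultimately have "(\<integral>\<^sup>+t. k t - g t \<partial>lborel) = 0"
      by (metis diff_eq_0_iff_ennreal le_less_trans)
    then have "AE t in lborel. k t - g t = 0"
      by (subst (asm) nn_integral_0_iff_AE) auto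
    then show ?thesis
    proof eventually_elim
      case (elim t)
      then have "k t \<le> g t" by (simp add: diff_eq_0_iff_ennreal)
      then have "t \<in> {u..v} \<longrightarrow> ennreal (cmod (h t) / e) \<le> ennreal (\<gamma> t)"
        by (auto simp: k_def g\<gamma>)
      moreover have "0 \<le> \<gamma> t" by (simp add: \<gamma>_def)
      ultimately show ?case using e by (simp add: ennreal_le_iff pos_divide_le_eq)
    qed
  qed
  with i show thesis using that[of \<gamma>] by (simp add: \<gamma>_def)
qed

lemma moll_tendsto:
  fixes a :: "real \<Rightarrow> real"
  assumes a: "continuous_on UNIV a"
  shows "(\<lambda>n. LBINT t. moll (Suc n) (t - x) * a t) \<longlonglongrightarrow> a x"
proof -
  have eq: "(LBINT t. moll (Suc n) (t - x) * a t) = (LBINT y. moll (Suc n) y * a (x + y))" for n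
    using integral_translate[of "\<lambda>t. moll (Suc n) (t - x) * a t" x] by (simp add: add.commute)
  have am[measurable]: "a \<in> borel_measurable borel" by (rule borel_measurable_continuous_onI[OF a])
  show ?thesis
  proof (rule LIMSEQ_I)
    fix r :: real assume "r > 0"
    then obtain d where d: "d > 0" "\<And>y. \<bar>y\<bar> < d \<Longrightarrow> \<bar>a (x + y) - a x\<bar> < r / 2"
      using a unfolding continuous_on_iff dist_real_def
      by (metis UNIV_I add_diff_cancel_left' half_gt_zero)
    obtain N where N: "1 / real (Suc N) < d" using nat_approx_posE[OF d(1)] by blast
    have "norm ((LBINT t. moll (Suc n) (t - x) * a t) - a x) < r" if n: "n \<ge> N" for n
    proof -
      note [measurable] = test1_measurable[OF moll_test1[of "Suc n"]]
      have small: "\<bar>a (x + y) - a x\<bar> < r / 2" if "\<bar>y\<bar> < 1 / real (Suc n)" for y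
      proof (rule d(2))
        have "1 / real (Suc n) \<le> 1 / real (Suc N)" using n by (simp add: field_simps)
        with that N show "\<bar>y\<bar> < d" by linarith
      qed
      have mi: "integrable lborel (moll (Suc n))" by (rule moll_integrable) simp
      have le: "\<bar>moll (Suc n) y * (a (x + y) - a x)\<bar> \<le> moll (Suc n) y * (r / 2)" for y
      proof (cases "\<bar>y\<bar> < 1 / real (Suc n)")
        case True
        show ?thesis using mult_left_mono[OF less_imp_le[OF small[OF True]] moll_nonneg[of "Suc n" y]] moll_nonneg[of "Suc n" y]
          by (simp add: abs_mult)
      next
        case False then show ?thesis using moll_zero[of "Suc n" y] by simp
      qed
      have i: "integrable lborel (\<lambda>y. moll (Suc n) y * (a (x + y) - a x))"
        by (rule integrable_bound[OF integrable_mult_left[OF mi, of "r / 2"]])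
          (measurable, use le in \<open>auto intro!: AE_I2 order_trans[OF _ abs_ge_self]\<close>)
      have "(LBINT y. moll (Suc n) y * a (x + y)) = (LBINT y. moll (Suc n) y * (a (x + y) - a x) + moll (Suc n) y * a x)"
        by (simp add: algebra_simps)
      also have "\<dots> = (LBINT y. moll (Suc n) y * (a (x + y) - a x)) + a x"
        using i mi integral_moll[of "Suc n"] by simp
      finally have "(LBINT t. moll (Suc n) (t - x) * a t) - a x = (LBINT y. moll (Suc n) y * (a (x + y) - a x))"
        unfolding eq by simp
      also have "\<bar>\<dots>\<bar> \<le> (LBINT y. moll (Suc n) y * (r / 2))"
        by (rule order_trans[OF integral_abs_bound integral_mono]) (use i mi le in auto)
      also have "\<dots> = r / 2" using integral_moll[of "Suc n"] by simp
      finally show ?thesis using \<open>r > 0\<close> by simp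
    qed
    then show "\<exists>no. \<forall>n\<ge>no. norm ((LBINT t. moll (Suc n) (t - x) * a t) - a x) < r" by blast
  qed
qed

text \<open>The fundamental theorem of calculus for a continuous function with a locally integrable
  distributional derivative. Testing with mollified indicators of [u, v], one side tends to the
  integral of \<open>b\<close> and the other to the endpoint values.\<close>

lemma time_du_Bois_Reymond:
  fixes b :: "real \<Rightarrow> complex" and a :: "real \<Rightarrow> real"
  assumes a: "continuous_on UNIV a" and b[measurable]: "b \<in> borel_measurable borel"
    and bi: "\<And>u v. set_integrable lborel {u..v} b"
    and eq: "\<And>\<theta> \<theta>'. test1 \<theta> \<Longrightarrow> test1 \<theta>' \<Longrightarrow> (\<And>t. (\<theta> has_real_derivative \<theta>' t) (at t)) \<Longrightarrow>
      (LBINT t. complex_of_real (\<theta> t) * b t) = - complex_of_real (LBINT t. \<theta>' t * a t)"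
    and uv: "u < v"
  shows "(LBINT t:{u..v}. b t) = complex_of_real (a v - a u)"
proof -
  obtain \<theta> :: "nat \<Rightarrow> real \<Rightarrow> real" where \<theta>: "\<And>n. test1 (\<theta> n)" "\<And>n x. \<bar>\<theta> n x\<bar> \<le> 1" "\<And>n x. x \<notin> {u-1..v+1} \<Longrightarrow> \<theta> n x = 0"
    "\<And>x. x \<noteq> u \<Longrightarrow> x \<noteq> v \<Longrightarrow> (\<lambda>n. \<theta> n x) \<longlonglongrightarrow> indicator {u..v} x"
    "\<And>n x. (\<theta> n has_real_derivative (moll (Suc n) (x - u) - moll (Suc n) (x - v))) (at x)"
    using indicator_by_test1[OF uv] by blast
  note [measurable] = test1_measurable[OF \<theta>(1)]
  have ms: "test1 (\<lambda>x. moll (Suc n) (x - c))" for n :: nat and c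
    using test1_affine[OF moll_test1[of "Suc n"], of 1 "- c"] by simp
  have "smooth (\<lambda>x. (-1::real))" by (rule smooth_const)
  then have "test1 (\<lambda>x. moll (Suc n) (x - u) + moll (Suc n) (x - v) * (-1))" for n :: nat
    by (intro test1_add test1_mult ms)
  then have t': "test1 (\<lambda>x. moll (Suc n) (x - u) - moll (Suc n) (x - v))" for n :: nat by simp
  have [measurable]: "a \<in> borel_measurable borel" by (rule borel_measurable_continuous_onI[OF a])
  have ci: "integrable lborel (\<lambda>t. moll (Suc n) (t - c) * a t)" for n :: nat and c
  proof -
    obtain R where R: "\<And>x. \<bar>x\<bar> > R \<Longrightarrow> moll (Suc n) (x - c) = 0" using ms[of n c] unfolding test1_def by blast
    have "continuous_on UNIV (\<lambda>t. moll (Suc n) (t - c) * a t)"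
      by (intro continuous_on_mult test1_continuous[OF ms] a)
    then obtain B where "\<And>x. norm (moll (Suc n) (x - c) * a x) \<le> B"
      by (rule bounded_compact_support[of _ R]) (use R in auto)
    then show ?thesis
      by (intro integrable_compact_support[where B=B and R=R]) (use R \<open>continuous_on UNIV (\<lambda>t. moll (Suc n) (t - c) * a t)\<close> in \<open>auto intro: borel_measurable_continuous_onI\<close>)
  qed
  have "(\<lambda>n. LBINT t. complex_of_real (\<theta> n t) * b t) \<longlonglongrightarrow> (LBINT t. complex_of_real (indicator {u..v} t) * b t)"
  proof (rule integral_dominated_convergence)
    show "integrable lborel (\<lambda>t. norm (indicator {u-1..v+1} t *\<^sub>R b t))"
      using bi[of "u-1" "v+1"] unfolding set_integrable_def by (rule integrable_norm)
    have "AE x in lborel. x \<noteq> u" "AE x in lborel. x \<noteq> v" by (rule AE_lborel_singleton)+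
    then show "AE t in lborel. (\<lambda>n. complex_of_real (\<theta> n t) * b t) \<longlonglongrightarrow> complex_of_real (indicator {u..v} t) * b t"
      by eventually_elim (intro tendsto_mult tendsto_const tendsto_of_real \<theta>(4))
    show "AE t in lborel. norm (complex_of_real (\<theta> n t) * b t) \<le> norm (indicator {u-1..v+1} t *\<^sub>R b t)" for n
    proof (rule AE_I2)
      fix t
      have "\<bar>\<theta> n t\<bar> * cmod (b t) \<le> 1 * cmod (b t)" by (intro mult_right_mono \<theta>(2)) simp
      then show "norm (complex_of_real (\<theta> n t) * b t) \<le> norm (indicator {u-1..v+1} t *\<^sub>R b t)"
        using \<theta>(3)[of t n] by (cases "t \<in> {u-1..v+1}") (auto simp: norm_mult)
    qed
  qed measurable
  moreover have "(LBINT t. complex_of_real (\<theta> n t) * b t) = - complex_of_real ((LBINT t. moll (Suc n) (t - u) * a t) - (LBINT t. moll (Suc n) (t - v) * a t))" for n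
  proof -
    have "(LBINT t. (moll (Suc n) (t - u) - moll (Suc n) (t - v)) * a t) = (LBINT t. moll (Suc n) (t - u) * a t) - (LBINT t. moll (Suc n) (t - v) * a t)"
      unfolding left_diff_distrib by (rule integral_diff[OF ci ci])
    then show ?thesis using eq[OF \<theta>(1) t' \<theta>(5), of n] by simp
  qed
  moreover have "(\<lambda>n. - complex_of_real ((LBINT t. moll (Suc n) (t - u) * a t) - (LBINT t. moll (Suc n) (t - v) * a t))) \<longlonglongrightarrow> - complex_of_real (a u - a v)"
    by (intro tendsto_minus tendsto_of_real tendsto_diff moll_tendsto a)
  ultimately have "(LBINT t. complex_of_real (indicator {u..v} t) * b t) = - complex_of_real (a u - a v)"
    by (simp add: LIMSEQ_unique)
  then show ?thesis by (simp add: set_lebesgue_integral_def scaleR_conv_of_real)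
qed

section \<open>Integration in time\<close>

definition L2cont :: "(real \<Rightarrow> real \<Rightarrow> real) \<Rightarrow> bool" where
  "L2cont g \<longleftrightarrow> (\<forall>t\<^sub>0. ((\<lambda>t. LBINT x. (g t x - g t\<^sub>0 x)\<^sup>2) \<longlongrightarrow> 0) (at t\<^sub>0))"

lemma L2cont_sequence:
  assumes "L2cont g" "X \<longlonglongrightarrow> t"
  shows "(\<lambda>n. LBINT x. (g (X n) x - g t x)\<^sup>2) \<longlonglongrightarrow> 0"
proof -
  have "((\<lambda>s. LBINT x. (g s x - g t x)\<^sup>2) \<longlongrightarrow> (LBINT x. (g t x - g t x)\<^sup>2)) (at t)"
    using assms(1) unfolding L2cont_def by simp
  then have "((\<lambda>s. LBINT x. (g s x - g t x)\<^sup>2) \<longlongrightarrow> (LBINT x. (g t x - g t x)\<^sup>2)) (nhds t)"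
    by (rule tendsto_at_iff_tendsto_nhds[of "\<lambda>s. LBINT x. (g s x - g t x)\<^sup>2" t, THEN iffD1])
  from filterlim_compose[OF this assms(2)] show ?thesis by simp
qed

lemma L2cont_pairing:
  assumes g: "L2cont g" "\<And>t. g t \<in> borel_measurable borel" "\<And>t. integrable lborel (\<lambda>x. (g t x)\<^sup>2)"
    and k: "k \<in> borel_measurable borel" "integrable lborel (\<lambda>x. (k x)\<^sup>2)"
  shows "continuous_on UNIV (\<lambda>t. LBINT x. g t x * k x)"
  unfolding continuous_on_eq_continuous_at[OF open_UNIV] isCont_def
proof
  fix t\<^sub>0
  note [measurable] = g(2) k(1)
  have "((\<lambda>t. (LBINT x. g t x * k x) - (LBINT x. g t\<^sub>0 x * k x)) \<longlongrightarrow> 0) (at t\<^sub>0)"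
  proof (rule Lim_null_comparison)
    show "\<forall>\<^sub>F t in at t\<^sub>0. norm ((LBINT x. g t x * k x) - (LBINT x. g t\<^sub>0 x * k x))
      \<le> sqrt (LBINT x. (g t x - g t\<^sub>0 x)\<^sup>2) * sqrt (LBINT x. (k x)\<^sup>2)"
    proof (intro always_eventually allI)
      fix t
      have i: "integrable lborel (\<lambda>x. g t x * k x)" for t
        by (rule integrable_square_product(1)) (use g k in auto)
      have d: "integrable lborel (\<lambda>x. (g t x - g t\<^sub>0 x)\<^sup>2)"
        by (rule integrable_square_product(3)) (use g in auto)
      have "(LBINT x. g t x * k x) - (LBINT x. g t\<^sub>0 x * k x) = (LBINT x. (g t x - g t\<^sub>0 x) * k x)"
        using i by (simp add: left_diff_distrib)
      also have "\<bar>\<dots>\<bar> \<le> (LBINT x. \<bar>(g t x - g t\<^sub>0 x) * k x\<bar>)" by (rule integral_abs_bound)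
      also have "\<dots> \<le> sqrt (LBINT x. (g t x - g t\<^sub>0 x)\<^sup>2) * sqrt (LBINT x. (k x)\<^sup>2)"
        by (rule Cauchy_Schwarz_integral) (use d k in auto)
      finally show "norm ((LBINT x. g t x * k x) - (LBINT x. g t\<^sub>0 x * k x))
        \<le> sqrt (LBINT x. (g t x - g t\<^sub>0 x)\<^sup>2) * sqrt (LBINT x. (k x)\<^sup>2)" by simp
    qed
    have "((\<lambda>t. sqrt (LBINT x. (g t x - g t\<^sub>0 x)\<^sup>2) * sqrt (LBINT x. (k x)\<^sup>2)) \<longlongrightarrow> sqrt 0 * sqrt (LBINT x. (k x)\<^sup>2)) (at t\<^sub>0)"
      using g(1) unfolding L2cont_def by (intro tendsto_intros) auto
    then show "((\<lambda>t. sqrt (LBINT x. (g t x - g t\<^sub>0 x)\<^sup>2) * sqrt (LBINT x. (k x)\<^sup>2)) \<longlongrightarrow> 0) (at t\<^sub>0)" by simp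
  qed
  then show "((\<lambda>t. LBINT x. g t x * k x) \<longlongrightarrow> (LBINT x. g t\<^sub>0 x * k x)) (at t\<^sub>0)"
    by (rule LIM_zero_cancel)
qed

text \<open>\<open>N\<close> cannot be integrated additively as long as its measurability is
  unknown. The integrable \<gamma> stands in for it: in time integrals of measurable functions
  bounded by \<open>N t * e\<close>, it may be used as if it were \<open>N\<close>.\<close>

definition dominates :: "(real \<Rightarrow> real) \<Rightarrow> real \<Rightarrow> (real \<Rightarrow> real) \<Rightarrow> bool" where
  "dominates N r \<gamma> \<longleftrightarrow> integrable lborel \<gamma> \<and> (\<forall>t. 0 \<le> \<gamma> t) \<and>
    (\<forall>(h :: real \<Rightarrow> complex) e u v. h \<in> borel_measurable borel \<longrightarrow> 0 \<le> e \<longrightarrow> (\<forall>t\<in>{u..v}. cmod (h t) \<le> N t * e) \<longrightarrow> {u..v} \<subseteq> {-r..r} \<longrightarrow>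
      set_integrable lborel {u..v} h \<and> cmod (LBINT t:{u..v}. h t) \<le> e * (LBINT t:{u..v}. \<gamma> t))"

lemma dominatesD:
  fixes h :: "real \<Rightarrow> complex"
  assumes "dominates N r \<gamma>"
    "h \<in> borel_measurable borel" "0 \<le> e" "\<And>t. t \<in> {u..v} \<Longrightarrow> cmod (h t) \<le> N t * e" "{u..v} \<subseteq> {-r..r}"
  shows "set_integrable lborel {u..v} h" "cmod (LBINT t:{u..v}. h t) \<le> e * (LBINT t:{u..v}. \<gamma> t)"
  using assms unfolding dominates_def by blast+

text \<open>A time-dependent element of \<open>H^(s-1)\<close> with norm at most \<open>N t\<close>,
  seen only through its values on admissible functions. The instances are \<open>u_xx\<close> and
  \<open>u_tx\<close>, with constant \<open>N\<close>, and \<open>u_tt\<close>, where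
  \<open>N\<close> is merely locally integrable.\<close>

locale time_dual =
  fixes \<sigma> :: real and N :: "real \<Rightarrow> real" and L :: "real \<Rightarrow> (real \<Rightarrow> real) \<Rightarrow> complex"
  assumes sigma: "1/2 < \<sigma>" "\<sigma> \<le> 1"
    and dual: "\<And>t. dual_fun \<sigma> (N t) (L t)" and N_nonneg: "\<And>t. 0 \<le> N t"
    and meas: "\<And>\<psi>. test1 \<psi> \<Longrightarrow> (\<lambda>t. L t \<psi>) \<in> borel_measurable borel"
    and N_int: "\<And>r. (\<integral>\<^sup>+t\<in>{-r..r}. ennreal (N t) \<partial>lborel) < \<infinity>"
begin

lemma sigma_pos: "0 < \<sigma>"
  using sigma by simp

lemma L_diff: "adm \<sigma> R M f \<Longrightarrow> adm \<sigma> R M g \<Longrightarrow> L t (\<lambda>x. f x - g x) = L t f - L t g"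
  using dual unfolding dual_fun_def by blast

lemma L_scale: "L t (\<lambda>x. a * f x) = complex_of_real a * L t f"
  using dual unfolding dual_fun_def by blast

lemma L_bound: "adm \<sigma> R M f \<Longrightarrow> (LBINT x. (f x)\<^sup>2) \<le> \<eta>\<^sup>2 \<Longrightarrow> cmod (L t f) \<le> N t * Qb \<sigma> M \<eta>"
  using dual unfolding dual_fun_def by blast

lemma L_add:
  assumes f: "adm \<sigma> R M f" and g: "adm \<sigma> R M g"
  shows "L t (\<lambda>x. f x + g x) = L t f + L t g"
proof -
  have "adm \<sigma> R M (\<lambda>x. (-1) * g x)" using adm_cmult[OF g, of "-1"] by simp
  from L_diff[OF f this, of t] show ?thesis by (simp only: L_scale) simp
qed

lemma L_diff_bound:
  assumes "adm \<sigma> R M f" "adm \<sigma> R M g" "(LBINT x. (f x - g x)\<^sup>2) \<le> \<eta>\<^sup>2"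
  shows "cmod (L t f - L t g) \<le> N t * Qb \<sigma> (2 * (M + M)) \<eta>"
  using L_bound[OF adm_diff[OF assms(1,2)] assms(3)] L_diff[OF assms(1,2)] by simp

lemma L_tendsto:
  assumes f: "\<And>n. adm \<sigma> R M (f n)" and g: "adm \<sigma> R M g" and lim: "(\<lambda>n. LBINT x. (f n x - g x)\<^sup>2) \<longlonglongrightarrow> 0"
  shows "(\<lambda>n. L t (f n)) \<longlonglongrightarrow> L t g"
proof -
  have "(\<lambda>n. sqrt (LBINT x. (f n x - g x)\<^sup>2)) \<longlonglongrightarrow> sqrt 0"
    by (intro tendsto_real_sqrt lim)
  then have "(\<lambda>n. N t * Qb \<sigma> (2 * (M + M)) (sqrt (LBINT x. (f n x - g x)\<^sup>2))) \<longlonglongrightarrow> N t * 0"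
    by (intro tendsto_mult tendsto_const Qb_tendsto_0 sigma) simp
  moreover have b: "norm (L t (f n) - L t g) \<le> N t * Qb \<sigma> (2 * (M + M)) (sqrt (LBINT x. (f n x - g x)\<^sup>2))" for n
    by (rule L_diff_bound[OF f g]) simp
  ultimately have "(\<lambda>n. L t (f n) - L t g) \<longlonglongrightarrow> 0"
    using Lim_null_comparison[OF always_eventually[OF allI[OF b]]] by simp
  then show ?thesis by (rule LIM_zero_cancel)
qed

lemma meas_adm:
  assumes f: "adm \<sigma> R M f" shows "(\<lambda>t. L t f) \<in> borel_measurable borel"
proof -
  obtain \<psi> where \<psi>: "\<And>n. test1 (\<psi> n)" "\<And>n. adm \<sigma> (R + 1) M (\<psi> n)" "(\<lambda>n::nat. LBINT x. (\<psi> n x - f x)\<^sup>2) \<longlonglongrightarrow> 0"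
    using mollify[OF f sigma_pos] by blast
  have f': "adm \<sigma> (R + 1) M f" by (rule adm_mono[OF f]) auto
  show ?thesis
    by (rule borel_measurable_LIMSEQ_metric[OF meas[OF \<psi>(1)]]) (rule L_tendsto[OF \<psi>(2) f' \<psi>(3)])
qed

lemma meas_family:
  assumes g: "\<And>t. adm \<sigma> R M (g t)" and c: "L2cont g"
  shows "(\<lambda>t. L t (g t)) \<in> borel_measurable borel"
proof -
  \<comment> \<open>Time is discretized to the grid of step 1/(n+1). The test function then takes
    countably many values, so measurability reduces to that for fixed functions.\<close>
  define T where "T n t = real_of_int \<lfloor>real (Suc n) * t\<rfloor> / real (Suc n)" for n t
  have T: "(\<lambda>n. T n t) \<longlonglongrightarrow> t" for t
  proof -
    have le: "\<bar>T n t - t\<bar> \<le> 1 / real (Suc n)" for n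
    proof -
      have "T n t - t = (real_of_int \<lfloor>real (Suc n) * t\<rfloor> - real (Suc n) * t) / real (Suc n)"
        unfolding T_def by (simp add: field_simps)
      also have "\<bar>\<dots>\<bar> \<le> 1 / real (Suc n)"
        unfolding abs_divide by (intro frac_le) (auto simp: abs_le_iff, linarith+)
      finally show ?thesis .
    qed
    have "(\<lambda>n. T n t - t) \<longlonglongrightarrow> 0"
      by (rule Lim_null_comparison[OF always_eventually LIMSEQ_Suc[OF lim_1_over_n]]) (use le in auto)
    then show ?thesis by (rule LIM_zero_cancel)
  qed
  show ?thesis
  proof (rule borel_measurable_LIMSEQ_metric[where f="\<lambda>n t. L t (g (T n t))"])
    show "(\<lambda>t. L t (g (T n t))) \<in> borel_measurable borel" for n
      unfolding T_def
      by (rule measurable_compose_countable[where f="\<lambda>i t. L t (g (real_of_int i / real (Suc n)))"])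
        (auto intro: meas_adm[OF g])
    show "(\<lambda>n. L t (g (T n t))) \<longlonglongrightarrow> L t (g t)" for t
      by (rule L_tendsto[OF g g L2cont_sequence[OF c T]])
  qed
qed

lemma majorant:
  obtains \<gamma> where "dominates N r \<gamma>"
proof (rule measurable_majorant[OF N_int N_nonneg, of r])
  fix \<gamma> :: "real \<Rightarrow> real"
  assume \<gamma>: "integrable lborel \<gamma>" "\<And>t. 0 \<le> \<gamma> t"
    and dom: "\<And>(h :: real \<Rightarrow> complex) e u v. \<lbrakk>h \<in> borel_measurable borel; 0 \<le> e; \<And>t. t \<in> {u..v} \<Longrightarrow> cmod (h t) \<le> N t * e; {u..v} \<subseteq> {-r..r}\<rbrakk>
      \<Longrightarrow> AE t in lborel. t \<in> {u..v} \<longrightarrow> cmod (h t) \<le> \<gamma> t * e"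
  have "set_integrable lborel {u..v} h \<and> cmod (LBINT t:{u..v}. h t) \<le> e * (LBINT t:{u..v}. \<gamma> t)"
    if h: "h \<in> borel_measurable borel" "0 \<le> e" "\<forall>t\<in>{u..v}. cmod (h t) \<le> N t * e" "{u..v} \<subseteq> {-r..r}"
    for h :: "real \<Rightarrow> complex" and e u v
  proof -
    note [measurable] = h(1)
    have i: "integrable lborel (\<lambda>t. indicator {u..v} t * \<gamma> t)"
      using integrable_real_mult_indicator[OF _ \<gamma>(1), of "{u..v}"] by (simp add: mult.commute)
    have "AE t in lborel. t \<in> {u..v} \<longrightarrow> cmod (h t) \<le> \<gamma> t * e"
      by (rule dom) (use h in auto)
    then have AE: "AE t in lborel. norm (indicator {u..v} t *\<^sub>R h t) \<le> e * (indicator {u..v} t * \<gamma> t)"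
      by (rule eventually_mono) (auto simp: indicator_def mult.commute)
    have AE': "AE t in lborel. norm (indicator {u..v} t *\<^sub>R h t) \<le> norm (e * (indicator {u..v} t * \<gamma> t))"
      using AE by (rule eventually_mono) (simp add: abs_mult \<gamma>(2) h(2))
    have hi: "integrable lborel (\<lambda>t. indicator {u..v} t *\<^sub>R h t)"
      by (rule integrable_bound[OF integrable_mult_right[OF i, of e] _ AE']) measurable
    have "cmod (LBINT t. indicator {u..v} t *\<^sub>R h t) \<le> (LBINT t. norm (indicator {u..v} t *\<^sub>R h t))"
      by (rule integral_norm_bound)
    also have "\<dots> \<le> (LBINT t. e * (indicator {u..v} t * \<gamma> t))"
      by (rule integral_mono_AE[OF integrable_norm[OF hi] _ AE]) (use i in simp)
    finally have "cmod (LBINT t. indicator {u..v} t *\<^sub>R h t) \<le> (LBINT t. e * (indicator {u..v} t * \<gamma> t))" .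
    with hi show ?thesis unfolding set_integrable_def set_lebesgue_integral_def by simp
  qed
  then have "dominates N r \<gamma>" unfolding dominates_def using \<gamma> by blast
  then show thesis by (rule that)
qed

lemma family_integrable:
  assumes g: "\<And>t. adm \<sigma> R M (g t)" and c: "L2cont g"
  shows "set_integrable lborel {u..v} (\<lambda>t. L t (g t))"
proof -
  have R: "(LBINT x. (g t x)\<^sup>2) \<le> (sqrt (2 * \<bar>R\<bar> * M\<^sup>2))\<^sup>2" for t
  proof -
    note a = admD[OF g[of t]]
    have "(LBINT x. (g t x)\<^sup>2) \<le> (LBINT x. M\<^sup>2 * indicator {-\<bar>R\<bar>..\<bar>R\<bar>} x)"
    proof (rule integral_mono')
      show "(g t x)\<^sup>2 \<le> M\<^sup>2 * indicator {-\<bar>R\<bar>..\<bar>R\<bar>} x" for x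
        using a(2)[of x] a(3)[of x] a(5) by (cases "\<bar>x\<bar> > R") (auto simp: indicator_def abs_le_square_iff[symmetric])
    qed (auto intro!: integrable_mult_right simp: integrable_indicator_iff emeasure_lborel_Icc_eq)
    then show ?thesis by (simp add: mult.commute)
  qed
  obtain \<gamma> where \<gamma>: "dominates N (\<bar>u\<bar> + \<bar>v\<bar>) \<gamma>" by (rule majorant)
  show ?thesis
    by (rule dominatesD(1)[OF \<gamma> meas_family[OF g c] Qb_nonneg[OF sigma(1)] L_bound[OF g R]]) auto
qed

lemma integral_limit:
  fixes h :: "nat \<Rightarrow> real \<Rightarrow> complex"
  assumes h: "\<And>n. h n \<in> borel_measurable borel" "h' \<in> borel_measurable borel"
    and i: "\<And>n. set_integrable lborel {u..v} (h n)" "set_integrable lborel {u..v} h'"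
    and le: "\<And>n t. cmod (h n t - h' t) \<le> N t * e n" and e: "\<And>n. 0 \<le> e n" "e \<longlonglongrightarrow> 0"
  shows "(\<lambda>n. LBINT t:{u..v}. h n t) \<longlonglongrightarrow> (LBINT t:{u..v}. h' t)"
proof -
  obtain \<gamma> where \<gamma>: "dominates N (\<bar>u\<bar> + \<bar>v\<bar>) \<gamma>" by (rule majorant)
  have b: "cmod ((LBINT t:{u..v}. h n t) - (LBINT t:{u..v}. h' t)) \<le> e n * (LBINT t:{u..v}. \<gamma> t)" for n
    unfolding set_integral_diff(2)[OF i, symmetric]
    by (rule dominatesD(2)[OF \<gamma>]) (use h e le in auto)
  have "(\<lambda>n. e n * (LBINT t:{u..v}. \<gamma> t)) \<longlonglongrightarrow> 0 * (LBINT t:{u..v}. \<gamma> t)"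
    by (intro tendsto_mult e tendsto_const)
  then have "(\<lambda>n. (LBINT t:{u..v}. h n t) - (LBINT t:{u..v}. h' t)) \<longlonglongrightarrow> 0"
    using Lim_null_comparison[OF always_eventually[OF allI[OF b]]] by simp
  then show ?thesis by (rule LIM_zero_cancel)
qed

text \<open>The distributional hypothesis speaks of smooth test functions only. For these,
  \<open>time_du_Bois_Reymond\<close> applies; an admissible \<open>f\<close> is then reached by
  mollification, with errors controlled uniformly in time relative to \<open>N\<close>.\<close>

lemma time_integral:
  assumes g: "L2cont g" "\<And>t. g t \<in> borel_measurable borel" "\<And>t. integrable lborel (\<lambda>x. (g t x)\<^sup>2)"
    and eq: "\<And>\<theta> \<theta>' \<psi>. \<lbrakk>test1 \<theta>; test1 \<theta>'; \<And>t. (\<theta> has_real_derivative \<theta>' t) (at t); test1 \<psi>\<rbrakk> \<Longrightarrow>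
      (LBINT t. complex_of_real (\<theta> t) * L t \<psi>) = - complex_of_real (LBINT t. \<theta>' t * (LBINT x. g t x * \<psi> x))"
    and f: "adm \<sigma> R M f" and uv: "u < v"
  shows "(LBINT t:{u..v}. L t f) = complex_of_real ((LBINT x. g v x * f x) - (LBINT x. g u x * f x))"
proof -
  obtain \<psi> where \<psi>: "\<And>n. test1 (\<psi> n)" "\<And>n. adm \<sigma> (R + 1) M (\<psi> n)" "(\<lambda>n::nat. LBINT x. (\<psi> n x - f x)\<^sup>2) \<longlonglongrightarrow> 0"
    using mollify[OF f sigma_pos] by blast
  have f': "adm \<sigma> (R + 1) M f" by (rule adm_mono[OF f]) auto
  have c: "L2cont (\<lambda>_. k)" for k by (simp add: L2cont_def)
  have 1: "(LBINT t:{u..v}. L t (\<psi> n)) = complex_of_real ((LBINT x. g v x * \<psi> n x) - (LBINT x. g u x * \<psi> n x))" for n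
  proof (rule time_du_Bois_Reymond)
    show "continuous_on UNIV (\<lambda>t. LBINT x. g t x * \<psi> n x)"
      by (rule L2cont_pairing[OF g admD(1) adm_integrable(2)]) (rule \<psi>(2))+
    show "set_integrable lborel {u..v} (\<lambda>t. L t (\<psi> n))" for u v
      by (rule family_integrable[OF \<psi>(2) c])
  qed (use \<psi>(1) meas eq uv in auto)
  define d where "d n = sqrt (LBINT x. (\<psi> n x - f x)\<^sup>2)" for n
  have d: "d \<longlonglongrightarrow> 0" unfolding d_def using tendsto_real_sqrt[OF \<psi>(3)] by simp
  have "(\<lambda>n. LBINT t:{u..v}. L t (\<psi> n)) \<longlonglongrightarrow> (LBINT t:{u..v}. L t f)"
  proof (rule integral_limit)
    show "cmod (L t (\<psi> n) - L t f) \<le> N t * Qb \<sigma> (2 * (M + M)) (d n)" for n t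
      by (rule L_diff_bound[OF \<psi>(2) f']) (simp add: d_def)
    show "(\<lambda>n. Qb \<sigma> (2 * (M + M)) (d n)) \<longlonglongrightarrow> 0" by (rule Qb_tendsto_0[OF sigma(1) d])
  qed (auto intro: meas_adm \<psi>(2) f family_integrable[OF _ c] Qb_nonneg sigma)
  moreover have lim: "(\<lambda>n. LBINT x. g t x * \<psi> n x) \<longlonglongrightarrow> (LBINT x. g t x * f x)" for t
  proof -
    note [measurable] = g(2) admD(1)[OF \<psi>(2)] admD(1)[OF f]
    have b: "norm ((LBINT x. g t x * \<psi> n x) - (LBINT x. g t x * f x)) \<le> sqrt (LBINT x. (g t x)\<^sup>2) * d n" for n
    proof -
      have i: "integrable lborel (\<lambda>x. g t x * \<psi> n x)" "integrable lborel (\<lambda>x. g t x * f x)"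
        by (rule integrable_square_product(1); use g adm_integrable(2)[OF \<psi>(2)] adm_integrable(2)[OF f] in auto)+
      have "(LBINT x. g t x * \<psi> n x) - (LBINT x. g t x * f x) = (LBINT x. g t x * (\<psi> n x - f x))"
        using i by (simp add: right_diff_distrib)
      also have "\<bar>\<dots>\<bar> \<le> (LBINT x. \<bar>g t x * (\<psi> n x - f x)\<bar>)" by (rule integral_abs_bound)
      also have "\<dots> \<le> sqrt (LBINT x. (g t x)\<^sup>2) * d n"
        unfolding d_def
        by (rule Cauchy_Schwarz_integral) (use g integrable_square_product(3)[OF _ _ adm_integrable(2)[OF \<psi>(2)] adm_integrable(2)[OF f]] in auto)
      finally show ?thesis by simp
    qed
    have "(\<lambda>n. sqrt (LBINT x. (g t x)\<^sup>2) * d n) \<longlonglongrightarrow> sqrt (LBINT x. (g t x)\<^sup>2) * 0"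
      by (intro tendsto_mult tendsto_const d)
    then have "(\<lambda>n. (LBINT x. g t x * \<psi> n x) - (LBINT x. g t x * f x)) \<longlonglongrightarrow> 0"
      using Lim_null_comparison[OF always_eventually[OF allI[OF b]]] by simp
    then show ?thesis by (rule LIM_zero_cancel)
  qed
  have "(\<lambda>n. complex_of_real ((LBINT x. g v x * \<psi> n x) - (LBINT x. g u x * \<psi> n x))) \<longlonglongrightarrow>
    complex_of_real ((LBINT x. g v x * f x) - (LBINT x. g u x * f x))"
    by (intro tendsto_of_real tendsto_diff lim)
  ultimately show ?thesis unfolding 1 using LIMSEQ_unique by blast
qed

end

section \<open>Lipschitz nonlinearities with quadratic Taylor remainder\<close>

definition nice :: "(real \<Rightarrow> real \<Rightarrow> real) \<Rightarrow> bool" where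
  "nice H \<longleftrightarrow> (\<exists>L. lipb L H) \<and> (\<lambda>z. H (fst z) (snd z)) \<in> borel_measurable borel"

lemma lipbD:
  assumes "lipb L H"
  shows "\<lbrakk>\<bar>a\<bar> \<le> 1; \<bar>b\<bar> \<le> 1\<rbrakk> \<Longrightarrow> \<bar>H a b\<bar> \<le> L"
    "\<lbrakk>\<bar>a\<bar> \<le> 1; \<bar>b\<bar> \<le> 1; \<bar>a'\<bar> \<le> 1; \<bar>b'\<bar> \<le> 1\<rbrakk> \<Longrightarrow> \<bar>H a' b' - H a b\<bar> \<le> L * (\<bar>a' - a\<bar> + \<bar>b' - b\<bar>)"
    "0 \<le> L"
proof -
  show "\<lbrakk>\<bar>a\<bar> \<le> 1; \<bar>b\<bar> \<le> 1\<rbrakk> \<Longrightarrow> \<bar>H a b\<bar> \<le> L"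
    "\<lbrakk>\<bar>a\<bar> \<le> 1; \<bar>b\<bar> \<le> 1; \<bar>a'\<bar> \<le> 1; \<bar>b'\<bar> \<le> 1\<rbrakk> \<Longrightarrow> \<bar>H a' b' - H a b\<bar> \<le> L * (\<bar>a' - a\<bar> + \<bar>b' - b\<bar>)"
    using assms unfolding lipb_def by blast+
  have "\<bar>H 0 0\<bar> \<le> L" using assms[unfolded lipb_def, rule_format, of 0 0 0 0] by simp
  then show "0 \<le> L" by (rule order_trans[OF abs_ge_zero])
qed

lemma niceE:
  assumes "nice H" obtains L where "lipb L H"
  using assms unfolding nice_def by blast

lemma nice_measurable:
  assumes "nice H" "p \<in> borel_measurable M" "q \<in> borel_measurable M"
  shows "(\<lambda>x. H (p x) (q x)) \<in> borel_measurable M"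
  using measurable_compose[OF borel_measurable_Pair[OF assms(2,3)] conjunct2[OF assms(1)[unfolded nice_def]]] by simp

lemma nice_const: "nice (\<lambda>a b. c)"
  unfolding nice_def by (auto simp: lipb_def intro!: exI[of _ "\<bar>c\<bar>"])

lemma nice_fst: "nice (\<lambda>a b. a)" and nice_snd: "nice (\<lambda>a b. b)"
  unfolding nice_def by (auto simp: lipb_def intro!: exI[of _ 1] borel_measurable_continuous_onI continuous_intros)

lemma nice_add:
  assumes "nice H" "nice K" shows "nice (\<lambda>a b. H a b + K a b)"
proof -
  obtain L L' where L: "lipb L H" "lipb L' K" using assms niceE by metis
  have "lipb (L + L') (\<lambda>a b. H a b + K a b)"
    unfolding lipb_def
  proof (intro allI impI conjI)
    fix a b a' b' :: real assume ab: "\<bar>a\<bar> \<le> 1" "\<bar>b\<bar> \<le> 1" "\<bar>a'\<bar> \<le> 1" "\<bar>b'\<bar> \<le> 1"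
    show "\<bar>H a b + K a b\<bar> \<le> L + L'"
      using lipbD(1)[OF L(1) ab(1,2)] lipbD(1)[OF L(2) ab(1,2)] by linarith
    show "\<bar>H a' b' + K a' b' - (H a b + K a b)\<bar> \<le> (L + L') * (\<bar>a' - a\<bar> + \<bar>b' - b\<bar>)"
      unfolding distrib_right[of L L'] using lipbD(2)[OF L(1) ab] lipbD(2)[OF L(2) ab] by linarith
  qed
  with assms show ?thesis unfolding nice_def by auto
qed

lemma nice_mult:
  assumes "nice H" "nice K" shows "nice (\<lambda>a b. H a b * K a b)"
proof -
  obtain L L' where L: "lipb L H" "lipb L' K" using assms niceE by metis
  note nn = lipbD(3)[OF L(1)] lipbD(3)[OF L(2)]
  have "lipb (2 * L * L') (\<lambda>a b. H a b * K a b)"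
    unfolding lipb_def
  proof (intro allI impI conjI)
    fix a b a' b' :: real assume ab: "\<bar>a\<bar> \<le> 1" "\<bar>b\<bar> \<le> 1" "\<bar>a'\<bar> \<le> 1" "\<bar>b'\<bar> \<le> 1"
    let ?d = "\<bar>a' - a\<bar> + \<bar>b' - b\<bar>"
    have "\<bar>H a b * K a b\<bar> \<le> L * L'"
      unfolding abs_mult by (intro mult_mono lipbD(1)[OF L(1)] lipbD(1)[OF L(2)] ab nn) auto
    moreover have "0 \<le> L * L'" using nn by simp
    ultimately show "\<bar>H a b * K a b\<bar> \<le> 2 * L * L'" by linarith
    have "H a' b' * K a' b' - H a b * K a b = (H a' b' - H a b) * K a' b' + H a b * (K a' b' - K a b)"
      by (simp add: algebra_simps)
    also have "\<bar>\<dots>\<bar> \<le> \<bar>H a' b' - H a b\<bar> * \<bar>K a' b'\<bar> + \<bar>H a b\<bar> * \<bar>K a' b' - K a b\<bar>"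
      by (rule order_trans[OF abs_triangle_ineq]) (simp add: abs_mult)
    also have "\<dots> \<le> (L * ?d) * L' + L * (L' * ?d)"
      by (intro add_mono mult_mono lipbD(1,2)[OF L(1)] lipbD(1,2)[OF L(2)] ab nn mult_nonneg_nonneg) auto
    finally show "\<bar>H a' b' * K a' b' - H a b * K a b\<bar> \<le> 2 * L * L' * ?d" by (simp add: algebra_simps)
  qed
  with assms show ?thesis unfolding nice_def by auto
qed

definition taylor :: "real \<Rightarrow> (real \<Rightarrow> real \<Rightarrow> real) \<Rightarrow> (real \<Rightarrow> real \<Rightarrow> real) \<Rightarrow> (real \<Rightarrow> real \<Rightarrow> real) \<Rightarrow> bool" where
  "taylor C G Gp Gq \<longleftrightarrow> 0 \<le> C \<and> (\<forall>a b a' b'. \<bar>a\<bar> \<le> 1 \<longrightarrow> \<bar>b\<bar> \<le> 1 \<longrightarrow> \<bar>a'\<bar> \<le> 1 \<longrightarrow> \<bar>b'\<bar> \<le> 1 \<longrightarrow>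
     \<bar>G a' b' - G a b - Gp a b * (a' - a) - Gq a b * (b' - b)\<bar> \<le> C * ((a' - a)\<^sup>2 + (b' - b)\<^sup>2))"

lemma taylorD:
  assumes "taylor C G Gp Gq"
  shows "0 \<le> C" "\<lbrakk>\<bar>a\<bar> \<le> 1; \<bar>b\<bar> \<le> 1; \<bar>a'\<bar> \<le> 1; \<bar>b'\<bar> \<le> 1\<rbrakk> \<Longrightarrow>
    \<bar>G a' b' - G a b - Gp a b * (a' - a) - Gq a b * (b' - b)\<bar> \<le> C * ((a' - a)\<^sup>2 + (b' - b)\<^sup>2)"
  using assms unfolding taylor_def by blast+

text \<open>Differentiability is encoded by the quadratic Taylor bound on the unit square, the only
  form in which it is used. Sums and products preserve it and produce the partial derivatives as
  explicit terms, so no two-variable calculus is needed for the concrete densities.\<close>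

definition C2 :: "(real \<Rightarrow> real \<Rightarrow> real) \<Rightarrow> (real \<Rightarrow> real \<Rightarrow> real) \<Rightarrow> (real \<Rightarrow> real \<Rightarrow> real) \<Rightarrow> bool" where
  "C2 G Gp Gq \<longleftrightarrow> nice G \<and> nice Gp \<and> nice Gq \<and> (\<exists>C. taylor C G Gp Gq)"

lemma C2_const: "C2 (\<lambda>a b. c) (\<lambda>a b. 0) (\<lambda>a b. 0)"
  unfolding C2_def taylor_def using nice_const by (auto intro!: exI[of _ 0])

lemma C2_fst: "C2 (\<lambda>a b. a) (\<lambda>a b. 1) (\<lambda>a b. 0)" and C2_snd: "C2 (\<lambda>a b. b) (\<lambda>a b. 0) (\<lambda>a b. 1)"
  unfolding C2_def taylor_def using nice_const nice_fst nice_snd by (auto intro!: exI[of _ 0])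

lemma C2_add:
  assumes "C2 G Gp Gq" "C2 H Hp Hq"
  shows "C2 (\<lambda>a b. G a b + H a b) (\<lambda>a b. Gp a b + Hp a b) (\<lambda>a b. Gq a b + Hq a b)"
proof -
  obtain C where "taylor C G Gp Gq" using assms(1) unfolding C2_def by blast
  note C = taylorD[OF this]
  obtain D where "taylor D H Hp Hq" using assms(2) unfolding C2_def by blast
  note D = taylorD[OF this]
  have "\<bar>(G a' b' + H a' b') - (G a b + H a b) - (Gp a b + Hp a b) * (a' - a) - (Gq a b + Hq a b) * (b' - b)\<bar> \<le> (C + D) * ((a' - a)\<^sup>2 + (b' - b)\<^sup>2)"
    if "\<bar>a\<bar> \<le> 1" "\<bar>b\<bar> \<le> 1" "\<bar>a'\<bar> \<le> 1" "\<bar>b'\<bar> \<le> 1" for a b a' b'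
  proof -
    have "(G a' b' + H a' b') - (G a b + H a b) - (Gp a b + Hp a b) * (a' - a) - (Gq a b + Hq a b) * (b' - b)
      = (G a' b' - G a b - Gp a b * (a' - a) - Gq a b * (b' - b)) + (H a' b' - H a b - Hp a b * (a' - a) - Hq a b * (b' - b))"
      by (simp add: algebra_simps)
    also have "\<bar>\<dots>\<bar> \<le> C * ((a' - a)\<^sup>2 + (b' - b)\<^sup>2) + D * ((a' - a)\<^sup>2 + (b' - b)\<^sup>2)"
      by (rule order_trans[OF abs_triangle_ineq add_mono[OF C(2)[OF that] D(2)[OF that]]])
    finally show ?thesis by (simp add: distrib_right)
  qed
  with assms C(1) D(1) show ?thesis
    unfolding C2_def taylor_def by (auto intro!: nice_add exI[of _ "C + D"])
qed

lemma C2_mult: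
  assumes "C2 G Gp Gq" "C2 H Hp Hq"
  shows "C2 (\<lambda>a b. G a b * H a b) (\<lambda>a b. Gp a b * H a b + G a b * Hp a b) (\<lambda>a b. Gq a b * H a b + G a b * Hq a b)"
proof -
  obtain C where "taylor C G Gp Gq" using assms(1) unfolding C2_def by blast
  note C = taylorD[OF this]
  obtain D where "taylor D H Hp Hq" using assms(2) unfolding C2_def by blast
  note D = taylorD[OF this]
  obtain L L' where L: "lipb L G" "lipb L' H" using assms niceE unfolding C2_def by metis
  note nn = lipbD(3)[OF L(1)] lipbD(3)[OF L(2)]
  have "\<bar>G a' b' * H a' b' - G a b * H a b - (Gp a b * H a b + G a b * Hp a b) * (a' - a) - (Gq a b * H a b + G a b * Hq a b) * (b' - b)\<bar>
      \<le> (L' * C + L * D + 2 * L * L') * ((a' - a)\<^sup>2 + (b' - b)\<^sup>2)"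
    if ab: "\<bar>a\<bar> \<le> 1" "\<bar>b\<bar> \<le> 1" "\<bar>a'\<bar> \<le> 1" "\<bar>b'\<bar> \<le> 1" for a b a' b'
  proof -
    let ?e = "(a' - a)\<^sup>2 + (b' - b)\<^sup>2" and ?d = "\<bar>a' - a\<bar> + \<bar>b' - b\<bar>"
    let ?RG = "G a' b' - G a b - Gp a b * (a' - a) - Gq a b * (b' - b)"
    let ?RH = "H a' b' - H a b - Hp a b * (a' - a) - Hq a b * (b' - b)"
    let ?X = "G a' b' * H a' b' - G a b * H a b - (Gp a b * H a b + G a b * Hp a b) * (a' - a) - (Gq a b * H a b + G a b * Hq a b) * (b' - b)"
    \<comment> \<open>The remainder of a product is made of the two individual remainders and the
      product of the two increments; the latter is quadratic by the Lipschitz bounds.\<close>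
    have eq: "?X = H a b * ?RG + G a b * ?RH + (G a' b' - G a b) * (H a' b' - H a b)"
      by (simp add: algebra_simps)
    have tri: "\<bar>x * x' + y * y' + z * z'\<bar> \<le> \<bar>x\<bar> * \<bar>x'\<bar> + \<bar>y\<bar> * \<bar>y'\<bar> + \<bar>z\<bar> * \<bar>z'\<bar>" for x x' y y' z z' :: real
      unfolding abs_mult[symmetric] by linarith
    have "\<bar>?X\<bar> \<le> \<bar>H a b\<bar> * \<bar>?RG\<bar> + \<bar>G a b\<bar> * \<bar>?RH\<bar> + \<bar>G a' b' - G a b\<bar> * \<bar>H a' b' - H a b\<bar>"
      unfolding eq by (rule tri)
    also have "\<dots> \<le> L' * (C * ?e) + L * (D * ?e) + (L * ?d) * (L' * ?d)"
    proof (rule add_mono[OF add_mono])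
      show "\<bar>H a b\<bar> * \<bar>?RG\<bar> \<le> L' * (C * ?e)"
        by (rule mult_mono[OF lipbD(1)[OF L(2) ab(1,2)] C(2)[OF ab] nn(2) abs_ge_zero])
      show "\<bar>G a b\<bar> * \<bar>?RH\<bar> \<le> L * (D * ?e)"
        by (rule mult_mono[OF lipbD(1)[OF L(1) ab(1,2)] D(2)[OF ab] nn(1) abs_ge_zero])
      show "\<bar>G a' b' - G a b\<bar> * \<bar>H a' b' - H a b\<bar> \<le> (L * ?d) * (L' * ?d)"
        by (rule mult_mono[OF lipbD(2)[OF L(1) ab] lipbD(2)[OF L(2) ab] _ abs_ge_zero]) (use nn in simp)
    qed
    finally have 1: "\<bar>?X\<bar> \<le> L' * (C * ?e) + L * (D * ?e) + (L * ?d) * (L' * ?d)" .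
    have "(L * ?d) * (L' * ?d) = L * L' * ?d\<^sup>2" by (simp add: power2_eq_square)
    also have "\<dots> \<le> L * L' * (2 * ?e)"
      using abs_sum_square[of "a' - a" "b' - b"] nn by (intro mult_left_mono) auto
    finally have 2: "(L * ?d) * (L' * ?d) \<le> L * L' * (2 * ?e)" .
    have "x \<le> (L' * C + L * D + 2 * L * L') * e"
      if "x \<le> L' * (C * e) + L * (D * e) + w" "w \<le> L * L' * (2 * e)" for x w e :: real
      using that by (simp add: algebra_simps)
    from this[OF 1 2] show ?thesis .
  qed
  then have "\<exists>E\<ge>0. \<forall>a b a' b'. \<bar>a\<bar> \<le> 1 \<longrightarrow> \<bar>b\<bar> \<le> 1 \<longrightarrow> \<bar>a'\<bar> \<le> 1 \<longrightarrow> \<bar>b'\<bar> \<le> 1 \<longrightarrow>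
    \<bar>G a' b' * H a' b' - G a b * H a b - (Gp a b * H a b + G a b * Hp a b) * (a' - a) - (Gq a b * H a b + G a b * Hq a b) * (b' - b)\<bar>
      \<le> E * ((a' - a)\<^sup>2 + (b' - b)\<^sup>2)"
    using C(1) D(1) nn by (intro exI[of _ "L' * C + L * D + 2 * L * L'"]) auto
  with assms show ?thesis
    unfolding C2_def taylor_def by (auto intro!: nice_add nice_mult)
qed

text \<open>With r = 1/(1 + a^2), r' its value at a' and d = a' - a, one has r' - r = -(a' + a) d r
  r'. The Taylor remainder becomes r d (2 a (r - r') - d r'), whose bracket is at most (4 + 1) |d|;
  hence the constant 5.\<close>

lemma C2_weight: "C2 (\<lambda>a b. 1 / (1 + a\<^sup>2)) (\<lambda>a b. - 2 * a * (1 / (1 + a\<^sup>2)) * (1 / (1 + a\<^sup>2))) (\<lambda>a b. 0)"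
proof -
  let ?r = "\<lambda>a::real. 1 / (1 + a\<^sup>2)"
  have r: "0 \<le> ?r a" "?r a \<le> 1" for a using weight_pos[of a] by (auto simp: field_simps)
  have d: "?r a' - ?r a = - ((a' + a) * (a' - a) * (?r a * ?r a'))" for a a'
  proof -
    have "1 / y - 1 / x = - ((y - x) * (1 / x * (1 / y)))" if "x > 0" "y > 0" for x y :: real
      using that by (simp add: field_simps)
    note this[OF weight_pos[of a] weight_pos[of a']]
    moreover have "1 + a'\<^sup>2 - (1 + a\<^sup>2) = (a' + a) * (a' - a)" by (simp add: power2_eq_square algebra_simps)
    ultimately show ?thesis by (simp only:)
  qed
  have dr: "\<bar>?r a' - ?r a\<bar> \<le> 2 * \<bar>a' - a\<bar>" if "\<bar>a\<bar> \<le> 1" "\<bar>a'\<bar> \<le> 1" for a a'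
  proof -
    have "\<bar>?r a' - ?r a\<bar> = (\<bar>a' + a\<bar> * \<bar>a' - a\<bar>) * (?r a * ?r a')"
      unfolding d abs_minus_cancel abs_mult using r by (simp add: abs_of_nonneg)
    also have "\<dots> \<le> (2 * \<bar>a' - a\<bar>) * (1 * 1)"
      using that r by (intro mult_mono) auto
    finally show ?thesis by simp
  qed
  have n: "nice (\<lambda>a b. ?r a)"
    unfolding nice_def lipb_def
  proof (intro conjI exI[of _ 2] allI impI)
    fix a b a' b' :: real assume "\<bar>a\<bar> \<le> 1" "\<bar>a'\<bar> \<le> 1"
    then show "\<bar>?r a' - ?r a\<bar> \<le> 2 * (\<bar>a' - a\<bar> + \<bar>b' - b\<bar>)" by (intro order_trans[OF dr]) auto
    show "\<bar>?r a\<bar> \<le> 2" using r[of a] by simp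
  next
    show "(\<lambda>z. ?r (fst z)) \<in> borel_measurable borel"
      by (intro borel_measurable_continuous_onI continuous_intros) (metis weight_pos less_irrefl)
  qed
  have sq: "\<bar>x\<bar> * (5 * \<bar>x\<bar>) = 5 * x\<^sup>2" for x :: real
    by (cases "x \<ge> 0") (auto simp: power2_eq_square)
  have "\<bar>?r a' - ?r a - (- 2 * a * ?r a * ?r a) * (a' - a) - 0 * (b' - b)\<bar> \<le> 5 * ((a' - a)\<^sup>2 + (b' - b)\<^sup>2)"
    if ab: "\<bar>a\<bar> \<le> 1" "\<bar>a'\<bar> \<le> 1" for a b a' b' :: real
  proof -
    define A where "A = ?r a"
    define A' where "A' = ?r a'"
    have A: "0 \<le> A" "A \<le> 1" "0 \<le> A'" "A' \<le> 1" "A' - A = - ((a' + a) * (a' - a) * (A * A'))"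
      "\<bar>A - A'\<bar> \<le> 2 * \<bar>a - a'\<bar>"
      using r d dr[of a' a] ab unfolding A_def A'_def by auto
    have "A' - A - (- 2 * a * A * A) * (a' - a) - 0 * (b' - b) = (A' - A) + 2 * a * A * A * (a' - a)"
      by simp
    also have "\<dots> = A * (a' - a) * (2 * a * (A - A') - (a' - a) * A')"
      unfolding A(5) by (simp add: algebra_simps)
    also have "\<bar>\<dots>\<bar> = A * \<bar>a' - a\<bar> * \<bar>2 * a * (A - A') - (a' - a) * A'\<bar>"
      unfolding abs_mult using A by (simp add: abs_of_nonneg)
    also have "\<dots> \<le> 1 * \<bar>a' - a\<bar> * (5 * \<bar>a' - a\<bar>)"
    proof (intro mult_mono)
      have 1: "\<bar>2 * a * (A - A')\<bar> \<le> 2 * (2 * \<bar>a - a'\<bar>)"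
        unfolding abs_mult[of "2 * a"] using ab A by (intro mult_mono) auto
      have 2: "\<bar>(a' - a) * A'\<bar> \<le> \<bar>a' - a\<bar> * 1"
        unfolding abs_mult using A by (intro mult_left_mono) auto
      show "\<bar>2 * a * (A - A') - (a' - a) * A'\<bar> \<le> 5 * \<bar>a' - a\<bar>"
        using order_trans[OF abs_triangle_ineq4 add_mono[OF 1 2]] by (simp add: abs_minus_commute)
    qed (use A in auto)
    also have "\<dots> \<le> 5 * ((a' - a)\<^sup>2 + (b' - b)\<^sup>2)"
      unfolding mult_1 sq by simp
    finally show ?thesis unfolding A_def A'_def .
  qed
  moreover have "nice (\<lambda>a b. - 2 * a * ?r a * ?r a)"
    by (intro nice_mult nice_const nice_fst n)
  ultimately show ?thesis
    unfolding C2_def taylor_def using n nice_const[of 0] by (auto intro!: exI[of _ 5])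
qed

section \<open>Conservation laws\<close>

lemma set_integral_combine:
  fixes f :: "real \<Rightarrow> 'a::{banach, second_countable_topology}"
  assumes ab: "a \<le> b" "b \<le> c" and i: "set_integrable lborel {a..b} f" "set_integrable lborel {b..c} f"
  shows "(LBINT t:{a..c}. f t) = (LBINT t:{a..b}. f t) + (LBINT t:{b..c}. f t)"
proof -
  have i': "integrable lborel (\<lambda>t. indicator {a..b} t *\<^sub>R f t)" "integrable lborel (\<lambda>t. indicator {b..c} t *\<^sub>R f t)"
    using i unfolding set_integrable_def by auto
  have AE: "AE t in lborel. indicator {a..b} t *\<^sub>R f t + indicator {b..c} t *\<^sub>R f t = indicator {a..c} t *\<^sub>R f t"
    by (rule AE_mp[OF AE_lborel_singleton[of b]]) (use ab in \<open>auto simp: indicator_def intro!: AE_I2\<close>)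
  have s: "integrable lborel (\<lambda>t. indicator {a..b} t *\<^sub>R f t + indicator {b..c} t *\<^sub>R f t)"
    using i' by simp
  have "(LBINT t. indicator {a..c} t *\<^sub>R f t) = (LBINT t. indicator {a..b} t *\<^sub>R f t + indicator {b..c} t *\<^sub>R f t)"
  proof (cases "(\<lambda>t. indicator {a..c} t *\<^sub>R f t) \<in> borel_measurable lborel")
    case True
    then show ?thesis by (intro integral_cong_AE borel_measurable_integrable[OF s]) (use AE in \<open>auto elim: eventually_mono\<close>)
  next
    case False
    have "(\<lambda>t. indicator {a..c} t *\<^sub>R f t) = (\<lambda>t. if t \<in> {b} then f b else indicator {a..b} t *\<^sub>R f t + indicator {b..c} t *\<^sub>R f t)"
      using ab by (auto simp: indicator_def fun_eq_iff)
    moreover have "(\<lambda>t. if t \<in> {b} then f b else indicator {a..b} t *\<^sub>R f t + indicator {b..c} t *\<^sub>R f t) \<in> borel_measurable lborel"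
      by (intro measurable_If_set borel_measurable_integrable[OF s]) auto
    ultimately show ?thesis using False by simp
  qed
  then show ?thesis using i' by (simp add: set_lebesgue_integral_def)
qed

text \<open>An estimate that holds only on short intervals, but with a right-hand side additive over
  intervals, sums up over a subdivision without loss. Here \<Gamma> is a primitive of a time
  majorant and \<open>e\<close> is arbitrary.\<close>

lemma telescoping_bound:
  fixes D \<Gamma> :: "real \<Rightarrow> real"
  assumes ab: "a < b" and \<delta>: "\<delta> > 0"
    and step: "\<And>t t'. \<lbrakk>a \<le> t; t < t'; t' \<le> b; t' - t < \<delta>\<rbrakk> \<Longrightarrow> \<bar>D t' - D t\<bar> \<le> e * (\<Gamma> t' - \<Gamma> t)"
  shows "\<bar>D b - D a\<bar> \<le> e * (\<Gamma> b - \<Gamma> a)"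
proof -
  obtain n :: nat where n: "(b - a) / \<delta> < real n" using reals_Archimedean2 by blast
  have n0: "n > 0" using n ab \<delta> by (metis divide_pos_pos diff_gt_0_iff_gt gr0I less_asym of_nat_0)
  define h where "h = (b - a) / real n"
  have h: "h > 0" "h < \<delta>" "real n * h = b - a"
    using n n0 ab \<delta> by (auto simp: h_def field_simps)
  have "\<bar>D (a + real k * h) - D a\<bar> \<le> e * (\<Gamma> (a + real k * h) - \<Gamma> a)" if "k \<le> n" for k
    using that
  proof (induction k)
    case (Suc k)
    let ?t = "a + real k * h" and ?t' = "a + real (Suc k) * h"
    have "real (Suc k) * h \<le> real n * h" using Suc.prems h by (intro mult_right_mono) auto
    then have "\<bar>D ?t' - D ?t\<bar> \<le> e * (\<Gamma> ?t' - \<Gamma> ?t)"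
      using h by (intro step) (auto simp: algebra_simps)
    moreover have "\<bar>D ?t - D a\<bar> \<le> e * (\<Gamma> ?t - \<Gamma> a)" using Suc by simp
    ultimately have "\<bar>D ?t' - D a\<bar> \<le> e * (\<Gamma> ?t' - \<Gamma> ?t) + e * (\<Gamma> ?t - \<Gamma> a)" by linarith
    then show ?case by (simp add: algebra_simps)
  qed simp
  from this[of n] h show ?thesis by simp
qed

text \<open>The interface between the equation and the argument, with \<open>p = u_x\<close>,
  \<open>q = u_t\<close> and \<open>X\<close>, \<open>Y\<close>, \<open>W\<close> the functionals of
  \<open>u_xx\<close>, \<open>u_tx\<close>, \<open>u_tt\<close>. \<open>Y\<close> has two roles: by
  \<open>Ylim\<close> it is the space derivative of \<open>q\<close>, by \<open>weak_p\<close> the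
  time derivative of \<open>p\<close>. This compatibility replaces the symmetry of second
  derivatives.\<close>

locale bi_sol =
  X: time_dual \<sigma> "\<lambda>_. K" X + Y: time_dual \<sigma> "\<lambda>_. K" Y + W: time_dual \<sigma> N W
  for \<sigma> K :: real and N :: "real \<Rightarrow> real" and X Y W :: "real \<Rightarrow> (real \<Rightarrow> real) \<Rightarrow> complex" +
  fixes p q :: "real \<Rightarrow> real \<Rightarrow> real"
  assumes reg: "\<And>t. reg \<sigma> K (p t)" "\<And>t. reg \<sigma> K (q t)"
    and small: "\<And>t x. \<bar>p t x\<bar> \<le> 1/2" "\<And>t x. \<bar>q t x\<bar> \<le> 1/2"
    and L2: "\<And>t. integrable lborel (\<lambda>x. (p t x)\<^sup>2)" "\<And>t. integrable lborel (\<lambda>x. (q t x)\<^sup>2)"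
    and energy: "\<And>t. (LBINT x. (p t x)\<^sup>2) \<le> K" "\<And>t. (LBINT x. (q t x)\<^sup>2) \<le> K"
    and cont: "L2cont p" "L2cont q"
    and Xlim: "\<And>t R M f h. \<lbrakk>adm \<sigma> R M f; \<And>n. h n \<noteq> 0; h \<longlonglongrightarrow> 0\<rbrakk> \<Longrightarrow>
      (\<lambda>n. complex_of_real ((LBINT x. (p t (x + h n) - p t x) * f x) / h n)) \<longlonglongrightarrow> X t f"
    and Ylim: "\<And>t R M f h. \<lbrakk>adm \<sigma> R M f; \<And>n. h n \<noteq> 0; h \<longlonglongrightarrow> 0\<rbrakk> \<Longrightarrow>
      (\<lambda>n. complex_of_real ((LBINT x. (q t (x + h n) - q t x) * f x) / h n)) \<longlonglongrightarrow> Y t f"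
    and weak_p: "\<And>\<theta> \<theta>' \<psi>. \<lbrakk>test1 \<theta>; test1 \<theta>'; \<And>t. (\<theta> has_real_derivative \<theta>' t) (at t); test1 \<psi>\<rbrakk> \<Longrightarrow>
      (LBINT t. complex_of_real (\<theta> t) * Y t \<psi>) = - complex_of_real (LBINT t. \<theta>' t * (LBINT x. p t x * \<psi> x))"
    and weak_q: "\<And>\<theta> \<theta>' \<psi>. \<lbrakk>test1 \<theta>; test1 \<theta>'; \<And>t. (\<theta> has_real_derivative \<theta>' t) (at t); test1 \<psi>\<rbrakk> \<Longrightarrow>
      (LBINT t. complex_of_real (\<theta> t) * W t \<psi>) = - complex_of_real (LBINT t. \<theta>' t * (LBINT x. q t x * \<psi> x))"
    and weak_eq: "\<And>\<theta> \<psi>. \<lbrakk>test1 \<theta>; test1 \<psi>\<rbrakk> \<Longrightarrow>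
      (LBINT t. complex_of_real (\<theta> t) * (X t (\<lambda>x. (1 - (q t x)\<^sup>2) * \<psi> x) + Y t (\<lambda>x. (2 * p t x * q t x) * \<psi> x)
        - W t (\<lambda>x. (1 + (p t x)\<^sup>2) * \<psi> x))) = 0"
begin

lemma sigma: "1/2 < \<sigma>" "\<sigma> \<le> 1" by (rule X.sigma)+

lemma small1: "\<bar>p t x\<bar> \<le> 1" "\<bar>q t x\<bar> \<le> 1"
  using small[of t x] by simp_all

lemma pq_measurable[measurable]: "p t \<in> borel_measurable borel" "q t \<in> borel_measurable borel"
  using regD(1)[OF reg(1)] regD(1)[OF reg(2)] by auto

section \<open>Test functions with coefficients depending on the solution\<close>

definition fam :: "(real \<Rightarrow> real \<Rightarrow> real) \<Rightarrow> (real \<Rightarrow> real) \<Rightarrow> real \<Rightarrow> real \<Rightarrow> real" where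
  "fam H f t x = H (p t x) (q t x) * f x"

text \<open>The squared L2 distance between the states at two times. Its convergence to 0 is the
  whole of the time regularity that is available; it comes without a rate.\<close>

definition dd :: "real \<Rightarrow> real \<Rightarrow> real" where
  "dd t s = (LBINT x. (p t x - p s x)\<^sup>2) + (LBINT x. (q t x - q s x)\<^sup>2)"

lemma dd_integrable: "integrable lborel (\<lambda>x. (p t x - p s x)\<^sup>2)" "integrable lborel (\<lambda>x. (q t x - q s x)\<^sup>2)"
  by (rule integrable_square_product(3); use L2 in simp)+

lemma dd_nonneg: "0 \<le> dd t s" by (simp add: dd_def)

lemma dd_commute: "dd t s = dd s t" by (simp add: dd_def power2_commute)

lemma dd_triangle: "dd t s \<le> 2 * dd t c + 2 * dd c s"
proof -
  have tri: "(LBINT x. (f t x - f s x)\<^sup>2) \<le> 2 * (LBINT x. (f t x - f c x)\<^sup>2) + 2 * (LBINT x. (f c x - f s x)\<^sup>2)"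
    if i: "\<And>t s. integrable lborel (\<lambda>x. (f t x - f s x)\<^sup>2)" for f :: "real \<Rightarrow> real \<Rightarrow> real"
  proof -
    have "(LBINT x. (f t x - f s x)\<^sup>2) \<le> (LBINT x. 2 * (f t x - f c x)\<^sup>2 + 2 * (f c x - f s x)\<^sup>2)"
    proof (rule integral_mono[OF i])
      show "(f t x - f s x)\<^sup>2 \<le> 2 * (f t x - f c x)\<^sup>2 + 2 * (f c x - f s x)\<^sup>2" for x
        using square_sum_le[of "f t x - f c x" "f c x - f s x"] by simp
    qed (use i in simp)
    then show ?thesis using i by simp
  qed
  show ?thesis unfolding dd_def using add_mono[OF tri[of p, OF dd_integrable(1)] tri[of q, OF dd_integrable(2)]]
    by (simp only: distrib_left add_ac)
qed

lemma dd_tendsto: "((\<lambda>t. dd t s) \<longlongrightarrow> 0) (at s)"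
  unfolding dd_def using cont unfolding L2cont_def by (intro tendsto_add_zero) auto

text \<open>A Lebesgue number of the cover of [a, b] by balls of continuity. The value e/4 at the
  centres compensates the factor 2 in the triangle inequality for squares.\<close>

lemma dd_uniform:
  assumes "e > 0" obtains \<delta> where "\<delta> > 0" "\<And>t s. \<lbrakk>t \<in> {a..b}; \<bar>t - s\<bar> < \<delta>\<rbrakk> \<Longrightarrow> dd t s < e"
proof -
  have "\<exists>\<delta>>0. \<forall>t. \<bar>t - c\<bar> < \<delta> \<longrightarrow> dd t c < e / 4" for c
  proof -
    obtain d where d: "d > 0" "\<And>t. t \<noteq> c \<Longrightarrow> dist t c < d \<Longrightarrow> dd t c < e / 4"
      using order_tendstoD(2)[OF dd_tendsto[of c], of "e / 4"] assms unfolding eventually_at by auto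
    have "dd c c < e / 4" using assms by (simp add: dd_def)
    then have "dd t c < e / 4" if "\<bar>t - c\<bar> < d" for t
      using d(2)[of t] that by (cases "t = c") (auto simp: dist_real_def)
    with d(1) show ?thesis by blast
  qed
  then obtain d where d: "\<And>c. d c > 0" "\<And>c t. \<bar>t - c\<bar> < d c \<Longrightarrow> dd t c < e / 4" by metis
  have "{a..b} \<subseteq> \<Union>((\<lambda>c. ball c (d c)) ` {a..b})" using d(1) by auto
  then obtain \<delta> where \<delta>: "\<delta> > 0" "\<And>x. x \<in> {a..b} \<Longrightarrow> \<exists>G\<in>(\<lambda>c. ball c (d c)) ` {a..b}. ball x \<delta> \<subseteq> G"
    by (rule Heine_Borel_lemma[OF compact_Icc, of a b "(\<lambda>c. ball c (d c)) ` {a..b}"]) blast+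
  have "dd t s < e" if ts: "t \<in> {a..b}" "\<bar>t - s\<bar> < \<delta>" for t s
  proof -
    obtain c where c: "ball t \<delta> \<subseteq> ball c (d c)" using \<delta>(2)[OF ts(1)] by blast
    have "t \<in> ball t \<delta>" "s \<in> ball t \<delta>" using ts \<delta>(1) by (simp_all add: dist_real_def)
    with c have "t \<in> ball c (d c)" "s \<in> ball c (d c)" by blast+
    then have "\<bar>t - c\<bar> < d c" "\<bar>s - c\<bar> < d c" by (simp_all add: dist_real_def abs_minus_commute)
    then have "dd t c < e / 4" "dd s c < e / 4" using d(2) by blast+
    then show ?thesis using dd_triangle[of t s c] dd_commute[of c s] by linarith
  qed
  with \<delta>(1) that show thesis by blast
qed

lemma fam_adm:
  assumes H: "nice H" and f: "adm \<sigma> R M f"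
  obtains M' where "\<And>t. adm \<sigma> R M' (fam H f t)"
proof -
  obtain L where L: "lipb L H" using H by (rule niceE)
  have "adm \<sigma> R (2 * M * (L * (1 + 2 * K))) (fam H f t)" for t
  proof -
    have m: "(\<lambda>x. H (p t x) (q t x)) \<in> borel_measurable borel" by (rule nice_measurable[OF H]) measurable
    show ?thesis
      using adm_mult[OF f reg_compose[OF reg small1 L m]] by (simp add: fam_def[abs_def] mult.commute)
  qed
  then show thesis using that by blast
qed

lemma fam_fam_adm:
  assumes P: "nice P" and H: "nice H" and f: "adm \<sigma> R M f"
  obtains M' where "\<And>t s. adm \<sigma> R M' (fam H (fam P f t) s)"
proof -
  obtain M1 where M1: "\<And>t. adm \<sigma> R M1 (fam P f t)" using fam_adm[OF P f] by blast
  obtain L where L: "lipb L H" using H by (rule niceE)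
  have "adm \<sigma> R (2 * M1 * (L * (1 + 2 * K))) (fam H (fam P f t) s)" for t s
  proof -
    have m: "(\<lambda>x. H (p s x) (q s x)) \<in> borel_measurable borel" by (rule nice_measurable[OF H]) measurable
    show ?thesis
      using adm_mult[OF M1 reg_compose[OF reg small1 L m]] by (simp add: fam_def[abs_def] mult.commute)
  qed
  then show thesis using that by blast
qed

lemma L2_difference_bound:
  assumes m: "f \<in> borel_measurable borel" and C: "0 \<le> C"
    and le: "\<And>x. \<bar>f x\<bar> \<le> C * (\<bar>p t x - p s x\<bar> + \<bar>q t x - q s x\<bar>)"
  shows "(LBINT x. (f x)\<^sup>2) \<le> 2 * C\<^sup>2 * dd t s"
proof -
  let ?B = "\<lambda>x. C\<^sup>2 * (2 * (p t x - p s x)\<^sup>2 + 2 * (q t x - q s x)\<^sup>2)"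
  have "(LBINT x. (f x)\<^sup>2) \<le> (LBINT x. ?B x)"
  proof (rule integral_mono')
    fix x
    have "\<bar>f x\<bar>\<^sup>2 \<le> (C * (\<bar>p t x - p s x\<bar> + \<bar>q t x - q s x\<bar>))\<^sup>2"
      by (intro power_mono le) simp
    also have "\<dots> \<le> ?B x"
      unfolding power_mult_distrib by (intro mult_left_mono abs_sum_square) simp
    finally show "(f x)\<^sup>2 \<le> ?B x" by simp
  qed (use dd_integrable in auto)
  also have "\<dots> = 2 * C\<^sup>2 * dd t s"
    unfolding dd_def using dd_integrable by simp
  finally show ?thesis .
qed

text \<open>At equal times both products agree, so the difference consists of increments of
  \<open>Q\<close> and \<open>Q'\<close> between the two times, each multiplied by a bounded factor.
  This decides freely which part of a coefficient is frozen and which part runs with time.\<close>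

lemma fam_swap:
  assumes n: "nice P" "nice Q" "nice P'" "nice Q'" and f: "adm \<sigma> R M f"
    and eq: "\<And>a b. \<bar>a\<bar> \<le> 1 \<Longrightarrow> \<bar>b\<bar> \<le> 1 \<Longrightarrow> P a b * Q a b = P' a b * Q' a b"
  obtains M' C where "0 \<le> C" "\<And>t s. adm \<sigma> R M' (fam Q (fam P f t) s)" "\<And>t s. adm \<sigma> R M' (fam Q' (fam P' f t) s)"
    "\<And>t s. (LBINT x. (fam Q (fam P f t) s x - fam Q' (fam P' f t) s x)\<^sup>2) \<le> 2 * C\<^sup>2 * dd t s"
proof -
  obtain M1 where M1: "\<And>t s. adm \<sigma> R M1 (fam Q (fam P f t) s)" using fam_fam_adm[OF n(1,2) f] by blast
  obtain M2 where M2: "\<And>t s. adm \<sigma> R M2 (fam Q' (fam P' f t) s)" using fam_fam_adm[OF n(3,4) f] by blast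
  obtain LP where LP: "lipb LP P" using n(1) by (rule niceE)
  obtain LQ where LQ: "lipb LQ Q" using n(2) by (rule niceE)
  obtain LP' where LP': "lipb LP' P'" using n(3) by (rule niceE)
  obtain LQ' where LQ': "lipb LQ' Q'" using n(4) by (rule niceE)
  note nn = lipbD(3)[OF LP] lipbD(3)[OF LQ] lipbD(3)[OF LP'] lipbD(3)[OF LQ'] admD(5)[OF f]
  define C where "C = (LP * LQ + LP' * LQ') * M"
  have C: "0 \<le> C" unfolding C_def using nn by simp
  have d: "\<bar>fam Q (fam P f t) s x - fam Q' (fam P' f t) s x\<bar> \<le> C * (\<bar>p t x - p s x\<bar> + \<bar>q t x - q s x\<bar>)" for t s x
  proof -
    let ?d = "\<bar>p t x - p s x\<bar> + \<bar>q t x - q s x\<bar>"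
    let ?P = "P (p t x) (q t x)" and ?P' = "P' (p t x) (q t x)"
    have "fam Q (fam P f t) s x - fam Q' (fam P' f t) s x =
      (?P * (Q (p s x) (q s x) - Q (p t x) (q t x)) + ?P' * (Q' (p t x) (q t x) - Q' (p s x) (q s x))) * f x"
      using eq[OF small1, of t x t x] by (simp add: fam_def algebra_simps)
    moreover have "\<bar>?P * (Q (p s x) (q s x) - Q (p t x) (q t x)) + ?P' * (Q' (p t x) (q t x) - Q' (p s x) (q s x))\<bar> \<le> LP * (LQ * ?d) + LP' * (LQ' * ?d)"
    proof (rule order_trans[OF abs_triangle_ineq add_mono])
      have "\<bar>Q (p s x) (q s x) - Q (p t x) (q t x)\<bar> \<le> LQ * ?d"
        using lipbD(2)[OF LQ small1(1)[of t x] small1(2)[of t x] small1(1)[of s x] small1(2)[of s x]] by (simp add: abs_minus_commute)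
      then show "\<bar>?P * (Q (p s x) (q s x) - Q (p t x) (q t x))\<bar> \<le> LP * (LQ * ?d)"
        unfolding abs_mult using nn by (intro mult_mono lipbD(1)[OF LP] small1) auto
      have "\<bar>Q' (p t x) (q t x) - Q' (p s x) (q s x)\<bar> \<le> LQ' * ?d"
        using lipbD(2)[OF LQ' small1(1)[of s x] small1(2)[of s x] small1(1)[of t x] small1(2)[of t x]] .
      then show "\<bar>?P' * (Q' (p t x) (q t x) - Q' (p s x) (q s x))\<bar> \<le> LP' * (LQ' * ?d)"
        unfolding abs_mult using nn by (intro mult_mono lipbD(1)[OF LP'] small1) auto
    qed
    ultimately have "\<bar>fam Q (fam P f t) s x - fam Q' (fam P' f t) s x\<bar> \<le> (LP * (LQ * ?d) + LP' * (LQ' * ?d)) * M"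
      unfolding abs_mult using nn admD(2)[OF f] by (simp only: abs_mult) (intro mult_mono, auto)
    also have "\<dots> = C * ?d" by (simp add: C_def algebra_simps)
    finally show ?thesis .
  qed
  show thesis
  proof (rule that[of C "max M1 M2"])
    show "(LBINT x. (fam Q (fam P f t) s x - fam Q' (fam P' f t) s x)\<^sup>2) \<le> 2 * C\<^sup>2 * dd t s" for t s
      by (rule L2_difference_bound[OF _ C d]) (intro borel_measurable_diff admD(1)[OF M1] admD(1)[OF M2])
  qed (use C in \<open>auto intro: adm_mono[OF M1] adm_mono[OF M2]\<close>)
qed

lemma fam_L2cont:
  assumes H: "nice H" and f: "adm \<sigma> R M f" shows "L2cont (fam H f)"
  unfolding L2cont_def
proof
  fix s
  obtain L where L: "lipb L H" using H by (rule niceE)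
  obtain M' where M': "\<And>t. adm \<sigma> R M' (fam H f t)" using fam_adm[OF H f] by blast
  have nn: "0 \<le> L" "0 \<le> M" using lipbD(3)[OF L] admD(5)[OF f] by auto
  have le: "(LBINT x. (fam H f t x - fam H f s x)\<^sup>2) \<le> 2 * (L * M)\<^sup>2 * dd t s" for t
  proof (rule L2_difference_bound)
    fix x
    have "\<bar>(H (p t x) (q t x) - H (p s x) (q s x)) * f x\<bar> \<le> (L * (\<bar>p t x - p s x\<bar> + \<bar>q t x - q s x\<bar>)) * M"
      unfolding abs_mult using nn by (intro mult_mono lipbD(2)[OF L] small1 admD(2)[OF f]) auto
    then show "\<bar>fam H f t x - fam H f s x\<bar> \<le> L * M * (\<bar>p t x - p s x\<bar> + \<bar>q t x - q s x\<bar>)"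
      unfolding fam_def left_diff_distrib[symmetric] by (simp only: mult.assoc mult.commute[of M] mult.left_commute[of M])
  qed (use nn in \<open>auto intro!: borel_measurable_diff admD(1)[OF M']\<close>)
  have "((\<lambda>t. 2 * (L * M)\<^sup>2 * dd t s) \<longlongrightarrow> 2 * (L * M)\<^sup>2 * 0) (at s)"
    by (intro tendsto_mult tendsto_const dd_tendsto)
  then show "((\<lambda>t. LBINT x. (fam H f t x - fam H f s x)\<^sup>2) \<longlongrightarrow> 0) (at s)"
    by (intro tendsto_sandwich[of "\<lambda>_. 0" "\<lambda>t. LBINT x. (fam H f t x - fam H f s x)\<^sup>2" "at s" "\<lambda>t. 2 * (L * M)\<^sup>2 * dd t s"])
      (use le in auto)
qed

lemma fam_limit:
  assumes d: "time_dual \<sigma> N' L" and H: "nice H" and \<psi>: "\<And>n. adm \<sigma> R M (\<psi> n)" and f: "adm \<sigma> R M f"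
    and lim: "(\<lambda>n::nat. LBINT x. (\<psi> n x - f x)\<^sup>2) \<longlonglongrightarrow> 0"
  shows "(\<lambda>n. LBINT s:{u..v}. L s (fam H (\<psi> n) s)) \<longlonglongrightarrow> (LBINT s:{u..v}. L s (fam H f s))"
proof -
  interpret time_dual \<sigma> N' L by (rule d)
  obtain LH where LH: "lipb LH H" using H by (rule niceE)
  have LH0: "0 \<le> LH" by (rule lipbD(3)[OF LH])
  have m: "(\<lambda>x. H (p t x) (q t x)) \<in> borel_measurable borel" for t by (rule nice_measurable[OF H]) measurable
  define M' where "M' = 2 * M * (LH * (1 + 2 * K))"
  have a: "adm \<sigma> R M' (fam H g t)" if "adm \<sigma> R M g" for g t
    using adm_mult[OF that reg_compose[OF reg small1 LH m]] by (simp add: fam_def[abs_def] mult.commute M'_def)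
  define d where "d n = LH * sqrt (LBINT x. (\<psi> n x - f x)\<^sup>2)" for n
  have d: "d \<longlonglongrightarrow> 0"
    unfolding d_def using tendsto_mult[OF tendsto_const[of LH] tendsto_real_sqrt[OF lim]] by simp
  have le: "(LBINT x. (fam H (\<psi> n) t x - fam H f t x)\<^sup>2) \<le> (d n)\<^sup>2" for n t
  proof -
    note i = integrable_square_product(3)[OF _ _ adm_integrable(2)[OF \<psi>] adm_integrable(2)[OF f], of n]
    have i': "integrable lborel (\<lambda>x. (\<psi> n x - f x)\<^sup>2)" by (rule i) (use admD(1)[OF \<psi>] admD(1)[OF f] in auto)
    have "(LBINT x. (fam H (\<psi> n) t x - fam H f t x)\<^sup>2) \<le> (LBINT x. LH\<^sup>2 * (\<psi> n x - f x)\<^sup>2)"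
    proof (rule integral_mono')
      fix x
      have "(H (p t x) (q t x))\<^sup>2 \<le> LH\<^sup>2"
        using lipbD(1)[OF LH small1] LH0 by (simp add: abs_le_square_iff[symmetric])
      then show "(fam H (\<psi> n) t x - fam H f t x)\<^sup>2 \<le> LH\<^sup>2 * (\<psi> n x - f x)\<^sup>2"
        unfolding fam_def right_diff_distrib[symmetric] power_mult_distrib by (intro mult_right_mono) auto
    qed (use i' in auto)
    then show ?thesis by (simp add: d_def power_mult_distrib)
  qed
  show ?thesis
  proof (rule integral_limit)
    show "cmod (L t (fam H (\<psi> n) t) - L t (fam H f t)) \<le> N' t * Qb \<sigma> (2 * (M' + M')) (d n)" for n t
      by (rule L_diff_bound[OF a[OF \<psi>] a[OF f] le])
    show "(\<lambda>n. Qb \<sigma> (2 * (M' + M')) (d n)) \<longlonglongrightarrow> 0" by (rule Qb_tendsto_0[OF sigma(1) d])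
  qed (auto intro!: meas_family[OF a] family_integrable[OF a] fam_L2cont[OF H] \<psi> f Qb_nonneg sigma)
qed

lemma fam_integrable:
  assumes d: "time_dual \<sigma> N' L" and H: "nice H" and f: "adm \<sigma> R M f"
  shows "set_integrable lborel {u..v} (\<lambda>s. L s (fam H f s))" "(\<lambda>s. L s (fam H f s)) \<in> borel_measurable borel"
proof -
  interpret time_dual \<sigma> N' L by (rule d)
  obtain M' where M': "\<And>t. adm \<sigma> R M' (fam H f t)" using fam_adm[OF H f] by blast
  show "set_integrable lborel {u..v} (\<lambda>s. L s (fam H f s))" "(\<lambda>s. L s (fam H f s)) \<in> borel_measurable borel"
    by (rule family_integrable[OF M' fam_L2cont[OF H f]], rule meas_family[OF M' fam_L2cont[OF H f]])
qed

lemma duals: "time_dual \<sigma> (\<lambda>_. K) X" "time_dual \<sigma> (\<lambda>_. K) Y" "time_dual \<sigma> N W"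
  by unfold_locales

lemma nice_coeffs: "nice (\<lambda>a b. 1 - b\<^sup>2)" "nice (\<lambda>a b. 2 * a * b)" "nice (\<lambda>a b. 1 + a\<^sup>2)"
proof -
  have "nice (\<lambda>a b. 1 + (-1) * (b * b))" "nice (\<lambda>a b. 2 * a * b)" "nice (\<lambda>a b. 1 + a * a)"
    by (intro nice_add nice_mult nice_const nice_fst nice_snd)+
  then show "nice (\<lambda>a b. 1 - b\<^sup>2)" "nice (\<lambda>a b. 2 * a * b)" "nice (\<lambda>a b. 1 + a\<^sup>2)"
    by (simp_all add: power2_eq_square)
qed

text \<open>Passes from smooth test functions to admissible ones. This is indispensable, because the
  equation will be tested with \<open>k(p, q) \<phi>\<close> at a frozen time, which is no smoother
  than the solution. For smooth \<psi>, the equation says that a locally integrable function of time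
  is zero as a distribution.\<close>

lemma integrated_equation:
  assumes f: "adm \<sigma> R M f" and uv: "u < v"
  shows "(LBINT s:{u..v}. X s (fam (\<lambda>a b. 1 - b\<^sup>2) f s)) + (LBINT s:{u..v}. Y s (fam (\<lambda>a b. 2 * a * b) f s))
    - (LBINT s:{u..v}. W s (fam (\<lambda>a b. 1 + a\<^sup>2) f s)) = 0"
proof -
  obtain \<psi> where \<psi>: "\<And>n. test1 (\<psi> n)" "\<And>n. adm \<sigma> (R + 1) M (\<psi> n)" "(\<lambda>n::nat. LBINT x. (\<psi> n x - f x)\<^sup>2) \<longlonglongrightarrow> 0"
    using mollify[OF f X.sigma_pos] by blast
  have f': "adm \<sigma> (R + 1) M f" by (rule adm_mono[OF f]) auto
  have 1: "(LBINT s:{u..v}. X s (fam (\<lambda>a b. 1 - b\<^sup>2) (\<psi> n) s)) + (LBINT s:{u..v}. Y s (fam (\<lambda>a b. 2 * a * b) (\<psi> n) s))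
    - (LBINT s:{u..v}. W s (fam (\<lambda>a b. 1 + a\<^sup>2) (\<psi> n) s)) = 0" for n
  proof -
    note i = fam_integrable[OF duals(1) nice_coeffs(1) \<psi>(2)[of n]] fam_integrable[OF duals(2) nice_coeffs(2) \<psi>(2)[of n]]
      fam_integrable[OF duals(3) nice_coeffs(3) \<psi>(2)[of n]]
    let ?b = "\<lambda>s. X s (fam (\<lambda>a b. 1 - b\<^sup>2) (\<psi> n) s) + Y s (fam (\<lambda>a b. 2 * a * b) (\<psi> n) s) - W s (fam (\<lambda>a b. 1 + a\<^sup>2) (\<psi> n) s)"
    have "(LBINT s:{u..v}. ?b s) = complex_of_real (0 - 0)"
    proof (rule time_du_Bois_Reymond[where a="\<lambda>_. 0"])
      show "?b \<in> borel_measurable borel" using i(2,4,6) by measurable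
      show "set_integrable lborel {u..v} ?b" for u v
        by (intro set_integral_diff(1) set_integral_add(1) i)
      show "(LBINT t. complex_of_real (\<theta> t) * ?b t) = - complex_of_real (LBINT t. \<theta>' t * 0)" if "test1 \<theta>" for \<theta> \<theta>'
        using weak_eq[OF that \<psi>(1)[of n]] by (simp add: fam_def[abs_def])
    qed (use uv in auto)
    then show ?thesis
      by (simp add: set_integral_diff(2) set_integral_add i)
  qed
  have "(\<lambda>n. (LBINT s:{u..v}. X s (fam (\<lambda>a b. 1 - b\<^sup>2) (\<psi> n) s)) + (LBINT s:{u..v}. Y s (fam (\<lambda>a b. 2 * a * b) (\<psi> n) s))
    - (LBINT s:{u..v}. W s (fam (\<lambda>a b. 1 + a\<^sup>2) (\<psi> n) s))) \<longlonglongrightarrow>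
    (LBINT s:{u..v}. X s (fam (\<lambda>a b. 1 - b\<^sup>2) f s)) + (LBINT s:{u..v}. Y s (fam (\<lambda>a b. 2 * a * b) f s))
    - (LBINT s:{u..v}. W s (fam (\<lambda>a b. 1 + a\<^sup>2) f s))"
    by (intro tendsto_diff tendsto_add fam_limit[OF duals(1) nice_coeffs(1) \<psi>(2) f' \<psi>(3)]
      fam_limit[OF duals(2) nice_coeffs(2) \<psi>(2) f' \<psi>(3)] fam_limit[OF duals(3) nice_coeffs(3) \<psi>(2) f' \<psi>(3)])
  then show ?thesis unfolding 1 using LIMSEQ_unique tendsto_const by blast
qed

lemma bounded_times_test1_integrable:
  assumes H: "nice H" and g: "integrable lborel g"
  shows "integrable lborel (\<lambda>x. H (p t x) (q t x) * g x)" "integrable lborel (\<lambda>x. H (p t (x + h)) (q t (x + h)) * g x)"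
proof -
  obtain L where L: "lipb L H" using H by (rule niceE)
  have m: "(\<lambda>x. H (p t x) (q t x)) \<in> borel_measurable borel" by (rule nice_measurable[OF H]) measurable
  have m': "(\<lambda>x. H (p t (x + h)) (q t (x + h))) \<in> borel_measurable borel"
    using measurable_compose[OF _ m, of "\<lambda>x. x + h" borel] by simp
  have *: "integrable lborel (\<lambda>x. k x * g x)" if "k \<in> borel_measurable borel" "\<And>x. \<bar>k x\<bar> \<le> L" for k
  proof (rule integrable_bound[OF integrable_mult_right[OF g, of L]])
    show "AE x in lborel. norm (k x * g x) \<le> norm (L * g x)"
      unfolding real_norm_def abs_mult
      by (intro AE_I2 mult_right_mono order_trans[OF that(2) abs_ge_self] abs_ge_zero)
  qed (use that(1) g in measurable)
  show "integrable lborel (\<lambda>x. H (p t x) (q t x) * g x)"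
    by (rule *[OF m]) (rule lipbD(1)[OF L small1])
  show "integrable lborel (\<lambda>x. H (p t (x + h)) (q t (x + h)) * g x)"
    by (rule *[OF m']) (rule lipbD(1)[OF L small1])
qed

text \<open>Replacing the derivatives by difference quotients of step \<open>h\<close> leaves a
  Taylor remainder bounded by the squared L2 increments of \<open>p\<close> and \<open>q\<close>,
  i.e. by a multiple of \<open>h^(2 \<sigma>)\<close>. Divided by \<open>h\<close> it still vanishes
  because \<sigma> > 1/2.\<close>

lemma space_chain_rule:
  assumes F: "C2 F Fp Fq" and \<phi>: "test1 \<phi>" and \<phi>': "\<And>x. (\<phi> has_real_derivative \<phi>' x) (at x)"
  shows "X t (fam Fp \<phi> t) + Y t (fam Fq \<phi> t) = - complex_of_real (LBINT x. F (p t x) (q t x) * \<phi>' x)"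
proof -
  obtain B L R where b: "B \<ge> 0" "L \<ge> 0" "R \<ge> 0" "\<And>x. \<bar>\<phi> x\<bar> \<le> B" "\<And>x. \<bar>x\<bar> > R \<Longrightarrow> \<phi> x = 0"
    "\<And>x y. \<bar>\<phi> x - \<phi> y\<bar> \<le> L * \<bar>x - y\<bar>" using test1_lipschitz[OF \<phi>] by metis
  obtain R' M where \<phi>a: "adm \<sigma> R' M \<phi>" using test1_adm[OF \<phi> sigma(2)] by metis
  have n: "nice F" "nice Fp" "nice Fq" using F unfolding C2_def by auto
  obtain C where "taylor C F Fp Fq" using F unfolding C2_def by blast
  note C = taylorD[OF this]
  obtain M1 where M1: "\<And>t. adm \<sigma> R' M1 (fam Fp \<phi> t)" using fam_adm[OF n(2) \<phi>a] by blast
  obtain M2 where M2: "\<And>t. adm \<sigma> R' M2 (fam Fq \<phi> t)" using fam_adm[OF n(3) \<phi>a] by blast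
  define h where "h m = 1 / real (Suc m)" for m
  have h: "h m \<noteq> 0" "0 < h m" "h m \<le> 1" for m by (auto simp: h_def)
  have h0: "h \<longlonglongrightarrow> 0" unfolding h_def by (rule LIMSEQ_Suc[OF lim_1_over_n])
  note \<phi>i = test1_integrable[OF \<phi>]
  have [measurable]: "\<phi> \<in> borel_measurable borel" by (rule test1_measurable[OF \<phi>])
  have Fm[measurable]: "(\<lambda>x. F (p t x) (q t x)) \<in> borel_measurable borel" by (rule nice_measurable[OF n(1)]) measurable
  define S where "S m = (LBINT x. (p t (x + h m) - p t x) * fam Fp \<phi> t x) / h m + (LBINT x. (q t (x + h m) - q t x) * fam Fq \<phi> t x) / h m" for m
  define T where "T m = (LBINT x. (F (p t (x + h m)) (q t (x + h m)) - F (p t x) (q t x)) * \<phi> x) / h m" for m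
  have S: "(\<lambda>m. complex_of_real (S m)) \<longlonglongrightarrow> X t (fam Fp \<phi> t) + Y t (fam Fq \<phi> t)"
    unfolding S_def of_real_add by (intro tendsto_add Xlim[OF M1 h(1) h0] Ylim[OF M2 h(1) h0])
  have T: "T \<longlonglongrightarrow> - (LBINT x. F (p t x) (q t x) * \<phi>' x)"
  proof -
    \<comment> \<open>Summation by parts: the shift is moved onto \<phi>, whose difference quotients
      converge boundedly.\<close>
    have T_eq: "T m = (LBINT x. F (p t x) (q t x) * ((\<phi> (x + (- h m)) - \<phi> x) / h m))" for m
    proof -
      have "(LBINT x. (F (p t (x + h m)) (q t (x + h m)) - F (p t x) (q t x)) * \<phi> x)
        = (LBINT x. F (p t (x + h m)) (q t (x + h m)) * \<phi> x) - (LBINT x. F (p t x) (q t x) * \<phi> x)"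
        unfolding left_diff_distrib by (rule integral_diff[OF bounded_times_test1_integrable(2,1)[OF n(1) \<phi>i]])
      also have "(LBINT x. F (p t (x + h m)) (q t (x + h m)) * \<phi> x) = (LBINT x. F (p t x) (q t x) * \<phi> (x + (- h m)))"
        using integral_translate[of "\<lambda>x. F (p t x) (q t x) * \<phi> (x + (- h m))" "h m"] by simp
      also have "\<dots> - (LBINT x. F (p t x) (q t x) * \<phi> x) = (LBINT x. F (p t x) (q t x) * (\<phi> (x + (- h m)) - \<phi> x))"
        unfolding right_diff_distrib
        by (rule integral_diff[symmetric, OF bounded_times_test1_integrable(1)[OF n(1)] bounded_times_test1_integrable(1)[OF n(1) \<phi>i]])
          (subst integrable_translate[of \<phi>], rule \<phi>i)
      finally show ?thesis unfolding T_def by simp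
    qed
    obtain LF where LF: "lipb LF F" using n(1) by (rule niceE)
    have "(\<lambda>m. LBINT x. F (p t x) (q t x) * ((\<phi> (x + (- h m)) - \<phi> x) / h m)) \<longlonglongrightarrow> (LBINT x. F (p t x) (q t x) * - \<phi>' x)"
    proof (rule integral_dominated_convergence)
      show "integrable lborel (\<lambda>x. LF * L * indicator {-(R+1)..R+1} x)"
        by (intro integrable_mult_right) (simp add: integrable_indicator_iff emeasure_lborel_Icc_eq)
      have lim: "(\<lambda>m. (\<phi> (x + (- h m)) - \<phi> x) / h m) \<longlonglongrightarrow> - \<phi>' x" for x
      proof -
        have "(\<lambda>m. (\<phi> (x + (- h m)) - \<phi> x) /\<^sub>R (- h m)) \<longlonglongrightarrow> \<phi>' x"
          by (rule vector_derivative_sequence) (use \<phi>' h(1) tendsto_minus[OF h0] in \<open>auto simp: has_real_derivative_iff_has_vector_derivative[symmetric]\<close>)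
        from tendsto_minus[OF this] show ?thesis by (simp add: divide_inverse mult.commute)
      qed
      show "AE x in lborel. (\<lambda>m. F (p t x) (q t x) * ((\<phi> (x + (- h m)) - \<phi> x) / h m)) \<longlonglongrightarrow> F (p t x) (q t x) * - \<phi>' x"
        by (intro AE_I2 tendsto_mult tendsto_const lim)
      have "\<phi>' \<in> borel_measurable borel"
        by (rule borel_measurable_LIMSEQ_metric[where f="\<lambda>m x. - ((\<phi> (x + (- h m)) - \<phi> x) / h m)"])
          (measurable, use tendsto_minus[OF lim] in simp)
      then show "(\<lambda>x. F (p t x) (q t x) * - \<phi>' x) \<in> borel_measurable lborel" by measurable
      show "AE x in lborel. norm (F (p t x) (q t x) * ((\<phi> (x + (- h m)) - \<phi> x) / h m)) \<le> LF * L * indicator {-(R+1)..R+1} x" for m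
      proof (rule AE_I2)
        fix x
        show "norm (F (p t x) (q t x) * ((\<phi> (x + (- h m)) - \<phi> x) / h m)) \<le> LF * L * indicator {-(R+1)..R+1} x"
        proof (cases "x \<in> {-(R+1)..R+1}")
          case True
          have "\<bar>(\<phi> (x + (- h m)) - \<phi> x) / h m\<bar> \<le> L"
            using b(6)[of "x + (- h m)" x] h(2)[of m] by (simp add: abs_divide pos_divide_le_eq)
          then have "\<bar>F (p t x) (q t x)\<bar> * \<bar>(\<phi> (x + (- h m)) - \<phi> x) / h m\<bar> \<le> LF * L"
            using lipbD(3)[OF LF] by (intro mult_mono lipbD(1)[OF LF] small1) auto
          with True show ?thesis by (simp add: abs_mult)
        next
          case False
          then have "\<bar>x\<bar> > R" "\<bar>x + (- h m)\<bar> > R" using h(2,3)[of m] by auto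
          then have "\<phi> x = 0" "\<phi> (x + (- h m)) = 0" using b(5) by blast+
          then show ?thesis using False by simp
        qed
      qed
    qed measurable
    then show ?thesis unfolding T_eq by simp
  qed
  have rem: "\<bar>S m - T m\<bar> \<le> (2 * C * B * K\<^sup>2) * h m powr (2 * \<sigma> - 1)" for m
  proof -
    let ?dp = "\<lambda>x. p t (x + h m) - p t x" and ?dq = "\<lambda>x. q t (x + h m) - q t x"
    have [measurable]: "(\<lambda>x. p t (x + h m)) \<in> borel_measurable borel" "(\<lambda>x. q t (x + h m)) \<in> borel_measurable borel" by measurable
    note ip = regD(4)[OF reg(1) h(2,3), of t m] and iq = regD(4)[OF reg(2) h(2,3), of t m]
    have i1: "integrable lborel (\<lambda>x. ?dp x * fam Fp \<phi> t x)"
      by (rule integrable_square_product(1)) (use ip adm_integrable(2)[OF M1] admD(1)[OF M1] in auto)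
    have i2: "integrable lborel (\<lambda>x. ?dq x * fam Fq \<phi> t x)"
      by (rule integrable_square_product(1)) (use iq adm_integrable(2)[OF M2] admD(1)[OF M2] in auto)
    have i3: "integrable lborel (\<lambda>x. (F (p t (x + h m)) (q t (x + h m)) - F (p t x) (q t x)) * \<phi> x)"
      unfolding left_diff_distrib
      by (rule integrable_diff[OF bounded_times_test1_integrable(2,1)[OF n(1) \<phi>i]])
    have ST: "(S m - T m) * h m = (LBINT x. (?dp x * fam Fp \<phi> t x + ?dq x * fam Fq \<phi> t x)
      - (F (p t (x + h m)) (q t (x + h m)) - F (p t x) (q t x)) * \<phi> x)"
      unfolding integral_diff[OF integrable_add[OF i1 i2] i3]
        integral_add[OF i1 i2] S_def T_def using h(1)[of m] by (simp add: left_diff_distrib distrib_right)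
    have "\<bar>(S m - T m) * h m\<bar> \<le> (LBINT x. \<bar>(?dp x * fam Fp \<phi> t x + ?dq x * fam Fq \<phi> t x)
      - (F (p t (x + h m)) (q t (x + h m)) - F (p t x) (q t x)) * \<phi> x\<bar>)"
      unfolding ST by (rule integral_abs_bound)
    also have "\<dots> \<le> (LBINT x. C * B * ((?dp x)\<^sup>2 + (?dq x)\<^sup>2))"
    proof (rule integral_mono)
      show "integrable lborel (\<lambda>x. \<bar>(?dp x * fam Fp \<phi> t x + ?dq x * fam Fq \<phi> t x)
        - (F (p t (x + h m)) (q t (x + h m)) - F (p t x) (q t x)) * \<phi> x\<bar>)"
        using i1 i2 i3 by (intro integrable_abs integrable_diff integrable_add)
      fix x
      have "(?dp x * fam Fp \<phi> t x + ?dq x * fam Fq \<phi> t x) - (F (p t (x + h m)) (q t (x + h m)) - F (p t x) (q t x)) * \<phi> x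
        = - ((F (p t (x + h m)) (q t (x + h m)) - F (p t x) (q t x) - Fp (p t x) (q t x) * ?dp x - Fq (p t x) (q t x) * ?dq x) * \<phi> x)"
        by (simp add: fam_def algebra_simps)
      moreover have "\<bar>(F (p t (x + h m)) (q t (x + h m)) - F (p t x) (q t x) - Fp (p t x) (q t x) * ?dp x - Fq (p t x) (q t x) * ?dq x) * \<phi> x\<bar>
        \<le> (C * ((?dp x)\<^sup>2 + (?dq x)\<^sup>2)) * B"
        unfolding abs_mult by (rule mult_mono[OF C(2)[OF small1 small1] b(4)]) (use C(1) in auto)
      ultimately show "\<bar>(?dp x * fam Fp \<phi> t x + ?dq x * fam Fq \<phi> t x) - (F (p t (x + h m)) (q t (x + h m)) - F (p t x) (q t x)) * \<phi> x\<bar>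
        \<le> C * B * ((?dp x)\<^sup>2 + (?dq x)\<^sup>2)" by (simp only: abs_minus_cancel mult_ac)
    qed (use ip iq in auto)
    also have "\<dots> = C * B * ((LBINT x. (?dp x)\<^sup>2) + (LBINT x. (?dq x)\<^sup>2))"
      using ip iq by simp
    also have "\<dots> \<le> C * B * ((K * h m powr \<sigma>)\<^sup>2 + (K * h m powr \<sigma>)\<^sup>2)"
      using C(1) b(1) by (intro mult_left_mono add_mono regD(5)[OF reg(1)] regD(5)[OF reg(2)] h) auto
    also have "\<dots> = (2 * C * B * K\<^sup>2) * h m powr (2 * \<sigma>)"
      by (simp add: power_mult_distrib power2_eq_square[of "h m powr \<sigma>"] powr_add[symmetric])
    finally have "\<bar>S m - T m\<bar> * h m \<le> (2 * C * B * K\<^sup>2) * h m powr (2 * \<sigma>)"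
      using h(2)[of m] by (simp add: abs_mult)
    moreover have "h m powr (2 * \<sigma>) = h m powr (2 * \<sigma> - 1) * h m"
      using h(2)[of m] by (simp add: powr_diff)
    ultimately show ?thesis using h(2)[of m] by (simp add: mult.assoc[symmetric])
  qed
  have "(\<lambda>m. (2 * C * B * K\<^sup>2) * h m powr (2 * \<sigma> - 1)) \<longlonglongrightarrow> (2 * C * B * K\<^sup>2) * 0"
    by (intro tendsto_mult tendsto_const tendsto_zero_powrI[where b="2 * \<sigma> - 1"] h0) (use sigma h in \<open>auto simp: less_imp_le\<close>)
  then have "(\<lambda>m. S m - T m) \<longlonglongrightarrow> 0"
    using Lim_null_comparison[of "\<lambda>m. S m - T m" "\<lambda>m. (2 * C * B * K\<^sup>2) * h m powr (2 * \<sigma> - 1)" sequentially] rem by simp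
  from tendsto_add[OF this T] have "S \<longlonglongrightarrow> - (LBINT x. F (p t x) (q t x) * \<phi>' x)" by simp
  from tendsto_of_real[OF this, where 'a=complex] show ?thesis
    using LIMSEQ_unique[OF S] by simp
qed

end

section \<open>Increments over short time intervals\<close>

context bi_sol
begin

text \<open>The time-integrated form of \<open>fam_swap\<close>, with uniform continuity of the
  state supplying the smallness. The error is \<open>e\<close> times the integral of \<gamma> over
  the same interval and not merely small, so it can be summed over a subdivision.\<close>

lemma swap_integral:
  assumes d: "time_dual \<sigma> N' L" and \<gamma>: "dominates N' r \<gamma>" and ab: "{a..b} \<subseteq> {-r..r}"
    and n: "nice P" "nice Q" "nice P'" "nice Q'" and f: "adm \<sigma> R M f"
    and eq: "\<And>a b. \<bar>a\<bar> \<le> 1 \<Longrightarrow> \<bar>b\<bar> \<le> 1 \<Longrightarrow> P a b * Q a b = P' a b * Q' a b" and e: "e > 0"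
  obtains \<delta> where "\<delta> > 0" "\<And>c t t'. \<lbrakk>a \<le> t; t < t'; t' \<le> b; t' - t < \<delta>; c \<in> {t..t'}\<rbrakk> \<Longrightarrow>
    cmod ((LBINT s:{t..t'}. L s (fam Q (fam P f c) s)) - (LBINT s:{t..t'}. L s (fam Q' (fam P' f c) s)))
      \<le> e * (LBINT s:{t..t'}. \<gamma> s)"
proof -
  interpret time_dual \<sigma> N' L by (rule d)
  obtain M' C where MC: "0 \<le> C" "\<And>t s. adm \<sigma> R M' (fam Q (fam P f t) s)" "\<And>t s. adm \<sigma> R M' (fam Q' (fam P' f t) s)"
    "\<And>t s. (LBINT x. (fam Q (fam P f t) s x - fam Q' (fam P' f t) s x)\<^sup>2) \<le> 2 * C\<^sup>2 * dd t s"
    by (rule fam_swap[OF n f eq]) blast+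
  have "((\<lambda>\<eta>. Qb \<sigma> (2 * (M' + M')) \<eta>) \<longlongrightarrow> 0) (at_right 0)"
    by (rule Qb_tendsto_0[OF sigma(1)]) (rule tendsto_ident_at)
  then have "eventually (\<lambda>\<eta>. Qb \<sigma> (2 * (M' + M')) \<eta> < e) (at_right 0)"
    using e by (rule order_tendstoD(2))
  then obtain \<eta> where \<eta>: "\<eta> > 0" "Qb \<sigma> (2 * (M' + M')) \<eta> < e"
    unfolding eventually_at_right_field using dense by metis
  \<comment> \<open>The summand 1 in the denominator keeps it positive when
    \<open>C = 0\<close>.\<close>
  obtain \<delta> where \<delta>: "\<delta> > 0" "\<And>t s. \<lbrakk>t \<in> {a..b}; \<bar>t - s\<bar> < \<delta>\<rbrakk> \<Longrightarrow> dd t s < \<eta>\<^sup>2 / (2 * C\<^sup>2 + 1)"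
    by (rule dd_uniform[of "\<eta>\<^sup>2 / (2 * C\<^sup>2 + 1)" a b]) (use \<eta>(1) in \<open>auto intro!: divide_pos_pos add_nonneg_pos\<close>)
  show thesis
  proof (rule that[OF \<delta>(1)])
    fix c t t' assume t: "a \<le> t" "t < t'" "t' \<le> b" "t' - t < \<delta>" "c \<in> {t..t'}"
    obtain M1 M2 where M1: "\<And>t. adm \<sigma> R M1 (fam P f t)" and M2: "\<And>t. adm \<sigma> R M2 (fam P' f t)"
      using fam_adm[OF n(1) f] fam_adm[OF n(3) f] by metis
    note i = fam_integrable[OF d n(2) M1] fam_integrable[OF d n(4) M2]
    have le: "cmod (L s (fam Q (fam P f c) s) - L s (fam Q' (fam P' f c) s)) \<le> N' s * e" if "s \<in> {t..t'}" for s
    proof -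
      have "\<bar>c - s\<bar> < \<delta>" using t that by auto
      moreover have "c \<in> {a..b}" using t by auto
      ultimately have "dd c s < \<eta>\<^sup>2 / (2 * C\<^sup>2 + 1)" by (intro \<delta>(2))
      then have "dd c s * (2 * C\<^sup>2 + 1) < \<eta>\<^sup>2"
        by (subst (asm) pos_less_divide_eq) (auto intro: add_nonneg_pos)
      then have "2 * C\<^sup>2 * dd c s \<le> \<eta>\<^sup>2" using dd_nonneg[of c s] by (simp add: algebra_simps)
      from L_diff_bound[OF MC(2,3) order_trans[OF MC(4) this], of s]
      have "cmod (L s (fam Q (fam P f c) s) - L s (fam Q' (fam P' f c) s)) \<le> N' s * Qb \<sigma> (2 * (M' + M')) \<eta>" .
      also have "\<dots> \<le> N' s * e" using \<eta>(2) N_nonneg by (intro mult_left_mono) auto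
      finally show ?thesis .
    qed
    show "cmod ((LBINT s:{t..t'}. L s (fam Q (fam P f c) s)) - (LBINT s:{t..t'}. L s (fam Q' (fam P' f c) s)))
      \<le> e * (LBINT s:{t..t'}. \<gamma> s)"
      unfolding set_integral_diff(2)[OF i(1,3), symmetric]
    proof (rule dominatesD(2)[OF \<gamma> _ _ le])
      show "{t..t'} \<subseteq> {-r..r}" using t ab by auto
      show "(\<lambda>s. L s (fam Q (fam P f c) s) - L s (fam Q' (fam P' f c) s)) \<in> borel_measurable borel"
        using i(2,4) by measurable
    qed (use e in auto)
  qed
qed

lemma fam_trivial: "fam (\<lambda>_ _. 1) f t = f" by (simp add: fam_def[abs_def])

text \<open>The case \<open>Q = P' = 1\<close>: the coefficient may be frozen at any nearby time.\<close>

lemma freeze_integral: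
  assumes d: "time_dual \<sigma> N' L" and \<gamma>: "dominates N' r \<gamma>" and ab: "{a..b} \<subseteq> {-r..r}"
    and n: "nice P" and f: "adm \<sigma> R M f" and e: "e > 0"
  obtains \<delta> where "\<delta> > 0" "\<And>c t t'. \<lbrakk>a \<le> t; t < t'; t' \<le> b; t' - t < \<delta>; c \<in> {t..t'}\<rbrakk> \<Longrightarrow>
    cmod ((LBINT s:{t..t'}. L s (fam P f c)) - (LBINT s:{t..t'}. L s (fam P f s)))
      \<le> e * (LBINT s:{t..t'}. \<gamma> s)"
  by (rule swap_integral[OF d \<gamma> ab n nice_const[of 1] nice_const[of 1] n f _ e, unfolded fam_trivial])
    (simp, blast)

lemma pairing_p: "adm \<sigma> R M f \<Longrightarrow> t < t' \<Longrightarrow>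
    (LBINT s:{t..t'}. Y s f) = complex_of_real ((LBINT x. p t' x * f x) - (LBINT x. p t x * f x))"
  by (rule Y.time_integral[OF cont(1) pq_measurable(1) L2(1) weak_p])

lemma pairing_q: "adm \<sigma> R M f \<Longrightarrow> t < t' \<Longrightarrow>
    (LBINT s:{t..t'}. W s f) = complex_of_real ((LBINT x. q t' x * f x) - (LBINT x. q t x * f x))"
  by (rule W.time_integral[OF cont(2) pq_measurable(2) L2(2) weak_q])

text \<open>Write h and h' for the values of \<open>H\<close> at \<open>t\<close> and
  \<open>t'\<close>. The weighted square of h' - h equals the increment tested with
  \<open>f h'\<close> minus the increment tested with \<open>f h\<close>. By \<open>ti\<close> these
  are time integrals of \<open>L\<close> on two frozen versions of \<open>f H\<close>, and both are
  close to the integral with the running coefficient. No modulus of continuity in time is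
  involved.\<close>

lemma time_square_integral:
  assumes d: "time_dual \<sigma> N' L" and \<gamma>: "dominates N' r \<gamma>" and ab: "{a..b} \<subseteq> {-r..r}"
    and n: "nice H" and f: "adm \<sigma> R M f" "\<And>x. 0 \<le> f x" and e: "e > 0"
    and ti: "\<And>R M f t t'. adm \<sigma> R M f \<Longrightarrow> t < t' \<Longrightarrow>
    (LBINT s:{t..t'}. L s f) = complex_of_real ((LBINT x. H (p t' x) (q t' x) * f x) - (LBINT x. H (p t x) (q t x) * f x))"
  obtains \<delta> where "\<delta> > 0" "\<And>t t'. \<lbrakk>a \<le> t; t < t'; t' \<le> b; t' - t < \<delta>\<rbrakk> \<Longrightarrow>
    (LBINT x. f x * (H (p t' x) (q t' x) - H (p t x) (q t x))\<^sup>2) \<le> 2 * e * (LBINT s:{t..t'}. \<gamma> s)"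
proof -
  interpret time_dual \<sigma> N' L by (rule d)
  obtain \<delta> where \<delta>: "\<delta> > 0" "\<And>c t t'. \<lbrakk>a \<le> t; t < t'; t' \<le> b; t' - t < \<delta>; c \<in> {t..t'}\<rbrakk> \<Longrightarrow>
    cmod ((LBINT s:{t..t'}. L s (fam H f c)) - (LBINT s:{t..t'}. L s (fam H f s)))
      \<le> e * (LBINT s:{t..t'}. \<gamma> s)"
    by (rule freeze_integral[OF d \<gamma> ab n f(1) e]) blast
  obtain M' where M': "\<And>t. adm \<sigma> R M' (fam H f t)" using fam_adm[OF n f(1)] by blast
  obtain B where B: "lipb B H" using n by (rule niceE)
  have i: "integrable lborel (\<lambda>x. H (p t x) (q t x) * fam H f t' x)" for t t'
    by (rule bounded_times_test1_integrable(1)[OF n adm_integrable(1)[OF M']])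
  show thesis
  proof (rule that[OF \<delta>(1)])
    fix t t' assume t: "a \<le> t" "t < t'" "t' \<le> b" "t' - t < \<delta>"
    let ?J = "\<lambda>c. LBINT s:{t..t'}. L s (fam H f c)" and ?I = "LBINT s:{t..t'}. L s (fam H f s)"
    have "(LBINT x. f x * (H (p t' x) (q t' x) - H (p t x) (q t x))\<^sup>2)
      = (LBINT x. (H (p t' x) (q t' x) * fam H f t' x - H (p t x) (q t x) * fam H f t' x)
        - (H (p t' x) (q t' x) * fam H f t x - H (p t x) (q t x) * fam H f t x))"
      by (rule integral_cong) (auto simp: fam_def power2_eq_square algebra_simps)
    also have "\<dots> = ((LBINT x. H (p t' x) (q t' x) * fam H f t' x) - (LBINT x. H (p t x) (q t x) * fam H f t' x))
      - ((LBINT x. H (p t' x) (q t' x) * fam H f t x) - (LBINT x. H (p t x) (q t x) * fam H f t x))"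
      using i by simp
    finally have "complex_of_real (LBINT x. f x * (H (p t' x) (q t' x) - H (p t x) (q t x))\<^sup>2) = ?J t' - ?J t"
      unfolding ti[OF M' t(2)] by simp
    from arg_cong[OF this, of Re]
    have "(LBINT x. f x * (H (p t' x) (q t' x) - H (p t x) (q t x))\<^sup>2) = Re ((?J t' - ?I) - (?J t - ?I))"
      by (simp only: Re_complex_of_real diff_diff_eq2 diff_add_cancel)
    also have "\<dots> \<le> cmod (?J t' - ?I) + cmod (?J t - ?I)"
      by (rule order_trans[OF complex_Re_le_cmod norm_triangle_ineq4])
    also have "\<dots> \<le> e * (LBINT s:{t..t'}. \<gamma> s) + e * (LBINT s:{t..t'}. \<gamma> s)"
      using t by (intro add_mono \<delta>(2)) auto
    finally show "(LBINT x. f x * (H (p t' x) (q t' x) - H (p t x) (q t x))\<^sup>2) \<le> 2 * e * (LBINT s:{t..t'}. \<gamma> s)"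
      by (simp only: mult_2 distrib_right)
  qed
qed

lemma dominates_interval_integrable: "dominates N' r \<gamma> \<Longrightarrow> set_integrable lborel {a..b} \<gamma>"
  unfolding dominates_def set_integrable_def by (intro integrable_mult_indicator) auto

lemma dominates_nonneg: "dominates N' r \<gamma> \<Longrightarrow> 0 \<le> (LBINT t:{a..b}. \<gamma> t)"
  unfolding dominates_def set_lebesgue_integral_def by (auto intro!: integral_nonneg)

lemma taylor_remainder:
  assumes G: "C2 G Gp Gq" and f: "adm \<sigma> R M f"
  obtains C where "0 \<le> C" "\<And>t t'. \<bar>(LBINT x. fam G f t' x) - (LBINT x. fam G f t x)
    - ((LBINT x. p t' x * fam Gp f t x) - (LBINT x. p t x * fam Gp f t x))
    - ((LBINT x. q t' x * fam Gq f t x) - (LBINT x. q t x * fam Gq f t x))\<bar>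
    \<le> C * ((LBINT x. \<bar>f x\<bar> * (p t' x - p t x)\<^sup>2) + (LBINT x. \<bar>f x\<bar> * (q t' x - q t x)\<^sup>2))"
proof -
  have n: "nice G" "nice Gp" "nice Gq" using G unfolding C2_def by auto
  obtain C where "taylor C G Gp Gq" using G unfolding C2_def by blast
  note C = taylorD[OF this]
  obtain M0 where M0: "\<And>t. adm \<sigma> R M0 (fam G f t)" using fam_adm[OF n(1) f] by blast
  obtain M1 where M1: "\<And>t. adm \<sigma> R M1 (fam Gp f t)" using fam_adm[OF n(2) f] by blast
  obtain M2 where M2: "\<And>t. adm \<sigma> R M2 (fam Gq f t)" using fam_adm[OF n(3) f] by blast
  note iG = adm_integrable(1)[OF M0]
  have ip: "integrable lborel (\<lambda>x. p t x * fam Gp f s x)" and iq: "integrable lborel (\<lambda>x. q t x * fam Gq f s x)" for t s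
    by (rule bounded_times_test1_integrable(1)[OF nice_fst adm_integrable(1)[OF M1]],
      rule bounded_times_test1_integrable(1)[OF nice_snd adm_integrable(1)[OF M2]])
  have sq: "integrable lborel (\<lambda>x. \<bar>f x\<bar> * (g x)\<^sup>2)" if "integrable lborel (\<lambda>x. (g x)\<^sup>2)" for g
  proof (rule integrable_bound[OF integrable_mult_right[OF that, of M]])
    show "(\<lambda>x. \<bar>f x\<bar> * (g x)\<^sup>2) \<in> borel_measurable lborel"
      using admD(1)[OF f] borel_measurable_integrable[OF that] by measurable
    show "AE x in lborel. norm (\<bar>f x\<bar> * (g x)\<^sup>2) \<le> norm (M * (g x)\<^sup>2)"
      unfolding real_norm_def abs_mult abs_abs
      by (intro AE_I2 mult_right_mono order_trans[OF admD(2)[OF f] abs_ge_self] abs_ge_zero)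
  qed
  note isq = sq[OF dd_integrable(1)] sq[OF dd_integrable(2)]
  show thesis
  proof (rule that[OF C(1)])
    fix t t'
    let ?E = "\<lambda>x. fam G f t' x - fam G f t x - (p t' x * fam Gp f t x - p t x * fam Gp f t x)
      - (q t' x * fam Gq f t x - q t x * fam Gq f t x)"
    have iE: "integrable lborel ?E"
      by (intro integrable_diff iG ip iq)
    have "(LBINT x. fam G f t' x) - (LBINT x. fam G f t x)
    - ((LBINT x. p t' x * fam Gp f t x) - (LBINT x. p t x * fam Gp f t x))
    - ((LBINT x. q t' x * fam Gq f t x) - (LBINT x. q t x * fam Gq f t x)) = (LBINT x. ?E x)"
      using iG ip iq by simp
    moreover have "\<bar>LBINT x. ?E x\<bar> \<le> (LBINT x. \<bar>?E x\<bar>)" by (rule integral_abs_bound)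
    moreover have "(LBINT x. \<bar>?E x\<bar>) \<le> (LBINT x. C * (\<bar>f x\<bar> * (p t' x - p t x)\<^sup>2 + \<bar>f x\<bar> * (q t' x - q t x)\<^sup>2))"
    proof (rule integral_mono)
      fix x
      have "?E x = (G (p t' x) (q t' x) - G (p t x) (q t x) - Gp (p t x) (q t x) * (p t' x - p t x) - Gq (p t x) (q t x) * (q t' x - q t x)) * f x"
        by (simp add: fam_def algebra_simps)
      moreover have "\<bar>\<dots>\<bar> \<le> (C * ((p t' x - p t x)\<^sup>2 + (q t' x - q t x)\<^sup>2)) * \<bar>f x\<bar>"
        unfolding abs_mult by (intro mult_right_mono C(2) small1) simp
      ultimately have "\<bar>?E x\<bar> \<le> (C * ((p t' x - p t x)\<^sup>2 + (q t' x - q t x)\<^sup>2)) * \<bar>f x\<bar>" by (simp only:)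
      also have "\<dots> = C * (\<bar>f x\<bar> * (p t' x - p t x)\<^sup>2 + \<bar>f x\<bar> * (q t' x - q t x)\<^sup>2)"
        by (simp add: distrib_left distrib_right mult.assoc mult.commute[of "\<bar>f x\<bar>"])
      finally show "\<bar>?E x\<bar> \<le> C * (\<bar>f x\<bar> * (p t' x - p t x)\<^sup>2 + \<bar>f x\<bar> * (q t' x - q t x)\<^sup>2)" .
    qed (intro integrable_abs iE integrable_mult_right integrable_add isq)+
    moreover have "(LBINT x. C * (\<bar>f x\<bar> * (p t' x - p t x)\<^sup>2 + \<bar>f x\<bar> * (q t' x - q t x)\<^sup>2))
      = C * ((LBINT x. \<bar>f x\<bar> * (p t' x - p t x)\<^sup>2) + (LBINT x. \<bar>f x\<bar> * (q t' x - q t x)\<^sup>2))"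
      using isq[of t' t] by simp
    ultimately show "\<bar>(LBINT x. fam G f t' x) - (LBINT x. fam G f t x)
    - ((LBINT x. p t' x * fam Gp f t x) - (LBINT x. p t x * fam Gp f t x))
    - ((LBINT x. q t' x * fam Gq f t x) - (LBINT x. q t x * fam Gq f t x))\<bar>
    \<le> C * ((LBINT x. \<bar>f x\<bar> * (p t' x - p t x)\<^sup>2) + (LBINT x. \<bar>f x\<bar> * (q t' x - q t x)\<^sup>2))"
      by (simp only:)
  qed
qed

theorem conservation_law:
  assumes G: "C2 G Gp Gq" and F: "C2 F Fp Fq" and k: "nice k"
    and alg: "\<And>a b. \<lbrakk>\<bar>a\<bar> \<le> 1; \<bar>b\<bar> \<le> 1\<rbrakk> \<Longrightarrow> Gq a b = (1 + a\<^sup>2) * k a b"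
      "\<And>a b. \<lbrakk>\<bar>a\<bar> \<le> 1; \<bar>b\<bar> \<le> 1\<rbrakk> \<Longrightarrow> Fp a b = (1 - b\<^sup>2) * k a b"
      "\<And>a b. \<lbrakk>\<bar>a\<bar> \<le> 1; \<bar>b\<bar> \<le> 1\<rbrakk> \<Longrightarrow> Fq a b = Gp a b + 2 * a * b * k a b"
    and \<phi>: "test1 \<phi>" and \<phi>': "\<And>x. (\<phi> has_real_derivative \<phi>' x) (at x)" and uv: "u < v"
  shows "set_integrable lborel {u..v} (\<lambda>t. LBINT x. F (p t x) (q t x) * \<phi>' x)"
    and "(LBINT x. G (p v x) (q v x) * \<phi> x) - (LBINT x. G (p u x) (q u x) * \<phi> x)
      = - (LBINT t:{u..v}. LBINT x. F (p t x) (q t x) * \<phi>' x)"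
proof -
  obtain R M where \<phi>a: "adm \<sigma> R M \<phi>" "adm \<sigma> R M (\<lambda>x. \<bar>\<phi> x\<bar>)" using test1_adm[OF \<phi> sigma(2)] by metis
  have n: "nice G" "nice Gp" "nice Gq" "nice F" "nice Fp" "nice Fq" using G F unfolding C2_def by auto
  define \<Phi> where "\<Phi> t = (LBINT x. F (p t x) (q t x) * \<phi>' x)" for t
  note chain = space_chain_rule[OF F \<phi> \<phi>', folded \<Phi>_def]
  note iX = fam_integrable[OF duals(1) n(5) \<phi>a(1)] and iY = fam_integrable[OF duals(2) n(6) \<phi>a(1)]
  have "set_integrable lborel {a..b} (\<lambda>t. - Re (X t (fam Fp \<phi> t) + Y t (fam Fq \<phi> t)))" for a b
    unfolding set_integrable_def
    using integrable_minus[OF integrable_Re[OF set_integral_add(1)[OF iX(1)[of a b] iY(1)[of a b], unfolded set_integrable_def]]]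
    by (simp add: algebra_simps)
  then have \<Phi>i: "set_integrable lborel {a..b} \<Phi>" for a b unfolding chain by simp
  then show "set_integrable lborel {u..v} (\<lambda>t. LBINT x. F (p t x) (q t x) * \<phi>' x)" unfolding \<Phi>_def .
  have \<Phi>_int: "(LBINT s:{a..b}. X s (fam Fp \<phi> s)) + (LBINT s:{a..b}. Y s (fam Fq \<phi> s))
    = - complex_of_real (LBINT s:{a..b}. \<Phi> s)" for a b
  proof -
    have "(LBINT s:{a..b}. X s (fam Fp \<phi> s)) + (LBINT s:{a..b}. Y s (fam Fq \<phi> s))
      = (LBINT s:{a..b}. - complex_of_real (\<Phi> s))"
      unfolding set_integral_add(2)[OF iX(1) iY(1), symmetric] chain ..
    also have "\<dots> = - complex_of_real (LBINT s:{a..b}. \<Phi> s)"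
      unfolding set_lebesgue_integral_def integral_complex_of_real[symmetric] by (simp add: scaleR_conv_of_real)
    finally show ?thesis .
  qed
  let ?r = "max \<bar>u\<bar> \<bar>v\<bar>"
  have sub: "{u..v} \<subseteq> {-?r..?r}" by auto
  obtain \<gamma>X \<gamma>Y \<gamma>W where \<gamma>: "dominates (\<lambda>_. K) ?r \<gamma>X" "dominates (\<lambda>_. K) ?r \<gamma>Y" "dominates N ?r \<gamma>W"
    using X.majorant Y.majorant W.majorant by metis
  define \<Gamma>I where "\<Gamma>I a b = (LBINT s:{a..b}. \<gamma>X s) + (LBINT s:{a..b}. \<gamma>Y s) + (LBINT s:{a..b}. \<gamma>W s)" for a b
  have \<gamma>le: "(LBINT s:{a..b}. \<gamma>X s) \<le> \<Gamma>I a b" "(LBINT s:{a..b}. \<gamma>Y s) \<le> \<Gamma>I a b" "(LBINT s:{a..b}. \<gamma>W s) \<le> \<Gamma>I a b" for a b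
    unfolding \<Gamma>I_def using dominates_nonneg[OF \<gamma>(1), of a b] dominates_nonneg[OF \<gamma>(2), of a b] dominates_nonneg[OF \<gamma>(3), of a b]
    by linarith+
  define A where "A t = (LBINT x. fam G \<phi> t x)" for t
  \<comment> \<open>\<open>D\<close> is the conserved combination of density and accumulated flux;
    the goal is that it is constant.\<close>
  define D where "D t = A t + (LBINT s:{u..t}. \<Phi> s)" for t
  obtain C where C: "0 \<le> C" "\<And>t t'. \<bar>A t' - A t
    - ((LBINT x. p t' x * fam Gp \<phi> t x) - (LBINT x. p t x * fam Gp \<phi> t x))
    - ((LBINT x. q t' x * fam Gq \<phi> t x) - (LBINT x. q t x * fam Gq \<phi> t x))\<bar>
    \<le> C * ((LBINT x. \<bar>\<phi> x\<bar> * (p t' x - p t x)\<^sup>2) + (LBINT x. \<bar>\<phi> x\<bar> * (q t' x - q t x)\<^sup>2))"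
    by (rule taylor_remainder[OF G \<phi>a(1), folded A_def]) (rule that)
  obtain M1 where M1: "\<And>t. adm \<sigma> R M1 (fam Gp \<phi> t)" using fam_adm[OF n(2) \<phi>a(1)] by blast
  obtain M2 where M2: "\<And>t. adm \<sigma> R M2 (fam Gq \<phi> t)" using fam_adm[OF n(3) \<phi>a(1)] by blast
  obtain M3 where M3: "\<And>t. adm \<sigma> R M3 (fam k \<phi> t)" using fam_adm[OF k \<phi>a(1)] by blast
  have n2: "nice (\<lambda>a b. 2 * a * b * k a b)" by (intro nice_mult nice_const nice_fst nice_snd k)
  obtain M4 where M4: "\<And>t. adm \<sigma> R M4 (fam (\<lambda>a b. 2 * a * b * k a b) \<phi> t)" using fam_adm[OF n2 \<phi>a(1)] by blast
  have Fq_split: "Y s (fam Fq \<phi> s) = Y s (fam Gp \<phi> s) + Y s (fam (\<lambda>a b. 2 * a * b * k a b) \<phi> s)" for s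
  proof -
    have "fam Fq \<phi> s = (\<lambda>x. fam Gp \<phi> s x + fam (\<lambda>a b. 2 * a * b * k a b) \<phi> s x)"
      using alg(3)[OF small1] by (simp add: fam_def fun_eq_iff distrib_right)
    moreover have "adm \<sigma> R (max M1 M4) (fam Gp \<phi> s)" "adm \<sigma> R (max M1 M4) (fam (\<lambda>a b. 2 * a * b * k a b) \<phi> s)"
      by (rule adm_mono[OF M1], simp, simp, rule adm_mono[OF M4], simp, simp)
    ultimately show ?thesis by (simp only: Y.L_add)
  qed
  have small_step: "\<bar>D v - D u\<bar> \<le> (4 + 4 * C) * e * \<Gamma>I u v" if e: "e > 0" for e
  proof -
    have sw: "k a b * (1 - b\<^sup>2) = 1 * Fp a b" "k a b * (1 + a\<^sup>2) = Gq a b * 1" if "\<bar>a\<bar> \<le> 1" "\<bar>b\<bar> \<le> 1" for a b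
      using alg(1,2)[OF that] by simp_all
    obtain d1 where d1: "d1 > 0" "\<And>c t t'. \<lbrakk>u \<le> t; t < t'; t' \<le> v; t' - t < d1; c \<in> {t..t'}\<rbrakk> \<Longrightarrow>
      cmod ((LBINT s:{t..t'}. X s (fam (\<lambda>a b. 1 - b\<^sup>2) (fam k \<phi> c) s)) - (LBINT s:{t..t'}. X s (fam Fp \<phi> s)))
        \<le> e * (LBINT s:{t..t'}. \<gamma>X s)"
      by (rule swap_integral[OF duals(1) \<gamma>(1) sub k nice_coeffs(1) nice_const[of 1] n(5) \<phi>a(1) sw(1) e, unfolded fam_trivial])
        (assumption | rule that)+
    obtain d2 where d2: "d2 > 0" "\<And>c t t'. \<lbrakk>u \<le> t; t < t'; t' \<le> v; t' - t < d2; c \<in> {t..t'}\<rbrakk> \<Longrightarrow>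
      cmod ((LBINT s:{t..t'}. W s (fam (\<lambda>a b. 1 + a\<^sup>2) (fam k \<phi> c) s)) - (LBINT s:{t..t'}. W s (fam Gq \<phi> c)))
        \<le> e * (LBINT s:{t..t'}. \<gamma>W s)"
      by (rule swap_integral[OF duals(3) \<gamma>(3) sub k nice_coeffs(3) n(3) nice_const[of 1] \<phi>a(1) sw(2) e, unfolded fam_trivial])
        (assumption | rule that)+
    obtain d3 where d3: "d3 > 0" "\<And>c t t'. \<lbrakk>u \<le> t; t < t'; t' \<le> v; t' - t < d3; c \<in> {t..t'}\<rbrakk> \<Longrightarrow>
      cmod ((LBINT s:{t..t'}. Y s (fam Gp \<phi> c)) - (LBINT s:{t..t'}. Y s (fam Gp \<phi> s)))
        \<le> e * (LBINT s:{t..t'}. \<gamma>Y s)"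
      by (rule freeze_integral[OF duals(2) \<gamma>(2) sub n(2) \<phi>a(1) e]) blast
    obtain d4 where d4: "d4 > 0" "\<And>c t t'. \<lbrakk>u \<le> t; t < t'; t' \<le> v; t' - t < d4; c \<in> {t..t'}\<rbrakk> \<Longrightarrow>
      cmod ((LBINT s:{t..t'}. Y s (fam (\<lambda>a b. 2 * a * b) (fam k \<phi> c) s)) - (LBINT s:{t..t'}. Y s (fam (\<lambda>a b. 2 * a * b * k a b) \<phi> s)))
        \<le> e * (LBINT s:{t..t'}. \<gamma>Y s)"
      by (rule swap_integral[OF duals(2) \<gamma>(2) sub k nice_coeffs(2) nice_const[of 1] n2 \<phi>a(1) _ e, unfolded fam_trivial])
        (simp, blast)
    obtain d5 where d5: "d5 > 0" "\<And>t t'. \<lbrakk>u \<le> t; t < t'; t' \<le> v; t' - t < d5\<rbrakk> \<Longrightarrow>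
      (LBINT x. \<bar>\<phi> x\<bar> * (p t' x - p t x)\<^sup>2) \<le> 2 * e * (LBINT s:{t..t'}. \<gamma>Y s)"
      by (rule time_square_integral[OF duals(2) \<gamma>(2) sub nice_fst \<phi>a(2) abs_ge_zero e pairing_p]) (assumption | rule that)+
    obtain d6 where d6: "d6 > 0" "\<And>t t'. \<lbrakk>u \<le> t; t < t'; t' \<le> v; t' - t < d6\<rbrakk> \<Longrightarrow>
      (LBINT x. \<bar>\<phi> x\<bar> * (q t' x - q t x)\<^sup>2) \<le> 2 * e * (LBINT s:{t..t'}. \<gamma>W s)"
      by (rule time_square_integral[OF duals(3) \<gamma>(3) sub nice_snd \<phi>a(2) abs_ge_zero e pairing_q]) (assumption | rule that)+
    define \<delta> where "\<delta> = Min {d1, d2, d3, d4, d5, d6}"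
    have \<delta>: "\<delta> > 0" "\<delta> \<le> d1" "\<delta> \<le> d2" "\<delta> \<le> d3" "\<delta> \<le> d4" "\<delta> \<le> d5" "\<delta> \<le> d6"
      unfolding \<delta>_def using d1(1) d2(1) d3(1) d4(1) d5(1) d6(1) by auto
    have "\<bar>D v - D u\<bar> \<le> ((4 + 4 * C) * e) * (\<Gamma>I u v - \<Gamma>I u u)"
    proof (rule telescoping_bound[OF uv \<delta>(1)])
      fix t t' assume t: "u \<le> t" "t < t'" "t' \<le> v" "t' - t < \<delta>"
      let ?X1 = "LBINT s:{t..t'}. X s (fam (\<lambda>a b. 1 - b\<^sup>2) (fam k \<phi> t) s)" and ?X2 = "LBINT s:{t..t'}. X s (fam Fp \<phi> s)"
      let ?W1 = "LBINT s:{t..t'}. W s (fam (\<lambda>a b. 1 + a\<^sup>2) (fam k \<phi> t) s)" and ?W2 = "LBINT s:{t..t'}. W s (fam Gq \<phi> t)"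
      let ?Y1 = "LBINT s:{t..t'}. Y s (fam Gp \<phi> t)" and ?Y2 = "LBINT s:{t..t'}. Y s (fam Gp \<phi> s)"
      let ?Z1 = "LBINT s:{t..t'}. Y s (fam (\<lambda>a b. 2 * a * b) (fam k \<phi> t) s)"
      let ?Z2 = "LBINT s:{t..t'}. Y s (fam (\<lambda>a b. 2 * a * b * k a b) \<phi> s)"
      define P where "P = (LBINT x. p t' x * fam Gp \<phi> t x) - (LBINT x. p t x * fam Gp \<phi> t x)"
      define Q where "Q = (LBINT x. q t' x * fam Gq \<phi> t x) - (LBINT x. q t x * fam Gq \<phi> t x)"
      have PQ: "complex_of_real P = ?Y1" "complex_of_real Q = ?W2"
        unfolding P_def Q_def pairing_p[OF M1 t(2)] pairing_q[OF M2 t(2)] by simp_all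
      have eq: "?X1 + ?Z1 - ?W1 = 0" by (rule integrated_equation[OF M3 t(2)])
      have Y_int: "(LBINT s:{t..t'}. Y s (fam Fq \<phi> s)) = ?Y2 + ?Z2"
        unfolding Fq_split by (rule set_integral_add(2)) (rule fam_integrable(1)[OF duals(2) _ \<phi>a(1)], rule n(2) n2)+
      have \<Phi>_eq: "?X2 + (?Y2 + ?Z2) = - complex_of_real (LBINT s:{t..t'}. \<Phi> s)"
        using \<Phi>_int[of t t'] unfolding Y_int .
      have "D t' - D t = A t' - A t + (LBINT s:{t..t'}. \<Phi> s)"
        unfolding D_def using set_integral_combine[OF t(1) less_imp_le[OF t(2)] \<Phi>i \<Phi>i] by simp
      also have "\<dots> = (A t' - A t - P - Q) + (P + Q + (LBINT s:{t..t'}. \<Phi> s))" by simp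
      finally have Deq: "D t' - D t = (A t' - A t - P - Q) + (P + Q + (LBINT s:{t..t'}. \<Phi> s))" .
      have "complex_of_real (P + Q + (LBINT s:{t..t'}. \<Phi> s)) = ?Y1 + ?W2 - (?X2 + (?Y2 + ?Z2)) + (?X1 + ?Z1 - ?W1)"
        unfolding \<Phi>_eq eq of_real_add PQ by simp
      also have "\<dots> = (?X1 - ?X2) - (?W1 - ?W2) + (?Y1 - ?Y2) + (?Z1 - ?Z2)" by (simp add: algebra_simps)
      finally have "\<bar>P + Q + (LBINT s:{t..t'}. \<Phi> s)\<bar> = cmod ((?X1 - ?X2) - (?W1 - ?W2) + (?Y1 - ?Y2) + (?Z1 - ?Z2))"
        by (metis norm_of_real)
      also have "\<dots> \<le> cmod (?X1 - ?X2) + cmod (?W1 - ?W2) + cmod (?Y1 - ?Y2) + cmod (?Z1 - ?Z2)"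
        by (intro order_trans[OF norm_triangle_ineq add_right_mono] norm_triangle_ineq4)
      also have "\<dots> \<le> e * (LBINT s:{t..t'}. \<gamma>X s) + e * (LBINT s:{t..t'}. \<gamma>W s) + e * (LBINT s:{t..t'}. \<gamma>Y s) + e * (LBINT s:{t..t'}. \<gamma>Y s)"
        using t \<delta> by (intro add_mono d1(2) d2(2) d3(2) d4(2)) auto
      also have "\<dots> \<le> e * \<Gamma>I t t' + e * \<Gamma>I t t' + e * \<Gamma>I t t' + e * \<Gamma>I t t'"
        using e by (intro add_mono mult_left_mono \<gamma>le) auto
      finally have 1: "\<bar>P + Q + (LBINT s:{t..t'}. \<Phi> s)\<bar> \<le> 4 * (e * \<Gamma>I t t')" by simp
      have "\<bar>A t' - A t - P - Q\<bar> \<le> C * ((LBINT x. \<bar>\<phi> x\<bar> * (p t' x - p t x)\<^sup>2) + (LBINT x. \<bar>\<phi> x\<bar> * (q t' x - q t x)\<^sup>2))"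
        unfolding P_def Q_def by (rule C(2))
      also have "\<dots> \<le> C * (2 * e * \<Gamma>I t t' + 2 * e * \<Gamma>I t t')"
        using e t \<delta> by (intro mult_left_mono add_mono order_trans[OF d5(2)] order_trans[OF d6(2)] \<gamma>le C(1)) auto
      finally have 2: "\<bar>A t' - A t - P - Q\<bar> \<le> 4 * C * (e * \<Gamma>I t t')" by (simp add: algebra_simps)
      have \<Gamma>_diff: "\<Gamma>I u t' - \<Gamma>I u t = \<Gamma>I t t'"
        unfolding \<Gamma>I_def set_integral_combine[OF t(1) less_imp_le[OF t(2)] dominates_interval_integrable[OF \<gamma>(1)] dominates_interval_integrable[OF \<gamma>(1)]]
          set_integral_combine[OF t(1) less_imp_le[OF t(2)] dominates_interval_integrable[OF \<gamma>(2)] dominates_interval_integrable[OF \<gamma>(2)]]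
          set_integral_combine[OF t(1) less_imp_le[OF t(2)] dominates_interval_integrable[OF \<gamma>(3)] dominates_interval_integrable[OF \<gamma>(3)]]
        by simp
      have "\<bar>D t' - D t\<bar> \<le> 4 * C * (e * \<Gamma>I t t') + 4 * (e * \<Gamma>I t t')"
        unfolding Deq by (rule order_trans[OF abs_triangle_ineq add_mono[OF 2 1]])
      then show "\<bar>D t' - D t\<bar> \<le> (4 + 4 * C) * e * (\<Gamma>I u t' - \<Gamma>I u t)"
        unfolding \<Gamma>_diff by (simp add: distrib_right mult.assoc)
    qed
    moreover have "\<Gamma>I u u = 0"
    proof -
      have "(LBINT s:{u..u}. g s) = 0" for g :: "real \<Rightarrow> real"
        unfolding set_lebesgue_integral_def by (intro integral_eq_zero_AE eventually_mono[OF AE_lborel_singleton[of u]]) (simp add: indicator_def)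
      then show ?thesis by (simp add: \<Gamma>I_def)
    qed
    ultimately show ?thesis by simp
  qed
  have "D v = D u"
  proof (rule ccontr)
    assume "D v \<noteq> D u"
    then have pos: "\<bar>D v - D u\<bar> > 0" by simp
    \<comment> \<open>\<open>B\<close> does not depend on \<open>e\<close>; a nonzero difference
      would be refuted by taking \<open>e\<close> with \<open>e * B\<close> equal to half of
      it.\<close>
    define B where "B = (4 + 4 * C) * \<Gamma>I u v"
    have B: "\<bar>D v - D u\<bar> \<le> e * B" if "e > 0" for e using small_step[OF that] by (simp add: B_def mult_ac)
    from B[of 1] pos have "B > 0" by simp
    with B[of "\<bar>D v - D u\<bar> / (2 * B)"] pos show False by simp
  qed
  moreover have "(LBINT s:{u..u}. \<Phi> s) = 0"
    unfolding set_lebesgue_integral_def by (intro integral_eq_zero_AE eventually_mono[OF AE_lborel_singleton[of u]]) (simp add: indicator_def)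
  ultimately have "A v - A u = - (LBINT s:{u..v}. \<Phi> s)" by (simp add: D_def)
  then show "(LBINT x. G (p v x) (q v x) * \<phi> x) - (LBINT x. G (p u x) (q u x) * \<phi> x)
      = - (LBINT t:{u..v}. LBINT x. F (p t x) (q t x) * \<phi>' x)"
    unfolding A_def \<Phi>_def fam_def .
qed

end

section \<open>The virial argument\<close>

text \<open>A primitive of a test function is constant near each end, possibly with two different
  constants. The weight in the functional \<open>V\<close> is of this kind: bounded, but not
  compactly supported.\<close>

lemma derivative_test1_bounds:
  assumes \<phi>': "test1 \<phi>'" and d: "\<And>x. (\<phi> has_real_derivative \<phi>' x) (at x)"
  obtains R L B where "R > 0" "L \<ge> 0" "\<And>x y. R \<le> x \<Longrightarrow> R \<le> y \<Longrightarrow> \<phi> x = \<phi> y" "\<And>x y. x \<le> -R \<Longrightarrow> y \<le> -R \<Longrightarrow> \<phi> x = \<phi> y"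
    "\<And>x y. \<bar>\<phi> x - \<phi> y\<bar> \<le> L * \<bar>x - y\<bar>" "\<And>x. \<bar>\<phi> x\<bar> \<le> B"
proof -
  obtain L R0 where L: "L \<ge> 0" "\<And>x. \<bar>\<phi>' x\<bar> \<le> L" and R0: "\<And>x. \<bar>x\<bar> > R0 \<Longrightarrow> \<phi>' x = 0"
    using test1_lipschitz[OF \<phi>'] by metis
  define R where "R = \<bar>R0\<bar> + 1"
  have R: "R > 0" "\<And>x. \<bar>x\<bar> \<ge> R \<Longrightarrow> \<phi>' x = 0" using R0 by (auto simp: R_def)
  have lip: "\<bar>\<phi> x - \<phi> y\<bar> \<le> L * \<bar>x - y\<bar>" for x y
    using norm_vector_derivative_bound[of \<phi> \<phi>' L x y] d L(2)
    by (simp add: has_real_derivative_iff_has_vector_derivative)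
  have zero: "(\<phi> has_real_derivative 0) (at x within S)" if "\<bar>x\<bar> \<ge> R" for x S
    using has_field_derivative_at_within[OF d[of x], of S] R(2)[OF that] by simp
  have "\<exists>c. \<forall>x\<in>{R..}. \<phi> x = c"
    using R(1) by (intro has_field_derivative_zero_constant zero) auto
  then have 1: "\<phi> x = \<phi> y" if "R \<le> x" "R \<le> y" for x y using that by auto
  have "\<exists>c. \<forall>x\<in>{..-R}. \<phi> x = c"
    using R(1) by (intro has_field_derivative_zero_constant zero) auto
  then have 2: "\<phi> x = \<phi> y" if "x \<le> -R" "y \<le> -R" for x y using that by auto
  have "\<bar>\<phi> x\<bar> \<le> \<bar>\<phi> 0\<bar> + L * R" for x
  proof -
    define y where "y = max (-R) (min R x)"
    have "\<phi> x = \<phi> y"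
      using 1[of x y] 2[of x y] R(1) unfolding y_def by (cases "x \<ge> R"; cases "x \<le> -R") auto
    moreover have "\<bar>\<phi> y - \<phi> 0\<bar> \<le> L * R"
    proof (rule order_trans[OF lip mult_left_mono[OF _ L(1)]])
      show "\<bar>y - 0\<bar> \<le> R" unfolding y_def using R(1) by auto
    qed
    ultimately show ?thesis by linarith
  qed
  from that[OF R(1) L(1) 1 2 lip this] show thesis by simp
qed

lemma integrable_times_bounded:
  fixes g k :: "real \<Rightarrow> real"
  assumes "integrable lborel g" "k \<in> borel_measurable borel" "\<And>x. \<bar>k x\<bar> \<le> D"
  shows "integrable lborel (\<lambda>x. g x * k x)"
proof (rule integrable_bound[OF integrable_mult_left[OF assms(1), of D]])
  show "AE x in lborel. norm (g x * k x) \<le> norm (g x * D)"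
    unfolding real_norm_def abs_mult
    by (intro AE_I2 mult_left_mono order_trans[OF assms(3) abs_ge_self] abs_ge_zero)
qed (use assms in measurable)

lemma abs_times_le: "\<bar>k\<bar> \<le> D \<Longrightarrow> \<bar>g * k\<bar> \<le> D * \<bar>g\<bar>" for g k D :: real
  unfolding abs_mult by (subst mult.commute) (rule mult_right_mono, simp_all)

lemma integral_times_bounded:
  fixes g k :: "real \<Rightarrow> real"
  assumes "integrable lborel g" "k \<in> borel_measurable borel" "\<And>x. \<bar>k x\<bar> \<le> D"
  shows "\<bar>LBINT x. g x * k x\<bar> \<le> D * (LBINT x. \<bar>g x\<bar>)"
proof -
  have "\<bar>LBINT x. g x * k x\<bar> \<le> (LBINT x. \<bar>g x * k x\<bar>)" by (rule integral_abs_bound)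
  also have "\<dots> \<le> (LBINT x. D * \<bar>g x\<bar>)"
    by (intro integral_mono integrable_abs integrable_times_bounded[OF assms] integrable_mult_right abs_times_le assms)
  finally show ?thesis by simp
qed

lemma integral_times_limit:
  fixes g k' :: "real \<Rightarrow> real" and k :: "nat \<Rightarrow> real \<Rightarrow> real"
  assumes g: "integrable lborel g" and k: "\<And>n. k n \<in> borel_measurable borel" "k' \<in> borel_measurable borel"
    and "\<And>n x. \<bar>k n x\<bar> \<le> D" "\<And>x. (\<lambda>n. k n x) \<longlonglongrightarrow> k' x"
  shows "(\<lambda>n. LBINT x. g x * k n x) \<longlonglongrightarrow> (LBINT x. g x * k' x)"
proof (rule integral_dominated_convergence)
  show "integrable lborel (\<lambda>x. D * \<bar>g x\<bar>)" using g by simp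
  show "AE x in lborel. (\<lambda>n. g x * k n x) \<longlonglongrightarrow> g x * k' x" using assms(5) by (intro AE_I2 tendsto_mult tendsto_const)
  show "AE x in lborel. norm (g x * k n x) \<le> D * \<bar>g x\<bar>" for n
    unfolding real_norm_def by (intro AE_I2 abs_times_le assms(4))
qed (use g k in measurable)

text \<open>\<open>g\<^sub>t = f\<^sub>x\<close> in the sense of distributions.\<close>

locale conserved =
  fixes g f :: "real \<Rightarrow> real \<Rightarrow> real" and B :: real
  assumes int: "\<And>t. integrable lborel (g t)" "\<And>t. integrable lborel (f t)"
    and bound: "\<And>t x. \<bar>g t x\<bar> \<le> 1"
    and mass: "\<And>t. (LBINT x. \<bar>f t x\<bar>) \<le> B"
    and cont: "\<And>\<phi>. test1 \<phi> \<Longrightarrow> continuous_on UNIV (\<lambda>t. LBINT x. g t x * \<phi> x)"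
      "\<And>\<phi>. test1 \<phi> \<Longrightarrow> continuous_on UNIV (\<lambda>t. LBINT x. f t x * \<phi> x)"
    and law: "\<And>\<phi> \<phi>' u v. \<lbrakk>test1 \<phi>; \<And>x. (\<phi> has_real_derivative \<phi>' x) (at x); u < v\<rbrakk> \<Longrightarrow>
      (LBINT x. g v x * \<phi> x) - (LBINT x. g u x * \<phi> x) = - (LBINT t:{u..v}. LBINT x. f t x * \<phi>' x)"
begin

lemma meas[measurable]: "g t \<in> borel_measurable borel" "f t \<in> borel_measurable borel"
  using borel_measurable_integrable[OF int(1)] borel_measurable_integrable[OF int(2)] by auto

text \<open>Cut off with \<eta>(h x) and let h tend to 0. The extra term carries the factor
  \<open>h\<close> and vanishes in the limit, since \<open>f\<close> is integrable uniformly in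
  time.\<close>

lemma law_extended:
  assumes \<phi>': "test1 \<phi>'" and d: "\<And>x. (\<phi> has_real_derivative \<phi>' x) (at x)" and uv: "u < v"
  shows "(LBINT x. g v x * \<phi> x) - (LBINT x. g u x * \<phi> x) = - (LBINT t:{u..v}. LBINT x. f t x * \<phi>' x)"
proof -
  obtain B1 where B1: "\<And>x. \<bar>\<phi> x\<bar> \<le> B1" by (rule derivative_test1_bounds[OF \<phi>' d]) blast
  obtain B2 where B2: "\<And>x. \<bar>\<phi>' x\<bar> \<le> B2" using test1_bounded[OF \<phi>'] by blast
  define \<eta> where "\<eta> x = bump x / bump 0" for x
  have b0: "bump 0 > 0" by (rule bump_pos) simp
  have \<eta>: "test1 \<eta>" "\<eta> 0 = 1"
    using test1_mult[OF bump_test1 smooth_const[of "1 / bump 0"]] b0 by (simp_all add: \<eta>_def[abs_def])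
  obtain \<eta>' where \<eta>': "test1 \<eta>'" "\<And>x. (\<eta> has_real_derivative \<eta>' x) (at x)" using test1_derivative[OF \<eta>(1)] by blast
  obtain B3 where B3: "\<And>x. \<bar>\<eta> x\<bar> \<le> B3" using test1_bounded[OF \<eta>(1)] by blast
  obtain B4 where B4: "\<And>x. \<bar>\<eta>' x\<bar> \<le> B4" using test1_bounded[OF \<eta>'(1)] by blast
  have nn: "0 \<le> B1" "0 \<le> B2" "0 \<le> B3" "0 \<le> B4"
    using B1[of 0] B2[of 0] B3[of 0] B4[of 0] by linarith+
  define h where "h n = 1 / real (Suc n)" for n
  have h: "h n \<noteq> 0" "0 \<le> h n" "h n \<le> 1" for n by (auto simp: h_def)
  have h0: "h \<longlonglongrightarrow> 0" unfolding h_def by (rule LIMSEQ_Suc[OF lim_1_over_n])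
  have hx: "(\<lambda>n. h n * x) \<longlonglongrightarrow> 0" for x using tendsto_mult[OF h0 tendsto_const[of x]] by simp
  define k where "k n x = \<phi> x * \<eta> (h n * x)" for n x
  define k' where "k' n x = \<phi>' x * \<eta> (h n * x) + \<phi> x * (\<eta>' (h n * x) * h n)" for n x
  have s\<phi>: "smooth \<phi>"
    by (rule smooth_from_derivative[of \<phi> \<phi>']) (use d \<phi>' in \<open>auto simp: has_real_derivative_iff_has_vector_derivative test1_def\<close>)
  have k_test: "test1 (k n)" for n
    using test1_mult'[OF test1_affine[OF \<eta>(1) h(1)[of n], of 0] s\<phi>] by (simp add: k_def[abs_def])
  have dk: "(k n has_real_derivative k' n x) (at x)" for n x
  proof -
    have "((\<lambda>x. \<eta> (h n * x)) has_real_derivative \<eta>' (h n * x) * h n) (at x)"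
      by (rule DERIV_chain2[OF \<eta>'(2)]) (auto intro!: derivative_eq_intros)
    from DERIV_mult[OF d[of x] this] show ?thesis by (simp add: k_def[abs_def] k'_def mult.commute)
  qed
  note [measurable] = smooth_continuous[OF s\<phi>, THEN borel_measurable_continuous_onI] test1_measurable[OF \<phi>'] test1_measurable[OF \<eta>(1)] test1_measurable[OF \<eta>'(1)]
  have km[measurable]: "k n \<in> borel_measurable borel" "k' n \<in> borel_measurable borel" for n
    unfolding k_def k'_def by measurable
  have kb: "\<bar>k n x\<bar> \<le> B1 * B3" for n x
    unfolding k_def abs_mult using nn by (intro mult_mono B1 B3) auto
  have k'b: "\<bar>k' n x\<bar> \<le> B2 * B3 + B1 * (B4 * 1)" for n x
    unfolding k'_def
  proof (rule order_trans[OF abs_triangle_ineq add_mono])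
    show "\<bar>\<phi>' x * \<eta> (h n * x)\<bar> \<le> B2 * B3" unfolding abs_mult using nn by (intro mult_mono B2 B3) auto
    show "\<bar>\<phi> x * (\<eta>' (h n * x) * h n)\<bar> \<le> B1 * (B4 * 1)"
      unfolding abs_mult using nn h[of n] by (intro mult_mono B1 B4) auto
  qed
  have \<eta>lim: "(\<lambda>n. \<eta> (h n * x)) \<longlonglongrightarrow> 1" for x
    using isCont_tendsto_compose[OF DERIV_isCont[OF \<eta>'(2)[of 0]] hx[of x]] \<eta>(2) by simp
  have klim: "(\<lambda>n. k n x) \<longlonglongrightarrow> \<phi> x" for x
    unfolding k_def using tendsto_mult[OF tendsto_const[of "\<phi> x"] \<eta>lim[of x]] by simp
  have k'lim: "(\<lambda>n. k' n x) \<longlonglongrightarrow> \<phi>' x" for x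
  proof -
    have "(\<lambda>n. \<eta>' (h n * x)) \<longlonglongrightarrow> \<eta>' 0"
      using isCont_tendsto_compose[OF _ hx[of x], of \<eta>'] test1_continuous[OF \<eta>'(1), of UNIV]
      by (simp add: continuous_on_eq_continuous_at)
    from tendsto_add[OF tendsto_mult[OF tendsto_const[of "\<phi>' x"] \<eta>lim[of x]] tendsto_mult[OF tendsto_const[of "\<phi> x"] tendsto_mult[OF this h0]]]
    show ?thesis unfolding k'_def by simp
  qed
  have L: "(\<lambda>n. LBINT x. g t x * k n x) \<longlonglongrightarrow> (LBINT x. g t x * \<phi> x)" for t
    by (rule integral_times_limit[OF int(1) km(1) _ kb klim]) measurable
  have R: "(\<lambda>n. LBINT x. f t x * k' n x) \<longlonglongrightarrow> (LBINT x. f t x * \<phi>' x)" for t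
    by (rule integral_times_limit[OF int(2) km(2) _ k'b k'lim]) measurable
  have k'_test: "test1 (k' n)" for n
  proof -
    obtain w where w: "test1 w" "\<And>x. (k n has_real_derivative w x) (at x)" using test1_derivative[OF k_test[of n]] by blast
    have "w = k' n" using DERIV_unique[OF w(2) dk] by (rule ext)
    with w(1) show ?thesis by simp
  qed
  have c: "(\<lambda>t. LBINT x. f t x * k' n x) \<in> borel_measurable borel" "(\<lambda>t. LBINT x. f t x * \<phi>' x) \<in> borel_measurable borel" for n
    by (intro borel_measurable_continuous_onI cont(2) k'_test \<phi>')+
  have RR: "(\<lambda>n. LBINT t:{u..v}. LBINT x. f t x * k' n x) \<longlonglongrightarrow> (LBINT t:{u..v}. LBINT x. f t x * \<phi>' x)"
    unfolding set_lebesgue_integral_def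
  proof (rule integral_dominated_convergence)
    let ?D = "(B2 * B3 + B1 * (B4 * 1)) * B"
    show "integrable lborel (\<lambda>t. ?D * indicator {u..v} t)"
      by (intro integrable_mult_right) (simp add: integrable_indicator_iff emeasure_lborel_Icc_eq)
    show "AE t in lborel. (\<lambda>n. indicator {u..v} t *\<^sub>R (LBINT x. f t x * k' n x)) \<longlonglongrightarrow> indicator {u..v} t *\<^sub>R (LBINT x. f t x * \<phi>' x)"
      by (intro AE_I2 tendsto_scaleR tendsto_const R)
    have "\<bar>LBINT x. f t x * k' n x\<bar> \<le> ?D" for t n
      using nn by (intro order_trans[OF integral_times_bounded[OF int(2) km(2) k'b]] mult_left_mono mass) auto
    then show "AE t in lborel. norm (indicator {u..v} t *\<^sub>R (LBINT x. f t x * k' n x)) \<le> ?D * indicator {u..v} t" for n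
      by (intro AE_I2) (simp add: indicator_def)
  qed (use c in measurable)
  have "(\<lambda>n. (LBINT x. g v x * k n x) - (LBINT x. g u x * k n x)) \<longlonglongrightarrow> (LBINT x. g v x * \<phi> x) - (LBINT x. g u x * \<phi> x)"
    by (intro tendsto_diff L)
  moreover have "(\<lambda>n. (LBINT x. g v x * k n x) - (LBINT x. g u x * k n x)) \<longlonglongrightarrow> - (LBINT t:{u..v}. LBINT x. f t x * \<phi>' x)"
    unfolding law[OF k_test dk uv] by (intro tendsto_minus RR)
  ultimately show ?thesis by (rule LIMSEQ_unique)
qed

text \<open>The law is an integrated identity with a flux continuous in time, so it can be
  differentiated. The base point \<open>t - 1\<close> makes \<open>t\<close> an interior point of
  the interval.\<close>

lemma fixed_derivative:
  assumes \<phi>': "test1 \<phi>'" and d: "\<And>x. (\<phi> has_real_derivative \<phi>' x) (at x)"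
  shows "((\<lambda>t. LBINT x. g t x * \<phi> x) has_real_derivative - (LBINT x. f t x * \<phi>' x)) (at t)"
proof -
  let ?J = "\<lambda>t. LBINT x. f t x * \<phi>' x" and ?I = "\<lambda>t. LBINT x. g t x * \<phi> x"
  have J: "continuous_on A ?J" for A by (rule continuous_on_subset[OF cont(2)[OF \<phi>']]) simp
  have "((\<lambda>s. ?I (t - 1) - integral {t - 1..s} ?J) has_real_derivative 0 - ?J t) (at t within {t - 1..t + 1})"
    by (intro DERIV_diff DERIV_const integral_has_real_derivative J) simp
  then have D: "((\<lambda>s. ?I (t - 1) - integral {t - 1..s} ?J) has_real_derivative - ?J t) (at t)"
    by (simp add: at_within_Icc_at)
  have eq: "?I (t - 1) - integral {t - 1..s} ?J = ?I s" if s: "t - 1 < s" for s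
  proof -
    have "set_integrable lborel {t - 1..s} ?J" by (rule borel_integrable_atLeastAtMost'[OF J])
    then show ?thesis
      using law_extended[OF \<phi>' d s] by (simp add: set_borel_integral_eq_integral(2))
  qed
  show ?thesis
    by (rule has_field_derivative_transform_within[OF D zero_less_one UNIV_I], rule eq) (auto simp: dist_real_def)
qed

text \<open>The difference quotient is split into the change of the dilated weight, tested against
  the density at the later time, and the change of the density for the fixed weight. In the first
  part the density moves with the step as well; L1 convergence of the weight quotients together with
  |g| <= 1 decouples the two limits.\<close>

lemma moving_derivative:
  assumes \<phi>': "test1 \<phi>'" and d: "\<And>x. (\<phi> has_real_derivative \<phi>' x) (at x)"
    and \<mu>: "(\<mu> has_real_derivative \<mu>') (at t)" and a: "\<mu> t > 0"
  shows "((\<lambda>s. LBINT x. g s x * \<phi> (\<mu> s * x)) has_real_derivative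
    (LBINT x. g t x * (\<phi>' (\<mu> t * x) * (\<mu>' * x))) - \<mu> t * (LBINT x. f t x * \<phi>' (\<mu> t * x))) (at t)"
  unfolding has_real_derivative_iff_has_vector_derivative has_vector_derivative_iff_limit tendsto_at_iff_sequentially o_def
proof (intro allI impI)
  fix h :: "nat \<Rightarrow> real" assume "\<forall>n. h n \<in> UNIV - {0}" and h0: "h \<longlonglongrightarrow> 0"
  then have h: "h n \<noteq> 0" for n by auto
  obtain R L B1 where b: "R > 0" "L \<ge> 0" "\<And>x y. R \<le> x \<Longrightarrow> R \<le> y \<Longrightarrow> \<phi> x = \<phi> y" "\<And>x y. x \<le> -R \<Longrightarrow> y \<le> -R \<Longrightarrow> \<phi> x = \<phi> y"
    "\<And>x y. \<bar>\<phi> x - \<phi> y\<bar> \<le> L * \<bar>x - y\<bar>" "\<And>x. \<bar>\<phi> x\<bar> \<le> B1"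
    by (rule derivative_test1_bounds[OF \<phi>' d]) (rule that)
  let ?a = "\<mu> t"
  have [measurable]: "\<phi> \<in> borel_measurable borel"
    by (intro borel_measurable_continuous_onI continuous_at_imp_continuous_on ballI DERIV_isCont[OF d])
  note [measurable] = test1_measurable[OF \<phi>']
  define k where "k n x = (\<phi> (\<mu> (t + h n) * x) - \<phi> (?a * x)) / h n" for n x
  define k' where "k' x = \<phi>' (?a * x) * (\<mu>' * x)" for x
  have km[measurable]: "k n \<in> borel_measurable borel" "k' \<in> borel_measurable borel" for n
    unfolding k_def k'_def by measurable
  have k'_test: "test1 k'"
    unfolding k'_def using a test1_affine[OF \<phi>', of ?a 0]
    by (intro test1_mult smooth_mult smooth_const smooth_ident) simp
  have klim: "(\<lambda>n. k n x) \<longlonglongrightarrow> k' x" for x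
  proof -
    have "((\<lambda>s. \<phi> (\<mu> s * x)) has_real_derivative \<phi>' (?a * x) * (\<mu>' * x)) (at t)"
      by (rule DERIV_chain2[OF d DERIV_cmult_right[OF \<mu>]])
    from vector_derivative_sequence[OF this[unfolded has_real_derivative_iff_has_vector_derivative] h h0]
    show ?thesis by (simp add: k_def k'_def divide_inverse mult.commute)
  qed
  have mlim: "(\<lambda>n. (\<mu> (t + h n) - ?a) /\<^sub>R h n) \<longlonglongrightarrow> \<mu>'"
    by (rule vector_derivative_sequence[OF \<mu>[unfolded has_real_derivative_iff_has_vector_derivative] h h0])
  have "Bseq (\<lambda>n. (\<mu> (t + h n) - ?a) /\<^sub>R h n)" by (rule convergent_imp_Bseq[OF convergentI[OF mlim]])
  then obtain K where K: "K > 0" "\<And>n. norm ((\<mu> (t + h n) - ?a) /\<^sub>R h n) \<le> K"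
    by (rule BseqE) blast
  have Kle: "\<bar>\<mu> (t + h n) - ?a\<bar> \<le> K * \<bar>h n\<bar>" for n
    using K(2)[of n] h[of n] by (simp add: abs_mult divide_inverse[symmetric] field_simps)
  have th: "(\<lambda>n. t + h n) \<longlonglongrightarrow> t" using tendsto_add[OF tendsto_const[of t] h0] by simp
  have "(\<lambda>n. \<mu> (t + h n)) \<longlonglongrightarrow> ?a" by (rule isCont_tendsto_compose[OF DERIV_isCont[OF \<mu>] th])
  then have "eventually (\<lambda>n. \<mu> (t + h n) > ?a / 2) sequentially" by (rule order_tendstoD) (use a in simp)
  then obtain n0 where n0: "\<And>n. n \<ge> n0 \<Longrightarrow> \<mu> (t + h n) > ?a / 2" unfolding eventually_sequentially by blast
  \<comment> \<open>Eventually all dilation factors exceed half of \<mu> t. So for |x| > r both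
    arguments lie beyond \<open>R\<close> on the same side, where \<phi> is constant, and the
    quotient vanishes.\<close>
  define r where "r = 2 * R / ?a"
  have r: "r > 0" "?a / 2 * r = R" using b(1) a by (auto simp: r_def)
  define w where "w x = L * K * r * indicator {-r..r} x" for x
  have wi: "integrable lborel w"
    unfolding w_def by (intro integrable_mult_right) (simp add: integrable_indicator_iff emeasure_lborel_Icc_eq)
  have kb: "\<bar>k n x\<bar> \<le> w x" if n: "n \<ge> n0" for n x
  proof (cases "x \<in> {-r..r}")
    case True
    then have "\<bar>x\<bar> \<le> r" by auto
    have "\<bar>\<phi> (\<mu> (t + h n) * x) - \<phi> (?a * x)\<bar> \<le> L * (\<bar>\<mu> (t + h n) - ?a\<bar> * \<bar>x\<bar>)"
      unfolding abs_mult[symmetric] left_diff_distrib by (rule b(5))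
    also have "\<dots> \<le> L * (K * \<bar>h n\<bar> * r)"
      using b(2) K(1) \<open>\<bar>x\<bar> \<le> r\<close> by (intro mult_left_mono mult_mono Kle) auto
    also have "\<dots> = L * K * r * \<bar>h n\<bar>" by simp
    finally have "\<bar>\<phi> (\<mu> (t + h n) * x) - \<phi> (?a * x)\<bar> / \<bar>h n\<bar> \<le> L * K * r"
      using h[of n] by (simp add: pos_divide_le_eq)
    with True show ?thesis by (simp add: k_def w_def abs_divide)
  next
    case False
    have m: "?a / 2 \<le> \<mu> (t + h n)" "?a / 2 \<le> ?a" using n0[OF n] a by auto
    have "\<phi> (\<mu> (t + h n) * x) = \<phi> (?a * x)"
    proof (cases "x > r")
      case True
      have "R \<le> c * x" if "?a / 2 \<le> c" for c
        using mult_mono[OF that less_imp_le[OF True]] r a that by auto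
      then show ?thesis by (intro b(3)) (use m in auto)
    next
      case F: False
      have "c * x \<le> - R" if "?a / 2 \<le> c" for c
        using mult_mono[OF that, of r "-x"] r a that F False by auto
      then show ?thesis by (intro b(4)) (use m in auto)
    qed
    with False show ?thesis by (simp add: k_def w_def)
  qed
  have k'b: "\<bar>k' x\<bar> \<le> w x" for x
    by (rule LIMSEQ_le_const2[OF tendsto_rabs[OF klim]]) (use kb in blast)
  \<comment> \<open>The majorant is available from index \<open>n0\<close> on, so the finitely many
    earlier terms of the sequence are skipped.\<close>
  define m where "m n = n + n0" for n
  have mge: "m n \<ge> n0" for n by (simp add: m_def)
  have klim': "(\<lambda>n. k (m n) x) \<longlonglongrightarrow> k' x" for x unfolding m_def by (rule LIMSEQ_ignore_initial_segment[OF klim])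
  have th': "(\<lambda>n. t + h (m n)) \<longlonglongrightarrow> t" unfolding m_def by (rule LIMSEQ_ignore_initial_segment[OF th])
  have h0': "(\<lambda>n. h (m n)) \<longlonglongrightarrow> 0" unfolding m_def by (rule LIMSEQ_ignore_initial_segment[OF h0])
  have wb: "w x \<le> L * K * r" for x using b(2) K(1) r(1) by (simp add: w_def indicator_def)
  have ki: "integrable lborel (\<lambda>x. g s x * k (m n) x)" for s n
    by (rule integrable_times_bounded[OF int(1) km(1) order_trans[OF kb[OF mge] wb]])
  have k'i: "integrable lborel (\<lambda>x. g s x * k' x)" for s
    by (rule integrable_times_bounded[OF int(1) km(2) order_trans[OF k'b wb]])
  have abs0: "(\<lambda>n. LBINT x. \<bar>k (m n) x - k' x\<bar>) \<longlonglongrightarrow> integral\<^sup>L lborel (\<lambda>x::real. 0)"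
  proof (rule integral_dominated_convergence)
    show "integrable lborel (\<lambda>x. 2 * w x)" using wi by simp
    show "AE x in lborel. (\<lambda>n. \<bar>k (m n) x - k' x\<bar>) \<longlonglongrightarrow> 0"
      by (intro AE_I2 tendsto_rabs_zero LIM_zero klim')
    show "AE x in lborel. norm \<bar>k (m n) x - k' x\<bar> \<le> 2 * w x" for n
    proof (rule AE_I2)
      fix x show "norm \<bar>k (m n) x - k' x\<bar> \<le> 2 * w x"
        using kb[OF mge, of n x] k'b[of x] by (simp add: abs_le_iff)
    qed
  qed measurable
  have di: "integrable lborel (\<lambda>x. k (m n) x - k' x)" for n
    by (rule integrable_bound[OF integrable_mult_right[OF wi, of 2]], measurable, rule AE_I2)
      (use kb[OF mge] k'b in \<open>smt (verit) real_norm_def\<close>)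
  have first: "(\<lambda>n. LBINT x. g (t + h (m n)) x * k (m n) x) \<longlonglongrightarrow> (LBINT x. g t x * k' x)"
  proof -
    have le: "\<bar>(LBINT x. g (t + h (m n)) x * k (m n) x) - (LBINT x. g (t + h (m n)) x * k' x)\<bar> \<le> (LBINT x. \<bar>k (m n) x - k' x\<bar>)" for n
    proof -
      have "(LBINT x. g (t + h (m n)) x * k (m n) x) - (LBINT x. g (t + h (m n)) x * k' x) = (LBINT x. (k (m n) x - k' x) * g (t + h (m n)) x)"
        unfolding integral_diff[OF ki k'i, symmetric] by (simp add: algebra_simps)
      then show ?thesis using integral_times_bounded[OF di meas(1) bound, of n] by simp
    qed
    have "(\<lambda>n. (LBINT x. g (t + h (m n)) x * k (m n) x) - (LBINT x. g (t + h (m n)) x * k' x)) \<longlonglongrightarrow> 0"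
      by (rule Lim_null_comparison[OF always_eventually, of _ "\<lambda>n. LBINT x. \<bar>k (m n) x - k' x\<bar>"]) (use le abs0 in auto)
    moreover have "(\<lambda>n. LBINT x. g (t + h (m n)) x * k' x) \<longlonglongrightarrow> (LBINT x. g t x * k' x)"
      by (rule continuous_on_tendsto_compose[OF cont(1)[OF k'_test] th']) auto
    ultimately show ?thesis using tendsto_add by fastforce
  qed
  have \<phi>i: "integrable lborel (\<lambda>x. g s x * \<phi> (c * x))" for s c
    by (rule integrable_times_bounded[OF int(1) _ b(6)]) measurable
  have "test1 (\<lambda>x. ?a * \<phi>' (?a * x))"
    using test1_mult'[OF test1_affine[OF \<phi>', of ?a 0] smooth_const[of ?a]] a by simp
  moreover have "((\<lambda>x. \<phi> (?a * x)) has_real_derivative ?a * \<phi>' (?a * x)) (at x)" for x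
    using DERIV_chain2[OF d DERIV_cmult[OF DERIV_ident, of ?a]] by (simp add: mult.commute)
  ultimately have D2: "((\<lambda>s. LBINT x. g s x * \<phi> (?a * x)) has_real_derivative - (LBINT x. f t x * (?a * \<phi>' (?a * x)))) (at t)"
    by (rule fixed_derivative)
  have second: "(\<lambda>n. ((LBINT x. g (t + h (m n)) x * \<phi> (?a * x)) - (LBINT x. g t x * \<phi> (?a * x))) /\<^sub>R h (m n)) \<longlonglongrightarrow>
    - (LBINT x. f t x * (?a * \<phi>' (?a * x)))"
    by (rule vector_derivative_sequence[OF D2[unfolded has_real_derivative_iff_has_vector_derivative] h h0'])
  let ?S = "\<lambda>n. ((LBINT x. g (t + h n) x * \<phi> (\<mu> (t + h n) * x)) - (LBINT x. g t x * \<phi> (?a * x))) /\<^sub>R h n"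
  have split: "?S n
    = (LBINT x. g (t + h n) x * k n x) + ((LBINT x. g (t + h n) x * \<phi> (?a * x)) - (LBINT x. g t x * \<phi> (?a * x))) /\<^sub>R h n" for n
  proof -
    have "(LBINT x. g (t + h n) x * k n x) = ((LBINT x. g (t + h n) x * \<phi> (\<mu> (t + h n) * x)) - (LBINT x. g (t + h n) x * \<phi> (?a * x))) / h n"
      unfolding k_def using \<phi>i by (simp add: right_diff_distrib)
    then show ?thesis by (simp add: divide_inverse algebra_simps)
  qed
  have "(\<lambda>n. ?S (m n)) \<longlonglongrightarrow>
    (LBINT x. g t x * k' x) + - (LBINT x. f t x * (?a * \<phi>' (?a * x)))"
    unfolding split by (rule tendsto_add[OF first second])
  then have "(\<lambda>n. ?S n) \<longlonglongrightarrow>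
    (LBINT x. g t x * k' x) + - (LBINT x. f t x * (?a * \<phi>' (?a * x)))"
    unfolding m_def by (rule LIMSEQ_offset[where f="?S"])
  moreover have "(LBINT x. f t x * (?a * \<phi>' (?a * x))) = ?a * (LBINT x. f t x * \<phi>' (?a * x))"
    by (simp add: mult.left_commute)
  ultimately show "(\<lambda>n. ((LBINT x. g (t + h n) x * \<phi> (\<mu> (t + h n) * x)) - (LBINT x. g t x * \<phi> (?a * x))) /\<^sub>R h n) \<longlonglongrightarrow>
    (LBINT x. g t x * (\<phi>' (?a * x) * (\<mu>' * x))) - ?a * (LBINT x. f t x * \<phi>' (?a * x))"
    by (simp add: k'_def)
qed

end

section \<open>Convergence of the virial functionals\<close>

lemma nonincreasing_converges:
  fixes V :: "real \<Rightarrow> real"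
  assumes dec: "\<And>s t. T \<le> s \<Longrightarrow> s \<le> t \<Longrightarrow> V t \<le> V s" and lb: "\<And>t. T \<le> t \<Longrightarrow> b \<le> V t"
  obtains l where "(V \<longlongrightarrow> l) at_top"
proof -
  let ?l = "Inf (V ` {T..})"
  have bdd: "bdd_below (V ` {T..})" using lb by (intro bdd_belowI[of _ b]) auto
  have "(V \<longlongrightarrow> ?l) at_top"
  proof (rule decreasing_tendsto)
    show "\<forall>\<^sub>F t in at_top. ?l \<le> V t"
      using eventually_ge_at_top[of T] by eventually_elim (intro cINF_lower bdd, simp)
    fix y assume "?l < y"
    then obtain s where s: "T \<le> s" "V s < y" using cINF_less_iff[OF _ bdd, of y] by auto
    show "\<forall>\<^sub>F t in at_top. V t < y"
      using eventually_ge_at_top[of s] by eventually_elim (use dec[OF s(1)] s(2) in force)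
  qed
  then show thesis by (rule that)
qed

text \<open>\<open>V\<close> and \<open>W + 2 D V\<close> decrease, so \<open>W\<close> converges. A positive limit would force \<open>V\<close> to decrease
  like \<open>- log t\<close>.\<close>

lemma virial_calculus:
  fixes V W E \<mu> V' W' :: "real \<Rightarrow> real"
  assumes T: "T > 0" and V: "\<And>t. t \<ge> T \<Longrightarrow> (V has_real_derivative V' t) (at t)"
    and W: "\<And>t. t \<ge> T \<Longrightarrow> (W has_real_derivative W' t) (at t)"
    and V': "\<And>t. t \<ge> T \<Longrightarrow> V' t \<le> - (\<mu> t / 2 * E t)" and W': "\<And>t. t \<ge> T \<Longrightarrow> W' t \<le> D * (\<mu> t * E t)"
    and bd: "\<And>t. t \<ge> T \<Longrightarrow> \<bar>V t\<bar> \<le> B" "\<And>t. t \<ge> T \<Longrightarrow> 0 \<le> W t" "\<And>t. t \<ge> T \<Longrightarrow> W t \<le> D' * E t"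
      "\<And>t. t \<ge> T \<Longrightarrow> c / t \<le> \<mu> t"
    and c: "D \<ge> 0" "D' > 0" "c > 0"
  shows "(W \<longlongrightarrow> 0) at_top"
proof -
  have E: "0 \<le> E t" "0 < \<mu> t" if "t \<ge> T" for t
  proof -
    have "0 \<le> D' * E t" using bd(2,3)[OF that] by linarith
    then show "0 \<le> E t" using c(2) by (simp add: zero_le_mult_iff)
    show "0 < \<mu> t" using bd(4)[OF that] c(3) T that by (intro less_le_trans[OF _ bd(4)[OF that]] divide_pos_pos) auto
  qed
  have V'0: "V' t \<le> 0" if "t \<ge> T" for t
    using V'[OF that] E[OF that] by (smt (verit) mult_nonneg_nonneg divide_nonneg_pos)
  have Vdec: "V t \<le> V s" if "T \<le> s" "s \<le> t" for s t
    by (rule DERIV_nonpos_imp_nonincreasing[OF that(2)]) (use V V'0 that in \<open>meson order_trans\<close>)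
  obtain v where v: "(V \<longlongrightarrow> v) at_top"
  proof (rule nonincreasing_converges[of T V "-B"])
    show "- B \<le> V t" if "T \<le> t" for t using bd(1)[OF that] by (simp add: abs_le_iff)
  qed (use Vdec in auto)
  let ?Z = "\<lambda>t. W t + 2 * D * V t"
  have Z: "(?Z has_real_derivative W' t + 2 * D * V' t) (at t)" if "t \<ge> T" for t
    by (intro DERIV_add W V DERIV_cmult that)
  have Z0: "W' t + 2 * D * V' t \<le> 0" if "t \<ge> T" for t
  proof -
    have "2 * D * V' t \<le> 2 * D * - (\<mu> t / 2 * E t)" using c(1) by (intro mult_left_mono V'[OF that]) simp
    then show ?thesis using W'[OF that] by simp
  qed
  have Zdec: "?Z t \<le> ?Z s" if "T \<le> s" "s \<le> t" for s t
    by (rule DERIV_nonpos_imp_nonincreasing[OF that(2), of ?Z]) (use Z Z0 that in \<open>meson order_trans\<close>)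
  obtain z where z: "(?Z \<longlongrightarrow> z) at_top"
  proof (rule nonincreasing_converges[of T ?Z "2 * D * - B"])
    show "2 * D * - B \<le> ?Z t" if "T \<le> t" for t
    proof -
      have "2 * D * - B \<le> 2 * D * V t" using bd(1)[OF that] c(1) by (intro mult_left_mono) (auto simp: abs_le_iff)
      then show ?thesis using bd(2)[OF that] by linarith
    qed
  qed (use Zdec in auto)
  define w where "w = z - 2 * D * v"
  have "((\<lambda>t. ?Z t - 2 * D * V t) \<longlongrightarrow> w) at_top"
    unfolding w_def by (intro tendsto_diff tendsto_mult tendsto_const z v)
  then have w: "(W \<longlongrightarrow> w) at_top" by simp
  have "w \<ge> 0"
    by (rule tendsto_lowerbound[OF w eventually_mono[OF eventually_ge_at_top[of T] bd(2)]]) simp_all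
  moreover have False if "w > 0"
  proof -
    have "\<forall>\<^sub>F t in at_top. w / 2 < W t" by (rule order_tendstoD(1)[OF w]) (use that in simp)
    then obtain T0 where T0: "\<And>t. t \<ge> T0 \<Longrightarrow> w / 2 < W t" unfolding eventually_at_top_linorder by blast
    define T1 where "T1 = max T T0"
    \<comment> \<open>From w/2 < W <= D' E and \<mu> >= c/t it follows that \<mu> E / 2 >= (c/t) w /
      (4 D'), and the derivative of \<open>V\<close> lies below -\<kappa>/t.\<close>
    define \<kappa> where "\<kappa> = c * w / (4 * D')"
    have \<kappa>: "\<kappa> > 0" using c that by (simp add: \<kappa>_def)
    have V'1: "V' t \<le> - (\<kappa> / t)" if t: "t \<ge> T1" for t
    proof -
      have t: "t \<ge> T" "t \<ge> T0" "t > 0" using t T by (auto simp: T1_def)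
      have "w / (2 * D') \<le> E t"
        using T0[OF t(2)] bd(3)[OF t(1)] c(2) by (simp add: field_simps)
      then have "(c / t) * (w / (2 * D')) \<le> \<mu> t * E t"
        using bd(4)[OF t(1)] E[OF t(1)] c \<open>w > 0\<close> by (intro mult_mono) auto
      moreover have "(c / t) * (w / (2 * D')) = 2 * (\<kappa> / t)" using c t by (simp add: \<kappa>_def)
      ultimately show ?thesis using V'[OF t(1)] by linarith
    qed
    have dec: "V t + \<kappa> * ln t \<le> V T1 + \<kappa> * ln T1" if t: "T1 \<le> t" for t
    proof (rule DERIV_nonpos_imp_nonincreasing[OF t, of "\<lambda>t. V t + \<kappa> * ln t"])
      fix s assume s: "T1 \<le> s" "s \<le> t"
      then have s': "s \<ge> T" "s > 0" using T by (auto simp: T1_def)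
      have "((\<lambda>t. V t + \<kappa> * ln t) has_real_derivative V' s + \<kappa> * (1 / s)) (at s)"
        using s' by (intro DERIV_add V DERIV_cmult DERIV_ln_divide) auto
      then show "\<exists>y. ((\<lambda>t. V t + \<kappa> * ln t) has_real_derivative y) (at s) \<and> y \<le> 0"
        using V'1[OF s(1)] by (intro exI[of _ "V' s + \<kappa> * (1 / s)"]) auto
    qed
    \<comment> \<open>Late enough that \<kappa> ln t exceeds \<kappa> ln T1 by more than 2 B, the
      largest possible variation of \<open>V\<close>.\<close>
    define t where "t = max T1 (exp ((2 * B + \<kappa> * ln T1) / \<kappa> + 1))"
    have t: "t \<ge> T1" "t \<ge> T" "t > 0" "exp ((2 * B + \<kappa> * ln T1) / \<kappa> + 1) \<le> t" using T by (auto simp: t_def T1_def)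
    have "(2 * B + \<kappa> * ln T1) / \<kappa> + 1 \<le> ln t" using t(3,4) by (simp add: ln_ge_iff)
    then have "2 * B + \<kappa> * ln T1 + \<kappa> \<le> \<kappa> * ln t" using \<kappa> by (simp add: field_simps)
    moreover have "V T1 \<le> B" "- B \<le> V t" using bd(1)[of T1] bd(1)[OF t(2)] by (auto simp: T1_def abs_le_iff)
    ultimately show False using dec[OF t(1)] \<kappa> by linarith
  qed
  ultimately have "w = 0" by force
  with w show ?thesis by simp
qed

lemma virial_decay:
  assumes m: "conserved m e B" and Q: "conserved Q F B'" and C: "C > 0"
    and le: "\<And>t x. \<bar>m t x\<bar> \<le> e t x" "\<And>t x. e t x \<le> 2 * Q t x" "\<And>t x. Q t x \<le> e t x" "\<And>t x. \<bar>F t x\<bar> \<le> e t x"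
  shows "((\<lambda>t. LBINT x:{-(C * t / (ln t)\<^sup>2)<..<C * t / (ln t)\<^sup>2}. e t x) \<longlongrightarrow> 0) at_top"
proof -
  interpret m: conserved m e B by (rule m)
  interpret Q: conserved Q F B' by (rule Q)
  have e0: "0 \<le> e t x" and Q0: "0 \<le> Q t x" for t x using le(1)[of t x] le(2)[of t x] by linarith+
  define \<mu> where "\<mu> t = (ln t)\<^sup>2 / (C * t)" for t
  define \<mu>' where "\<mu>' t = (2 * ln t - (ln t)\<^sup>2) / (C * t\<^sup>2)" for t
  have d\<mu>: "(\<mu> has_real_derivative \<mu>' t) (at t)" if "t > 0" for t
    unfolding \<mu>_def[abs_def] \<mu>'_def using that C
    by (auto intro!: derivative_eq_intros simp: field_simps power2_eq_square)
  \<comment> \<open>The ratio of \<mu>' to the square of \<mu> is C (2 ln t - (ln t)^2) / (ln t)^4,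
    which tends to 0; this is the effect of the logarithms in the width of the interval. The factor
    8 is what is needed to absorb the dilation term below.\<close>
  have "\<forall>\<^sub>F t in at_top. 8 * \<mu>' t \<le> (\<mu> t)\<^sup>2" "\<forall>\<^sub>F t in at_top. - (8 * \<mu>' t) \<le> (\<mu> t)\<^sup>2"
    unfolding \<mu>_def \<mu>'_def using C by real_asymp+
  then have "\<forall>\<^sub>F t in at_top. 8 * \<bar>\<mu>' t\<bar> \<le> (\<mu> t)\<^sup>2 \<and> t \<ge> 3"
    using eventually_ge_at_top[of 3] by eventually_elim (simp add: abs_if)
  then obtain T where T: "\<And>t. t \<ge> T \<Longrightarrow> 8 * \<bar>\<mu>' t\<bar> \<le> (\<mu> t)\<^sup>2" "\<And>t. t \<ge> T \<Longrightarrow> t \<ge> 3"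
    unfolding eventually_at_top_linorder by blast
  have ln1: "1 \<le> ln t" if "t \<ge> T" for t
    using T(2)[OF that] e_less_272 by (subst ln_ge_iff) auto
  have \<mu>1: "1 / C / t \<le> \<mu> t" "0 < \<mu> t" if "t \<ge> T" for t
  proof -
    have t: "t > 0" "1 \<le> (ln t)\<^sup>2" using T(2)[OF that] ln1[OF that] by (auto simp: one_le_power)
    then show "1 / C / t \<le> \<mu> t" using C by (simp add: \<mu>_def divide_right_mono)
    moreover have "0 < 1 / C / t" using C t by simp
    ultimately show "0 < \<mu> t" by linarith
  qed
  \<comment> \<open>The scales are nested: \<psi> is supported in |y| <= 2, where b >= c, so \<psi>
    and its derivative are controlled by \<open>b\<close>; and \<psi> >= c on |y| <= 1, which
    corresponds to the interval of the theorem. On the support of \<open>b\<close>, where |y| <= 4,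
    the dilation term is at most \<mu>/8 * 4 = \<mu>/2 times \<open>e b\<close>, half of the main
    term.\<close>
  define b where "b y = bump (1/4 * y + 0)" for y
  define \<psi> where "\<psi> y = bump (1/2 * y + 0)" for y
  have b: "test1 b" "\<And>y. 0 \<le> b y" "\<And>y. \<bar>y\<bar> \<ge> 4 \<Longrightarrow> b y = 0"
    unfolding b_def using test1_affine[OF bump_test1, of "1/4" 0] by (auto simp: bump_nonneg bump_zero)
  have \<psi>: "test1 \<psi>" "\<And>y. 0 \<le> \<psi> y" "\<And>y. \<bar>y\<bar> \<ge> 2 \<Longrightarrow> \<psi> y = 0"
    unfolding \<psi>_def using test1_affine[OF bump_test1, of "1/2" 0] by (auto simp: bump_nonneg bump_zero)
  obtain c where c: "c > 0" "\<And>x. \<bar>x\<bar> \<le> 1/2 \<Longrightarrow> c \<le> bump x" using bump_lower_bound[of "1/2"] by auto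
  have bc: "c \<le> b y" if "\<bar>y\<bar> \<le> 2" for y using that c(2)[of "1/4 * y + 0"] by (simp add: b_def)
  have \<psi>c: "c \<le> \<psi> y" if "\<bar>y\<bar> \<le> 1" for y using that c(2)[of "1/2 * y + 0"] by (simp add: \<psi>_def)
  obtain \<psi>' where \<psi>': "test1 \<psi>'" "\<And>x. (\<psi> has_real_derivative \<psi>' x) (at x)" using test1_derivative[OF \<psi>(1)] by blast
  have \<psi>'0: "\<psi>' y = 0" if "\<bar>y\<bar> > 2" for y
    using vanishing_derivative[of 2 \<psi> \<psi>' y] \<psi>(3) \<psi>'(2) that by (auto simp: has_real_derivative_iff_has_vector_derivative)
  obtain L where L: "L > 0" "\<And>x. \<bar>\<psi>' x\<bar> \<le> L" using test1_bounded[OF \<psi>'(1)] by blast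
  obtain M where M: "M > 0" "\<And>x. \<bar>\<psi> x\<bar> \<le> M" using test1_bounded[OF \<psi>(1)] by blast
  obtain Mb where Mb: "Mb > 0" "\<And>x. \<bar>b x\<bar> \<le> Mb" using test1_bounded[OF b(1)] by blast
  obtain \<phi> where \<phi>: "\<And>x. (\<phi> has_real_derivative b x) (at x)"
  proof -
    have "\<exists>F. \<forall>x::real. -\<infinity> < ereal x \<longrightarrow> ereal x < \<infinity> \<longrightarrow> (F has_vector_derivative b x) (at x)"
      using test1_continuous[OF b(1), of UNIV] by (intro einterval_antiderivative) (auto simp: continuous_on_eq_continuous_at)
    with that show thesis by (auto simp: has_real_derivative_iff_has_vector_derivative)
  qed
  obtain B1 where B1: "\<And>x. \<bar>\<phi> x\<bar> \<le> B1" by (rule derivative_test1_bounds[OF b(1) \<phi>]) blast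
  note [measurable] = test1_measurable[OF b(1)] test1_measurable[OF \<psi>(1)] test1_measurable[OF \<psi>'(1)]
  have [measurable]: "\<phi> \<in> borel_measurable borel"
    by (intro borel_measurable_continuous_onI continuous_at_imp_continuous_on ballI DERIV_isCont[OF \<phi>])
  define E where "E t = (LBINT x. e t x * b (\<mu> t * x))" for t
  define V where "V t = (LBINT x. m t x * \<phi> (\<mu> t * x))" for t
  define W where "W t = (LBINT x. Q t x * \<psi> (\<mu> t * x))" for t
  have ei: "integrable lborel (\<lambda>x. e t x * b (a * x))" for t a
    by (rule integrable_times_bounded[OF m.int(2) _ Mb(2)]) measurable
  have Wi: "integrable lborel (\<lambda>x. Q t x * \<psi> (a * x))" for t a
    by (rule integrable_times_bounded[OF Q.int(1) _ M(2)]) measurable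
  have dom: "\<bar>LBINT x. k x\<bar> \<le> D * E t" if "\<And>x. \<bar>k x\<bar> \<le> D * (e t x * b (\<mu> t * x))" "0 \<le> D" for k D t
  proof -
    have "\<bar>LBINT x. k x\<bar> \<le> (LBINT x. \<bar>k x\<bar>)" by (rule integral_abs_bound)
    also have "\<dots> \<le> (LBINT x. D * (e t x * b (\<mu> t * x)))"
      by (rule integral_mono'[OF integrable_mult_right[OF ei] that(1) order_trans[OF abs_ge_zero that(1)]])
    finally show ?thesis by (simp add: E_def)
  qed
  have sup4: "\<bar>y\<bar> * b y \<le> 4 * b y" for y
    using b(2)[of y] b(3)[of y] by (cases "\<bar>y\<bar> \<le> 4") (auto intro: mult_right_mono)
  have \<psi>'b: "\<bar>\<psi>' y\<bar> \<le> L / c * b y" "\<bar>\<psi>' y\<bar> * \<bar>y\<bar> \<le> 2 * (L / c * b y)" for y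
  proof -
    show 1: "\<bar>\<psi>' y\<bar> \<le> L / c * b y"
    proof (cases "\<bar>y\<bar> \<le> 2")
      case True
      have "\<bar>\<psi>' y\<bar> \<le> L / c * c" using L(2) c(1) by simp
      also have "\<dots> \<le> L / c * b y" using bc[OF True] L(1) c(1) by (intro mult_left_mono) auto
      finally show ?thesis .
    qed (use \<psi>'0[of y] b(2)[of y] L(1) c(1) in auto)
    show "\<bar>\<psi>' y\<bar> * \<bar>y\<bar> \<le> 2 * (L / c * b y)"
    proof (cases "\<bar>y\<bar> \<le> 2")
      case True
      then have "\<bar>\<psi>' y\<bar> * \<bar>y\<bar> \<le> \<bar>\<psi>' y\<bar> * 2" by (intro mult_left_mono) auto
      then show ?thesis using 1 by linarith
    qed (use \<psi>'0[of y] b(2)[of y] L(1) c(1) in auto)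
  qed
  have \<psi>b: "\<psi> y \<le> M / c * b y" for y
  proof (cases "\<bar>y\<bar> \<le> 2")
    case True
    have "\<psi> y \<le> M / c * c" using M(2)[of y] c(1) by simp
    also have "\<dots> \<le> M / c * b y" using bc[OF True] M(1) c(1) by (intro mult_left_mono) auto
    finally show ?thesis .
  qed (use \<psi>(3)[of y] b(2)[of y] M(1) c(1) in auto)
  have \<mu>'le: "\<bar>\<mu>' t * x\<bar> * (8 / \<mu> t) \<le> \<bar>\<mu> t * x\<bar>" if "t \<ge> T" for t x
  proof -
    have "8 * \<bar>\<mu>' t\<bar> * \<bar>x\<bar> \<le> (\<mu> t)\<^sup>2 * \<bar>x\<bar>" by (intro mult_right_mono T(1) that) simp
    then have "8 * \<bar>\<mu>' t\<bar> * \<bar>x\<bar> / \<mu> t \<le> (\<mu> t)\<^sup>2 * \<bar>x\<bar> / \<mu> t" using \<mu>1(2)[OF that] by (intro divide_right_mono) auto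
    then show ?thesis using \<mu>1(2)[OF that] by (simp add: abs_mult power2_eq_square mult_ac)
  qed
  have \<mu>'le': "\<bar>\<mu>' t * x\<bar> \<le> \<mu> t / 8 * \<bar>\<mu> t * x\<bar>" if "t \<ge> T" for t x
    using \<mu>'le[OF that, of x] \<mu>1(2)[OF that] by (simp add: field_simps)
  have Wlim: "(W \<longlongrightarrow> 0) at_top"
  proof (rule virial_calculus)
    show "0 < max T 3" by simp
    show "(V has_real_derivative (LBINT x. m t x * (b (\<mu> t * x) * (\<mu>' t * x))) - \<mu> t * E t) (at t)" if "max T 3 \<le> t" for t
      unfolding V_def[abs_def] E_def using that \<mu>1 by (intro m.moving_derivative b \<phi> d\<mu>) auto
    show "(W has_real_derivative (LBINT x. Q t x * (\<psi>' (\<mu> t * x) * (\<mu>' t * x))) - \<mu> t * (LBINT x. F t x * \<psi>' (\<mu> t * x))) (at t)" if "max T 3 \<le> t" for t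
      unfolding W_def[abs_def] using that \<mu>1 by (intro Q.moving_derivative \<psi>' d\<mu>) auto
    show "(LBINT x. m t x * (b (\<mu> t * x) * (\<mu>' t * x))) - \<mu> t * E t \<le> - (\<mu> t / 2 * E t)" if "max T 3 \<le> t" for t
    proof -
      have t: "t \<ge> T" using that by simp
      have "\<bar>LBINT x. m t x * (b (\<mu> t * x) * (\<mu>' t * x))\<bar> \<le> \<mu> t / 2 * E t"
      proof (rule dom)
        fix x
        have "\<bar>m t x * (b (\<mu> t * x) * (\<mu>' t * x))\<bar> \<le> e t x * (b (\<mu> t * x) * (\<mu> t / 8 * \<bar>\<mu> t * x\<bar>))"
          unfolding abs_mult[of "m t x"] abs_mult[of "b (\<mu> t * x)"] abs_of_nonneg[OF b(2)]
          by (intro mult_mono mult_left_mono le \<mu>'le' t e0 b mult_nonneg_nonneg abs_ge_zero)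
        also have "\<dots> = e t x * (\<mu> t / 8) * (\<bar>\<mu> t * x\<bar> * b (\<mu> t * x))" by simp
        also have "\<dots> \<le> e t x * (\<mu> t / 8) * (4 * b (\<mu> t * x))"
          using \<mu>1(2)[OF t] by (intro mult_left_mono sup4 mult_nonneg_nonneg e0) auto
        finally show "\<bar>m t x * (b (\<mu> t * x) * (\<mu>' t * x))\<bar> \<le> \<mu> t / 2 * (e t x * b (\<mu> t * x))" by simp
      qed (use \<mu>1(2)[OF t] in simp)
      then show ?thesis by (simp add: abs_le_iff)
    qed
    show "(LBINT x. Q t x * (\<psi>' (\<mu> t * x) * (\<mu>' t * x))) - \<mu> t * (LBINT x. F t x * \<psi>' (\<mu> t * x)) \<le> 2 * (L / c) * (\<mu> t * E t)" if "max T 3 \<le> t" for t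
    proof -
      have t: "t \<ge> T" using that by simp
      have Lc: "0 \<le> L / c" using L(1) c(1) by simp
      have 1: "\<bar>LBINT x. Q t x * (\<psi>' (\<mu> t * x) * (\<mu>' t * x))\<bar> \<le> (\<mu> t * (L / c)) * E t"
      proof (rule dom)
        fix x
        have "\<bar>Q t x * (\<psi>' (\<mu> t * x) * (\<mu>' t * x))\<bar> \<le> e t x * (\<bar>\<psi>' (\<mu> t * x)\<bar> * (\<mu> t / 8 * \<bar>\<mu> t * x\<bar>))"
          unfolding abs_mult[of "Q t x"] abs_mult[of "\<psi>' (\<mu> t * x)"] abs_of_nonneg[OF Q0]
          by (intro mult_mono mult_left_mono le \<mu>'le' t e0 mult_nonneg_nonneg abs_ge_zero)
        also have "\<dots> = e t x * (\<mu> t / 8) * (\<bar>\<psi>' (\<mu> t * x)\<bar> * \<bar>\<mu> t * x\<bar>)" by simp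
        also have "\<dots> \<le> e t x * (\<mu> t / 8) * (2 * (L / c * b (\<mu> t * x)))"
          using \<mu>1(2)[OF t] by (intro mult_left_mono \<psi>'b mult_nonneg_nonneg e0) auto
        also have "\<dots> = 1 / 4 * (\<mu> t * (L / c) * (e t x * b (\<mu> t * x)))" by simp
        also have "\<dots> \<le> \<mu> t * (L / c) * (e t x * b (\<mu> t * x))"
          using \<mu>1(2)[OF t] Lc e0[of t x] b(2)[of "\<mu> t * x"] by (intro mult_left_le_one_le mult_nonneg_nonneg) auto
        finally show "\<bar>Q t x * (\<psi>' (\<mu> t * x) * (\<mu>' t * x))\<bar> \<le> \<mu> t * (L / c) * (e t x * b (\<mu> t * x))" .
      qed (intro mult_nonneg_nonneg less_imp_le[OF \<mu>1(2)[OF t]] Lc)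
      have 2: "\<bar>LBINT x. F t x * \<psi>' (\<mu> t * x)\<bar> \<le> (L / c) * E t"
      proof (rule dom)
        fix x
        have "\<bar>F t x * \<psi>' (\<mu> t * x)\<bar> \<le> e t x * (L / c * b (\<mu> t * x))"
          unfolding abs_mult by (intro mult_mono le \<psi>'b e0 abs_ge_zero)
        then show "\<bar>F t x * \<psi>' (\<mu> t * x)\<bar> \<le> L / c * (e t x * b (\<mu> t * x))" by (simp only: mult.left_commute)
      qed (rule Lc)
      have "- (\<mu> t * (LBINT x. F t x * \<psi>' (\<mu> t * x))) \<le> \<mu> t * ((L / c) * E t)"
        unfolding mult_minus_right[symmetric] using 2 \<mu>1(2)[OF t] by (intro mult_left_mono) (auto simp: abs_le_iff)
      moreover have "(LBINT x. Q t x * (\<psi>' (\<mu> t * x) * (\<mu>' t * x))) \<le> \<mu> t * ((L / c) * E t)"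
        using 1 by (simp add: abs_le_iff)
      moreover have "2 * (L / c) * (\<mu> t * E t) = \<mu> t * ((L / c) * E t) + \<mu> t * ((L / c) * E t)" by simp
      ultimately show ?thesis by linarith
    qed
    show "\<bar>V t\<bar> \<le> B1 * B" if "max T 3 \<le> t" for t
    proof -
      have B1': "0 \<le> B1" using B1[of 0] by linarith
      have "\<bar>V t\<bar> \<le> B1 * (LBINT x. \<bar>m t x\<bar>)"
        unfolding V_def by (rule integral_times_bounded[OF m.int(1) _ B1]) measurable
      also have "\<dots> \<le> B1 * (LBINT x. \<bar>e t x\<bar>)"
        using m.int[of t] le(1) e0 B1' by (intro mult_left_mono integral_mono) auto
      also have "\<dots> \<le> B1 * B" using B1' by (intro mult_left_mono m.mass)
      finally show ?thesis .
    qed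
    show "0 \<le> W t" if "max T 3 \<le> t" for t
      unfolding W_def by (intro integral_nonneg mult_nonneg_nonneg Q0 \<psi>)
    show "W t \<le> M / c * E t" if "max T 3 \<le> t" for t
    proof -
      have "\<bar>W t\<bar> \<le> M / c * E t"
        unfolding W_def
      proof (rule dom)
        fix x
        have "\<bar>Q t x * \<psi> (\<mu> t * x)\<bar> \<le> e t x * (M / c * b (\<mu> t * x))"
          unfolding abs_mult abs_of_nonneg[OF Q0] abs_of_nonneg[OF \<psi>(2)] by (intro mult_mono le \<psi>b e0 \<psi>)
        then show "\<bar>Q t x * \<psi> (\<mu> t * x)\<bar> \<le> M / c * (e t x * b (\<mu> t * x))" by (simp only: mult.left_commute)
      qed (use M(1) c(1) in simp)
      then show ?thesis by linarith
    qed
    show "1 / C / t \<le> \<mu> t" if "max T 3 \<le> t" for t by (rule \<mu>1) (use that in simp)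
  qed (use L(1) c(1) M(1) C in auto)
  have le_W: "(LBINT x:{-(C * t / (ln t)\<^sup>2)<..<C * t / (ln t)\<^sup>2}. e t x) \<le> 2 / c * W t" if t: "t \<ge> T" for t
  proof -
    have i: "C * t / (ln t)\<^sup>2 = 1 / \<mu> t" by (simp add: \<mu>_def)
    have "(LBINT x:{-(1 / \<mu> t)<..<1 / \<mu> t}. e t x) \<le> (LBINT x. 2 / c * (Q t x * \<psi> (\<mu> t * x)))"
      unfolding set_lebesgue_integral_def
    proof (rule integral_mono')
      show "integrable lborel (\<lambda>x. 2 / c * (Q t x * \<psi> (\<mu> t * x)))" using Wi by simp
      fix x
      show "indicator {-(1 / \<mu> t)<..<1 / \<mu> t} x *\<^sub>R e t x \<le> 2 / c * (Q t x * \<psi> (\<mu> t * x))"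
      proof (cases "x \<in> {-(1 / \<mu> t)<..<1 / \<mu> t}")
        case True
        then have "\<bar>\<mu> t * x\<bar> \<le> 1"
          using \<mu>1(2)[OF t] by (auto simp: abs_mult field_simps abs_le_iff)
        then have "2 * Q t x * (c / c) \<le> 2 * Q t x * (\<psi> (\<mu> t * x) / c)"
          using \<psi>c c(1) Q0[of t x] by (intro mult_left_mono divide_right_mono) auto
        then show ?thesis using True le(2)[of t x] c(1) by (simp add: mult_ac)
      qed (use c(1) Q0[of t x] \<psi>(2)[of "\<mu> t * x"] in simp)
      show "0 \<le> 2 / c * (Q t x * \<psi> (\<mu> t * x))" using c(1) Q0[of t x] \<psi>(2)[of "\<mu> t * x"] by simp
    qed
    then show ?thesis unfolding i W_def by simp
  qed
  show ?thesis
  proof (rule tendsto_sandwich[where f="\<lambda>_. 0"])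
    show "\<forall>\<^sub>F t in at_top. 0 \<le> (LBINT x:{-(C * t / (ln t)\<^sup>2)<..<C * t / (ln t)\<^sup>2}. e t x)"
      unfolding set_lebesgue_integral_def by (intro always_eventually allI integral_nonneg) (simp add: e0)
    show "\<forall>\<^sub>F t in at_top. (LBINT x:{-(C * t / (ln t)\<^sup>2)<..<C * t / (ln t)\<^sup>2}. e t x) \<le> 2 / c * W t"
      using eventually_ge_at_top[of T] by eventually_elim (rule le_W)
    show "((\<lambda>t. 2 / c * W t) \<longlongrightarrow> 0) at_top" using tendsto_mult[OF tendsto_const[of "2 / c"] Wlim] by simp
  qed simp
qed

text \<open>Under time reversal \<open>q\<close> changes sign, so \<open>M\<close> is odd and
  \<open>e\<close> is even. With \<open>c = -1\<close> the first law keeps the positive flux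
  \<open>e\<close>; with \<open>c = 1\<close> the second keeps its positive density. The forward
  argument then covers negative times.\<close>

lemma conserved_reverse:
  assumes "conserved g f B" and c: "c = 1 \<or> c = -1"
  shows "conserved (\<lambda>t x. c * g (- t) x) (\<lambda>t x. - c * f (- t) x) B"
proof -
  interpret conserved g f B by (rule assms(1))
  have abs_c: "\<bar>c * y\<bar> = \<bar>y\<bar>" "\<bar>- c * y\<bar> = \<bar>y\<bar>" for y using c by auto
  have ct: "continuous_on UNIV (\<lambda>t. k (- t))" if "continuous_on UNIV k" for k :: "real \<Rightarrow> real"
    using continuous_on_compose2[OF that, of UNIV uminus] by (simp add: continuous_intros)
  show ?thesis
  proof
    fix t x
    show "integrable lborel (\<lambda>x. c * g (- t) x)" "integrable lborel (\<lambda>x. - c * f (- t) x)"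
      by (intro integrable_mult_right int)+
    show "\<bar>c * g (- t) x\<bar> \<le> 1" unfolding abs_c by (rule bound)
    show "(LBINT x. \<bar>- c * f (- t) x\<bar>) \<le> B" unfolding abs_c by (rule mass)
  next
    fix \<phi> :: "real \<Rightarrow> real" assume "test1 \<phi>"
    note * = ct[OF cont(1)[OF this]] ct[OF cont(2)[OF this]]
    show "continuous_on UNIV (\<lambda>t. LBINT x. c * g (- t) x * \<phi> x)" "continuous_on UNIV (\<lambda>t. LBINT x. - c * f (- t) x * \<phi> x)"
      unfolding mult.assoc integral_mult_right_zero by (intro continuous_on_mult continuous_on_const *)+
  next
    fix \<phi> \<phi>' :: "real \<Rightarrow> real" and u v :: real
    assume \<phi>: "test1 \<phi>" "\<And>x. (\<phi> has_real_derivative \<phi>' x) (at x)" and "u < v"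
    then have "- v < - u" by simp
    note l = law[OF \<phi> this]
    have "(LBINT t:{-v..-u}. LBINT x. f t x * \<phi>' x) = (LBINT t:{u..v}. LBINT x. f (- t) x * \<phi>' x)"
      using integral_reflect[of "\<lambda>t. indicator {-v..-u} t *\<^sub>R (LBINT x. f t x * \<phi>' x)" 0]
      unfolding set_lebesgue_integral_def
      by (simp add: indicator_def conj_commute cong: if_cong)
    with l c show "(LBINT x. c * g (- v) x * \<phi> x) - (LBINT x. c * g (- u) x * \<phi> x)
      = - (LBINT t:{u..v}. LBINT x. - c * f (- t) x * \<phi>' x)"
      unfolding mult.assoc integral_mult_right_zero set_integral_mult_right by auto
  qed
qed

text \<open>The bounds 1/2 give e <= a^2 + b^2 <= 1/2, and |M| <= e by the arithmetic-geometric mean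
  inequality, hence M^2 <= e^2 <= e/2. Terms such as \<open>e + -1 * (M * M)\<close> have the shape
  in which \<open>C2_add\<close> and \<open>C2_mult\<close> produce the densities.\<close>

lemma energy_inequalities:
  fixes a b :: real
  assumes ab: "\<bar>a\<bar> \<le> 1/2" "\<bar>b\<bar> \<le> 1/2"
  defines "r \<equiv> 1 / (1 + a\<^sup>2)"
  defines "M \<equiv> 2 * a * b * r" and "e \<equiv> (a * a + b * b) * r"
  shows "\<bar>M\<bar> \<le> e" "e \<le> 2 * (e + -1 * (M * M))" "e + -1 * (M * M) \<le> e" "\<bar>M + -1 * (M * e)\<bar> \<le> e"
    "e \<le> a\<^sup>2 + b\<^sup>2" "a\<^sup>2 + b\<^sup>2 \<le> 2 * e" "a\<^sup>2 + b\<^sup>2 \<le> 1" "0 \<le> e"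
proof -
  have s: "a\<^sup>2 \<le> 1/4" "b\<^sup>2 \<le> 1/4"
    using power_mono[OF ab(1), of 2] power_mono[OF ab(2), of 2] by (simp_all add: power2_eq_square)
  have r: "0 \<le> r" "r \<le> 1" "1/2 \<le> r" using s weight_pos[of a] by (auto simp: r_def field_simps)
  have E: "e = (a\<^sup>2 + b\<^sup>2) * r" by (simp add: e_def power2_eq_square)
  show "a\<^sup>2 + b\<^sup>2 \<le> 1" using s by simp
  show e: "e \<le> a\<^sup>2 + b\<^sup>2" "0 \<le> e" unfolding E using r by (auto intro: mult_left_le)
  show "a\<^sup>2 + b\<^sup>2 \<le> 2 * e" unfolding E using mult_left_mono[OF r(3), of "a\<^sup>2 + b\<^sup>2"] by simp
  have "\<bar>2 * a * b\<bar> \<le> a\<^sup>2 + b\<^sup>2"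
    using sum_squares_bound[of "\<bar>a\<bar>" "\<bar>b\<bar>"] by (simp add: abs_mult)
  then show M: "\<bar>M\<bar> \<le> e" unfolding M_def E abs_mult[of _ r] using r by (simp add: mult_right_mono)
  have e1: "e \<le> 1/2" using e s by linarith
  have "M * M \<le> e * e" using mult_mono[OF M M] e by (simp add: abs_mult[symmetric])
  moreover have "e * e \<le> e * (1/2)" using e1 e by (intro mult_left_mono)
  ultimately show "e \<le> 2 * (e + -1 * (M * M))" by simp
  show "e + -1 * (M * M) \<le> e" by simp
  have "\<bar>M + -1 * (M * e)\<bar> = \<bar>M\<bar> * \<bar>1 - e\<bar>" unfolding abs_mult[symmetric] by (simp add: right_diff_distrib)
  also have "\<dots> \<le> e * 1" using e e1 M by (intro mult_mono) auto
  finally show "\<bar>M + -1 * (M * e)\<bar> \<le> e" by simp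
qed

section \<open>The two conservation laws and the decay of the local energy\<close>

context bi_sol
begin

lemma continuous_density:
  assumes H: "nice H" and \<phi>: "test1 \<phi>" shows "continuous_on UNIV (\<lambda>t. LBINT x. H (p t x) (q t x) * \<phi> x)"
proof -
  obtain R M where a: "adm \<sigma> R M \<phi>" using test1_adm[OF \<phi> sigma(2)] by metis
  obtain M' where M': "\<And>t. adm \<sigma> R M' (fam H \<phi> t)" using fam_adm[OF H a] by blast
  \<comment> \<open>\<phi> is absorbed into \<open>fam\<close>, so the indicator of its support
    supplies the square-integrable second factor of \<open>L2cont_pairing\<close>.\<close>
  have "(LBINT x. H (p t x) (q t x) * \<phi> x) = (LBINT x. fam H \<phi> t x * indicator {-R..R} x)" for t
  proof (rule integral_cong[OF refl])
    show "H (p t x) (q t x) * \<phi> x = fam H \<phi> t x * indicator {-R..R} x" for x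
      using admD(3)[OF a, of x] by (cases "R < \<bar>x\<bar>") (auto simp: fam_def indicator_def)
  qed
  moreover have "continuous_on UNIV (\<lambda>t. LBINT x. fam H \<phi> t x * indicator {-R..R} x)"
  proof (rule L2cont_pairing[OF fam_L2cont[OF H a] admD(1)[OF M'] adm_integrable(2)[OF M']])
    have "(\<lambda>x. (indicator {-R..R} x :: real)\<^sup>2) = indicator {-R..R}" by (auto simp: indicator_def)
    then show "integrable lborel (\<lambda>x. (indicator {-R..R} x :: real)\<^sup>2)" by (simp add: integrable_indicator_iff emeasure_lborel_Icc_eq)
  qed measurable
  ultimately show ?thesis by simp
qed

lemma conservedI:
  assumes G: "C2 G Gp Gq" and F: "C2 F Fp Fq" and k: "nice k"
    and alg: "\<And>a b. \<lbrakk>\<bar>a\<bar> \<le> 1; \<bar>b\<bar> \<le> 1\<rbrakk> \<Longrightarrow> Gq a b = (1 + a\<^sup>2) * k a b"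
      "\<And>a b. \<lbrakk>\<bar>a\<bar> \<le> 1; \<bar>b\<bar> \<le> 1\<rbrakk> \<Longrightarrow> Fp a b = (1 - b\<^sup>2) * k a b"
      "\<And>a b. \<lbrakk>\<bar>a\<bar> \<le> 1; \<bar>b\<bar> \<le> 1\<rbrakk> \<Longrightarrow> Fq a b = Gp a b + 2 * a * b * k a b"
    and le: "\<And>a b. \<lbrakk>\<bar>a\<bar> \<le> 1/2; \<bar>b\<bar> \<le> 1/2\<rbrakk> \<Longrightarrow> \<bar>G a b\<bar> \<le> a\<^sup>2 + b\<^sup>2" "\<And>a b. \<lbrakk>\<bar>a\<bar> \<le> 1/2; \<bar>b\<bar> \<le> 1/2\<rbrakk> \<Longrightarrow> \<bar>F a b\<bar> \<le> a\<^sup>2 + b\<^sup>2"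
  shows "conserved (\<lambda>t x. G (p t x) (q t x)) (\<lambda>t x. F (p t x) (q t x)) (2 * K)"
proof
  have n: "nice G" "nice F" using G F unfolding C2_def by auto
  have pq: "integrable lborel (\<lambda>x. (p t x)\<^sup>2 + (q t x)\<^sup>2)" for t using L2 by simp
  have i: "integrable lborel (\<lambda>x. H (p t x) (q t x))"
    if "nice H" "\<And>a b. \<lbrakk>\<bar>a\<bar> \<le> 1/2; \<bar>b\<bar> \<le> 1/2\<rbrakk> \<Longrightarrow> \<bar>H a b\<bar> \<le> a\<^sup>2 + b\<^sup>2" for H t
  proof (rule integrable_bound[OF pq[of t]])
    show "(\<lambda>x. H (p t x) (q t x)) \<in> borel_measurable lborel" using nice_measurable[OF that(1) pq_measurable] by simp
    show "AE x in lborel. norm (H (p t x) (q t x)) \<le> norm ((p t x)\<^sup>2 + (q t x)\<^sup>2)"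
      by (intro AE_I2) (use that(2)[OF small] in simp)
  qed
  fix t x
  show "integrable lborel (\<lambda>x. G (p t x) (q t x))" "integrable lborel (\<lambda>x. F (p t x) (q t x))"
    by (rule i[OF n(1) le(1)], assumption+, rule i[OF n(2) le(2)])
  show "\<bar>G (p t x) (q t x)\<bar> \<le> 1"
    by (rule order_trans[OF le(1)[OF small] energy_inequalities(7)[OF small]])
  have "(LBINT x. \<bar>F (p t x) (q t x)\<bar>) \<le> (LBINT x. (p t x)\<^sup>2 + (q t x)\<^sup>2)"
    by (rule integral_mono'[OF pq]) (auto intro: le(2) small)
  then show "(LBINT x. \<bar>F (p t x) (q t x)\<bar>) \<le> 2 * K"
    using L2[of t] energy[of t] by simp
next
  show "test1 \<phi> \<Longrightarrow> continuous_on UNIV (\<lambda>t. LBINT x. G (p t x) (q t x) * \<phi> x)"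
    "test1 \<phi> \<Longrightarrow> continuous_on UNIV (\<lambda>t. LBINT x. F (p t x) (q t x) * \<phi> x)" for \<phi>
    using G F unfolding C2_def by (auto intro: continuous_density)
qed (rule conservation_law(2)[OF G F k alg])

lemma energy_decay:
  assumes C: "C > 0"
  shows "((\<lambda>t. LBINT x:inner_interval C t. (p t x)\<^sup>2 + (q t x)\<^sup>2) \<longlongrightarrow> 0) at_top" (is "?top")
    and "((\<lambda>t. LBINT x:inner_interval C t. (p t x)\<^sup>2 + (q t x)\<^sup>2) \<longlongrightarrow> 0) at_bot" (is "?bot")
proof -
  let ?r = "\<lambda>a. 1 / (1 + a\<^sup>2)"
  define M where "M a b = 2 * a * b * ?r a" for a b :: real
  define e where "e a b = (a * a + b * b) * ?r a" for a b :: real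
  note Mc = C2_mult[OF C2_mult[OF C2_mult[OF C2_const[of 2] C2_fst] C2_snd] C2_weight, folded M_def]
  note ec = C2_mult[OF C2_add[OF C2_mult[OF C2_fst C2_fst] C2_mult[OF C2_snd C2_snd]] C2_weight, folded e_def]
  note Qc = C2_add[OF ec C2_mult[OF C2_const[of "-1"] C2_mult[OF Mc Mc]]]
  note Fc = C2_add[OF Mc C2_mult[OF C2_const[of "-1"] C2_mult[OF Mc ec]]]
  have nr: "nice (\<lambda>a b. ?r a)" using C2_weight unfolding C2_def by blast
  note le = energy_inequalities[folded M_def e_def]
  have le': "\<bar>M a b\<bar> \<le> a\<^sup>2 + b\<^sup>2" "\<bar>e a b\<bar> \<le> a\<^sup>2 + b\<^sup>2" "\<bar>e a b + -1 * (M a b * M a b)\<bar> \<le> a\<^sup>2 + b\<^sup>2"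
    "\<bar>M a b + -1 * (M a b * e a b)\<bar> \<le> a\<^sup>2 + b\<^sup>2" if "\<bar>a\<bar> \<le> 1/2" "\<bar>b\<bar> \<le> 1/2" for a b
  proof -
    note l = le[OF that]
    show "\<bar>M a b\<bar> \<le> a\<^sup>2 + b\<^sup>2" "\<bar>e a b\<bar> \<le> a\<^sup>2 + b\<^sup>2" "\<bar>M a b + -1 * (M a b * e a b)\<bar> \<le> a\<^sup>2 + b\<^sup>2"
      using l(5,8) order_trans[OF l(1) l(5)] order_trans[OF l(4) l(5)] by simp_all
    show "\<bar>e a b + -1 * (M a b * M a b)\<bar> \<le> a\<^sup>2 + b\<^sup>2"
    proof -
      have "\<bar>x\<bar> \<le> z" if "y \<le> 2 * x" "x \<le> y" "y \<le> z" "0 \<le> y" for x y z :: real using that by linarith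
      from this[OF l(2,3,5,8)] show ?thesis .
    qed
  qed
  \<comment> \<open>Naming the reciprocal turns the differential conditions into polynomial
    identities modulo the single relation R (1 + a^2) = 1.\<close>
  have R: "\<exists>R. ?r a = R \<and> R * (1 + a\<^sup>2) = 1" for a :: real
    using weight_pos[of a] by simp
  \<comment> \<open>The multiplier is \<open>M_q / (1 + a^2)\<close>, as dictated by the first
    condition. The others hold since \<open>e_p = 2 a r^2 (1 - b^2)\<close>, and since the terms 4
    a^2 b r^2 cancel in \<open>M_p + 2 a b k = 2 b r\<close>.\<close>
  have c1: "conserved (\<lambda>t x. M (p t x) (q t x)) (\<lambda>t x. e (p t x) (q t x)) (2 * K)"
  proof (rule conservedI[OF Mc ec, where k="\<lambda>a b. 2 * a * ?r a * ?r a"], goal_cases)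
    case 1
    show ?case by (intro nice_mult nice_const nice_fst nr)
  next
    case (2 a b)
    obtain R where R: "?r a = R" "R * (1 + a\<^sup>2) = 1" using R by blast
    show ?case unfolding M_def e_def R(1) using R(2) by algebra
  next
    case (3 a b)
    obtain R where R: "?r a = R" "R * (1 + a\<^sup>2) = 1" using R by blast
    show ?case unfolding M_def e_def R(1) using R(2) by algebra
  next
    case (4 a b)
    show ?case unfolding M_def e_def by algebra
  qed (rule le', assumption+)+
  \<comment> \<open>Again the density determines the multiplier: the q-derivative of
    \<open>e - M^2\<close> is 2 b r - 8 a^2 b r^2, and division by \<open>1 + a^2\<close> gives one
    more factor \<open>r\<close>.\<close>
  have c2: "conserved (\<lambda>t x. e (p t x) (q t x) + -1 * (M (p t x) (q t x) * M (p t x) (q t x)))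
    (\<lambda>t x. M (p t x) (q t x) + -1 * (M (p t x) (q t x) * e (p t x) (q t x))) (2 * K)"
  proof (rule conservedI[OF Qc Fc, where k="\<lambda>a b. 2 * b * ?r a * ?r a + -8 * a * a * b * ?r a * ?r a * ?r a"], goal_cases)
    case 1
    show ?case by (intro nice_add nice_mult nice_const nice_fst nice_snd nr)
  next
    case (2 a b)
    obtain R where R: "?r a = R" "R * (1 + a\<^sup>2) = 1" using R by blast
    show ?case unfolding M_def e_def R(1) using R(2) by algebra
  next
    case (3 a b)
    obtain R where R: "?r a = R" "R * (1 + a\<^sup>2) = 1" using R by blast
    show ?case unfolding M_def e_def R(1) using R(2) by algebra
  next
    case (4 a b)
    show ?case unfolding M_def e_def by algebra
  qed (rule le', assumption+)+
  \<comment> \<open>\<open>c\<close> is 1 or -1 in the two applications, one for each direction of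
    time. The energy without the weight \<open>r\<close> is at most twice \<open>e\<close>.\<close>
  have fin: "((\<lambda>t. LBINT x:inner_interval C t. (p (c * t) x)\<^sup>2 + (q (c * t) x)\<^sup>2) \<longlongrightarrow> 0) at_top"
    if d: "((\<lambda>t. LBINT x:{-(C * t / (ln t)\<^sup>2)<..<C * t / (ln t)\<^sup>2}. e (p (c * t) x) (q (c * t) x)) \<longlongrightarrow> 0) at_top"
      (is "(?E \<longlongrightarrow> 0) at_top") for c
  proof (rule tendsto_sandwich[where f="\<lambda>_. 0"])
    let ?I = "\<lambda>t. LBINT x:inner_interval C t. (p (c * t) x)\<^sup>2 + (q (c * t) x)\<^sup>2"
    show "\<forall>\<^sub>F t in at_top. 0 \<le> ?I t"
      unfolding set_lebesgue_integral_def by (intro always_eventually allI integral_nonneg) simp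
    show "((\<lambda>t. 2 * ?E t) \<longlongrightarrow> 0) at_top" using tendsto_mult[OF tendsto_const[of 2] d] by simp
    have "?I t \<le> 2 * ?E t" if t: "t \<ge> 0" for t
    proof -
      have I: "inner_interval C t = {-(C * t / (ln t)\<^sup>2)<..<C * t / (ln t)\<^sup>2}" using t by (simp add: inner_interval_def)
      have "?I t \<le> (LBINT x:inner_interval C t. 2 * e (p (c * t) x) (q (c * t) x))"
      proof (rule set_integral_mono)
        have "integrable lborel (\<lambda>x. (p (c * t) x)\<^sup>2 + (q (c * t) x)\<^sup>2)" using L2 by simp
        then show "set_integrable lborel (inner_interval C t) (\<lambda>x. (p (c * t) x)\<^sup>2 + (q (c * t) x)\<^sup>2)"
          unfolding set_integrable_def inner_interval_def by (intro integrable_mult_indicator) auto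
        have "integrable lborel (\<lambda>x. 2 * e (p (c * t) x) (q (c * t) x))"
          using conserved.int(2)[OF c1] by simp
        then show "set_integrable lborel (inner_interval C t) (\<lambda>x. 2 * e (p (c * t) x) (q (c * t) x))"
          unfolding set_integrable_def inner_interval_def by (intro integrable_mult_indicator) auto
      qed (rule le(6)[OF small])
      then show ?thesis unfolding I by simp
    qed
    then show "\<forall>\<^sub>F t in at_top. ?I t \<le> 2 * ?E t"
      by (rule eventually_mono[OF eventually_ge_at_top[of 0]])
  qed simp
  show ?top
    using fin[of 1] virial_decay[OF c1 c2 C] le(1-4)[OF small] by simp
  have "((\<lambda>t. LBINT x:{-(C * t / (ln t)\<^sup>2)<..<C * t / (ln t)\<^sup>2}. - (-1) * e (p (- t) x) (q (- t) x)) \<longlongrightarrow> 0) at_top"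
    by (rule virial_decay[OF conserved_reverse[OF c1, of "-1"] conserved_reverse[OF c2, of 1] C])
      (use le(1-4)[OF small] in \<open>simp_all add: abs_minus_commute\<close>)
  then have "((\<lambda>t. LBINT x:inner_interval C t. (p (-1 * t) x)\<^sup>2 + (q (-1 * t) x)\<^sup>2) \<longlongrightarrow> 0) at_top"
    using fin[of "-1"] by simp
  then show ?bot
    unfolding filterlim_at_bot_mirror by (simp add: inner_interval_def)
qed

end

section \<open>Solutions of the Born-Infeld equation\<close>

lemma tensor_test_fun:
  assumes \<theta>: "test1 \<theta>" and \<psi>: "test1 \<psi>"
  shows "(\<lambda>t x. complex_of_real (\<theta> t * \<psi> x)) \<in> test_fun"
proof -
  obtain D where D: "D 0 = \<theta>" "\<And>k x. (D k has_vector_derivative D (Suc k) x) (at x)"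
    using \<theta> unfolding test1_def smooth_def by blast
  obtain E where E: "E 0 = \<psi>" "\<And>k x. (E k has_vector_derivative E (Suc k) x) (at x)"
    using \<psi> unfolding test1_def smooth_def by blast
  obtain R where R: "\<And>t. \<bar>t\<bar> > R \<Longrightarrow> \<theta> t = 0" using \<theta> unfolding test1_def by blast
  obtain S where S: "\<And>x. \<bar>x\<bar> > S \<Longrightarrow> \<psi> x = 0" using \<psi> unfolding test1_def by blast
  have c: "continuous_on UNIV (D k)" "continuous_on UNIV (E k)" for k
    using has_vector_derivative_continuous[OF D(2)] has_vector_derivative_continuous[OF E(2)]
    by (simp_all add: continuous_at_imp_continuous_on)
  show ?thesis
    unfolding test_fun_def
  proof (intro CollectI conjI exI[of _ "\<lambda>j k t x. complex_of_real (D j t * E k x)"] exI[of _ "max R S"] allI impI)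
    show "continuous_on UNIV (\<lambda>(t, x). complex_of_real (D j t * E k x))" for j k
      unfolding case_prod_beta
      by (intro continuous_intros continuous_on_compose2[OF c(1)] continuous_on_compose2[OF c(2)]) auto
    fix t x :: real
    assume nz: "complex_of_real (\<theta> t * \<psi> x) \<noteq> 0"
    show "\<bar>t\<bar> \<le> max R S" using nz R[of t] by (cases "\<bar>t\<bar> > R") auto
    show "\<bar>x\<bar> \<le> max R S" using nz S[of x] by (cases "\<bar>x\<bar> > S") auto
  next
    fix j k :: nat and t x :: real
    show "((\<lambda>\<tau>. complex_of_real (D j \<tau> * E k x)) has_vector_derivative complex_of_real (D (Suc j) t * E k x)) (at t)"
      by (intro has_vector_derivative_of_real DERIV_cmult_right) (simp add: D(2) has_real_derivative_iff_has_vector_derivative)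
    show "((\<lambda>y. complex_of_real (D j t * E k y)) has_vector_derivative complex_of_real (D j t * E (Suc k) x)) (at x)"
      by (intro has_vector_derivative_of_real DERIV_cmult) (simp add: E(2) has_real_derivative_iff_has_vector_derivative)
  qed (simp add: D E)
qed

lemma distr_of_real: "distr_of f (\<lambda>x. complex_of_real (\<psi> x)) = complex_of_real (LBINT x. f x * \<psi> x)"
  unfolding distr_of_def integral_complex_of_real[symmetric] by simp

lemma L2cont_continuous:
  assumes "L2cont g" "\<And>t. g t \<in> borel_measurable borel" "\<And>t. integrable lborel (\<lambda>x. (g t x)\<^sup>2)" "test1 \<psi>"
  shows "continuous_on UNIV (\<lambda>t. LBINT x. g t x * \<psi> x)"
proof (rule L2cont_pairing[OF assms(1-3)])
  obtain R M where a: "adm 1 R M \<psi>" by (rule test1_adm[OF assms(4) order_refl])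
  show "\<psi> \<in> borel_measurable borel" "integrable lborel (\<lambda>x. (\<psi> x)\<^sup>2)" by (rule admD(1)[OF a], rule adm_integrable(2)[OF a])
qed

lemma dual_fun_mono:
  assumes "dual_fun \<sigma> c L" "c \<le> c'" "1/2 < \<sigma>" shows "dual_fun \<sigma> c' L"
  using assms unfolding dual_fun_def by (meson mult_right_mono Qb_nonneg order_trans)

context
  fixes s \<epsilon> :: real and u ut :: "real \<Rightarrow> real \<Rightarrow> real"
  assumes s: "s > 1/2" and \<epsilon>: "0 < \<epsilon>" "\<epsilon> \<le> 1/4" "sob_const s * \<epsilon> \<le> 1/2"
    and sol: "born_infeld_global_solution s u ut" and sm: "\<And>t. pair_norm s (u t) (ut t) < \<epsilon>"
begin

lemma solution_space: "u t \<in> sobolev_fun (s + 1)" "ut t \<in> sobolev_fun s" "weak_deriv (u t) \<in> sobolev_fun s"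
  using sol weak_deriv_sobolev(1)[OF _ s] unfolding born_infeld_global_solution_def by auto

lemma sobolev_fun_measurable: "f \<in> sobolev_fun s \<Longrightarrow> f \<in> borel_measurable borel"
  using sobolev_funD(1) by (auto simp: L2_fun_def)

lemma pair_norm_bounds:
  "sobolev_norm (s + 1) (distr_of f) \<le> pair_norm s f g" "sobolev_norm s (distr_of g) \<le> pair_norm s f g" "0 \<le> pair_norm s f g"
  unfolding pair_norm_def using sobolev_norm_nonneg by (auto intro!: real_le_rsqrt)

lemma solution_norm: "sobolev_norm s (distr_of (weak_deriv (u t))) \<le> \<epsilon>" "sobolev_norm s (distr_of (ut t)) \<le> \<epsilon>"
  using weak_deriv_sobolev(2)[OF solution_space(1) s, of t] pair_norm_bounds(1)[of "u t" "ut t"] pair_norm_bounds(2)[of "ut t" "u t"] sm[of t]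
  by linarith+

text \<open>Both conditions on \<epsilon> are used.
  \<open>sob_const s * \<epsilon> \<le> 1/2\<close> gives the pointwise bound through the Sobolev
  embedding; \<epsilon> <= 1/4 makes the modulus constant, twice the norm, at most 1, so that
  \<open>bi_sol\<close> can be instantiated with \<open>K = 1\<close>.\<close>

lemma rep_small:
  assumes f: "f \<in> sobolev_fun s" "sobolev_norm s (distr_of f) \<le> \<epsilon>"
  shows "\<bar>rep f x\<bar> \<le> 1/2" "(LBINT x. (rep f x)\<^sup>2) \<le> 1" "reg (min s 1) 1 (rep f)"
proof -
  have c: "0 \<le> sob_const s" by (simp add: sob_const_def)
  have N: "0 \<le> sobolev_norm s (distr_of f)" "sobolev_norm s (distr_of f) \<le> 1/4" using f(2) \<epsilon> sobolev_norm_nonneg by auto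
  show b: "\<bar>rep f x\<bar> \<le> 1/2" for x
    using rep_bounded[OF f(1) s, of x] mult_left_mono[OF f(2) c] \<epsilon>(3) by linarith
  have "(sobolev_norm s (distr_of f))\<^sup>2 \<le> 1" using N by (simp add: power_le_one)
  then show "(LBINT x. (rep f x)\<^sup>2) \<le> 1" using rep_L2(2)[OF f(1) s] by linarith
  show "reg (min s 1) 1 (rep f)"
    unfolding reg_def
  proof (intro conjI allI impI)
    show "\<bar>rep f x\<bar> \<le> 1" for x using b[of x] by simp
    fix h :: real assume h: "0 < h \<and> h \<le> 1"
    show "integrable lborel (\<lambda>x. (rep f (x + h) - rep f x)\<^sup>2)" by (rule rep_modulus(1)[OF f(1) s]) (use h in simp)
    have "(LBINT x. (rep f (x + h) - rep f x)\<^sup>2) \<le> (2 * h powr (min s 1) * sobolev_norm s (distr_of f))\<^sup>2"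
      by (rule rep_modulus(2)[OF f(1) s]) (use h in simp)
    also have "\<dots> \<le> (2 * h powr (min s 1) * (1/4))\<^sup>2" using N by (intro power_mono mult_left_mono) auto
    also have "\<dots> \<le> (1 * h powr (min s 1))\<^sup>2" by (intro power_mono) auto
    finally show "(LBINT x. (rep f (x + h) - rep f x)\<^sup>2) \<le> (1 * h powr (min s 1))\<^sup>2" .
  qed (rule rep_measurable[OF f(1) s])
qed

lemma rep_diff_norm:
  assumes f: "f \<in> sobolev_fun s" and g: "g \<in> sobolev_fun s"
  shows "(LBINT x. (rep f x - rep g x)\<^sup>2) \<le> (sobolev_norm s (distr_of (\<lambda>x. f x - g x)))\<^sup>2"
proof -
  note d = sobolev_fun_diff[OF f g]
  note [measurable] = rep_measurable[OF f s] rep_measurable[OF g s] rep_measurable[OF d s]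
  have "(LBINT x. (rep f x - rep g x)\<^sup>2) = (LBINT x. (rep (\<lambda>x. f x - g x) x)\<^sup>2)"
    by (rule integral_cong_AE[OF _ _ eventually_mono[OF eventually_conj[OF rep_AE[OF f s] eventually_conj[OF rep_AE[OF g s] rep_AE[OF d s]]]]])
      (measurable, auto)
  then show ?thesis using rep_L2(2)[OF d s] by simp
qed

lemma rep_L2cont: "L2cont (\<lambda>t. rep (weak_deriv (u t)))" "L2cont (\<lambda>t. rep (ut t))"
proof -
  have lim: "((\<lambda>t. (pair_norm s (\<lambda>x. u t x - u t\<^sub>0 x) (\<lambda>x. ut t x - ut t\<^sub>0 x))\<^sup>2) \<longlongrightarrow> 0) (at t\<^sub>0)" for t\<^sub>0
    using sol tendsto_power[of "\<lambda>t. pair_norm s (\<lambda>x. u t x - u t\<^sub>0 x) (\<lambda>x. ut t x - ut t\<^sub>0 x)" 0 "at t\<^sub>0" 2]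
    unfolding born_infeld_global_solution_def by simp
  have 1: "(LBINT x. (rep (weak_deriv (u t)) x - rep (weak_deriv (u t\<^sub>0)) x)\<^sup>2) \<le> (pair_norm s (\<lambda>x. u t x - u t\<^sub>0 x) (\<lambda>x. ut t x - ut t\<^sub>0 x))\<^sup>2"
    "(LBINT x. (rep (ut t) x - rep (ut t\<^sub>0) x)\<^sup>2) \<le> (pair_norm s (\<lambda>x. u t x - u t\<^sub>0 x) (\<lambda>x. ut t x - ut t\<^sub>0 x))\<^sup>2" for t t\<^sub>0
    by (rule order_trans[OF rep_diff_norm[OF solution_space(3) solution_space(3)]], rule power_mono,
        rule order_trans[OF weak_deriv_diff_norm[OF solution_space(1) solution_space(1) s] pair_norm_bounds(1)], rule sobolev_norm_nonneg,
        rule order_trans[OF rep_diff_norm[OF solution_space(2) solution_space(2)]], rule power_mono, rule pair_norm_bounds(2), rule sobolev_norm_nonneg)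
  show "L2cont (\<lambda>t. rep (weak_deriv (u t)))" "L2cont (\<lambda>t. rep (ut t))"
    unfolding L2cont_def
    by (intro allI tendsto_sandwich[OF always_eventually always_eventually tendsto_const lim] 1 integral_nonneg zero_le_power2)+
qed

lemma distr_rep:
  assumes "f \<in> sobolev_fun s" "test1 \<psi>"
  shows "distr_of f (\<lambda>x. complex_of_real (\<psi> x)) = complex_of_real (LBINT x. rep f x * \<psi> x)"
proof -
  have [measurable]: "f \<in> borel_measurable borel" "rep f \<in> borel_measurable borel" "\<psi> \<in> borel_measurable borel"
    using sobolev_funD(1)[OF assms(1)] rep_measurable[OF assms(1) s] test1_measurable[OF assms(2)] by (auto simp: L2_fun_def)
  have "(LBINT x. f x * \<psi> x) = (LBINT x. rep f x * \<psi> x)"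
    by (rule integral_cong_AE[OF _ _ eventually_mono[OF rep_AE[OF assms(1) s]]]) auto
  then show ?thesis by (simp add: distr_of_real)
qed

lemma derivative_pairing_test:
  assumes f: "f \<in> sobolev_fun s" and \<psi>: "test1 \<psi>" "test1 \<psi>'" "\<And>x. (\<psi> has_real_derivative \<psi>' x) (at x)"
  shows "distr_deriv (distr_of f) (\<lambda>x. complex_of_real (\<psi> x)) = - complex_of_real (LBINT x. rep f x * \<psi>' x)"
proof -
  have "vector_derivative (\<lambda>x. complex_of_real (\<psi> x)) (at x) = complex_of_real (\<psi>' x)" for x
    using \<psi>(3) by (intro vector_derivative_at has_vector_derivative_of_real) (simp add: has_real_derivative_iff_has_vector_derivative)
  then show ?thesis unfolding distr_deriv_def by (simp add: distr_rep[OF f \<psi>(2)])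
qed

lemma time_derivative_product:
  assumes "test1 \<theta>" "test1 \<theta>'" "\<And>t. (\<theta> has_real_derivative \<theta>' t) (at t)" "test1 \<psi>" "is_time_deriv U V"
  shows "(LBINT t. V t (\<lambda>x. complex_of_real (\<theta> t * \<psi> x))) = - (LBINT t. U t (\<lambda>x. complex_of_real (\<theta>' t * \<psi> x)))"
proof -
  have "vector_derivative (\<lambda>\<tau>. complex_of_real (\<theta> \<tau> * \<psi> x)) (at t) = complex_of_real (\<theta>' t * \<psi> x)" for t x
    using assms(3) by (intro vector_derivative_at has_vector_derivative_of_real DERIV_cmult_right)
      (simp add: has_real_derivative_iff_has_vector_derivative)
  then show ?thesis
    using assms(5) tensor_test_fun[OF assms(1,4)] unfolding is_time_deriv_def by (auto dest: bspec)
qed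

text \<open>Moves one derivative into \<open>weak_deriv\<close>, so that \<open>u_xx\<close> becomes
  the first derivative of an element of \<open>H^s\<close> and \<open>derivative_pairing\<close>
  applies. The two distributions agree on Schwartz functions, hence have the same chosen
  transform.\<close>

lemma second_derivative_pairing:
  "pairing (distr_deriv (distr_deriv (distr_of (u t)))) = pairing (distr_deriv (distr_of (weak_deriv (u t))))"
proof -
  have "fourier_distr (distr_deriv (distr_deriv (distr_of (u t)))) = fourier_distr (distr_deriv (distr_of (weak_deriv (u t))))"
    by (rule fourier_distr_cong)
      (simp add: distr_deriv_def[of "distr_deriv (distr_of (u t))"] distr_deriv_def[of "distr_of (weak_deriv (u t))"]
        weak_deriv_exists(2)[OF solution_space(1) s schwartz_vector_derivative])
  then show ?thesis unfolding pairing_def[abs_def] by simp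
qed

lemma born_infeld_pairing:
  fixes t c :: real
  assumes \<psi>: "test1 \<psi>" and T: "T \<in> sobolev (s - 1)"
  defines "p \<equiv> rep (weak_deriv (u t))" and "q \<equiv> rep (ut t)"
  shows "born_infeld (u t) (ut t) T (\<lambda>x. complex_of_real (c * \<psi> x)) = complex_of_real c *
    (pairing (distr_deriv (distr_of (weak_deriv (u t)))) (\<lambda>x. (1 - (q x)\<^sup>2) * \<psi> x)
     + pairing (distr_deriv (distr_of (ut t))) (\<lambda>x. (2 * p x * q x) * \<psi> x) - pairing T (\<lambda>x. (1 + (p x)\<^sup>2) * \<psi> x))"
proof -
  have sg: "1/2 < min s 1" "min s 1 \<le> 1" using s by auto
  have [measurable]: "p \<in> borel_measurable borel" "q \<in> borel_measurable borel" "\<psi> \<in> borel_measurable borel"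
    "weak_deriv (u t) \<in> borel_measurable borel" "ut t \<in> borel_measurable borel"
    unfolding p_def q_def by (intro rep_measurable[OF _ s] sobolev_fun_measurable solution_space test1_measurable[OF \<psi>])+
  note AE = rep_AE[OF solution_space(3) s, of t, folded p_def] rep_AE[OF solution_space(2) s, of t, folded q_def]
  have scale: "pairing S (\<lambda>x. a * f x) = complex_of_real a * pairing S f" if "S \<in> sobolev (s - 1)" for S a f
    using pairing_dual_fun[OF that s sg] unfolding dual_fun_def by blast
  note S = derivative_pairing(1)[OF solution_space(3) s, of t] derivative_pairing(1)[OF solution_space(2) s, of t]
  have "distr_mult (\<lambda>x. 1 - (ut t x)\<^sup>2) (distr_deriv (distr_deriv (distr_of (u t)))) (\<lambda>x. complex_of_real (c * \<psi> x))
    = pairing (distr_deriv (distr_of (weak_deriv (u t)))) (\<lambda>x. c * ((1 - (q x)\<^sup>2) * \<psi> x))"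
    unfolding distr_mult_pairing second_derivative_pairing
    by (rule pairing_cong_AE[OF eventually_mono[OF AE(2)]]) (simp, measurable)
  \<comment> \<open>The factor c/2 compensates the 2 in the coefficient \<open>2 p q\<close>; the 2
    in front of this product in \<open>born_infeld\<close> restores \<open>c\<close>.\<close>
  moreover have "distr_mult (\<lambda>x. weak_deriv (u t) x * ut t x) (distr_deriv (distr_of (ut t))) (\<lambda>x. complex_of_real (c * \<psi> x))
    = pairing (distr_deriv (distr_of (ut t))) (\<lambda>x. (c / 2) * ((2 * p x * q x) * \<psi> x))"
    unfolding distr_mult_pairing
    by (rule pairing_cong_AE[OF eventually_mono[OF eventually_conj[OF AE]]]) (simp, measurable)
  moreover have "distr_mult (\<lambda>x. 1 + (weak_deriv (u t) x)\<^sup>2) T (\<lambda>x. complex_of_real (c * \<psi> x))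
    = pairing T (\<lambda>x. c * ((1 + (p x)\<^sup>2) * \<psi> x))"
    unfolding distr_mult_pairing
    by (rule pairing_cong_AE[OF eventually_mono[OF AE(1)]]) (simp, measurable)
  ultimately show ?thesis
    unfolding born_infeld_def scale[OF S(1)] scale[OF S(2)] scale[OF T] by (simp add: algebra_simps)
qed

text \<open>The identity \<open>p_t = q_x\<close> is obtained by applying the time derivative of
  \<open>u\<close> to the product of \<theta> and \<psi>': on one side the space derivative falls on
  \<open>u_t\<close> and gives \<open>Y\<close>, on the other it falls on \<open>u\<close> and gives
  \<open>p\<close>. Product test functions in (t, x) are enough for all three weak
  identities.\<close>

lemma solution_bi_sol:
  obtains N W where "bi_sol (min s 1) 1 N (\<lambda>t. pairing (distr_deriv (distr_of (weak_deriv (u t))))) (\<lambda>t. pairing (distr_deriv (distr_of (ut t)))) W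
    (\<lambda>t. rep (weak_deriv (u t))) (\<lambda>t. rep (ut t))"
proof -
  obtain utt where li: "loc_integrable_sobolev (s - 1) utt" and td: "is_time_deriv (\<lambda>t. distr_of (ut t)) utt"
    and eq: "\<And>\<phi>. \<phi> \<in> test_fun \<Longrightarrow> (LBINT t. born_infeld (u t) (ut t) (utt t) (\<phi> t)) = 0"
    using sol unfolding born_infeld_global_solution_def by blast
  have td1: "is_time_deriv (\<lambda>t. distr_of (u t)) (\<lambda>t. distr_of (ut t))"
    using sol unfolding born_infeld_global_solution_def by blast
  have T: "utt t \<in> sobolev (s - 1)" for t using li unfolding loc_integrable_sobolev_def by blast
  have sg: "1/2 < min s 1" "min s 1 \<le> 1" using s by auto
  note S = solution_space(3) solution_space(2)
  let ?X = "\<lambda>f. pairing (distr_deriv (distr_of f))"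
  have dual: "dual_fun (min s 1) 1 (?X f)" if f: "f \<in> sobolev_fun s" "sobolev_norm s (distr_of f) \<le> \<epsilon>" for f
    by (rule dual_fun_mono[OF pairing_dual_fun[OF derivative_pairing(1)[OF f(1) s] s sg] _ sg(1)])
      (use derivative_pairing(2)[OF f(1) s] f(2) \<epsilon> in linarith)
  have test: "?X f \<psi> = - complex_of_real (LBINT x. rep f x * \<psi>' x)"
    if "f \<in> sobolev_fun s" "test1 \<psi>" "test1 \<psi>'" "\<And>x. (\<psi> has_real_derivative \<psi>' x) (at x)" for f \<psi> \<psi>'
    using pairing_schwartz[OF derivative_pairing(1)[OF that(1) s] that(2)] derivative_pairing_test[OF that] by simp
  have meas: "(\<lambda>t. ?X (f t) \<psi>) \<in> borel_measurable borel"
    if f: "\<And>t. f t \<in> sobolev_fun s" "L2cont (\<lambda>t. rep (f t))" and \<psi>: "test1 \<psi>" for f \<psi>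
  proof -
    obtain \<psi>' where \<psi>': "test1 \<psi>'" "\<And>x. (\<psi> has_real_derivative \<psi>' x) (at x)" using test1_derivative[OF \<psi>] by blast
    have [measurable]: "(\<lambda>t. LBINT x. rep (f t) x * \<psi>' x) \<in> borel_measurable borel"
      by (intro borel_measurable_continuous_onI L2cont_continuous f(2) rep_measurable[OF f(1) s] rep_L2(1)[OF f(1) s] \<psi>')
    show ?thesis unfolding test[OF f(1) \<psi> \<psi>'] by measurable
  qed
  have const: "(\<integral>\<^sup>+t\<in>{-r..r}. ennreal 1 \<partial>lborel) < \<infinity>" for r :: real
    by (simp add: emeasure_lborel_Icc_eq)
  have "bi_sol (min s 1) 1 (\<lambda>t. sobolev_norm (s - 1) (utt t)) (\<lambda>t. ?X (weak_deriv (u t))) (\<lambda>t. ?X (ut t)) (\<lambda>t. pairing (utt t))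
    (\<lambda>t. rep (weak_deriv (u t))) (\<lambda>t. rep (ut t))"
  proof
    show "(\<lambda>t. ?X (weak_deriv (u t)) \<psi>) \<in> borel_measurable borel" "(\<lambda>t. ?X (ut t) \<psi>) \<in> borel_measurable borel" if "test1 \<psi>" for \<psi>
      by (intro meas S rep_L2cont that)+
    show "(\<lambda>t. pairing (utt t) \<psi>) \<in> borel_measurable borel" if "test1 \<psi>" for \<psi>
      unfolding pairing_schwartz[OF T that] using li test1_schwartz[OF that] unfolding loc_integrable_sobolev_def by blast
    show "(\<integral>\<^sup>+t\<in>{-r..r}. ennreal (sobolev_norm (s - 1) (utt t)) \<partial>lborel) < \<infinity>" for r
      using li unfolding loc_integrable_sobolev_def by blast
    show "(LBINT t. complex_of_real (\<theta> t) * ?X (ut t) \<psi>) = - complex_of_real (LBINT t. \<theta>' t * (LBINT x. rep (weak_deriv (u t)) x * \<psi> x))"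
      if \<theta>: "test1 \<theta>" "test1 \<theta>'" "\<And>t. (\<theta> has_real_derivative \<theta>' t) (at t)" and \<psi>: "test1 \<psi>" for \<theta> \<theta>' \<psi>
    proof -
      obtain \<psi>' where \<psi>': "test1 \<psi>'" "\<And>x. (\<psi> has_real_derivative \<psi>' x) (at x)" using test1_derivative[OF \<psi>] by blast
      have scal: "distr_of f (\<lambda>x. complex_of_real (a * k x)) = complex_of_real a * distr_of f (\<lambda>x. complex_of_real (k x))" for f k a
        unfolding distr_of_def by (simp add: mult.left_commute[of _ "complex_of_real a"])
      have "distr_of (u t) (\<lambda>x. complex_of_real (\<psi>' x)) = - complex_of_real (LBINT x. rep (weak_deriv (u t)) x * \<psi> x)" for t
      proof -
        have "vector_derivative (\<lambda>x. complex_of_real (\<psi> x)) (at x) = complex_of_real (\<psi>' x)" for x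
          using \<psi>'(2) by (intro vector_derivative_at has_vector_derivative_of_real) (simp add: has_real_derivative_iff_has_vector_derivative)
        then have "distr_deriv (distr_of (u t)) (\<lambda>x. complex_of_real (\<psi> x)) = - distr_of (u t) (\<lambda>x. complex_of_real (\<psi>' x))"
          unfolding distr_deriv_def by simp
        then show ?thesis
          using weak_deriv_exists(2)[OF solution_space(1) s test1_schwartz[OF \<psi>], of t] distr_rep[OF S(1) \<psi>, of t] by simp
      qed
      note 1 = this
      have "(LBINT t. complex_of_real (\<theta> t) * ?X (ut t) \<psi>) = - (LBINT t. distr_of (ut t) (\<lambda>x. complex_of_real (\<theta> t * \<psi>' x)))"
        unfolding test[OF S(2) \<psi> \<psi>'] scal distr_rep[OF S(2) \<psi>'(1)] by simp
      also have "\<dots> = (LBINT t. distr_of (u t) (\<lambda>x. complex_of_real (\<theta>' t * \<psi>' x)))"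
        using time_derivative_product[OF \<theta> \<psi>'(1) td1] by simp
      also have "\<dots> = - (LBINT t. complex_of_real (\<theta>' t * (LBINT x. rep (weak_deriv (u t)) x * \<psi> x)))"
        unfolding scal 1 by simp
      finally show ?thesis unfolding integral_complex_of_real .
    qed
    show "(LBINT t. complex_of_real (\<theta> t) * pairing (utt t) \<psi>) = - complex_of_real (LBINT t. \<theta>' t * (LBINT x. rep (ut t) x * \<psi> x))"
      if \<theta>: "test1 \<theta>" "test1 \<theta>'" "\<And>t. (\<theta> has_real_derivative \<theta>' t) (at t)" and \<psi>: "test1 \<psi>" for \<theta> \<theta>' \<psi>
    proof -
      have "complex_of_real (\<theta> t) * pairing (utt t) \<psi> = utt t (\<lambda>x. complex_of_real (\<theta> t * \<psi> x))" for t
      proof -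
        have "pairing (utt t) (\<lambda>x. \<theta> t * \<psi> x) = complex_of_real (\<theta> t) * pairing (utt t) \<psi>"
          using pairing_dual_fun[OF T s sg, of t] unfolding dual_fun_def by blast
        then show ?thesis using pairing_schwartz[OF T test1_mult'[OF \<psi> smooth_const], of t "\<theta> t"] by simp
      qed
      then have "(LBINT t. complex_of_real (\<theta> t) * pairing (utt t) \<psi>) = - (LBINT t. distr_of (ut t) (\<lambda>x. complex_of_real (\<theta>' t * \<psi> x)))"
        using time_derivative_product[OF \<theta> \<psi> td] by simp
      also have "(\<lambda>t. distr_of (ut t) (\<lambda>x. complex_of_real (\<theta>' t * \<psi> x))) = (\<lambda>t. complex_of_real (\<theta>' t * (LBINT x. rep (ut t) x * \<psi> x)))"
        unfolding distr_rep[OF S(2) test1_mult'[OF \<psi> smooth_const]] by (simp add: mult.left_commute[of _ "\<theta>' _"])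
      finally show ?thesis unfolding integral_complex_of_real .
    qed
    show "(LBINT t. complex_of_real (\<theta> t) * (?X (weak_deriv (u t)) (\<lambda>x. (1 - (rep (ut t) x)\<^sup>2) * \<psi> x)
      + ?X (ut t) (\<lambda>x. (2 * rep (weak_deriv (u t)) x * rep (ut t) x) * \<psi> x) - pairing (utt t) (\<lambda>x. (1 + (rep (weak_deriv (u t)) x)\<^sup>2) * \<psi> x))) = 0"
      if "test1 \<theta>" "test1 \<psi>" for \<theta> \<psi>
      using eq[OF tensor_test_fun[OF that]] unfolding born_infeld_pairing[OF that(2) T] .
  qed (use sg sobolev_norm_nonneg const dual[OF S(1) solution_norm(1)] dual[OF S(2) solution_norm(2)] pairing_dual_fun[OF T s sg]
    rep_small[OF S(1) solution_norm(1)] rep_small[OF S(2) solution_norm(2)] rep_L2(1)[OF S(1) s] rep_L2(1)[OF S(2) s] rep_L2cont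
    derivative_pairing(3)[OF S(1) s _ sg] derivative_pairing(3)[OF S(2) s _ sg] in \<open>assumption | simp\<close>)+
  then show thesis by (rule that)
qed

lemma energy_norm_rep:
  assumes "I \<in> sets borel"
  shows "energy_norm I (u t) (ut t) = sqrt (LBINT x:I. (rep (weak_deriv (u t)) x)\<^sup>2 + (rep (ut t) x)\<^sup>2)"
proof -
  have [measurable]: "I \<in> sets lborel" using assms by simp
  have [measurable]: "rep (weak_deriv (u t)) \<in> borel_measurable borel" "rep (ut t) \<in> borel_measurable borel"
    "weak_deriv (u t) \<in> borel_measurable borel" "ut t \<in> borel_measurable borel"
    by (intro rep_measurable[OF _ s] sobolev_fun_measurable solution_space)+
  have "(LBINT x:I. (weak_deriv (u t) x)\<^sup>2 + (ut t x)\<^sup>2) = (LBINT x:I. (rep (weak_deriv (u t)) x)\<^sup>2 + (rep (ut t) x)\<^sup>2)"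
    unfolding set_lebesgue_integral_def
    by (rule integral_cong_AE[OF _ _ eventually_mono[OF eventually_conj[OF rep_AE[OF solution_space(3) s, of t] rep_AE[OF solution_space(2) s, of t]]]])
      auto
  then show ?thesis by (simp add: energy_norm_def)
qed

lemma energy_norm_tendsto:
  assumes C: "C > 0"
  shows "((\<lambda>t. energy_norm (inner_interval C t) (u t) (ut t)) \<longlongrightarrow> 0) at_top"
    and "((\<lambda>t. energy_norm (inner_interval C t) (u t) (ut t)) \<longlongrightarrow> 0) at_bot"
proof -
  obtain N W where b: "bi_sol (min s 1) 1 N (\<lambda>t. pairing (distr_deriv (distr_of (weak_deriv (u t))))) (\<lambda>t. pairing (distr_deriv (distr_of (ut t)))) W
    (\<lambda>t. rep (weak_deriv (u t))) (\<lambda>t. rep (ut t))" by (rule solution_bi_sol)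
  have e: "energy_norm (inner_interval C t) (u t) (ut t) = sqrt (LBINT x:inner_interval C t. (rep (weak_deriv (u t)) x)\<^sup>2 + (rep (ut t) x)\<^sup>2)" for t
    by (rule energy_norm_rep) (simp add: inner_interval_def)
  show "((\<lambda>t. energy_norm (inner_interval C t) (u t) (ut t)) \<longlongrightarrow> 0) at_top"
    unfolding e using tendsto_real_sqrt[OF bi_sol.energy_decay(1)[OF b C]] by simp
  show "((\<lambda>t. energy_norm (inner_interval C t) (u t) (ut t)) \<longlongrightarrow> 0) at_bot"
    unfolding e using tendsto_real_sqrt[OF bi_sol.energy_decay(2)[OF b C]] by simp
qed

end

theorem theorem1p1:
  fixes C s :: real
  assumes "C > 0" and "s > 1 / 2"
  shows "\<exists>\<epsilon>\<^sub>0 > 0. \<forall>\<epsilon>. 0 < \<epsilon> \<and> \<epsilon> < \<epsilon>\<^sub>0 \<longrightarrow>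
    (\<forall>u ut :: real \<Rightarrow> real \<Rightarrow> real.
       born_infeld_global_solution s u ut \<longrightarrow>
       (SUP t. ennreal (pair_norm s (u t) (ut t))) < ennreal \<epsilon> \<longrightarrow>
       ((\<lambda>t. energy_norm (inner_interval C t) (u t) (ut t)) \<longlongrightarrow> 0) at_top \<and>
       ((\<lambda>t. energy_norm (inner_interval C t) (u t) (ut t)) \<longlongrightarrow> 0) at_bot)"
proof -
  have c: "0 \<le> sob_const s" by (simp add: sob_const_def)
  \<comment> \<open>The first entry bounds the modulus constant, the second gives the pointwise
    bound 1/2; the summand 1 keeps the denominator positive. \<open>C\<close> does not
    occur.\<close>
  define \<epsilon>\<^sub>0 where "\<epsilon>\<^sub>0 = min (1/4) (1 / (2 * (sob_const s + 1)))"
  have "\<epsilon>\<^sub>0 > 0" using c by (simp add: \<epsilon>\<^sub>0_def)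
  moreover have "((\<lambda>t. energy_norm (inner_interval C t) (u t) (ut t)) \<longlongrightarrow> 0) at_top \<and>
      ((\<lambda>t. energy_norm (inner_interval C t) (u t) (ut t)) \<longlongrightarrow> 0) at_bot"
    if \<epsilon>: "0 < \<epsilon>" "\<epsilon> < \<epsilon>\<^sub>0" and sol: "born_infeld_global_solution s u ut"
      and sm: "(SUP t. ennreal (pair_norm s (u t) (ut t))) < ennreal \<epsilon>" for \<epsilon> u ut
  proof -
    have "\<epsilon> \<le> 1/4" "\<epsilon> \<le> 1 / (2 * (sob_const s + 1))" using \<epsilon> by (auto simp: \<epsilon>\<^sub>0_def)
    then have "\<epsilon> \<le> 1/4" "\<epsilon> * (2 * (sob_const s + 1)) \<le> 1" using c by (auto simp: pos_le_divide_eq)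
    then have e: "\<epsilon> \<le> 1/4" "sob_const s * \<epsilon> \<le> 1/2" using \<epsilon>(1) by (auto simp: algebra_simps)
    have "pair_norm s (u t) (ut t) < \<epsilon>" for t
    proof -
      have "ennreal (pair_norm s (u t) (ut t)) < ennreal \<epsilon>"
        by (rule le_less_trans[OF SUP_upper sm]) simp
      then show ?thesis by (simp add: ennreal_less_iff pair_norm_def)
    qed
    from energy_norm_tendsto[OF assms(2) \<epsilon>(1) e sol this assms(1)] show ?thesis by blast
  qed
  ultimately show ?thesis by blast
qed

end
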